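(* Let $R$ be a commutative ring and let $A$ and $B$ be coaugmented chain coalgebras over $R$. There exist a chain map $\sigma:\Omega A\otimes\Omega B\to\Omega(A\otimes B)$ and a map $h:\Omega(A\otimes B)\to\Omega(A\otimes B)$ of degree $+1$ such that, together with the Milgram map $q:\Omega(A\otimes B)\to\Omega A\otimes\Omega B$, they form a strong deformation retract of chain complexes $$\Omega A\otimes\Omega B\ \underset{q}{\overset{\sigma}{\rightleftharpoons}}\ \Omega(A\otimes B)\circlearrowleft h.$$ In particular, $q$ is a chain homotopy equivalence.
   Context: Chain coalgebras are coassociative and counital. For a coaugmented chain coalgebra $(C,d,\Delta)$ with counit $\varepsilon$, let $\overline C=\ker\varepsilon$ and $\overline\Delta(c)=\Delta(c)-(c\otimes1+1\otimes c)$ for $c\in\overline C$ ($1$ being the image of the unit under the coaugmentation). The cobar construction is the chain algebra $\Omega C=(T(s^{-1}\overline C),d_\Omega)$ with $T$ the tensor algebra, $s^{-1}$ desuspension, and $d_\Omega=-s^{-1}ds+\mu(s^{-1}\otimes s^{-1})\overline\Delta s$ on generators, extended as a derivation (Koszul sign convention). Words are written $[x_1|\cdots|x_n]=s^{-1}x_1\otimes\cdots\otimes s^{-1}x_n$, and the unit is $[\,]$. The Milgram map $q:\Omega(A\otimes B)\to\Omega A\otimes\Omega B$ is the chain algebra morphism specified by $q[a\otimes1]=[a]\otimes[\,]$, $q[1\otimes b]=[\,]\otimes[b]$, $q[a\otimes b]=0$ for $a\in\overline A$, $b\in\overline B$. A strong deformation retract $(X,\partial)\underset{f}{\overset{\nabla}{\rightleftharpoons}}(Y,d)\circlearrowleft\varphi$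 of chain complexes consists of chain maps $\nabla:X\to Y$, $f:Y\to X$ with $f\nabla=1_X$ and a degree $+1$ map $\varphi:Y\to Y$ such that $d\varphi+\varphi d=\nabla f-1_Y$, $\varphi\nabla=0$, $f\varphi=0$ and $\varphi^2=0$. *)

theory Defs
  imports "HOL-Algebra.Module" "HOL-Algebra.AbelCoset"
begin

section \<open>Modules given by generators and relations\<close>

definition module_hom ::
  "('r, 'm) ring_scheme \<Rightarrow> ('r, 'a, 'n) module_scheme \<Rightarrow> ('r, 'b, 'k) module_scheme \<Rightarrow> ('a \<Rightarrow> 'b) set"
  where "module_hom R M N =
    {f \<in> hom (add_monoid M) (add_monoid N).
       \<forall>r\<in>carrier R. \<forall>x\<in>carrier M. f (r \<odot>\<^bsub>M\<^esub> x) = r \<odot>\<^bsub>N\<^esub> f x}"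

text \<open>
  The record type of modules extends that of rings; the fields \<open>mult\<close> and \<open>one\<close> play no role
  in the locale \<^locale>\<open>module\<close>.
\<close>

definition free_module :: "('r, 'm) ring_scheme \<Rightarrow> 'x set \<Rightarrow> ('r, 'x \<Rightarrow> 'r) module"
  where "free_module R G =
    \<lparr>carrier = {p. (\<forall>g. p g \<in> carrier R) \<and> (\<forall>g. g \<notin> G \<longrightarrow> p g = \<zero>\<^bsub>R\<^esub>) \<and> finite {g. p g \<noteq> \<zero>\<^bsub>R\<^esub>}},
     mult = undefined, one = undefined,
     zero = (\<lambda>g. \<zero>\<^bsub>R\<^esub>), add = (\<lambda>p q g. p g \<oplus>\<^bsub>R\<^esub> q g), smult = (\<lambda>r p g. r \<otimes>\<^bsub>R\<^esub> p g)\<rparr>"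

definition basis_elt :: "('r, 'm) ring_scheme \<Rightarrow> 'x \<Rightarrow> 'x \<Rightarrow> 'r"
  where "basis_elt R g = (\<lambda>g'. if g' = g then \<one>\<^bsub>R\<^esub> else \<zero>\<^bsub>R\<^esub>)"

definition submodule_gen :: "('r, 'm) ring_scheme \<Rightarrow> ('r, 'a, 'n) module_scheme \<Rightarrow> 'a set \<Rightarrow> 'a set"
  where "submodule_gen R M S = \<Inter>{H. submodule H R M \<and> S \<subseteq> H}"

definition quot_module :: "('r, 'a, 'n) module_scheme \<Rightarrow> 'a set \<Rightarrow> ('r, 'a set) module"
  where "quot_module M H =
    \<lparr>carrier = a_rcosets\<^bsub>M\<^esub> H, mult = undefined, one = undefined,
     zero = H, add = set_add M, smult = (\<lambda>r K. \<Union>x\<in>K. H +>\<^bsub>M\<^esub> (r \<odot>\<^bsub>M\<^esub> x))\<rparr>"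

definition presented :: "('r, 'm) ring_scheme \<Rightarrow> 'x set \<Rightarrow> ('x \<Rightarrow> 'r) set \<Rightarrow> ('r, ('x \<Rightarrow> 'r) set) module"
  where "presented R G S = quot_module (free_module R G) (submodule_gen R (free_module R G) S)"

definition gen_class :: "('r, 'm) ring_scheme \<Rightarrow> 'x set \<Rightarrow> ('x \<Rightarrow> 'r) set \<Rightarrow> 'x \<Rightarrow> ('x \<Rightarrow> 'r) set"
  where "gen_class R G S g =
    submodule_gen R (free_module R G) S +>\<^bsub>free_module R G\<^esub> basis_elt R g"

text \<open>
  \<open>lift R P \<phi>\<close> is the linear map into \<open>P\<close>, defined on a module with generators \<open>G\<close>, that sends
  the class of a generator \<open>g\<close> to \<open>\<phi> g\<close>.  It is meaningful when the linear extension of \<open>\<phi>\<close>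
  annihilates the relations; the value then does not depend on the chosen representative.
\<close>

definition lift :: "('r, 'm) ring_scheme \<Rightarrow> ('r, 'b, 'n) module_scheme \<Rightarrow> ('x \<Rightarrow> 'b) \<Rightarrow> ('x \<Rightarrow> 'r) set \<Rightarrow> 'b"
  where "lift R P \<phi> K =
    (let p = (SOME p. p \<in> K) in finsum P (\<lambda>g. p g \<odot>\<^bsub>P\<^esub> \<phi> g) {g. p g \<noteq> \<zero>\<^bsub>R\<^esub>})"


section \<open>Graded modules and the Koszul sign convention\<close>

text \<open>
  A graded module is a family of modules indexed by the integers, and a map of degree \<open>k\<close> is a
  family of linear maps \<open>M n \<rightarrow> N (n + k)\<close>.  A homogeneous element \<open>x\<close> of degree \<open>n\<close> that occurs
  in a tensor carries its degree along, as the pair \<open>(n, x)\<close>.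
\<close>

type_synonym ('r, 'a) gmodule = "int \<Rightarrow> ('r, 'a) module"
type_synonym 'a homog = "int \<times> 'a"
type_synonym ('r, 'a, 'b) tensor = "('a homog \<times> 'b homog \<Rightarrow> 'r) set"
type_synonym ('r, 'a) tensor_word = "('a homog list \<Rightarrow> 'r) set"

definition graded_map ::
  "('r, 'm) ring_scheme \<Rightarrow> ('r, 'a) gmodule \<Rightarrow> ('r, 'b) gmodule \<Rightarrow> int \<Rightarrow> (int \<Rightarrow> 'a \<Rightarrow> 'b) \<Rightarrow> bool"
  where "graded_map R M N k f \<longleftrightarrow> (\<forall>n. f n \<in> module_hom R (M n) (N (n + k)))"

definition ksign :: "('r, 'a, 'n) module_scheme \<Rightarrow> int \<Rightarrow> 'a \<Rightarrow> 'a"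
  where "ksign M k x = (if even k then x else \<ominus>\<^bsub>M\<^esub> x)"


subsection \<open>Tensor product\<close>

definition tensor_gens :: "('r, 'a) gmodule \<Rightarrow> ('r, 'b) gmodule \<Rightarrow> int \<Rightarrow> ('a homog \<times> 'b homog) set"
  where "tensor_gens M N n =
    {((i, x), (j, y)) | i x j y. i + j = n \<and> x \<in> carrier (M i) \<and> y \<in> carrier (N j)}"

definition tensor_rels ::
  "('r, 'm) ring_scheme \<Rightarrow> ('r, 'a) gmodule \<Rightarrow> ('r, 'b) gmodule \<Rightarrow> int \<Rightarrow> ('a homog \<times> 'b homog \<Rightarrow> 'r) set"
  where "tensor_rels R M N n =
    (let F = free_module R (tensor_gens M N n); e = (\<lambda>i x j y. basis_elt R ((i, x), (j, y))) in
      {e i (x \<oplus>\<^bsub>M i\<^esub> x') j y \<ominus>\<^bsub>F\<^esub> (e i x j y \<oplus>\<^bsub>F\<^esub> e i x' j y) | i x x' j y.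
         i + j = n \<and> x \<in> carrier (M i) \<and> x' \<in> carrier (M i) \<and> y \<in> carrier (N j)} \<union>
      {e i x j (y \<oplus>\<^bsub>N j\<^esub> y') \<ominus>\<^bsub>F\<^esub> (e i x j y \<oplus>\<^bsub>F\<^esub> e i x j y') | i x j y y'.
         i + j = n \<and> x \<in> carrier (M i) \<and> y \<in> carrier (N j) \<and> y' \<in> carrier (N j)} \<union>
      {e i (r \<odot>\<^bsub>M i\<^esub> x) j y \<ominus>\<^bsub>F\<^esub> (r \<odot>\<^bsub>F\<^esub> e i x j y) | r i x j y.
         r \<in> carrier R \<and> i + j = n \<and> x \<in> carrier (M i) \<and> y \<in> carrier (N j)} \<union>
      {e i x j (r \<odot>\<^bsub>N j\<^esub> y) \<ominus>\<^bsub>F\<^esub> (r \<odot>\<^bsub>F\<^esub> e i x j y) | r i x j y.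
         r \<in> carrier R \<and> i + j = n \<and> x \<in> carrier (M i) \<and> y \<in> carrier (N j)})"

definition tensor_module ::
  "('r, 'm) ring_scheme \<Rightarrow> ('r, 'a) gmodule \<Rightarrow> ('r, 'b) gmodule \<Rightarrow> ('r, ('r, 'a, 'b) tensor) gmodule"
  where "tensor_module R M N n = presented R (tensor_gens M N n) (tensor_rels R M N n)"

definition tens ::
  "('r, 'm) ring_scheme \<Rightarrow> ('r, 'a) gmodule \<Rightarrow> ('r, 'b) gmodule \<Rightarrow> 'a homog \<Rightarrow> 'b homog \<Rightarrow> ('r, 'a, 'b) tensor"
  where "tens R M N a b =
    (let n = fst a + fst b in gen_class R (tensor_gens M N n) (tensor_rels R M N n) (a, b))"

text \<open>
  For \<open>f\<close> of degree \<open>p\<close> into \<open>M'\<close> and \<open>g\<close> of degree \<open>q\<close> into \<open>N'\<close>, the map \<open>f \<otimes> g\<close> sends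
  \<open>x \<otimes> y\<close> to \<open>(-1)\<^sup>q\<^sup>i f x \<otimes> g y\<close>, where \<open>i\<close> is the degree of \<open>x\<close>.
\<close>

definition tensor_map ::
  "('r, 'm) ring_scheme \<Rightarrow> ('r, 'c) gmodule \<Rightarrow> ('r, 'd) gmodule \<Rightarrow> int \<Rightarrow> int \<Rightarrow>
   (int \<Rightarrow> 'a \<Rightarrow> 'c) \<Rightarrow> (int \<Rightarrow> 'b \<Rightarrow> 'd) \<Rightarrow> int \<Rightarrow> ('r, 'a, 'b) tensor \<Rightarrow> ('r, 'c, 'd) tensor"
  where "tensor_map R M' N' p q f g n =
    (let P = tensor_module R M' N' (n + p + q) in
      lift R P (\<lambda>((i, x), (j, y)). ksign P (q * i) (tens R M' N' (i + p, f i x) (j + q, g j y))))"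

definition tensor_assoc ::
  "('r, 'm) ring_scheme \<Rightarrow> ('r, 'a) gmodule \<Rightarrow> ('r, 'b) gmodule \<Rightarrow> ('r, 'c) gmodule \<Rightarrow> int \<Rightarrow>
   ('r, ('r, 'a, 'b) tensor, 'c) tensor \<Rightarrow> ('r, 'a, ('r, 'b, 'c) tensor) tensor"
  where "tensor_assoc R L M N n =
    (let P = tensor_module R L (tensor_module R M N) n in
      lift R P (\<lambda>((m, t), (k, z)).
        lift R P (\<lambda>((i, x), (j, y)).
          tens R L (tensor_module R M N) (i, x) (j + k, tens R M N (j, y) (k, z))) t))"


subsection \<open>Tensor algebra\<close>

text \<open>
  In degree \<open>n\<close>, the tensor algebra on \<open>V\<close> is generated by the words of homogeneous elements of
  \<open>V\<close> of total degree \<open>n\<close>, subject to multilinearity; this is the direct sum, over all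
  \<open>k \<ge> 0\<close> and all \<open>(i\<^sub>1, \<dots>, i\<^sub>k)\<close> with sum \<open>n\<close>, of the tensor products
  \<open>V i\<^sub>1 \<otimes> \<dots> \<otimes> V i\<^sub>k\<close>.
\<close>

definition word_deg :: "'a homog list \<Rightarrow> int"
  where "word_deg w = sum_list (map fst w)"

definition word_gens :: "('r, 'a) gmodule \<Rightarrow> int \<Rightarrow> 'a homog list set"
  where "word_gens V n = {w. (\<forall>(i, x)\<in>set w. x \<in> carrier (V i)) \<and> word_deg w = n}"

definition word_rels :: "('r, 'm) ring_scheme \<Rightarrow> ('r, 'a) gmodule \<Rightarrow> int \<Rightarrow> ('a homog list \<Rightarrow> 'r) set"
  where "word_rels R V n =
    (let F = free_module R (word_gens V n); e = (\<lambda>u i x w. basis_elt R (u @ (i, x) # w)) in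
      {e u i (x \<oplus>\<^bsub>V i\<^esub> y) w \<ominus>\<^bsub>F\<^esub> (e u i x w \<oplus>\<^bsub>F\<^esub> e u i y w) | u i x y w.
         u @ (i, x) # w \<in> word_gens V n \<and> u @ (i, y) # w \<in> word_gens V n} \<union>
      {e u i (r \<odot>\<^bsub>V i\<^esub> x) w \<ominus>\<^bsub>F\<^esub> (r \<odot>\<^bsub>F\<^esub> e u i x w) | r u i x w.
         r \<in> carrier R \<and> u @ (i, x) # w \<in> word_gens V n})"

definition tensor_alg ::
  "('r, 'm) ring_scheme \<Rightarrow> ('r, 'a) gmodule \<Rightarrow> ('r, ('r, 'a) tensor_word) gmodule"
  where "tensor_alg R V n = presented R (word_gens V n) (word_rels R V n)"

definition word :: "('r, 'm) ring_scheme \<Rightarrow> ('r, 'a) gmodule \<Rightarrow> 'a homog list \<Rightarrow> ('r, 'a) tensor_word"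
  where "word R V w =
    (let n = word_deg w in gen_class R (word_gens V n) (word_rels R V n) w)"

definition word_mult ::
  "('r, 'm) ring_scheme \<Rightarrow> ('r, 'a) gmodule \<Rightarrow> int \<Rightarrow> int \<Rightarrow>
   ('r, 'a) tensor_word \<Rightarrow> ('r, 'a) tensor_word \<Rightarrow> ('r, 'a) tensor_word"
  where "word_mult R V m n s t =
    (let P = tensor_alg R V (m + n) in lift R P (\<lambda>u. lift R P (\<lambda>v. word R V (u @ v)) t) s)"


section \<open>Chain complexes, chain algebras and chain coalgebras\<close>

record ('r, 'a) chain_cx =
  obj :: "('r, 'a) gmodule"
  bd :: "int \<Rightarrow> 'a \<Rightarrow> 'a"

record ('r, 'a) chain_alg = "('r, 'a) chain_cx" +
  amult :: "int \<Rightarrow> int \<Rightarrow> 'a \<Rightarrow> 'a \<Rightarrow> 'a"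
  aunit :: "'a"

record ('r, 'a) chain_coalg = "('r, 'a) chain_cx" +
  comult :: "int \<Rightarrow> 'a \<Rightarrow> ('r, 'a, 'a) tensor"
  counit :: "int \<Rightarrow> 'a \<Rightarrow> 'r"

record ('r, 'a) coaug_chain_coalg = "('r, 'a) chain_coalg" +
  coaug :: "int \<Rightarrow> 'r \<Rightarrow> 'a"

definition chain_complex :: "('r, 'm) ring_scheme \<Rightarrow> ('r, 'a, 'z) chain_cx_scheme \<Rightarrow> bool"
  where "chain_complex R X \<longleftrightarrow>
    (\<forall>n. module R (obj X n)) \<and> graded_map R (obj X) (obj X) (- 1) (bd X) \<and>
    (\<forall>n. \<forall>x\<in>carrier (obj X n). bd X (n - 1) (bd X n x) = \<zero>\<^bsub>obj X (n - 2)\<^esub>)"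

definition chain_map ::
  "('r, 'm) ring_scheme \<Rightarrow> ('r, 'a, 'z) chain_cx_scheme \<Rightarrow> ('r, 'b, 'w) chain_cx_scheme \<Rightarrow>
   (int \<Rightarrow> 'a \<Rightarrow> 'b) \<Rightarrow> bool"
  where "chain_map R X Y f \<longleftrightarrow>
    graded_map R (obj X) (obj Y) 0 f \<and>
    (\<forall>n. \<forall>x\<in>carrier (obj X n). f (n - 1) (bd X n x) = bd Y n (f n x))"

definition tensor_bd ::
  "('r, 'm) ring_scheme \<Rightarrow> ('r, 'a, 'z) chain_cx_scheme \<Rightarrow> ('r, 'b, 'w) chain_cx_scheme \<Rightarrow>
   int \<Rightarrow> ('r, 'a, 'b) tensor \<Rightarrow> ('r, 'a, 'b) tensor"
  where "tensor_bd R X Y n t =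
    tensor_map R (obj X) (obj Y) (- 1) 0 (bd X) (\<lambda>_ y. y) n t
      \<oplus>\<^bsub>tensor_module R (obj X) (obj Y) (n - 1)\<^esub>
    tensor_map R (obj X) (obj Y) 0 (- 1) (\<lambda>_ x. x) (bd Y) n t"

definition tensor_cx ::
  "('r, 'm) ring_scheme \<Rightarrow> ('r, 'a, 'z) chain_cx_scheme \<Rightarrow> ('r, 'b, 'w) chain_cx_scheme \<Rightarrow>
   ('r, ('r, 'a, 'b) tensor) chain_cx"
  where "tensor_cx R X Y = \<lparr>obj = tensor_module R (obj X) (obj Y), bd = tensor_bd R X Y\<rparr>"


subsection \<open>Homotopies\<close>

definition strong_deformation_retract ::
  "('r, 'm) ring_scheme \<Rightarrow> ('r, 'a, 'z) chain_cx_scheme \<Rightarrow> ('r, 'b, 'w) chain_cx_scheme \<Rightarrow>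
   (int \<Rightarrow> 'a \<Rightarrow> 'b) \<Rightarrow> (int \<Rightarrow> 'b \<Rightarrow> 'a) \<Rightarrow> (int \<Rightarrow> 'b \<Rightarrow> 'b) \<Rightarrow> bool"
  where "strong_deformation_retract R X Y g f \<phi> \<longleftrightarrow>
    chain_complex R X \<and> chain_complex R Y \<and>
    chain_map R X Y g \<and> chain_map R Y X f \<and> graded_map R (obj Y) (obj Y) 1 \<phi> \<and>
    (\<forall>n. \<forall>x\<in>carrier (obj X n). f n (g n x) = x) \<and>
    (\<forall>n. \<forall>y\<in>carrier (obj Y n).
       bd Y (n + 1) (\<phi> n y) \<oplus>\<^bsub>obj Y n\<^esub> \<phi> (n - 1) (bd Y n y) = g n (f n y) \<ominus>\<^bsub>obj Y n\<^esub> y) \<and>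
    (\<forall>n. \<forall>x\<in>carrier (obj X n). \<phi> n (g n x) = \<zero>\<^bsub>obj Y (n + 1)\<^esub>) \<and>
    (\<forall>n. \<forall>y\<in>carrier (obj Y n). f (n + 1) (\<phi> n y) = \<zero>\<^bsub>obj X (n + 1)\<^esub>) \<and>
    (\<forall>n. \<forall>y\<in>carrier (obj Y n). \<phi> (n + 1) (\<phi> n y) = \<zero>\<^bsub>obj Y (n + 2)\<^esub>)"

definition chain_homotopic ::
  "('r, 'm) ring_scheme \<Rightarrow> ('r, 'a, 'z) chain_cx_scheme \<Rightarrow> ('r, 'b, 'w) chain_cx_scheme \<Rightarrow>
   (int \<Rightarrow> 'a \<Rightarrow> 'b) \<Rightarrow> (int \<Rightarrow> 'a \<Rightarrow> 'b) \<Rightarrow> bool"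
  where "chain_homotopic R X Y f g \<longleftrightarrow>
    (\<exists>H. graded_map R (obj X) (obj Y) 1 H \<and>
      (\<forall>n. \<forall>x\<in>carrier (obj X n).
         bd Y (n + 1) (H n x) \<oplus>\<^bsub>obj Y n\<^esub> H (n - 1) (bd X n x) = f n x \<ominus>\<^bsub>obj Y n\<^esub> g n x))"

definition chain_homotopy_equivalence ::
  "('r, 'm) ring_scheme \<Rightarrow> ('r, 'a, 'z) chain_cx_scheme \<Rightarrow> ('r, 'b, 'w) chain_cx_scheme \<Rightarrow>
   (int \<Rightarrow> 'a \<Rightarrow> 'b) \<Rightarrow> bool"
  where "chain_homotopy_equivalence R X Y f \<longleftrightarrow>
    chain_map R X Y f \<and>
    (\<exists>g. chain_map R Y X g \<and>
       chain_homotopic R X X (\<lambda>n x. g n (f n x)) (\<lambda>_ x. x) \<and>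
       chain_homotopic R Y Y (\<lambda>n y. f n (g n y)) (\<lambda>_ y. y))"


subsection \<open>Chain algebras\<close>

definition chain_alg_hom ::
  "('r, 'm) ring_scheme \<Rightarrow> ('r, 'a, 'z) chain_alg_scheme \<Rightarrow> ('r, 'b, 'w) chain_alg_scheme \<Rightarrow>
   (int \<Rightarrow> 'a \<Rightarrow> 'b) \<Rightarrow> bool"
  where "chain_alg_hom R X Y f \<longleftrightarrow>
    chain_map R X Y f \<and> f 0 (aunit X) = aunit Y \<and>
    (\<forall>m n. \<forall>x\<in>carrier (obj X m). \<forall>y\<in>carrier (obj X n).
       f (m + n) (amult X m n x y) = amult Y m n (f m x) (f n y))"

text \<open>\<open>(x \<otimes> y) (x' \<otimes> y') = (-1)\<^sup>j\<^sup>k x x' \<otimes> y y'\<close> for \<open>y\<close> of degree \<open>j\<close> and \<open>x'\<close> of degree \<open>k\<close>.\<close>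

definition tensor_chain_alg ::
  "('r, 'm) ring_scheme \<Rightarrow> ('r, 'a, 'z) chain_alg_scheme \<Rightarrow> ('r, 'b, 'w) chain_alg_scheme \<Rightarrow>
   ('r, ('r, 'a, 'b) tensor) chain_alg"
  where "tensor_chain_alg R X Y =
    \<lparr>obj = tensor_module R (obj X) (obj Y), bd = tensor_bd R X Y,
     amult = (\<lambda>m n s t.
       let P = tensor_module R (obj X) (obj Y) (m + n) in
         lift R P (\<lambda>((i, x), (j, y)).
           lift R P (\<lambda>((k, x'), (l, y')).
             ksign P (j * k)
               (tens R (obj X) (obj Y) (i + k, amult X i k x x') (j + l, amult Y j l y y'))) t) s),
     aunit = tens R (obj X) (obj Y) (0, aunit X) (0, aunit Y)\<rparr>"


subsection \<open>Chain coalgebras\<close>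

definition ground_module :: "('r, 'm) ring_scheme \<Rightarrow> ('r, 'r) gmodule"
  where "ground_module R n =
    \<lparr>carrier = (if n = 0 then carrier R else {\<zero>\<^bsub>R\<^esub>}), mult = mult R, one = \<one>\<^bsub>R\<^esub>,
     zero = \<zero>\<^bsub>R\<^esub>, add = add R, smult = mult R\<rparr>"

definition ground_coalg :: "('r, 'm) ring_scheme \<Rightarrow> ('r, 'r) chain_coalg"
  where "ground_coalg R =
    \<lparr>obj = ground_module R, bd = (\<lambda>_ _. \<zero>\<^bsub>R\<^esub>),
     comult = (\<lambda>n r.
       let P = tensor_module R (ground_module R) (ground_module R) n in
         if n = 0 then r \<odot>\<^bsub>P\<^esub> tens R (ground_module R) (ground_module R) (0, \<one>\<^bsub>R\<^esub>) (0, \<one>\<^bsub>R\<^esub>) else \<zero>\<^bsub>P\<^esub>),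
     counit = (\<lambda>_ r. r)\<rparr>"

definition chain_coalgebra :: "('r, 'm) ring_scheme \<Rightarrow> ('r, 'a, 'z) chain_coalg_scheme \<Rightarrow> bool"
  where "chain_coalgebra R C \<longleftrightarrow>
    chain_complex R C \<and>
    chain_map R C (tensor_cx R C C) (comult C) \<and>
    chain_map R C (ground_coalg R) (counit C) \<and>
    (\<forall>n. \<forall>c\<in>carrier (obj C n).
       tensor_assoc R (obj C) (obj C) (obj C) n
         (tensor_map R (tensor_module R (obj C) (obj C)) (obj C) 0 0 (comult C) (\<lambda>_ x. x) n (comult C n c))
       = tensor_map R (obj C) (tensor_module R (obj C) (obj C)) 0 0 (\<lambda>_ x. x) (comult C) n (comult C n c)) \<and>
    (\<forall>n. \<forall>c\<in>carrier (obj C n).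
       lift R (obj C n)
         (\<lambda>((i, x), (j, y)). if i = 0 then counit C i x \<odot>\<^bsub>obj C n\<^esub> y else \<zero>\<^bsub>obj C n\<^esub>) (comult C n c) = c \<and>
       lift R (obj C n)
         (\<lambda>((i, x), (j, y)). if j = 0 then counit C j y \<odot>\<^bsub>obj C n\<^esub> x else \<zero>\<^bsub>obj C n\<^esub>) (comult C n c) = c)"

definition chain_coalg_hom ::
  "('r, 'm) ring_scheme \<Rightarrow> ('r, 'a, 'z) chain_coalg_scheme \<Rightarrow> ('r, 'b, 'w) chain_coalg_scheme \<Rightarrow>
   (int \<Rightarrow> 'a \<Rightarrow> 'b) \<Rightarrow> bool"
  where "chain_coalg_hom R C D f \<longleftrightarrow>
    chain_map R C D f \<and>
    (\<forall>n. \<forall>c\<in>carrier (obj C n).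
       comult D n (f n c) = tensor_map R (obj D) (obj D) 0 0 f f n (comult C n c) \<and>
       counit D n (f n c) = counit C n c)"

definition coaugmented_chain_coalgebra ::
  "('r, 'm) ring_scheme \<Rightarrow> ('r, 'a, 'z) coaug_chain_coalg_scheme \<Rightarrow> bool"
  where "coaugmented_chain_coalgebra R C \<longleftrightarrow>
    chain_coalgebra R C \<and> chain_coalg_hom R (ground_coalg R) C (coaug C)"

definition coaug_one :: "('r, 'm) ring_scheme \<Rightarrow> ('r, 'a, 'z) coaug_chain_coalg_scheme \<Rightarrow> 'a"
  where "coaug_one R C = coaug C 0 \<one>\<^bsub>R\<^esub>"

text \<open>
  The map \<open>1 \<otimes> \<tau> \<otimes> 1\<close> from \<open>(M \<otimes> M) \<otimes> (N \<otimes> N)\<close> to \<open>(M \<otimes> N) \<otimes> (M \<otimes> N)\<close>, where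
  \<open>\<tau>\<close> interchanges the factors \<open>x'\<close> of degree \<open>j\<close> and \<open>y\<close> of degree \<open>k\<close> with the sign \<open>(-1)\<^sup>j\<^sup>k\<close>.
\<close>

definition middle_swap ::
  "('r, 'm) ring_scheme \<Rightarrow> ('r, 'a) gmodule \<Rightarrow> ('r, 'b) gmodule \<Rightarrow> int \<Rightarrow>
   ('r, ('r, 'a, 'a) tensor, ('r, 'b, 'b) tensor) tensor \<Rightarrow>
   ('r, ('r, 'a, 'b) tensor, ('r, 'a, 'b) tensor) tensor"
  where "middle_swap R M N n =
    (let T = tensor_module R M N; P = tensor_module R T T n in
      lift R P (\<lambda>((_, s), (_, t)).
        lift R P (\<lambda>((i, x), (j, x')).
          lift R P (\<lambda>((k, y), (l, y')).
            ksign P (j * k)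
              (tens R T T (i + k, tens R M N (i, x) (k, y)) (j + l, tens R M N (j, x') (l, y')))) t) s))"

definition tensor_coalg ::
  "('r, 'm) ring_scheme \<Rightarrow> ('r, 'a, 'z) coaug_chain_coalg_scheme \<Rightarrow>
   ('r, 'b, 'w) coaug_chain_coalg_scheme \<Rightarrow> ('r, ('r, 'a, 'b) tensor) coaug_chain_coalg"
  where "tensor_coalg R A B =
    (let M = obj A; N = obj B; T = tensor_module R M N in
      \<lparr>obj = T, bd = tensor_bd R A B,
       comult = (\<lambda>n t. middle_swap R M N n
         (tensor_map R (tensor_module R M M) (tensor_module R N N) 0 0 (comult A) (comult B) n t)),
       counit = (\<lambda>n. lift R (ground_module R n)
         (\<lambda>((i, x), (j, y)). counit A i x \<otimes>\<^bsub>R\<^esub> counit B j y)),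
       coaug = (\<lambda>n r. if n = 0
         then r \<odot>\<^bsub>T 0\<^esub> tens R M N (0, coaug_one R A) (0, coaug_one R B) else \<zero>\<^bsub>T n\<^esub>)\<rparr>)"


section \<open>The cobar construction\<close>

definition ker_counit ::
  "('r, 'm) ring_scheme \<Rightarrow> ('r, 'a, 'z) coaug_chain_coalg_scheme \<Rightarrow> ('r, 'a) gmodule"
  where "ker_counit R C n =
    (obj C n)\<lparr>carrier := {x \<in> carrier (obj C n). counit C n x = \<zero>\<^bsub>R\<^esub>}\<rparr>"

text \<open>
  Given a coaugmentation \<open>\<eta>\<close>, the module \<open>C\<close> is the direct sum of the image of \<open>\<eta>\<close> and
  \<open>ker \<epsilon>\<close>, and \<open>x \<mapsto> x - \<eta> (\<epsilon> x)\<close> is the projection onto \<open>ker \<epsilon>\<close>.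
\<close>

definition ker_proj :: "('r, 'a, 'z) coaug_chain_coalg_scheme \<Rightarrow> int \<Rightarrow> 'a \<Rightarrow> 'a"
  where "ker_proj C n x = x \<ominus>\<^bsub>obj C n\<^esub> coaug C n (counit C n x)"

text \<open>
  The element \<open>\<Delta> c - (c \<otimes> 1 + 1 \<otimes> c)\<close> of \<open>C \<otimes> C\<close> lies in the direct summand
  \<open>ker \<epsilon> \<otimes> ker \<epsilon>\<close>; it is transported there by the tensor square of the projection, which is the
  inverse of the inclusion on that summand.
\<close>

definition reduced_comult ::
  "('r, 'm) ring_scheme \<Rightarrow> ('r, 'a, 'z) coaug_chain_coalg_scheme \<Rightarrow> int \<Rightarrow> 'a \<Rightarrow> ('r, 'a, 'a) tensor"
  where "reduced_comult R C n c =
    (let P = tensor_module R (obj C) (obj C) n; u = coaug_one R C in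
      tensor_map R (ker_counit R C) (ker_counit R C) 0 0 (ker_proj C) (ker_proj C) n
        (comult C n c \<ominus>\<^bsub>P\<^esub>
           (tens R (obj C) (obj C) (n, c) (0, u) \<oplus>\<^bsub>P\<^esub> tens R (obj C) (obj C) (0, u) (n, c))))"

text \<open>
  The desuspension has the same elements with the degree lowered by one, so that \<open>s\<^sup>-\<^sup>1\<close> is given
  by the identity, as a map of degree \<open>-1\<close>.
\<close>

definition desusp_ker ::
  "('r, 'm) ring_scheme \<Rightarrow> ('r, 'a, 'z) coaug_chain_coalg_scheme \<Rightarrow> ('r, 'a) gmodule"
  where "desusp_ker R C n = ker_counit R C (n + 1)"

definition cobar_gen_bd ::
  "('r, 'm) ring_scheme \<Rightarrow> ('r, 'a, 'z) coaug_chain_coalg_scheme \<Rightarrow> 'a homog \<Rightarrow> ('r, 'a) tensor_word"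
  where "cobar_gen_bd R C l =
    (let V = desusp_ker R C; k = fst l; c = snd l; P = tensor_alg R V (k - 1) in
      (\<ominus>\<^bsub>P\<^esub> word R V [(k - 1, bd C (k + 1) c)]) \<oplus>\<^bsub>P\<^esub>
      lift R P (\<lambda>(a, b). word R V [a, b])
        (tensor_map R V V (- 1) (- 1) (\<lambda>_ x. x) (\<lambda>_ x. x) (k + 1) (reduced_comult R C (k + 1) c)))"

primrec cobar_word_bd ::
  "('r, 'm) ring_scheme \<Rightarrow> ('r, 'a, 'z) coaug_chain_coalg_scheme \<Rightarrow> 'a homog list \<Rightarrow> ('r, 'a) tensor_word"
  where
    "cobar_word_bd R C [] = \<zero>\<^bsub>tensor_alg R (desusp_ker R C) (- 1)\<^esub>"
  | "cobar_word_bd R C (l # w) =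
      (let V = desusp_ker R C; k = fst l; n = word_deg w; P = tensor_alg R V (k + n - 1) in
        word_mult R V (k - 1) n (cobar_gen_bd R C l) (word R V w) \<oplus>\<^bsub>P\<^esub>
        ksign P k (word_mult R V k (n - 1) (word R V [l]) (cobar_word_bd R C w)))"

definition cobar ::
  "('r, 'm) ring_scheme \<Rightarrow> ('r, 'a, 'z) coaug_chain_coalg_scheme \<Rightarrow> ('r, ('r, 'a) tensor_word) chain_alg"
  where "cobar R C =
    (let V = desusp_ker R C in
      \<lparr>obj = tensor_alg R V,
       bd = (\<lambda>n. lift R (tensor_alg R V (n - 1)) (cobar_word_bd R C)),
       amult = word_mult R V,
       aunit = word R V []\<rparr>)"


section \<open>The Milgram map\<close>

text \<open>The letter \<open>[x]\<close> of the cobar construction, for \<open>x\<close> of degree \<open>n\<close> in \<open>ker \<epsilon>\<close>.\<close>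

definition cobar_letter ::
  "('r, 'm) ring_scheme \<Rightarrow> ('r, 'a, 'z) coaug_chain_coalg_scheme \<Rightarrow> int \<Rightarrow> 'a \<Rightarrow> ('r, 'a) tensor_word"
  where "cobar_letter R C n x = word R (desusp_ker R C) [(n - 1, x)]"

definition is_milgram_map ::
  "('r, 'm) ring_scheme \<Rightarrow> ('r, 'a, 'z) coaug_chain_coalg_scheme \<Rightarrow>
   ('r, 'b, 'w) coaug_chain_coalg_scheme \<Rightarrow>
   (int \<Rightarrow> ('r, ('r, 'a, 'b) tensor) tensor_word \<Rightarrow>
     ('r, ('r, 'a) tensor_word, ('r, 'b) tensor_word) tensor) \<Rightarrow> bool"
  where "is_milgram_map R A B q \<longleftrightarrow>
    (let AB = tensor_coalg R A B; T = tens R (obj A) (obj B);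
         \<Omega>A = cobar R A; \<Omega>B = cobar R B; U = tens R (obj \<Omega>A) (obj \<Omega>B) in
      chain_alg_hom R (cobar R AB) (tensor_chain_alg R \<Omega>A \<Omega>B) q \<and>
      (\<forall>n. \<forall>a\<in>carrier (ker_counit R A n).
         q (n - 1) (cobar_letter R AB n (T (n, a) (0, coaug_one R B))) =
         U (n - 1, cobar_letter R A n a) (0, aunit \<Omega>B)) \<and>
      (\<forall>n. \<forall>b\<in>carrier (ker_counit R B n).
         q (n - 1) (cobar_letter R AB n (T (0, coaug_one R A) (n, b))) =
         U (0, aunit \<Omega>A) (n - 1, cobar_letter R B n b)) \<and>
      (\<forall>m n. \<forall>a\<in>carrier (ker_counit R A m). \<forall>b\<in>carrier (ker_counit R B n).
         q (m + n - 1) (cobar_letter R AB (m + n) (T (m, a) (n, b))) =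
         \<zero>\<^bsub>tensor_module R (obj \<Omega>A) (obj \<Omega>B) (m + n - 1)\<^esub>))"

text \<open>
  The letters listed above generate \<open>\<Omega> (A \<otimes> B)\<close> as an algebra, so the Milgram map is unique on
  the carriers; choice only fixes its irrelevant values outside of them.
\<close>

definition milgram_map ::
  "('r, 'm) ring_scheme \<Rightarrow> ('r, 'a, 'z) coaug_chain_coalg_scheme \<Rightarrow>
   ('r, 'b, 'w) coaug_chain_coalg_scheme \<Rightarrow>
   int \<Rightarrow> ('r, ('r, 'a, 'b) tensor) tensor_word \<Rightarrow>
     ('r, ('r, 'a) tensor_word, ('r, 'b) tensor_word) tensor"
  where "milgram_map R A B = (SOME q. is_milgram_map R A B q)"

end

theory Submission
  imports Defs
begin

text \<open>
  The Milgram map \<open>q\<close> kills every letter \<open>[a \<otimes> b]\<close> with \<open>a\<close>, \<open>b\<close> in the kernels of the counits, and a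
  section of it has to restore them. For a word \<open>x = [a\<^sub>1|...|a\<^sub>n]\<close> over \<open>A\<close> consider the map from \<open>B\<close>
  to \<open>\<Omega>(A \<otimes> B)\<close> sending \<open>c\<close> to \<open>\<Sum> \<plusminus> [a\<^sub>1 \<otimes> c\<^sub>1] ... [a\<^sub>n \<otimes> c\<^sub>n]\<close>, a convolution product over the
  coproduct of \<open>c\<close>. This defines a morphism from \<open>\<Omega>A\<close> to the convolution algebra, and \<open>\<tau>(c) = [1 \<otimes> c]\<close>
  is a twisting cochain; the morphism is compatible with differentials when that of the
  convolution algebra is twisted by the commutator with \<open>\<tau>\<close> (\<open>phi_d\<close>). Multiplying by \<open>[1 \<otimes> b]\<close> for
  every letter \<open>[b]\<close> of a word over \<open>B\<close> gives operators \<open>K c : \<Omega>A \<otimes> \<Omega>B \<rightarrow> \<Omega>(A \<otimes> B)\<close>, whose differential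
  \<open>d_K\<close> computes. The operator \<open>S = K 1\<close> is a chain map, and \<open>q (K c u) = \<epsilon>(c) u\<close>, so \<open>q S = 1\<close>.

  The section \<open>S\<close> is not multiplicative. For an element \<open>t\<close> of \<open>A \<otimes> B\<close> let \<open>kap t\<close> be the operator
  \<open>\<epsilon>(t) S - K ((\<epsilon> \<otimes> 1) t)\<close>. By \<open>d_kap\<close> it is a homotopy between \<open>[t] S(u)\<close> and \<open>S(q[t] u)\<close>, up to terms
  involving the coproduct of \<open>t\<close>. The homotopy \<open>H\<close> is defined along words by
  \<open>H([t] x) = \<plusminus> [t] H(x) + kap t (q x)\<close> and \<open>H[] = 0\<close>, and \<open>d H + H d = S q - 1\<close> follows by induction,
  the coproduct terms cancelling those in \<open>d[t]\<close> (\<open>d_H\<close>). The side conditions reduce to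
  \<open>q (K c u) = \<epsilon>(c) u\<close> and \<open>H (K c u) = 0\<close>: they give \<open>q H = 0\<close>, \<open>H S = 0\<close> and, as \<open>kap\<close> is made of
  operators \<open>K\<close>, also \<open>H H = 0\<close>.

  Two devices keep degrees and tensors out of these arguments. A chain algebra is replaced by the
  direct sum \<open>Tot\<close> of its degrees, an ordinary ring with ordinary linear endomorphisms; maps of a
  fixed degree there are the same as graded maps (\<open>graded_of_tot\<close>). And a coproduct is only used in
  Sweedler's form, as the sum \<open>csum\<close> of a multilinear function over a chosen representation by pure
  tensors; \<open>coalgebra_into\<close> lists the coalgebra axioms in this form.
\<close>

abbreviation (input) op_mult ("(_ \<otimes>[_] _)" [70, 0, 71] 70) where "x \<otimes>[G] y == x \<otimes>\<^bsub>G\<^esub> y"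
abbreviation (input) op_add ("(_ \<oplus>[_] _)" [65, 0, 66] 65) where "x \<oplus>[G] y == x \<oplus>\<^bsub>G\<^esub> y"
abbreviation (input) op_diff ("(_ \<ominus>[_] _)" [65, 0, 66] 65) where "x \<ominus>[G] y == x \<ominus>\<^bsub>G\<^esub> y"
abbreviation (input) op_smult ("(_ \<odot>[_] _)" [70, 0, 71] 70) where "r \<odot>[G] x == r \<odot>\<^bsub>G\<^esub> x"
abbreviation (input) op_minus ("(\<ominus>[_] _)" [0, 81] 80) where "\<ominus>[G] x == \<ominus>\<^bsub>G\<^esub> x"
abbreviation (input) op_zero ("\<zero>[_]") where "\<zero>[G] == \<zero>\<^bsub>G\<^esub>"
abbreviation (input) op_one ("\<one>[_]") where "\<one>[G] == \<one>\<^bsub>G\<^esub>"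
abbreviation (input) "car == carrier"
abbreviation (input) "Hom == module_hom"

section \<open>Linear maps and finite sums\<close>

lemma mhI:
 assumes "!!x. x : car M ==> f x : car N"
  and "!!x y. [|x : car M; y : car M|] ==> f (x \<oplus>[M] y) = f x \<oplus>[N] f y"
  and "!!r x. [|r : car R; x : car M|] ==> f (r \<odot>[M] x) = r \<odot>[N] f x"
 shows "f : Hom R M N" using assms by (auto simp: module_hom_def hom_def)

lemma mh_closed: "f : Hom R M N ==> x : car M ==> f x : car N" by (auto simp: module_hom_def hom_def)

lemma mh_add:
 "f : Hom R M N ==> x : car M ==> y : car M ==> f (x \<oplus>[M] y) = f x \<oplus>[N] f y" by (auto simp: module_hom_def hom_def)

lemma mh_smult:
 "f : Hom R M N ==> r : car R ==> x : car M ==> f (r \<odot>[M] x) = r \<odot>[N] f x" by (auto simp: module_hom_def)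

lemma mh_zero:
 assumes f: "f : Hom R M N" and M: "module R M" and N: "module R N"
 shows "f \<zero>[M] = \<zero>[N]"
proof -
 interpret M: module R M by fact
 interpret N: module R N by fact
 have "f \<zero>[M] \<oplus>[N] f \<zero>[M] = f \<zero>[M]" using mh_add[OF f, of "\<zero>[M]" "\<zero>[M]"] by simp
 then show ?thesis using mh_closed[OF f M.zero_closed] N.add.r_cancel_one' by metis
qed

lemma mh_neg:
 assumes f: "f : Hom R M N" and M: "module R M" and N: "module R N"
  and x: "x : car M"
 shows "f (\<ominus>[M] x) = \<ominus>[N] f x"
proof -
 interpret M: module R M by fact
 interpret N: module R N by fact
 have "f (\<ominus>[M] x) \<oplus>[N] f x = \<zero>[N]" using mh_add[OF f, of "\<ominus>[M] x" x] x mh_zero[OF f M N] by (simp add: M.l_neg)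
 then show ?thesis using mh_closed[OF f] x by (simp add: N.minus_equality)
qed

lemma mh_minus:
 assumes f: "f : Hom R M N" and M: "module R M" and N: "module R N"
  and x: "x : car M" "y : car M"
 shows "f (x \<ominus>[M] y) = f x \<ominus>[N] f y"
proof -
 interpret M: module R M by fact
 show ?thesis using mh_add[OF f x(1), of "\<ominus>[M] y"] mh_neg[OF f M N x(2)] x by (simp add: a_minus_def)
qed

lemma minus_eq_zero_iff:
 assumes "abelian_group P" "x : car P" "y : car P"
 shows "x \<ominus>[P] y = \<zero>[P] \<longleftrightarrow> x = y"
proof -
 interpret abelian_group P by fact
 show ?thesis using assms(2,3) add.inv_solve_right[of "\<zero>[P]" x y] by (auto simp: a_minus_def)
qed

lemma mh_comp:
 "f : Hom R M N ==> g : Hom R N P ==> (%x. g (f x)) : Hom R M P" by (rule mhI) (simp_all add: mh_closed mh_add mh_smult)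

lemma mh_id: "(%x. x) : Hom R M M" by (rule mhI) auto

lemma mh_plus:
 assumes f: "f : Hom R M N" and g: "g : Hom R M N" and N: "module R N"
 shows "(%x. f x \<oplus>[N] g x) : Hom R M N"
proof -
 interpret N: module R N by fact
 show ?thesis by (rule mhI) (simp_all add: mh_closed[OF f] mh_closed[OF g] mh_add[OF f] mh_add[OF g]
    mh_smult[OF f] mh_smult[OF g] N.a_ac N.smult_r_distr)
qed

lemma mh_scale:
 assumes f: "f : Hom R M N" and N: "module R N" and r: "r : car R"
 shows "(%x. r \<odot>[N] f x) : Hom R M N"
proof -
 interpret N: module R N by fact
 show ?thesis using r by (intro mhI) (simp_all add: mh_closed[OF f] mh_add[OF f]
    mh_smult[OF f] N.smult_r_distr N.R.m_comm flip: N.smult_assoc1)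
qed

lemma mh_const_zero: "module R N ==> (%x. \<zero>[N]) : Hom R M N"
proof -
 assume "module R N"
 then interpret N: module R N .
 show ?thesis by (rule mhI) auto
qed

text \<open>
  Every sign is written as a power of \<open>-1\<close>, even the one of a difference; an identity between signed
  sums then reduces to comparing parities of exponents.
\<close>

lemma ksign_closed [simp]: "abelian_group P ==> x : car P ==> ksign P k x : car P" by (simp add: ksign_def abelian_group.a_inv_closed)

lemma ksign_add:
 "abelian_group P ==> x : car P ==> y : car P ==>
  ksign P k (x \<oplus>[P] y) = ksign P k x \<oplus>[P] ksign P k y" by (simp add: ksign_def abelian_group.minus_add)

lemma ksign_zero [simp]:
 assumes "abelian_group P" shows "ksign P k \<zero>[P] = \<zero>[P]"
proof -
 interpret abelian_group P by fact
 show ?thesis by (simp add: ksign_def)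
qed

lemma ksign_ksign: "abelian_group P ==> x : car P ==> ksign P k (ksign P l x) = ksign P (k + l) x" by (simp add: ksign_def abelian_group.minus_minus)

lemma ksign_0 [simp]: "ksign P 0 x = x" by (simp add: ksign_def)

lemma ksign_cong: "even k = even l ==> ksign P k x = ksign P l x" by (simp add: ksign_def)

lemma neg_ksign: "\<ominus>[P] x = ksign P 1 x" by (simp add: ksign_def)

lemma ksign_cancel:
 assumes "abelian_group P" "x : car P" "even k ~= even l"
 shows "ksign P k x \<oplus>[P] ksign P l x = \<zero>[P]"
proof -
 interpret abelian_group P by fact
 show ?thesis using assms by (auto simp: ksign_def l_neg r_neg)
qed

lemma mh_ksign:
 assumes f: "f : Hom R M N" and M: "module R M" and N: "module R N"
  and x: "x : car M"
 shows "f (ksign M k x) = ksign N k (f x)" using mh_neg[OF f M N x] by (simp add: ksign_def)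

lemma ksign_smult: "module R P ==> r : car R ==> x : car P ==>
  ksign P k (r \<odot>[P] x) = r \<odot>[P] ksign P k x" by (simp add: ksign_def module.smult_r_minus)

lemma mh_ksignI:
 assumes f: "f : Hom R M N" and N: "module R N"
 shows "(%x. ksign N k (f x)) : Hom R M N"
proof -
 interpret N: module R N by fact
 show ?thesis by (rule mhI) (simp_all add: mh_closed[OF f] mh_add[OF f] mh_smult[OF f] ksign_add[OF N.abelian_group_axioms]
    ksign_smult[OF N] N.abelian_group_axioms)
qed

primrec lsum :: "('b, 'n) ring_scheme => ('x => 'b) => 'x list => 'b" where
 "lsum P f [] = \<zero>[P]"
| "lsum P f (x # xs) = f x \<oplus>[P] lsum P f xs"

lemma lsum_closed:
 "abelian_group P ==> (!!x. x : set xs ==> f x : car P) ==> lsum P f xs : car P"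
 by (induction xs) (auto simp: abelian_monoid.zero_closed abelian_group.axioms(1) abelian_monoid.a_closed)

lemma lsum_cong: "(!!x. x : set xs ==> f x = g x) ==> lsum P f xs = lsum P g xs" by (induction xs) auto

lemma lsum_add:
 assumes P: "abelian_group P"
  and "!!x. x : set xs ==> f x : car P" "!!x. x : set xs ==> g x : car P"
 shows "lsum P (%x. f x \<oplus>[P] g x) xs = lsum P f xs \<oplus>[P] lsum P g xs"
proof -
 interpret P: abelian_group P by fact
 show ?thesis using assms(2,3) by (induction xs) (auto simp: P.a_ac lsum_closed[OF P])
qed

lemma lsum_zero: "abelian_group P ==> lsum P (%x. \<zero>[P]) xs = \<zero>[P]"
 by (induction xs) (auto simp: abelian_monoid.zero_closed abelian_group.axioms(1) abelian_monoid.l_zero)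

lemma lsum_hom:
 assumes f: "f : Hom R P Q" and P: "module R P" and Q: "module R Q"
  and g: "!!x. x : set xs ==> g x : car P"
 shows "f (lsum P g xs) = lsum Q (%x. f (g x)) xs" using g
proof (induction xs)
 case Nil
 show ?case by (simp add: mh_zero[OF f P Q])
next
 case (Cons x xs)
 have "lsum P g xs : car P" using Cons.prems by (intro lsum_closed module.axioms(2)[OF P]) auto
 then show ?case using Cons by (simp add: mh_add[OF f])
qed

lemma lsum_swap:
 assumes P: "abelian_group P"
  and F: "!!x y. x : set xs ==> y : set ys ==> F x y : car P"
 shows "lsum P (%x. lsum P (%y. F x y) ys) xs = lsum P (%y. lsum P (%x. F x y) xs) ys" using F
proof (induction xs)
 case Nil
 show ?case by (simp add: lsum_zero[OF P])
next
 case (Cons x xs)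
 then show ?case by (simp add: lsum_add[OF P] lsum_closed[OF P])
qed

section \<open>Modules given by generators and relations\<close>

lemma free_module_simps [simp]:
 "zero (free_module R G) = (%g. \<zero>[R])"
 "add (free_module R G) = (%p q g. p g \<oplus>[R] q g)"
 "smult (free_module R G) = (%r p g. r \<otimes>[R] p g)" by (simp_all add: free_module_def)

lemma free_carrier:
 "p : car (free_module R G) \<longleftrightarrow>
  (\<forall>g. p g : car R) & (\<forall>g. g ~: G --> p g = \<zero>[R]) & finite {g. p g ~= \<zero>[R]}" by (simp add: free_module_def)

lemma free_module_module:
 assumes "cring R" shows "module R (free_module R G)"
proof -
 interpret cring R by fact
 let ?F = "free_module R G"
 have add: "(%g. p g \<oplus>[R] q g) : car ?F" if "p : car ?F" "q : car ?F" for p q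
 proof -
  have "{g. p g \<oplus>[R] q g ~= \<zero>[R]} <= {g. p g ~= \<zero>[R]} \<union> {g. q g ~= \<zero>[R]}" by auto
  with that show ?thesis by (auto simp: free_carrier intro: finite_subset)
 qed
 have sm: "(%g. r \<otimes>[R] q g) : car ?F" if "r : car R" "q : car ?F" for r q
 proof -
  have "{g. r \<otimes>[R] q g ~= \<zero>[R]} <= {g. q g ~= \<zero>[R]}" using that by auto
  with that show ?thesis by (auto simp: free_carrier intro: finite_subset)
 qed
 have inv: "\<exists>y\<in>carrier ?F. (%g. y g \<oplus>[R] p g) = (%g. \<zero>[R])" if "p : car ?F" for p
  using that by (intro bexI[OF _ sm[of "\<ominus>[R] \<one>[R]" p]]) (auto simp: free_carrier l_minus l_neg)
 have car: "p g : car R" if "p : car ?F" for p g using that by (simp add: free_carrier)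
 have z: "(%g. \<zero>[R]) : car ?F" by (simp add: free_carrier)
 show ?thesis by (rule moduleI[OF assms abelian_groupI])
    (use inv in \<open>simp_all add: add sm z car a_ac l_distr r_distr m_assoc\<close>)
qed

lemma basis_closed:
 assumes "cring R" "g : G"
 shows "basis_elt R g : car (free_module R G)"
proof -
 interpret cring R by fact
 have "{h. basis_elt R g h ~= \<zero>[R]} <= {g}" by (auto simp: basis_elt_def)
 then have "finite {h. basis_elt R g h ~= \<zero>[R]}" by (rule finite_subset) simp
 then show ?thesis using assms(2) by (auto simp: free_carrier basis_elt_def)
qed

definition ev :: "('r, 'm) ring_scheme => ('r, 'b, 'n) module_scheme => ('x => 'b) => ('x => 'r) => 'b" where
 "ev R P \<phi> p = finsum P (%g. p g \<odot>[P] \<phi> g) {g. p g ~= \<zero>[R]}"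

lemma lift_ev: "lift R P \<phi> K = ev R P \<phi> (SOME p. p : K)" by (simp add: lift_def ev_def Let_def)

lemma ev_superset:
 assumes "module R P" and "p : car (free_module R G)" and "!!g. g : G ==> \<phi> g : car P"
  and "finite S" "{g. p g ~= \<zero>[R]} <= S" "S <= G"
 shows "ev R P \<phi> p = finsum P (%g. p g \<odot>[P] \<phi> g) S"
proof -
 interpret P: module R P by fact
 show ?thesis unfolding ev_def using assms(2-) by (intro P.add.finprod_mono_neutral_cong_left) (auto simp: free_carrier)
qed

lemma ev_hom:
 assumes P: "module R P" and \<phi>: "!!g. g : G ==> \<phi> g : car P"
 shows "ev R P \<phi> : Hom R (free_module R G) P"
proof (rule mhI)
 interpret P: module R P by fact
 interpret F: module R "free_module R G" by (rule free_module_module) (rule P.R.cring_axioms)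
 have c: "p g : car R" if "p : car (free_module R G)" for p g using that by (simp add: free_carrier)
 have s: "finite {g. p g ~= \<zero>[R]}" "{g. p g ~= \<zero>[R]} <= G" if "p : car (free_module R G)" for p using that by (auto simp: free_carrier)
 fix p assume p: "p : car (free_module R G)"
 let ?S = "{g. p g ~= \<zero>[R]}"
 show "ev R P \<phi> p : car P" unfolding ev_def using c[OF p] subsetD[OF s(2)[OF p]] \<phi> by (intro P.finsum_closed) blast
 { fix q assume q: "q : car (free_module R G)"
  let ?U = "?S \<union> {g. q g ~= \<zero>[R]}"
  have U: "finite ?U" "?U <= G" using s[OF p] s[OF q] by auto
  have \<phi>U: "\<phi> g : car P" if "g : ?U" for g using \<phi> U that by blast
  have pq: "(%g. p g \<oplus>[R] q g) : car (free_module R G)" using F.a_closed[OF p q] by simp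
  have "ev R P \<phi> (p \<oplus>[free_module R G] q) = finsum P (%g. (p g \<oplus>[R] q g) \<odot>[P] \<phi> g) ?U"
   unfolding free_module_simps by (rule ev_superset[OF P pq \<phi> U(1) _ U(2)]) auto
  also have "... = finsum P (%g. p g \<odot>[P] \<phi> g \<oplus>[P] q g \<odot>[P] \<phi> g) ?U" using c[OF p] c[OF q] \<phi>U
   by (intro P.finsum_cong' refl P.smult_l_distr Pi_I P.a_closed P.smult_closed)
  also have "... = finsum P (%g. p g \<odot>[P] \<phi> g) ?U \<oplus>[P] finsum P (%g. q g \<odot>[P] \<phi> g) ?U"
   using c[OF p] c[OF q] \<phi>U by (intro P.finsum_addf Pi_I P.smult_closed)
  also have "... = ev R P \<phi> p \<oplus>[P] ev R P \<phi> q"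
   using ev_superset[OF P p \<phi> U(1) _ U(2)] ev_superset[OF P q \<phi> U(1) _ U(2)] by auto
  finally show "ev R P \<phi> (p \<oplus>[free_module R G] q) = ev R P \<phi> p \<oplus>[P] ev R P \<phi> q" . }
 { fix r assume r: "r : car R"
  have \<phi>S: "\<phi> g : car P" if "g : ?S" for g using \<phi> s[OF p] that by blast
  have rp: "(%g. r \<otimes>[R] p g) : car (free_module R G)" using F.smult_closed[OF r p] by simp
  have "ev R P \<phi> (r \<odot>[free_module R G] p) = finsum P (%g. (r \<otimes>[R] p g) \<odot>[P] \<phi> g) ?S"
   unfolding free_module_simps by (rule ev_superset[OF P rp \<phi> s(1)[OF p] _ s(2)[OF p]]) (use r in auto)
  also have "... = finsum P (%g. r \<odot>[P] (p g \<odot>[P] \<phi> g)) ?S"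
   using c[OF p] \<phi>S r by (intro P.finsum_cong' refl P.smult_assoc1 Pi_I P.smult_closed)
  also have "... = r \<odot>[P] ev R P \<phi> p" unfolding ev_def using c[OF p] \<phi>S r s(1)[OF p]
   by (intro P.finsum_smult_ldistr[symmetric] Pi_I P.smult_closed)
  finally show "ev R P \<phi> (r \<odot>[free_module R G] p) = r \<odot>[P] ev R P \<phi> p" . }
qed

lemma ev_basis:
 assumes P: "module R P" and \<phi>: "!!g. g : G ==> \<phi> g : car P" and g: "g : G"
 shows "ev R P \<phi> (basis_elt R g) = \<phi> g"
proof -
 interpret P: module R P by fact
 have "ev R P \<phi> (basis_elt R g) = finsum P (%h. basis_elt R g h \<odot>[P] \<phi> h) {g}"
  using g by (intro ev_superset[OF P basis_closed[OF P.R.cring_axioms] \<phi>])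
   (auto simp: basis_elt_def split: if_splits)
 also have "... = \<phi> g" using \<phi>[OF g] by (simp add: basis_elt_def)
 finally show ?thesis .
qed

lemma free_induct [consumes 2, case_names zero step]:
 assumes "cring R" and "p : car (free_module R G)"
  and "Q (%g. \<zero>[R])"
  and step: "!!p r g. [|p : car (free_module R G); Q p; r : car R; g : G|] ==>
   Q (p \<oplus>[free_module R G] (r \<odot>[free_module R G] basis_elt R g))"
 shows "Q p"
proof -
 interpret cring R by fact
 have "Q p" if "p : car (free_module R G)" "{g. p g ~= \<zero>[R]} <= S" "finite S" for p S using that(3,1,2)
 proof (induction S arbitrary: p rule: finite_induct)
  case empty
  then have "p = (%g. \<zero>[R])" by auto
  then show ?case using assms(3) by simp
 next
  case (insert x S)
  let ?p = "p(x := \<zero>[R])"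
  have sub: "{g. ?p g ~= \<zero>[R]} <= {g. p g ~= \<zero>[R]}" by auto
  have p: "?p : car (free_module R G)" using insert.prems(1) finite_subset[OF sub] by (auto simp: free_carrier)
  have Q: "Q ?p" using insert.prems(2) by (intro insert.IH p) auto
  show ?case
  proof (cases "x : G")
   case True
   have "p x : car R" using insert.prems(1) by (simp add: free_carrier)
   from step[OF p Q this True]
   moreover have "(?p \<oplus>[free_module R G] (p x \<odot>[free_module R G] basis_elt R x)) = p"
    using insert.prems(1) by (auto simp: basis_elt_def free_carrier)
   ultimately show ?thesis by simp
  next
   case False
   then have "?p = p" using insert.prems(1) by (auto simp: free_carrier)
   then show ?thesis using Q by simp
  qed
 qed
 then show ?thesis using assms(2) by (auto simp: free_carrier)
qed

lemma submodule_gen_submodule: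
 assumes M: "module R M" and S: "S <= car M"
 shows "submodule (submodule_gen R M S) R M"
proof -
 interpret M: module R M by fact
 have c: "submodule (car M) R M & S <= car M" using M.carrier_is_submodule S by blast
 have z: "\<zero>[M] : H" if "submodule H R M" for H using subgroup.one_closed[OF submodule.axioms(1)[OF that]] by simp
 show ?thesis unfolding submodule_gen_def
 proof (rule M.submoduleI)
  show "\<Inter> {H. submodule H R M & S <= H} <= car M" using c by blast
 qed (use z M.submoduleE(3,4,5) in \<open>simp_all\<close>)
qed

lemma submodule_gen_least:
 "submodule H R M ==> S <= H ==> submodule_gen R M S <= H" by (auto simp: submodule_gen_def)

lemma submodule_gen_superset: "S <= submodule_gen R M S" by (auto simp: submodule_gen_def)

lemma kernel_submodule:
 assumes f: "f : Hom R M N" and M: "module R M" and N: "module R N"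
 shows "submodule {x : car M. f x = \<zero>[N]} R M"
proof -
 interpret M: module R M by fact
 interpret N: module R N by fact
 show ?thesis by (rule M.submoduleI)
   (auto simp: mh_zero[OF f M N] mh_neg[OF f M N] mh_add[OF f] mh_smult[OF f])
qed

lemma quot_abelian_subgroup:
 "module R M ==> submodule H R M ==> abelian_subgroup H M"
 by (intro abelian_subgroupI3 additive_subgroupI) (auto simp: module_def dest: submodule.axioms(1))

lemma quot_carrier: "car (quot_module M H) = (%x. H +>\<^bsub>M\<^esub> x) ` car M" by (auto simp: quot_module_def A_RCOSETS_def')

lemma quot_add:
 assumes "module R M" "submodule H R M" "x : car M" "y : car M"
 shows "(H +>\<^bsub>M\<^esub> x) \<oplus>[quot_module M H] (H +>\<^bsub>M\<^esub> y) = H +>\<^bsub>M\<^esub> (x \<oplus>[M] y)"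
 using abelian_subgroup.a_rcos_sum[OF quot_abelian_subgroup[OF assms(1,2)] assms(3,4)] by (simp add: quot_module_def)

lemma quot_coset_eq:
 assumes M: "module R M" and H: "submodule H R M" and "x : car M" "y : car M"
 shows "H +>\<^bsub>M\<^esub> x = H +>\<^bsub>M\<^esub> y \<longleftrightarrow> x \<ominus>[M] y : H"
proof -
 interpret abelian_subgroup H M by (rule quot_abelian_subgroup) fact+
 have "x \<ominus>[M] y : H \<longleftrightarrow> x : H +>\<^bsub>M\<^esub> y" using a_rcos_module[of y x] assms(3,4) by (simp add: a_minus_def)
 also have "... \<longleftrightarrow> H +>\<^bsub>M\<^esub> x = H +>\<^bsub>M\<^esub> y"
  using a_repr_independence[OF _ assms(4) a_subgroup, of x] a_rcos_self[OF assms(3)] by auto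
 finally show ?thesis by simp
qed

lemma quot_smult:
 assumes M: "module R M" and H: "submodule H R M" and x: "x : car M" and r: "r : car R"
 shows "r \<odot>[quot_module M H] (H +>\<^bsub>M\<^esub> x) = H +>\<^bsub>M\<^esub> (r \<odot>[M] x)"
proof -
 interpret M: module R M by fact
 interpret S: abelian_subgroup H M by (rule quot_abelian_subgroup) fact+
 have eq: "H +>\<^bsub>M\<^esub> (r \<odot>[M] y) = H +>\<^bsub>M\<^esub> (r \<odot>[M] x)" if y: "y : H +>\<^bsub>M\<^esub> x" for y
 proof -
  have yc: "y : car M" using y x S.a_elemrcos_carrier by blast
  have "H +>\<^bsub>M\<^esub> y = H +>\<^bsub>M\<^esub> x" using y x S.a_repr_independence' by blast
  then have "y \<ominus>[M] x : H" using quot_coset_eq[OF M H yc x] by simp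
  then have "r \<odot>[M] (y \<ominus>[M] x) : H" using M.submoduleE(4)[OF H] r by blast
  then have "r \<odot>[M] y \<ominus>[M] r \<odot>[M] x : H" using r x yc by (simp add: a_minus_def M.smult_r_distr M.smult_r_minus)
  then show ?thesis using quot_coset_eq[OF M H] r x yc by simp
 qed
 have "x : H +>\<^bsub>M\<^esub> x" using x by (rule S.a_rcos_self)
 then have "(\<Union>y\<in>H +>\<^bsub>M\<^esub> x. H +>\<^bsub>M\<^esub> (r \<odot>[M] y)) = (\<Union>y\<in>H +>\<^bsub>M\<^esub> x. H +>\<^bsub>M\<^esub> (r \<odot>[M] x))"
  by (intro SUP_cong refl eq)
 with `x : H +>\<^bsub>M\<^esub> x` show ?thesis by (auto simp: quot_module_def)
qed

lemma quot_zero: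
 assumes M: "module R M" and H: "submodule H R M"
 shows "\<zero>[quot_module M H] = H +>\<^bsub>M\<^esub> \<zero>[M]"
proof -
 interpret abelian_subgroup H M by (rule quot_abelian_subgroup) fact+
 show ?thesis using a_coset_add_zero[OF a_subset] by (simp add: quot_module_def)
qed

lemma quot_module_module:
 assumes M: "module R M" and H: "submodule H R M"
 shows "module R (quot_module M H)"
proof -
 interpret M: module R M by fact
 note s = quot_carrier quot_add[OF M H] quot_smult[OF M H] quot_zero[OF M H]
 show ?thesis
 proof (rule moduleI[OF M.R.cring_axioms abelian_groupI])
  fix x assume "x : car (quot_module M H)"
  then obtain a where a: "a : car M" "x = H +>\<^bsub>M\<^esub> a" by (auto simp: quot_carrier)
  show "\<exists>y\<in>carrier (quot_module M H). y \<oplus>[quot_module M H] x = \<zero>[quot_module M H]"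
   using a by (intro bexI[of _ "H +>\<^bsub>M\<^esub> (\<ominus>[M] a)"]) (auto simp: s M.l_neg)
 qed (auto simp: s M.a_ac M.smult_l_distr M.smult_r_distr M.smult_assoc1)
qed

lemma quot_proj_hom:
 assumes M: "module R M" and H: "submodule H R M"
 shows "(%x. H +>\<^bsub>M\<^esub> x) : Hom R M (quot_module M H)" by (rule mhI) (auto simp: quot_carrier quot_add[OF M H] quot_smult[OF M H])

context
 fixes R :: "('r, 'm) ring_scheme" and G :: "'x set" and S :: "('x => 'r) set"
 assumes R: "cring R" and S: "S <= car (free_module R G)"
begin

private abbreviation "F == free_module R G"
private abbreviation "H == submodule_gen R F S"

private lemma F: "module R F" by (rule free_module_module[OF R])
private lemma H: "submodule H R F" by (rule submodule_gen_submodule[OF F S])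

lemma presented_module: "module R (presented R G S)" unfolding presented_def by (rule quot_module_module[OF F H])

lemma gen_closed: "g : G ==> gen_class R G S g : car (presented R G S)" by (auto simp: presented_def gen_class_def quot_carrier basis_closed[OF R])

private lemma proj_hom: "(%x. H +>\<^bsub>F\<^esub> x) : Hom R F (presented R G S)" unfolding presented_def by (rule quot_proj_hom[OF F H])

lemma relation_eq:
 assumes "p : car F" "q : car F" "p \<ominus>[F] q : S"
 shows "H +>\<^bsub>F\<^esub> p = H +>\<^bsub>F\<^esub> q" using quot_coset_eq[OF F H assms(1,2)] submodule_gen_superset[of S R F] assms(3) by auto

lemma presented_induct [consumes 1, case_names zero step]:
 assumes t: "t : car (presented R G S)"
  and z: "Q \<zero>[presented R G S]"
  and step: "!!t r g. [|t : car (presented R G S); Q t; r : car R; g : G|] ==>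
   Q (t \<oplus>[presented R G S] (r \<odot>[presented R G S] gen_class R G S g))"
 shows "Q t"
proof -
 obtain p where p: "p : car F" "t = H +>\<^bsub>F\<^esub> p" using t by (auto simp: presented_def quot_carrier)
 interpret F: module R F by (rule F)
 have "Q (H +>\<^bsub>F\<^esub> p)" using R p(1)
 proof (induction p rule: free_induct)
  case zero
  show ?case using z quot_zero[OF F H] by (simp add: presented_def)
 next
  case (step p r g)
  have b: "basis_elt R g : car F" by (rule basis_closed[OF R step.hyps(3)])
  show ?case using assms(3)[OF mh_closed[OF proj_hom step.hyps(1)] step.IH step.hyps(2,3)] step.hyps b
   by (simp add: gen_class_def mh_add[OF proj_hom] mh_smult[OF proj_hom] del: free_module_simps)
 qed
 then show ?thesis by (simp add: p)
qed

context
 fixes P :: "('r, 'b, 'n) module_scheme" and \<phi>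
 assumes P: "module R P" and \<phi>: "!!g. g : G ==> \<phi> g : car P"
  and kill: "!!s. s : S ==> ev R P \<phi> s = \<zero>[P]"
begin

private lemma lift_coset:
 assumes p: "p : car F" shows "lift R P \<phi> (H +>\<^bsub>F\<^esub> p) = ev R P \<phi> p"
proof -
 interpret P: module R P by (rule P)
 interpret Sub: abelian_subgroup H F by (rule quot_abelian_subgroup[OF F H])
 note e = ev_hom[where \<phi> = \<phi>, OF P \<phi>, of G]
 let ?q = "SOME q. q : H +>\<^bsub>F\<^esub> p"
 have q: "?q : H +>\<^bsub>F\<^esub> p" using Sub.a_rcos_self[OF p] by (rule someI[of "%q. q : H +>\<^bsub>F\<^esub> p"])
 then have qc: "?q : car F" using p Sub.a_elemrcos_carrier by blast
 have "H <= {x : car F. ev R P \<phi> x = \<zero>[P]}" using S kill by (intro submodule_gen_least kernel_submodule[OF e F P]) auto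
 moreover have "H +>\<^bsub>F\<^esub> ?q = H +>\<^bsub>F\<^esub> p" using q p Sub.a_repr_independence' by blast
 then have "?q \<ominus>[F] p : H" using quot_coset_eq[OF F H qc p] by simp
 ultimately have "ev R P \<phi> (?q \<ominus>[F] p) = \<zero>[P]" by auto
 then have "ev R P \<phi> ?q = ev R P \<phi> p" using mh_minus[OF e F P qc p] mh_closed[OF e qc] mh_closed[OF e p]
  by (simp add: minus_eq_zero_iff[OF P.abelian_group_axioms])
 then show ?thesis by (simp add: lift_ev)
qed

lemma lift_hom: "lift R P \<phi> : Hom R (presented R G S) P"
proof (rule mhI)
 interpret F: module R F by (rule F)
 note e = ev_hom[where \<phi> = \<phi>, OF P \<phi>, of G]
 fix x assume "x : car (presented R G S)"
 then obtain p where p: "p : car F" "x = H +>\<^bsub>F\<^esub> p" by (auto simp: presented_def quot_carrier)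
 show "lift R P \<phi> x : car P" using p by (simp add: lift_coset mh_closed[OF e])
 { fix y assume "y : car (presented R G S)"
  then obtain q where q: "q : car F" "y = H +>\<^bsub>F\<^esub> q" by (auto simp: presented_def quot_carrier)
  show "lift R P \<phi> (x \<oplus>[presented R G S] y) = lift R P \<phi> x \<oplus>[P] lift R P \<phi> y"
   using p q by (simp add: lift_coset mh_add[OF e] flip: mh_add[OF proj_hom] del: free_module_simps) }
 { fix r assume r: "r : car R"
  show "lift R P \<phi> (r \<odot>[presented R G S] x) = r \<odot>[P] lift R P \<phi> x"
   using p r by (simp add: lift_coset mh_smult[OF e] flip: mh_smult[OF proj_hom] del: free_module_simps) }
qed

lemma lift_gen: "g : G ==> lift R P \<phi> (gen_class R G S g) = \<phi> g"
 by (simp add: gen_class_def lift_coset basis_closed[OF R] ev_basis[where \<phi> = \<phi>, OF P \<phi>])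

end

end

section \<open>Multilinear functions of homogeneous elements\<close>

definition gmod :: "('r, 'm) ring_scheme => ('r, 'a) gmodule => bool" where
 "gmod R M \<longleftrightarrow> (\<forall>n. module R (M n))"

lemma gmodD: "gmod R M ==> module R (M n)" by (simp add: gmod_def)

definition homs :: "('r, 'a) gmodule => 'a homog set" where
 "homs M = {(n, x). x : car (M n)}"

abbreviation (input) "els X == homs (obj X)"

lemma homs_iff [simp]: "(n, x) : homs M \<longleftrightarrow> x : car (M n)" by (simp add: homs_def)

lemma homs_snd: "a : homs M ==> snd a : car (M (fst a))" by (cases a) simp

definition lin :: "('r, 'm) ring_scheme => ('r, 'a) gmodule => ('r, 'b, 'n) module_scheme => ('a homog => 'b) => bool" where
 "lin R M P F \<longleftrightarrow> (\<forall>n. (%x. F (n, x)) : Hom R (M n) P)"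

definition bil :: "('r, 'm) ring_scheme => ('r, 'a) gmodule => ('r, 'b) gmodule => ('r, 'c, 'n) module_scheme =>
  ('a homog => 'b homog => 'c) => bool" where
 "bil R M N P F \<longleftrightarrow> (\<forall>a\<in>homs M. lin R N P (F a)) & (\<forall>b\<in>homs N. lin R M P (%a. F a b))"

definition mul :: "('r, 'm) ring_scheme => ('r, 'a) gmodule => ('r, 'b, 'n) module_scheme => ('a homog list => 'b) => bool" where
 "mul R V P \<phi> \<longleftrightarrow> \<phi> [] : car P &
   (\<forall>u w. set u <= homs V --> set w <= homs V --> lin R V P (%l. \<phi> (u @ l # w)))"

lemma linI:
 assumes "!!n x. x : car (M n) ==> F (n, x) : car P"
  and "!!n x y. [|x : car (M n); y : car (M n)|] ==> F (n, x \<oplus>[M n] y) = F (n, x) \<oplus>[P] F (n, y)"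
  and "!!n r x. [|r : car R; x : car (M n)|] ==> F (n, r \<odot>[M n] x) = r \<odot>[P] F (n, x)"
 shows "lin R M P F" using assms by (auto simp: lin_def intro!: mhI)

lemma lin_hom: "lin R M P F ==> (%x. F (n, x)) : Hom R (M n) P" by (simp add: lin_def)

lemma lin_closed: "lin R M P F ==> a : homs M ==> F a : car P" using mh_closed[OF lin_hom] by (cases a) fastforce

lemma lin_add: "lin R M P F ==> x : car (M n) ==> y : car (M n) ==>
  F (n, x \<oplus>[M n] y) = F (n, x) \<oplus>[P] F (n, y)" using mh_add[OF lin_hom] by fastforce

lemma lin_smult: "lin R M P F ==> r : car R ==> x : car (M n) ==>
  F (n, r \<odot>[M n] x) = r \<odot>[P] F (n, x)" using mh_smult[OF lin_hom] by fastforce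

lemma lin_zero: "lin R M P F ==> module R (M n) ==> module R P ==> F (n, \<zero>[M n]) = \<zero>[P]" using mh_zero[OF lin_hom] by fastforce

lemma lin_minus: "lin R M P F ==> module R (M n) ==> module R P ==> x : car (M n) ==> y : car (M n) ==>
  F (n, x \<ominus>[M n] y) = F (n, x) \<ominus>[P] F (n, y)" using mh_minus[OF lin_hom] by fastforce

lemma lin_ksign: "lin R M P F ==> module R (M n) ==> module R P ==> x : car (M n) ==>
  F (n, ksign (M n) k x) = ksign P k (F (n, x))" using mh_ksign[OF lin_hom] by fastforce

lemma lin_comp: "lin R M P F ==> f : Hom R P Q ==> lin R M Q (%a. f (F a))" unfolding lin_def using mh_comp by fast

lemma lin_plus: "lin R M P F ==> lin R M P G ==> module R P ==> lin R M P (%a. F a \<oplus>[P] G a)" unfolding lin_def using mh_plus by blast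

lemma lin_ksignI: "lin R M P F ==> module R P ==> lin R M P (%a. ksign P (k (fst a)) (F a))" unfolding lin_def by (simp add: mh_ksignI)

lemma lin_zeroI: "module R P ==> lin R M P (%a. \<zero>[P])" by (simp add: lin_def mh_const_zero)

lemma lin_scale: "lin R M P F ==> module R P ==> r : car R ==> lin R M P (%a. r \<odot>[P] F a)" by (simp add: lin_def mh_scale)

lemma bilI:
 assumes "!!a. a : homs M ==> lin R N P (F a)" "!!b. b : homs N ==> lin R M P (%a. F a b)"
 shows "bil R M N P F" using assms by (simp add: bil_def)

lemma bil_right: "bil R M N P F ==> a : homs M ==> lin R N P (F a)" by (simp add: bil_def)

lemma bil_left: "bil R M N P F ==> b : homs N ==> lin R M P (%a. F a b)" by (simp add: bil_def)

lemma bil_closed: "bil R M N P F ==> a : homs M ==> b : homs N ==> F a b : car P" by (metis bil_right lin_closed)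

lemma bil_comp: "bil R M N P F ==> f : Hom R P Q ==> bil R M N Q (%a b. f (F a b))" unfolding bil_def by (metis lin_comp)

lemma lin_lsum:
 assumes P: "module R P" and F: "!!x. x : set xs ==> lin R M P (F x)"
 shows "lin R M P (%a. lsum P (%x. F x a) xs)" using F by (induction xs) (auto intro: lin_plus lin_zeroI P)

section \<open>The graded tensor product\<close>

definition biln :: "('r, 'm) ring_scheme => ('r, 'a) gmodule => ('r, 'b) gmodule => ('r, 'c, 'n) module_scheme => int =>
  ('a homog \<times> 'b homog => 'c) => bool" where
 "biln R M N P n \<phi> \<longleftrightarrow> (\<forall>i j. i + j = n -->
   (\<forall>y\<in>carrier (N j). (%x. \<phi> ((i, x), (j, y))) : Hom R (M i) P) &
   (\<forall>x\<in>carrier (M i). (%y. \<phi> ((i, x), (j, y))) : Hom R (N j) P))"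

lemma biln_bil: "bil R M N P F ==> biln R M N P n (%(a, b). F a b)" by (simp add: bil_def biln_def homs_def lin_def)

lemma tensor_gens_iff: "(a, b) : tensor_gens M N n \<longleftrightarrow> a : homs M & b : homs N & fst a + fst b = n"
 by (cases a; cases b) (auto simp: tensor_gens_def)

context
 fixes R :: "('r, 'm) ring_scheme" and M :: "('r, 'a) gmodule" and N :: "('r, 'b) gmodule"
 assumes R: "cring R" and M: "gmod R M" and N: "gmod R N"
begin

private lemma rels_carrier: "tensor_rels R M N n <= car (free_module R (tensor_gens M N n))"
proof -
 interpret F: module R "free_module R (tensor_gens M N n)" by (rule free_module_module[OF R])
 have e: "basis_elt R ((i, x), (j, y)) : car (free_module R (tensor_gens M N n))"
  if "i + j = n" "x : car (M i)" "y : car (N j)" for i j x y using that by (intro basis_closed[OF R]) (simp add: tensor_gens_iff)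
 have a: "x \<oplus>[M i] x' : car (M i)" if "x : car (M i)" "x' : car (M i)" for i x x'
  using gmodD[OF M, of i] that by (simp add: module_def abelian_group_def abelian_monoid.a_closed)
 have b: "y \<oplus>[N i] y' : car (N i)" if "y : car (N i)" "y' : car (N i)" for i y y'
  using gmodD[OF N, of i] that by (simp add: module_def abelian_group_def abelian_monoid.a_closed)
 have c: "r \<odot>[M i] x : car (M i)" if "r : car R" "x : car (M i)" for i r x using gmodD[OF M, of i] that by (rule module.smult_closed)
 have d: "r \<odot>[N i] x : car (N i)" if "r : car R" "x : car (N i)" for i r x using gmodD[OF N, of i] that by (rule module.smult_closed)
 show ?thesis unfolding tensor_rels_def Let_def by (intro Un_least subsetI; elim CollectE exE conjE;
    simp add: F.minus_closed F.a_closed F.smult_closed e a b c d del: free_module_simps)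
qed

lemma tensor_module_module: "module R (tensor_module R M N n)" unfolding tensor_module_def by (rule presented_module[OF R rels_carrier])

lemma tensor_gmod: "gmod R (tensor_module R M N)" by (simp add: gmod_def tensor_module_module)

lemma tens_closed: "a : homs M ==> b : homs N ==> fst a + fst b = n ==> tens R M N a b : car (tensor_module R M N n)"
 unfolding tensor_module_def tens_def Let_def by (auto intro!: gen_closed[OF R rels_carrier] simp: tensor_gens_iff)

private lemma e: "a : homs M ==> b : homs N ==> fst a + fst b = n ==>
  basis_elt R (a, b) : car (free_module R (tensor_gens M N n))" by (rule basis_closed[OF R]) (simp add: tensor_gens_iff)

private lemma proj_add:
 assumes "p : car (free_module R (tensor_gens M N n))" "q : car (free_module R (tensor_gens M N n))"
 shows "submodule_gen R (free_module R (tensor_gens M N n)) (tensor_rels R M N n) +>\<^bsub>free_module R (tensor_gens M N n)\<^esub>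
   (p \<oplus>[free_module R (tensor_gens M N n)] q) =
  (submodule_gen R (free_module R (tensor_gens M N n)) (tensor_rels R M N n) +>\<^bsub>free_module R (tensor_gens M N n)\<^esub> p)
  \<oplus>[tensor_module R M N n]
  (submodule_gen R (free_module R (tensor_gens M N n)) (tensor_rels R M N n) +>\<^bsub>free_module R (tensor_gens M N n)\<^esub> q)"
 unfolding tensor_module_def presented_def
 by (rule quot_add[OF free_module_module[OF R] submodule_gen_submodule[OF free_module_module[OF R] rels_carrier] assms, symmetric])

private lemma proj_smult:
 assumes "r : car R" "p : car (free_module R (tensor_gens M N n))"
 shows "submodule_gen R (free_module R (tensor_gens M N n)) (tensor_rels R M N n) +>\<^bsub>free_module R (tensor_gens M N n)\<^esub>
   (r \<odot>[free_module R (tensor_gens M N n)] p) =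
  r \<odot>[tensor_module R M N n]
  (submodule_gen R (free_module R (tensor_gens M N n)) (tensor_rels R M N n) +>\<^bsub>free_module R (tensor_gens M N n)\<^esub> p)"
 unfolding tensor_module_def presented_def
 by (rule quot_smult[OF free_module_module[OF R] submodule_gen_submodule[OF free_module_module[OF R] rels_carrier] assms(2,1), symmetric])

lemma tens_left: "y : car (N j) ==> i + j = n ==>
  (%x. tens R M N (i, x) (j, y)) : Hom R (M i) (tensor_module R M N n)"
proof (rule mhI)
 let ?F = "free_module R (tensor_gens M N n)"
 interpret F: module R ?F by (rule free_module_module[OF R])
 interpret Mi: module R "M i" by (rule gmodD[OF M])
 assume y: "y : car (N j)" and n: "i + j = n"
 fix x assume x: "x : car (M i)"
 show "tens R M N (i, x) (j, y) : car (tensor_module R M N n)" using x y n by (intro tens_closed) auto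
 have bx: "basis_elt R ((i, x), (j, y)) : car ?F" using x y n by (intro e) auto
 { fix x' assume x': "x' : car (M i)"
  have bx': "basis_elt R ((i, x'), (j, y)) : car ?F" using x' y n by (intro e) auto
  have bs: "basis_elt R ((i, x \<oplus>[M i] x'), (j, y)) : car ?F" using x x' y n by (intro e) auto
  have "basis_elt R ((i, x \<oplus>[M i] x'), (j, y)) \<ominus>[?F] (basis_elt R ((i, x), (j, y)) \<oplus>[?F] basis_elt R ((i, x'), (j, y)))
   : tensor_rels R M N n" unfolding tensor_rels_def Let_def using x x' y n by blast
  from relation_eq[OF R rels_carrier bs F.a_closed[OF bx bx'] this] n
  show "tens R M N (i, x \<oplus>[M i] x') (j, y) = tens R M N (i, x) (j, y) \<oplus>[tensor_module R M N n] tens R M N (i, x') (j, y)"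
   by (simp add: tens_def Let_def gen_class_def proj_add[OF bx bx'] del: free_module_simps) }
 { fix r assume r: "r : car R"
  have bs: "basis_elt R ((i, r \<odot>[M i] x), (j, y)) : car ?F" using x r y n by (intro e) auto
  have "basis_elt R ((i, r \<odot>[M i] x), (j, y)) \<ominus>[?F] (r \<odot>[?F] basis_elt R ((i, x), (j, y))) : tensor_rels R M N n"
   unfolding tensor_rels_def Let_def using x r y n by blast
  from relation_eq[OF R rels_carrier bs F.smult_closed[OF r bx] this] n
  show "tens R M N (i, r \<odot>[M i] x) (j, y) = r \<odot>[tensor_module R M N n] tens R M N (i, x) (j, y)"
   by (simp add: tens_def Let_def gen_class_def proj_smult[OF r bx] del: free_module_simps) }
qed

lemma tens_right: "x : car (M i) ==> i + j = n ==>
  (%y. tens R M N (i, x) (j, y)) : Hom R (N j) (tensor_module R M N n)"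
proof (rule mhI)
 let ?F = "free_module R (tensor_gens M N n)"
 interpret F: module R ?F by (rule free_module_module[OF R])
 interpret Nj: module R "N j" by (rule gmodD[OF N])
 assume x: "x : car (M i)" and n: "i + j = n"
 fix y assume y: "y : car (N j)"
 show "tens R M N (i, x) (j, y) : car (tensor_module R M N n)" using x y n by (intro tens_closed) auto
 have bx: "basis_elt R ((i, x), (j, y)) : car ?F" using x y n by (intro e) auto
 { fix y' assume y': "y' : car (N j)"
  have bx': "basis_elt R ((i, x), (j, y')) : car ?F" using x y' n by (intro e) auto
  have bs: "basis_elt R ((i, x), (j, y \<oplus>[N j] y')) : car ?F" using x y y' n by (intro e) auto
  have "basis_elt R ((i, x), (j, y \<oplus>[N j] y')) \<ominus>[?F] (basis_elt R ((i, x), (j, y)) \<oplus>[?F] basis_elt R ((i, x), (j, y')))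
   : tensor_rels R M N n" unfolding tensor_rels_def Let_def using x y y' n by blast
  from relation_eq[OF R rels_carrier bs F.a_closed[OF bx bx'] this] n
  show "tens R M N (i, x) (j, y \<oplus>[N j] y') = tens R M N (i, x) (j, y) \<oplus>[tensor_module R M N n] tens R M N (i, x) (j, y')"
   by (simp add: tens_def Let_def gen_class_def proj_add[OF bx bx'] del: free_module_simps) }
 { fix r assume r: "r : car R"
  have bs: "basis_elt R ((i, x), (j, r \<odot>[N j] y)) : car ?F" using x r y n by (intro e) auto
  have "basis_elt R ((i, x), (j, r \<odot>[N j] y)) \<ominus>[?F] (r \<odot>[?F] basis_elt R ((i, x), (j, y))) : tensor_rels R M N n"
   unfolding tensor_rels_def Let_def using x r y n by blast
  from relation_eq[OF R rels_carrier bs F.smult_closed[OF r bx] this] n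
  show "tens R M N (i, x) (j, r \<odot>[N j] y) = r \<odot>[tensor_module R M N n] tens R M N (i, x) (j, y)"
   by (simp add: tens_def Let_def gen_class_def proj_smult[OF r bx] del: free_module_simps) }
qed

lemma tensor_induct [consumes 1, case_names zero add]:
 assumes t: "t : car (tensor_module R M N n)"
  and z: "Q \<zero>[tensor_module R M N n]"
  and step: "!!t a b. [|t : car (tensor_module R M N n); Q t; a : homs M; b : homs N; fst a + fst b = n|] ==>
   Q (tens R M N a b \<oplus>[tensor_module R M N n] t)"
 shows "Q t"
proof -
 interpret T: module R "tensor_module R M N n" by (rule tensor_module_module)
 show ?thesis using t unfolding tensor_module_def
 proof (induction rule: presented_induct[OF R rels_carrier, consumes 1, case_names zero step])
  case zero
  show ?case using z by (simp add: tensor_module_def)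
 next
  case (step t r g)
  obtain i x j y where g: "g = ((i, x), (j, y))" "x : car (M i)" "y : car (N j)" "i + j = n" using step(3) by (auto simp: tensor_gens_def)
  have rx: "r \<odot>[M i] x : car (M i)" by (rule module.smult_closed[OF gmodD[OF M] step(2) g(2)])
  have tc: "t : car (tensor_module R M N n)" using step(1) by (simp add: tensor_module_def)
  have "tens R M N (i, r \<odot>[M i] x) (j, y) = r \<odot>[tensor_module R M N n] tens R M N (i, x) (j, y)"
   using mh_smult[OF tens_left[OF g(3,4)] step(2) g(2)] .
  moreover have "tens R M N (i, x) (j, y) = gen_class R (tensor_gens M N n) (tensor_rels R M N n) g" using g by (simp add: tens_def Let_def)
  moreover have "Q (tens R M N (i, r \<odot>[M i] x) (j, y) \<oplus>[tensor_module R M N n] t)" using tc step(4) rx g by (intro assms(3)) auto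
  ultimately show ?case using T.a_comm[OF tc, of "tens R M N (i, r \<odot>[M i] x) (j, y)"] tens_closed[of "(i, r \<odot>[M i] x)" "(j, y)" n] rx g
   by (simp add: tensor_module_def)
 qed
qed

lemma tensor_ext:
 assumes f: "f : Hom R (tensor_module R M N n) P" and g: "g : Hom R (tensor_module R M N n) P"
  and P: "module R P"
  and eq: "!!a b. [|a : homs M; b : homs N; fst a + fst b = n|] ==> f (tens R M N a b) = g (tens R M N a b)"
  and t: "t : car (tensor_module R M N n)"
 shows "f t = g t" using t
proof (induction rule: tensor_induct)
 case zero
 show ?case using mh_zero[OF f tensor_module_module P] mh_zero[OF g tensor_module_module P] by simp
next
 case (add t a b)
 then show ?case by (simp add: mh_add[OF f] mh_add[OF g] tens_closed eq)
qed

context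
 fixes P :: "('r, 'c, 'n) module_scheme" and n \<phi>
 assumes P: "module R P" and \<phi>: "biln R M N P n \<phi>"
begin

private lemma \<phi>_closed: "g : tensor_gens M N n ==> \<phi> g : car P" using \<phi> by (auto simp: biln_def tensor_gens_def dest: mh_closed)

private lemma \<phi>_kill: "s : tensor_rels R M N n ==> ev R P \<phi> s = \<zero>[P]"
proof -
 let ?F = "free_module R (tensor_gens M N n)"
 interpret F: module R ?F by (rule free_module_module[OF R])
 interpret P: module R P by (rule P)
 have h: "ev R P \<phi> : Hom R ?F P" by (rule ev_hom[OF P \<phi>_closed])
 have b: "ev R P \<phi> (basis_elt R g) = \<phi> g" if "g : tensor_gens M N n" for g by (rule ev_basis[OF P \<phi>_closed that])
 have a: "ev R P \<phi> s = \<zero>[P]"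
  if "s = p \<ominus>[?F] q" "p : car ?F" "q : car ?F" "ev R P \<phi> p = ev R P \<phi> q" for s p q
  using mh_minus[OF h F.module_axioms P that(2,3)] that mh_closed[OF h that(2)] by (simp add: minus_eq_zero_iff[OF P.abelian_group_axioms])
 have hl: "(%x. \<phi> ((i, x), (j, y))) : Hom R (M i) P" if "i + j = n" "y : car (N j)" for i j y using \<phi> that by (simp add: biln_def)
 have hr: "(%y. \<phi> ((i, x), (j, y))) : Hom R (N j) P" if "i + j = n" "x : car (M i)" for i j x using \<phi> that by (simp add: biln_def)
 have L: "\<phi> ((i, x \<oplus>[M i] x'), (j, y)) = \<phi> ((i, x), (j, y)) \<oplus>[P] \<phi> ((i, x'), (j, y))"
   "r : car R ==> \<phi> ((i, r \<odot>[M i] x), (j, y)) = r \<odot>[P] \<phi> ((i, x), (j, y))"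
  if "i + j = n" "x : car (M i)" "x' : car (M i)" "y : car (N j)" for i j x x' y r
  using mh_add[OF hl[OF that(1,4)] that(2,3)] mh_smult[OF hl[OF that(1,4)] _ that(2)] by auto
 have Rt: "\<phi> ((i, x), (j, y \<oplus>[N j] y')) = \<phi> ((i, x), (j, y)) \<oplus>[P] \<phi> ((i, x), (j, y'))"
   "r : car R ==> \<phi> ((i, x), (j, r \<odot>[N j] y)) = r \<odot>[P] \<phi> ((i, x), (j, y))"
  if "i + j = n" "x : car (M i)" "y' : car (N j)" "y : car (N j)" for i j x y' y r
  using mh_add[OF hr[OF that(1,2)] that(4,3)] mh_smult[OF hr[OF that(1,2)] _ that(4)] by auto
 have g: "((i, x), (j, y)) : tensor_gens M N n" if "i + j = n" "x : car (M i)" "y : car (N j)" for i j x y using that by (simp add: tensor_gens_iff)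
 have bc: "basis_elt R ((i, x), (j, y)) : car ?F" if "i + j = n" "x : car (M i)" "y : car (N j)" for i j x y
  using g[OF that] by (rule basis_closed[OF R])
 have cl: "x \<oplus>[M i] x' : car (M i)" if "x : car (M i)" "x' : car (M i)" for i x x'
  using gmodD[OF M, of i] that by (simp add: module_def abelian_group_def abelian_monoid.a_closed)
 have cl2: "y \<oplus>[N i] y' : car (N i)" if "y : car (N i)" "y' : car (N i)" for i y y'
  using gmodD[OF N, of i] that by (simp add: module_def abelian_group_def abelian_monoid.a_closed)
 have cl3: "r \<odot>[M i] x : car (M i)" if "r : car R" "x : car (M i)" for i r x using gmodD[OF M, of i] that by (rule module.smult_closed)
 have cl4: "r \<odot>[N i] x : car (N i)" if "r : car R" "x : car (N i)" for i r x using gmodD[OF N, of i] that by (rule module.smult_closed)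
 show "s : tensor_rels R M N n ==> ev R P \<phi> s = \<zero>[P]" unfolding tensor_rels_def Let_def by (elim UnE CollectE exE conjE; erule a;
    simp add: mh_add[OF h] mh_smult[OF h] b g bc cl cl2 cl3 cl4 L Rt F.a_closed F.smult_closed del: free_module_simps)
qed

lemma liftn_hom: "lift R P \<phi> : Hom R (tensor_module R M N n) P"
 unfolding tensor_module_def by (rule lift_hom[OF R rels_carrier P \<phi>_closed \<phi>_kill])

lemma liftn_tens: "a : homs M ==> b : homs N ==> fst a + fst b = n ==> lift R P \<phi> (tens R M N a b) = \<phi> (a, b)"
 using lift_gen[OF R rels_carrier P \<phi>_closed \<phi>_kill, where g = "(a, b)"] by (auto simp: tens_def Let_def tensor_gens_iff)

end

lemma lift_bil_hom: "module R P ==> bil R M N P F ==> lift R P (%(a, b). F a b) : Hom R (tensor_module R M N n) P" by (rule liftn_hom[OF _ biln_bil])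

lemma lift_bil_tens:
 assumes "module R P" "bil R M N P F" "a : homs M" "b : homs N"
 shows "lift R P (%(a, b). F a b) (tens R M N a b) = F a b" using liftn_tens[OF assms(1) biln_bil[OF assms(2)] assms(3,4) refl] by simp

lemma tensor_rep: "t : car (tensor_module R M N n) ==>
  \<exists>L. (\<forall>p\<in>set L. fst p : homs M & snd p : homs N & fst (fst p) + fst (snd p) = n) &
    t = lsum (tensor_module R M N n) (%p. tens R M N (fst p) (snd p)) L"
proof (induction rule: tensor_induct)
 case zero
 show ?case by (rule exI[of _ "[]"]) simp
next
 case (add t a b)
 then obtain L where "\<forall>p\<in>set L. fst p : homs M & snd p : homs N & fst (fst p) + fst (snd p) = n"
   "t = lsum (tensor_module R M N n) (%p. tens R M N (fst p) (snd p)) L" by blast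
 with add show ?case by (intro exI[of _ "(a, b) # L"]) simp
qed

end

definition tn :: "('r, 'm) ring_scheme => ('r, 'a) gmodule => ('r, 'b) gmodule => 'a homog => 'b homog => ('r, 'a, 'b) tensor homog" where
 "tn R M N a b = (fst a + fst b, tens R M N a b)"

lemma fst_tn [simp]: "fst (tn R M N a b) = fst a + fst b" by (simp add: tn_def)

lemma tn_homs:
 assumes "cring R" "gmod R M" "gmod R N" "a : homs M" "b : homs N"
 shows "tn R M N a b : homs (tensor_module R M N)" using assms by (simp add: tn_def tens_closed)

lemma lin_tn:
 assumes R: "cring R" "gmod R M" "gmod R N" and F: "lin R (tensor_module R M N) P F"
 shows "bil R M N P (%a b. F (tn R M N a b))"
proof -
 have "(%x. F (n, tens R M N (i, x) (j, y))) : Hom R (M i) P" if "y : car (N j)" "n = i + j" for i j y n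
  using mh_comp[OF tens_left[OF R that(1)] lin_hom[OF F]] that(2) by simp
 moreover have "(%y. F (n, tens R M N (i, x) (j, y))) : Hom R (N j) P" if "x : car (M i)" "n = i + j" for i j x n
  using mh_comp[OF tens_right[OF R that(1)] lin_hom[OF F]] that(2) by simp
 ultimately show ?thesis by (auto simp: bil_def lin_def homs_def tn_def)
qed

lemma tn_ext:
 assumes R: "cring R" "gmod R M" "gmod R N" and P: "module R P"
  and F: "lin R (tensor_module R M N) P F" and G: "lin R (tensor_module R M N) P G"
  and eq: "!!a b. [|a : homs M; b : homs N|] ==> F (tn R M N a b) = G (tn R M N a b)"
  and t: "t : homs (tensor_module R M N)"
 shows "F t = G t"
proof (cases t)
 case (Pair n x)
 show ?thesis unfolding Pair by (rule tensor_ext[OF R lin_hom[OF F] lin_hom[OF G] P]) (use eq t Pair in \<open>auto simp: tn_def\<close>)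
qed

section \<open>The tensor algebra\<close>

lemma word_gens_iff: "w : word_gens V n \<longleftrightarrow> set w <= homs V & word_deg w = n" by (auto simp: word_gens_def homs_def)

lemma word_deg_simps [simp]:
 "word_deg [] = 0" "word_deg (l # w) = fst l + word_deg w" "word_deg (u @ w) = word_deg u + word_deg w" by (simp_all add: word_deg_def)

lemma mulI:
 assumes "\<phi> [] : car P" "!!u w. [|set u <= homs V; set w <= homs V|] ==> lin R V P (%l. \<phi> (u @ l # w))"
 shows "mul R V P \<phi>" using assms by (simp add: mul_def)

lemma mul_lin: "mul R V P \<phi> ==> set u <= homs V ==> set w <= homs V ==> lin R V P (%l. \<phi> (u @ l # w))" by (simp add: mul_def)

lemma mul_closed: "mul R V P \<phi> ==> set w <= homs V ==> \<phi> w : car P"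
 using mul_lin[of R V P \<phi> "[]" "tl w"] lin_closed[of R V P "%l. \<phi> (l # tl w)" "hd w"] by (cases w) (auto simp: mul_def)

text \<open>In a fixed degree, the degrees of the letters of a relation add up to it.\<close>

definition muln :: "('r, 'm) ring_scheme => ('r, 'a) gmodule => ('r, 'b, 'n) module_scheme => int => ('a homog list => 'b) => bool" where
 "muln R V P n \<phi> \<longleftrightarrow> (n = 0 --> \<phi> [] : car P) &
   (\<forall>u w i. set u <= homs V --> set w <= homs V --> word_deg u + i + word_deg w = n -->
    (%x. \<phi> (u @ (i, x) # w)) : Hom R (V i) P)"

lemma muln_mul: "mul R V P \<phi> ==> muln R V P n \<phi>" by (simp add: mul_def muln_def lin_def)

context
 fixes R :: "('r, 'm) ring_scheme" and V :: "('r, 'a) gmodule"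
 assumes R: "cring R" and V: "gmod R V"
begin

private lemma word_e: "set w <= homs V ==> word_deg w = n ==> basis_elt R w : car (free_module R (word_gens V n))"
 by (rule basis_closed[OF R]) (simp add: word_gens_iff)

private lemma cl: "x : car (V i) ==> y : car (V i) ==> x \<oplus>[V i] y : car (V i)"
 using gmodD[OF V, of i] by (simp add: module_def abelian_group_def abelian_monoid.a_closed)

private lemma cl2: "r : car R ==> x : car (V i) ==> r \<odot>[V i] x : car (V i)" using gmodD[OF V, of i] by (rule module.smult_closed)

private lemma word_rels_carrier: "word_rels R V n <= car (free_module R (word_gens V n))"
proof -
 interpret F: module R "free_module R (word_gens V n)" by (rule free_module_module[OF R])
 show ?thesis unfolding word_rels_def Let_def by (intro Un_least subsetI; elim CollectE exE conjE;
    simp add: F.minus_closed F.a_closed F.smult_closed word_e word_gens_iff cl cl2 del: free_module_simps)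
qed

lemma tensor_alg_module: "module R (tensor_alg R V n)" unfolding tensor_alg_def by (rule presented_module[OF R word_rels_carrier])

lemma tensor_alg_gmod: "gmod R (tensor_alg R V)" by (simp add: gmod_def tensor_alg_module)

lemma word_closed: "set w <= homs V ==> word_deg w = n ==> word R V w : car (tensor_alg R V n)" unfolding tensor_alg_def word_def Let_def
 by (auto intro!: gen_closed[OF R word_rels_carrier] simp: word_gens_iff)

lemma word_letter:
 assumes u: "set u <= homs V" and w: "set w <= homs V" and n: "word_deg u + i + word_deg w = n"
 shows "(%x. word R V (u @ (i, x) # w)) : Hom R (V i) (tensor_alg R V n)"
proof (rule mhI)
 let ?F = "free_module R (word_gens V n)"
 let ?H = "submodule_gen R ?F (word_rels R V n)"
 interpret F: module R ?F by (rule free_module_module[OF R])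
 have H: "submodule ?H R ?F" by (rule submodule_gen_submodule[OF F.module_axioms word_rels_carrier])
 have W: "word R V (u @ (i, x) # w) = ?H +>\<^bsub>?F\<^esub> basis_elt R (u @ (i, x) # w)" for x
  using n by (simp add: word_def Let_def gen_class_def add.assoc)
 have T: "tensor_alg R V n = quot_module ?F ?H" by (simp add: tensor_alg_def presented_def)
 have g: "u @ (i, x) # w : word_gens V n" if "x : car (V i)" for x using that u w n by (simp add: word_gens_iff)
 have b: "basis_elt R (u @ (i, x) # w) : car ?F" if "x : car (V i)" for x using g[OF that] by (rule basis_closed[OF R])
 fix x assume x: "x : car (V i)"
 show "word R V (u @ (i, x) # w) : car (tensor_alg R V n)" using x u w n by (intro word_closed) auto
 { fix y assume y: "y : car (V i)"
  have "basis_elt R (u @ (i, x \<oplus>[V i] y) # w) \<ominus>[?F] (basis_elt R (u @ (i, x) # w) \<oplus>[?F] basis_elt R (u @ (i, y) # w))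
   : word_rels R V n" unfolding word_rels_def Let_def using g[OF x] g[OF y] by blast
  from relation_eq[OF R word_rels_carrier b[OF cl[OF x y]] F.a_closed[OF b[OF x] b[OF y]] this]
  show "word R V (u @ (i, x \<oplus>[V i] y) # w) = word R V (u @ (i, x) # w) \<oplus>[tensor_alg R V n] word R V (u @ (i, y) # w)"
   unfolding W T quot_add[OF F.module_axioms H b[OF x] b[OF y]] . }
 { fix r assume r: "r : car R"
  have "basis_elt R (u @ (i, r \<odot>[V i] x) # w) \<ominus>[?F] (r \<odot>[?F] basis_elt R (u @ (i, x) # w)) : word_rels R V n"
   unfolding word_rels_def Let_def using g[OF x] r by blast
  from relation_eq[OF R word_rels_carrier b[OF cl2[OF r x]] F.smult_closed[OF r b[OF x]] this]
  show "word R V (u @ (i, r \<odot>[V i] x) # w) = r \<odot>[tensor_alg R V n] word R V (u @ (i, x) # w)"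
   unfolding W T quot_smult[OF F.module_axioms H b[OF x] r] . }
qed

lemma word_induct [consumes 1, case_names zero add]:
 assumes t: "t : car (tensor_alg R V n)"
  and z: "Q \<zero>[tensor_alg R V n]"
  and step: "!!t r w. [|t : car (tensor_alg R V n); Q t; r : car R; set w <= homs V; word_deg w = n|] ==>
   Q (t \<oplus>[tensor_alg R V n] (r \<odot>[tensor_alg R V n] word R V w))"
 shows "Q t" using t unfolding tensor_alg_def
proof (induction rule: presented_induct[OF R word_rels_carrier, consumes 1, case_names zero step])
 case zero
 show ?case using z by (simp add: tensor_alg_def)
next
 case (step t r g)
 then show ?case using assms(3)[of t r g] by (simp add: word_gens_iff tensor_alg_def word_def Let_def)
qed

lemma word_ext:
 assumes f: "f : Hom R (tensor_alg R V n) P" and g: "g : Hom R (tensor_alg R V n) P"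
  and P: "module R P"
  and eq: "!!w. [|set w <= homs V; word_deg w = n|] ==> f (word R V w) = g (word R V w)"
  and t: "t : car (tensor_alg R V n)"
 shows "f t = g t" using t
proof (induction rule: word_induct)
 case zero
 show ?case using mh_zero[OF f tensor_alg_module P] mh_zero[OF g tensor_alg_module P] by simp
next
 case (add t r w)
 have "r \<odot>[tensor_alg R V n] word R V w : car (tensor_alg R V n)" using add by (intro module.smult_closed[OF tensor_alg_module] word_closed)
 with add show ?case by (simp add: mh_add[OF f] mh_add[OF g] mh_smult[OF f] mh_smult[OF g] word_closed eq)
qed

context
 fixes P :: "('r, 'c, 'n) module_scheme" and n \<phi>
 assumes P: "module R P" and \<phi>: "muln R V P n \<phi>"
begin

private lemma \<phi>_letter: "u @ (i, x) # w : word_gens V n ==> (%x. \<phi> (u @ (i, x) # w)) : Hom R (V i) P"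
 using \<phi> by (auto simp: muln_def word_gens_iff)

private lemma \<phi>w_closed: "g : word_gens V n ==> \<phi> g : car P"
proof (cases g)
 case (Cons a w)
 assume "g : word_gens V n"
 then show ?thesis using Cons \<phi>_letter[of "[]" "fst a" "snd a" w] homs_snd[of a V] mh_closed by (fastforce simp: word_gens_iff)
qed (use \<phi> in \<open>auto simp: muln_def word_gens_iff\<close>)

private lemma \<phi>w_kill: "s : word_rels R V n ==> ev R P \<phi> s = \<zero>[P]"
proof -
 let ?F = "free_module R (word_gens V n)"
 interpret F: module R ?F by (rule free_module_module[OF R])
 interpret P: module R P by (rule P)
 have h: "ev R P \<phi> : Hom R ?F P" by (rule ev_hom[OF P \<phi>w_closed])
 have b: "ev R P \<phi> (basis_elt R g) = \<phi> g" if "g : word_gens V n" for g by (rule ev_basis[OF P \<phi>w_closed that])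
 have a: "ev R P \<phi> s = \<zero>[P]"
  if "s = p \<ominus>[?F] q" "p : car ?F" "q : car ?F" "ev R P \<phi> p = ev R P \<phi> q" for s p q
  using mh_minus[OF h F.module_axioms P that(2,3)] that mh_closed[OF h that(2)] by (simp add: minus_eq_zero_iff[OF P.abelian_group_axioms])
 have g: "u @ (i, y) # w : word_gens V n" if "u @ (i, x) # w : word_gens V n" "y : car (V i)" for u i x y w using that by (simp add: word_gens_iff)
 have c: "x : car (V i)" if "u @ (i, x) # w : word_gens V n" for u i x w using that by (simp add: word_gens_iff)
 have bc: "basis_elt R w : car ?F" if "w : word_gens V n" for w using that by (rule basis_closed[OF R])
 have L: "\<phi> (u @ (i, x \<oplus>[V i] y) # w) = \<phi> (u @ (i, x) # w) \<oplus>[P] \<phi> (u @ (i, y) # w)"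
   "r : car R ==> \<phi> (u @ (i, r \<odot>[V i] x) # w) = r \<odot>[P] \<phi> (u @ (i, x) # w)"
  if "u @ (i, x) # w : word_gens V n" "y : car (V i)" for u i x y w r
  using mh_add[OF \<phi>_letter[OF that(1)] c[OF that(1)] that(2)] mh_smult[OF \<phi>_letter[OF that(1)] _ c[OF that(1)]] by auto
 show "s : word_rels R V n ==> ev R P \<phi> s = \<zero>[P]" unfolding word_rels_def Let_def
 proof (elim UnE CollectE exE conjE)
  fix u i x y w
  assume s: "s = basis_elt R (u @ (i, x \<oplus>[V i] y) # w) \<ominus>[?F] (basis_elt R (u @ (i, x) # w) \<oplus>[?F] basis_elt R (u @ (i, y) # w))"
   and x: "u @ (i, x) # w : word_gens V n" and y: "u @ (i, y) # w : word_gens V n"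
  have xy: "u @ (i, x \<oplus>[V i] y) # w : word_gens V n" using x y by (intro g[OF x] cl c)
  show ?thesis by (rule a[OF s bc[OF xy] F.a_closed[OF bc[OF x] bc[OF y]]])
     (simp add: mh_add[OF h bc[OF x] bc[OF y]] b x y xy L(1)[OF x c[OF y]] del: free_module_simps)
 next
  fix r u i x w
  assume s: "s = basis_elt R (u @ (i, r \<odot>[V i] x) # w) \<ominus>[?F] (r \<odot>[?F] basis_elt R (u @ (i, x) # w))"
   and r: "r : car R" and x: "u @ (i, x) # w : word_gens V n"
  have xy: "u @ (i, r \<odot>[V i] x) # w : word_gens V n" using x r by (intro g[OF x] cl2 c)
  show ?thesis by (rule a[OF s bc[OF xy] F.smult_closed[OF r bc[OF x]]])
     (simp add: mh_smult[OF h r bc[OF x]] b x xy L(2)[OF x c[OF x] r] del: free_module_simps)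
 qed
qed

lemma liftw_hom: "lift R P \<phi> : Hom R (tensor_alg R V n) P"
 unfolding tensor_alg_def by (rule lift_hom[OF R word_rels_carrier P \<phi>w_closed \<phi>w_kill])

lemma liftw_word: "set w <= homs V ==> word_deg w = n ==> lift R P \<phi> (word R V w) = \<phi> w"
 using lift_gen[OF R word_rels_carrier P \<phi>w_closed \<phi>w_kill, where g = w] by (auto simp: word_def Let_def word_gens_iff)

end

end

section \<open>The direct sum of the degrees\<close>

text \<open>
  A graded algebra is replaced by the direct sum of its components, where products and sums of
  elements of different degrees live in a single ring. Identities between homogeneous elements can
  then be computed in that ring, without keeping track of the degree of each subterm.
\<close>

definition el :: "('r, 'a) gmodule => 'a homog => int => 'a" where
 "el M a = (%k. if k = fst a then snd a else \<zero>[M k])"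

definition tot :: "('r, 'a) gmodule => ((int => 'a) => (int => 'a) => int => 'a) => (int => 'a) => ('r, int => 'a) module" where
 "tot M m e = \<lparr>carrier = {f. (\<forall>n. f n : car (M n)) & finite {n. f n ~= \<zero>[M n]}}, mult = m, one = e,
   zero = (%n. \<zero>[M n]), add = (%f g n. f n \<oplus>[M n] g n), smult = (%r f n. r \<odot>[M n] f n)\<rparr>"

definition direct :: "('r, 'a) gmodule => ('r, 'b, 'n) module_scheme => ('a homog => 'b) => (int => 'a) => 'b" where
 "direct M P \<phi> f = finsum P (%n. \<phi> (n, f n)) {n. f n ~= \<zero>[M n]}"

lemma tot_carrier: "f : car (tot M m e) \<longleftrightarrow> (\<forall>n. f n : car (M n)) & finite {n. f n ~= \<zero>[M n]}" by (simp add: tot_def)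

lemma tot_simps:
 "zero (tot M m e) = (%n. \<zero>[M n])" "add (tot M m e) = (%f g n. f n \<oplus>[M n] g n)"
 "smult (tot M m e) = (%r f n. r \<odot>[M n] f n)" "mult (tot M m e) = m" "one (tot M m e) = e" by (simp_all add: tot_def)

context
 fixes R :: "('r, 'm) ring_scheme" and M :: "('r, 'a) gmodule"
 assumes R: "cring R" and M: "gmod R M"
begin

private lemma Mn: "module R (M n)" by (rule gmodD[OF M])

lemma tot_module: "module R (tot M m e)"
proof -
 interpret R: cring R by (rule R)
 interpret Mn: module R "M n" for n by (rule Mn)
 have a: "(%n. f n \<oplus>[M n] g n) : car (tot M m e)" if "f : car (tot M m e)" "g : car (tot M m e)" for f g
 proof -
  have "{n. f n \<oplus>[M n] g n ~= \<zero>[M n]} <= {n. f n ~= \<zero>[M n]} \<union> {n. g n ~= \<zero>[M n]}" by auto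
  with that show ?thesis by (auto simp: tot_carrier intro: finite_subset)
 qed
 have s: "(%n. r \<odot>[M n] f n) : car (tot M m e)" if "r : car R" "f : car (tot M m e)" for r f
 proof -
  have "{n. r \<odot>[M n] f n ~= \<zero>[M n]} <= {n. f n ~= \<zero>[M n]}" using that by auto
  with that show ?thesis by (auto simp: tot_carrier intro: finite_subset)
 qed
 have c: "f n : car (M n)" if "f : car (tot M m e)" for f n using that by (simp add: tot_carrier)
 have z: "(%n. \<zero>[M n]) : car (tot M m e)" by (simp add: tot_carrier)
 have i: "\<exists>y\<in>carrier (tot M m e). (%n. y n \<oplus>[M n] f n) = (%n. \<zero>[M n])" if "f : car (tot M m e)" for f using that c[OF that]
  by (intro bexI[OF _ s[of "\<ominus>[R] \<one>[R]" f]]) (auto simp: Mn.smult_l_minus Mn.l_neg)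
 show ?thesis by (rule moduleI[OF R abelian_groupI])
   (use i in \<open>simp_all add: a s z c tot_simps Mn.a_ac Mn.smult_l_distr Mn.smult_r_distr Mn.smult_assoc1\<close>)
qed

lemma el_lin: "lin R M (tot M m e) (el M)"
proof -
 interpret Mn: module R "M n" for n by (rule Mn)
 show ?thesis
 proof (rule linI)
  fix n x assume x: "x : car (M n)"
  have "{k. el M (n, x) k ~= \<zero>[M k]} <= {n}" by (auto simp: el_def)
  then have "finite {k. el M (n, x) k ~= \<zero>[M k]}" by (rule finite_subset) simp
  then show "el M (n, x) : car (tot M m e)" using x by (auto simp: tot_carrier el_def)
 qed (auto simp: el_def tot_simps)
qed

lemma el_closed: "a : homs M ==> el M a : car (tot M m e)" by (rule lin_closed[OF el_lin])

lemma tot_induct [consumes 1, case_names zero add]: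
 assumes f: "f : car (tot M m e)" and z: "Q \<zero>[tot M m e]"
  and step: "!!f a. [|f : car (tot M m e); Q f; a : homs M|] ==> Q (el M a \<oplus>[tot M m e] f)"
 shows "Q f"
proof -
 interpret Mn: module R "M n" for n by (rule Mn)
 have "Q f" if "f : car (tot M m e)" "{n. f n ~= \<zero>[M n]} <= S" "finite S" for f S using that(3,1,2)
 proof (induction S arbitrary: f rule: finite_induct)
  case empty
  then have "f = (%n. \<zero>[M n])" by auto
  then show ?case using z by (simp add: tot_simps)
 next
  case (insert x S)
  let ?f = "f(x := \<zero>[M x])"
  have sub: "{n. ?f n ~= \<zero>[M n]} <= {n. f n ~= \<zero>[M n]}" by auto
  have f: "?f : car (tot M m e)" using insert.prems(1) finite_subset[OF sub] by (auto simp: tot_carrier)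
  have "Q ?f" using insert.prems(2) by (intro insert.IH f) auto
  then have "Q (el M (x, f x) \<oplus>[tot M m e] ?f)" using insert.prems(1) by (intro step f) (auto simp: tot_carrier)
  moreover have "el M (x, f x) \<oplus>[tot M m e] ?f = f" using insert.prems(1) by (auto simp: tot_carrier tot_simps el_def)
  ultimately show ?case by simp
 qed
 then show ?thesis using f by (auto simp: tot_carrier)
qed

lemma tot_ext:
 assumes f: "f : Hom R (tot M m e) P" and g: "g : Hom R (tot M m e) P" and P: "module R P"
  and eq: "!!a. a : homs M ==> f (el M a) = g (el M a)"
  and t: "t : car (tot M m e)"
 shows "f t = g t" using t
proof (induction rule: tot_induct)
 case zero
 show ?case using mh_zero[OF f tot_module P] mh_zero[OF g tot_module P] by simp
next
 case (add t a)
 then show ?case by (simp add: mh_add[OF f] mh_add[OF g] el_closed eq)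
qed

context
 fixes P :: "('r, 'b, 'n) module_scheme" and \<phi>
 assumes P: "module R P" and \<phi>: "lin R M P \<phi>"
begin

private lemma direct_superset:
 assumes "f : car (tot M m e)" "finite S" "{n. f n ~= \<zero>[M n]} <= S"
 shows "direct M P \<phi> f = finsum P (%n. \<phi> (n, f n)) S"
proof -
 interpret P: module R P by (rule P)
 have c: "\<phi> (n, f n) : car P" for n using assms(1) by (intro lin_closed[OF \<phi>]) (simp add: tot_carrier)
 show ?thesis unfolding direct_def using assms(2,3) c by (intro P.add.finprod_mono_neutral_cong_left) (auto simp: lin_zero[OF \<phi> Mn P])
qed

lemma direct_hom: "direct M P \<phi> : Hom R (tot M m e) P"
proof (rule mhI)
 interpret P: module R P by (rule P)
 have c: "\<phi> (n, f n) : car P" if "f : car (tot M m e)" for n f using that by (intro lin_closed[OF \<phi>]) (simp add: tot_carrier)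
 have fin: "finite {n. f n ~= \<zero>[M n]}" if "f : car (tot M m e)" for f using that by (simp add: tot_carrier)
 have v: "f n : car (M n)" if "f : car (tot M m e)" for f n using that by (simp add: tot_carrier)
 interpret T: module R "tot M m e" by (rule tot_module)
 interpret Mn: module R "M n" for n by (rule Mn)
 fix f assume f: "f : car (tot M m e)"
 show "direct M P \<phi> f : car P" unfolding direct_def using c[OF f] by (intro P.finsum_closed) blast
 { fix g assume g: "g : car (tot M m e)"
  let ?U = "{n. f n ~= \<zero>[M n]} \<union> {n. g n ~= \<zero>[M n]}"
  have U: "finite ?U" using fin[OF f] fin[OF g] by simp
  have fg: "(%n. f n \<oplus>[M n] g n) : car (tot M m e)" using T.a_closed[OF f g] by (simp add: tot_simps)
  have "direct M P \<phi> (f \<oplus>[tot M m e] g) = finsum P (%n. \<phi> (n, f n \<oplus>[M n] g n)) ?U"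
   unfolding tot_simps by (rule direct_superset[OF fg U]) auto
  also have "... = finsum P (%n. \<phi> (n, f n) \<oplus>[P] \<phi> (n, g n)) ?U" using c[OF f] c[OF g] v[OF f] v[OF g]
   by (intro P.finsum_cong' refl lin_add[OF \<phi>] Pi_I P.a_closed)
  also have "... = finsum P (%n. \<phi> (n, f n)) ?U \<oplus>[P] finsum P (%n. \<phi> (n, g n)) ?U"
   using c[OF f] c[OF g] by (intro P.finsum_addf Pi_I)
  also have "... = direct M P \<phi> f \<oplus>[P] direct M P \<phi> g" using direct_superset[OF f U] direct_superset[OF g U] by auto
  finally show "direct M P \<phi> (f \<oplus>[tot M m e] g) = direct M P \<phi> f \<oplus>[P] direct M P \<phi> g" . }
 { fix r assume r: "r : car R"
  have rf: "(%n. r \<odot>[M n] f n) : car (tot M m e)" using T.smult_closed[OF r f] by (simp add: tot_simps)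
  have "direct M P \<phi> (r \<odot>[tot M m e] f) = finsum P (%n. \<phi> (n, r \<odot>[M n] f n)) {n. f n ~= \<zero>[M n]}"
   unfolding tot_simps by (rule direct_superset[OF rf fin[OF f]]) (use r in auto)
  also have "... = finsum P (%n. r \<odot>[P] \<phi> (n, f n)) {n. f n ~= \<zero>[M n]}"
   using c[OF f] v[OF f] r by (intro P.finsum_cong' refl lin_smult[OF \<phi>] Pi_I P.smult_closed)
  also have "... = r \<odot>[P] direct M P \<phi> f" unfolding direct_def using c[OF f] r fin[OF f] by (intro P.finsum_smult_ldistr[symmetric] Pi_I)
  finally show "direct M P \<phi> (r \<odot>[tot M m e] f) = r \<odot>[P] direct M P \<phi> f" . }
qed

lemma direct_el: "a : homs M ==> direct M P \<phi> (el M a) = \<phi> a"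
proof -
 assume a: "a : homs M"
 interpret P: module R P by (rule P)
 have "direct M P \<phi> (el M a) = finsum P (%n. \<phi> (n, el M a n)) {fst a}" by (rule direct_superset[OF el_closed[OF a]]) (auto simp: el_def)
 also have "... = \<phi> a" using lin_closed[OF \<phi> a] by (simp add: el_def)
 finally show ?thesis .
qed

end

end

lemma el_inj: "el M (n, x) = el M (n, y) ==> x = y" by (drule fun_cong[of _ _ n]) (simp add: el_def)

lemma el_at [simp]: "el M (n, x) n = x" by (simp add: el_def)

definition tmap :: "int => (int => 'a => 'b) => (int => 'a) => int => 'b" where
 "tmap k g f = (%n. g (n - k) (f (n - k)))"

context
 fixes R :: "('r, 'm) ring_scheme" and M :: "('r, 'a) gmodule" and N :: "('r, 'b) gmodule" and k g
 assumes M: "gmod R M" and N: "gmod R N" and g: "graded_map R M N k g"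
begin

private lemma gn: "g (n - k) : Hom R (M (n - k)) (N n)"
proof -
 have "g (n - k) : Hom R (M (n - k)) (N (n - k + k))" using g unfolding graded_map_def by blast
 then show ?thesis by simp
qed

private lemma g0: "g (n - k) \<zero>[M (n - k)] = \<zero>[N n]" by (rule mh_zero[OF gn gmodD[OF M] gmodD[OF N]])

lemma tmap_hom: "tmap k g : Hom R (tot M m e) (tot N m' e')"
proof (rule mhI)
 fix f assume f: "f : car (tot M m e)"
 have "{n. g (n - k) (f (n - k)) ~= \<zero>[N n]} <= (%n. n + k) ` {n. f n ~= \<zero>[M n]}"
 proof
  fix n assume "n : {n. g (n - k) (f (n - k)) ~= \<zero>[N n]}"
  then have "n - k : {n. f n ~= \<zero>[M n]}" using g0[of n] by auto
  then show "n : (%n. n + k) ` {n. f n ~= \<zero>[M n]}" by (intro image_eqI[of _ _ "n - k"]) auto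
 qed
 then have "finite {n. g (n - k) (f (n - k)) ~= \<zero>[N n]}" using f by (auto simp: tot_carrier intro: finite_subset)
 then show "tmap k g f : car (tot N m' e')" using f mh_closed[OF gn] by (auto simp: tot_carrier tmap_def)
qed (auto simp: tmap_def tot_simps tot_carrier mh_add[OF gn] mh_smult[OF gn])

lemma tmap_el: "tmap k g (el M (n, x)) = el N (n + k, g n x)" using g0 by (auto simp: tmap_def el_def)

end

lemma ksign_graded: "gmod R M ==> graded_map R M M 0 (%n. ksign (M n) n)" unfolding graded_map_def using mh_ksignI[OF mh_id gmodD] by fastforce

section \<open>Graded algebras\<close>

lemma ksign_even: "even k ==> ksign P k x = x" by (simp add: ksign_def)

definition ralg :: "('r, 'm) ring_scheme => ('r, 'a, 'n) module_scheme => bool" where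
 "ralg R P \<longleftrightarrow> module R P & ring P & (\<forall>r\<in>carrier R. \<forall>x\<in>carrier P. \<forall>y\<in>carrier P.
   (r \<odot>[P] x) \<otimes>[P] y = r \<odot>[P] (x \<otimes>[P] y) & x \<otimes>[P] (r \<odot>[P] y) = r \<odot>[P] (x \<otimes>[P] y))"

definition galg :: "('r, 'm) ring_scheme => ('r, 'a, 'z) chain_alg_scheme => bool" where
 "galg R X \<longleftrightarrow> cring R & gmod R (obj X) &
   (\<forall>m n. \<forall>y\<in>carrier (obj X n). (%x. amult X m n x y) : Hom R (obj X m) (obj X (m + n))) &
   (\<forall>m n. \<forall>x\<in>carrier (obj X m). (%y. amult X m n x y) : Hom R (obj X n) (obj X (m + n))) &
   (\<forall>l m n. \<forall>x\<in>carrier (obj X l). \<forall>y\<in>carrier (obj X m). \<forall>z\<in>carrier (obj X n).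
    amult X (l + m) n (amult X l m x y) z = amult X l (m + n) x (amult X m n y z)) &
   aunit X : car (obj X 0) &
   (\<forall>n. \<forall>x\<in>carrier (obj X n). amult X 0 n (aunit X) x = x & amult X n 0 x (aunit X) = x)"

definition hmult :: "('r, 'a, 'z) chain_alg_scheme => 'a homog => 'a homog => 'a homog" where
 "hmult X a b = (fst a + fst b, amult X (fst a) (fst b) (snd a) (snd b))"

definition Tot :: "('r, 'a, 'z) chain_alg_scheme => ('r, int => 'a) module" where
 "Tot X = (let M = obj X; P = tot M undefined undefined in
   tot M (%f g. direct M P (%a. direct M P (%b. el M (hmult X a b)) g) f) (el M (0, aunit X)))"

abbreviation EL :: "('r, 'a, 'z) chain_alg_scheme => 'a homog => int => 'a" where
 "EL X == el (obj X)"

text \<open>The grading involution, multiplication by \<open>(-1)\<^sup>n\<close> in degree \<open>n\<close>.\<close>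

definition gam :: "('r, 'a, 'z) chain_alg_scheme => (int => 'a) => int => 'a" where
 "gam X = tmap 0 (%n. ksign (obj X n) n)"

context
 fixes R :: "('r, 'm) ring_scheme" and X :: "('r, 'a, 'z) chain_alg_scheme"
 assumes X: "galg R X"
begin

private lemma R: "cring R" using X by (simp add: galg_def)

private lemma M: "gmod R (obj X)" using X by (simp add: galg_def)

lemma Tot_module: "module R (Tot X)" unfolding Tot_def Let_def by (rule tot_module[OF R M])

lemma EL_lin: "lin R (obj X) (Tot X) (EL X)" unfolding Tot_def Let_def by (rule el_lin[OF R M])

lemma EL_closed: "a : els X ==> EL X a : car (Tot X)" by (rule lin_closed[OF EL_lin])

lemma Tot_ext:
 assumes "f : Hom R (Tot X) P" "g : Hom R (Tot X) P" "module R P"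
  "!!a. a : els X ==> f (EL X a) = g (EL X a)" "t : car (Tot X)"
 shows "f t = g t" using assms unfolding Tot_def Let_def by (rule tot_ext[OF R M])

lemma Direct_hom: "module R P ==> lin R (obj X) P \<phi> ==> direct (obj X) P \<phi> : Hom R (Tot X) P"
 unfolding Tot_def Let_def by (rule direct_hom[OF R M])

lemma Direct_el: "module R P ==> lin R (obj X) P \<phi> ==> a : els X ==> direct (obj X) P \<phi> (EL X a) = \<phi> a" by (rule direct_el[OF R M])

lemma hmult_homs: "a : els X ==> b : els X ==> hmult X a b : els X" using X mh_closed unfolding galg_def hmult_def homs_def by fastforce

private abbreviation "P0 == tot (obj X) undefined undefined"

private lemma P0: "module R P0" by (rule tot_module[OF R M])

private lemma EL_hmult_bil: "bil R (obj X) (obj X) P0 (%a b. EL X (hmult X a b))"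
proof (rule bilI)
 fix a assume a: "a : els X"
 show "lin R (obj X) P0 (%b. EL X (hmult X a b))" unfolding lin_def hmult_def fst_conv snd_conv
 proof
  fix n
  have "(%y. amult X (fst a) n (snd a) y) : Hom R (obj X n) (obj X (fst a + n))" using X a unfolding galg_def homs_def by fastforce
  from mh_comp[OF this lin_hom[OF el_lin[OF R M]]]
  show "(%x. EL X (fst a + n, amult X (fst a) n (snd a) x)) : Hom R (obj X n) P0" .
 qed
next
 fix b assume b: "b : els X"
 show "lin R (obj X) P0 (%a. EL X (hmult X a b))" unfolding lin_def hmult_def fst_conv snd_conv
 proof
  fix n
  have "(%x. amult X n (fst b) x (snd b)) : Hom R (obj X n) (obj X (n + fst b))" using X b unfolding galg_def homs_def by fastforce
  from mh_comp[OF this lin_hom[OF el_lin[OF R M]]]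
  show "(%x. EL X (n + fst b, amult X n (fst b) x (snd b))) : Hom R (obj X n) P0" .
 qed
qed

private lemma mult_eq: "f \<otimes>[Tot X] g = direct (obj X) P0 (%a. direct (obj X) P0 (%b. EL X (hmult X a b)) g) f"
 by (simp add: Tot_def Let_def tot_simps)

private lemma Tot_P0: "Hom R N (Tot X) = Hom R N P0" "car (Tot X) = car P0"
 "add (Tot X) = add P0" "smult (Tot X) = smult P0" "zero (Tot X) = zero P0"
 by (simp_all add: Tot_def Let_def tot_simps tot_def module_hom_def hom_def)

private lemma inner_lin:
 assumes g: "g : car (Tot X)"
 shows "lin R (obj X) P0 (%a. direct (obj X) P0 (%b. EL X (hmult X a b)) g)"
proof (rule linI)
 interpret P: module R P0 by (rule P0)
 have L: "lin R (obj X) P0 (%b. EL X (hmult X a b))" if "a : els X" for a by (rule bil_right[OF EL_hmult_bil that])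
 have H: "direct (obj X) P0 (%b. EL X (hmult X a b)) : Hom R (Tot X) P0" if "a : els X" for a by (rule Direct_hom[OF P0 L[OF that]])
 have E: "direct (obj X) P0 (%b. EL X (hmult X a b)) (EL X c) = EL X (hmult X a c)"
  if "a : els X" "c : els X" for a c by (rule Direct_el[OF P0 L[OF that(1)] that(2)])
 fix n x assume x: "x : car (obj X n)"
 show "direct (obj X) P0 (%b. EL X (hmult X (n, x) b)) g : car P0" using mh_closed[OF H g] x by simp
 { fix y assume y: "y : car (obj X n)"
  have xy: "x \<oplus>[obj X n] y : car (obj X n)" using x y gmodD[OF M, of n] by (simp add: module_def abelian_group_def abelian_monoid.a_closed)
  show "direct (obj X) P0 (%b. EL X (hmult X (n, x \<oplus>[obj X n] y) b)) g =
    direct (obj X) P0 (%b. EL X (hmult X (n, x) b)) g \<oplus>[P0] direct (obj X) P0 (%b. EL X (hmult X (n, y) b)) g" using x y xy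
   by (intro Tot_ext[OF H mh_plus[OF H H P0] P0 _ g])
    (auto simp: E lin_add[OF bil_left[OF EL_hmult_bil]]) }
 { fix r assume r: "r : car R"
  have rx: "r \<odot>[obj X n] x : car (obj X n)" using x r gmodD[OF M, of n] by (simp add: module.smult_closed)
  show "direct (obj X) P0 (%b. EL X (hmult X (n, r \<odot>[obj X n] x) b)) g = r \<odot>[P0] direct (obj X) P0 (%b. EL X (hmult X (n, x) b)) g"
   using x rx r by (intro Tot_ext[OF H mh_scale[OF H P0 r] P0 _ g])
    (auto simp: E lin_smult[OF bil_left[OF EL_hmult_bil]]) }
qed

lemma mult_left_hom: "y : car (Tot X) ==> (%x. x \<otimes>[Tot X] y) : Hom R (Tot X) (Tot X)"
 by (simp only: mult_eq Tot_P0(1)) (rule Direct_hom[OF P0 inner_lin])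

lemma EL_mult:
 assumes "a : els X" "b : els X"
 shows "EL X a \<otimes>[Tot X] EL X b = EL X (hmult X a b)" unfolding mult_eq Direct_el[OF P0 inner_lin[OF EL_closed[OF assms(2)]] assms(1)]
 by (rule Direct_el[OF P0 bil_right[OF EL_hmult_bil assms(1)] assms(2)])

private lemma EL_mult_eq:
 "a : els X ==> y : car (Tot X) ==> EL X a \<otimes>[Tot X] y = direct (obj X) P0 (%b. EL X (hmult X a b)) y"
 unfolding mult_eq by (rule Direct_el[OF P0 inner_lin])

private lemma EL_mult_hom: "a : els X ==> direct (obj X) P0 (%b. EL X (hmult X a b)) : Hom R (Tot X) (Tot X)"
 unfolding Tot_P0(1) by (rule Direct_hom[OF P0 bil_right[OF EL_hmult_bil]])

lemma mult_right_hom: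
 assumes x: "x : car (Tot X)"
 shows "(%y. x \<otimes>[Tot X] y) : Hom R (Tot X) (Tot X)"
proof (rule mhI)
 interpret T: module R "Tot X" by (rule Tot_module)
 fix y assume y: "y : car (Tot X)"
 show "x \<otimes>[Tot X] y : car (Tot X)" by (rule mh_closed[OF mult_left_hom[OF y] x])
 { fix z assume z: "z : car (Tot X)"
  show "x \<otimes>[Tot X] (y \<oplus>[Tot X] z) = x \<otimes>[Tot X] y \<oplus>[Tot X] x \<otimes>[Tot X] z"
   by (rule Tot_ext[OF mult_left_hom[OF T.a_closed[OF y z]] mh_plus[OF mult_left_hom[OF y] mult_left_hom[OF z] Tot_module] Tot_module _ x])
     (simp add: EL_mult_eq y z mh_add[OF EL_mult_hom]) }
 { fix r assume r: "r : car R"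
  show "x \<otimes>[Tot X] (r \<odot>[Tot X] y) = r \<odot>[Tot X] (x \<otimes>[Tot X] y)"
   by (rule Tot_ext[OF mult_left_hom[OF T.smult_closed[OF r y]] mh_scale[OF mult_left_hom[OF y] Tot_module r] Tot_module _ x])
     (simp add: EL_mult_eq y r mh_smult[OF EL_mult_hom]) }
qed

private lemma mult_closed: "x : car (Tot X) ==> y : car (Tot X) ==> x \<otimes>[Tot X] y : car (Tot X)" by (rule mh_closed[OF mult_left_hom])

private lemma one_eq: "\<one>[Tot X] = EL X (0, aunit X)" by (simp add: Tot_def Let_def tot_simps)

private lemma one_homs: "(0, aunit X) : els X" using X by (simp add: galg_def)

private lemma hmult_assoc: "a : els X ==> b : els X ==> c : els X ==>
  hmult X (hmult X a b) c = hmult X a (hmult X b c)" using X unfolding galg_def hmult_def homs_def by (auto simp: add.assoc)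

private lemma mult_assoc:
 assumes x: "x : car (Tot X)" and y: "y : car (Tot X)" and z: "z : car (Tot X)"
 shows "x \<otimes>[Tot X] y \<otimes>[Tot X] z = x \<otimes>[Tot X] (y \<otimes>[Tot X] z)"
proof -
 note l = mult_left_hom and r = mult_right_hom
 have 1: "EL X a \<otimes>[Tot X] EL X b \<otimes>[Tot X] z = EL X a \<otimes>[Tot X] (EL X b \<otimes>[Tot X] z)"
  if a: "a : els X" and b: "b : els X" for a b
  by (rule Tot_ext[OF r[OF mult_closed[OF EL_closed[OF a] EL_closed[OF b]]] mh_comp[OF r[OF EL_closed[OF b]] r[OF EL_closed[OF a]]] Tot_module _ z])
    (simp add: EL_mult hmult_homs a b hmult_assoc)
 have 2: "EL X a \<otimes>[Tot X] y \<otimes>[Tot X] z = EL X a \<otimes>[Tot X] (y \<otimes>[Tot X] z)" if a: "a : els X" for a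
  by (rule Tot_ext[OF mh_comp[OF r[OF EL_closed[OF a]] l[OF z]] mh_comp[OF l[OF z] r[OF EL_closed[OF a]]] Tot_module _ y])
    (simp add: 1 a)
 show ?thesis by (rule Tot_ext[OF mh_comp[OF l[OF y] l[OF z]] l[OF mult_closed[OF y z]] Tot_module _ x]) (simp add: 2)
qed

lemma Tot_ralg: "ralg R (Tot X)"
proof -
 interpret T: module R "Tot X" by (rule Tot_module)
 have o: "\<one>[Tot X] : car (Tot X)" unfolding one_eq by (rule EL_closed[OF one_homs])
 have l1: "\<one>[Tot X] \<otimes>[Tot X] x = x" if x: "x : car (Tot X)" for x by (rule Tot_ext[OF mult_right_hom[OF o] mh_id Tot_module _ x])
    (use X in \<open>auto simp: one_eq EL_mult[OF one_homs] hmult_def galg_def homs_def\<close>)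
 have r1: "x \<otimes>[Tot X] \<one>[Tot X] = x" if x: "x : car (Tot X)" for x by (rule Tot_ext[OF mult_left_hom[OF o] mh_id Tot_module _ x])
    (use X in \<open>auto simp: one_eq EL_mult[OF _ one_homs] hmult_def galg_def homs_def\<close>)
 have "ring (Tot X)" by (rule ringI[OF T.abelian_group_axioms monoidI])
   (auto simp: mult_closed o mult_assoc l1 r1 mh_add[OF mult_left_hom] mh_add[OF mult_right_hom])
 then show ?thesis by (simp add: ralg_def Tot_module mh_smult[OF mult_left_hom] mh_smult[OF mult_right_hom])
qed

lemma gam_hom: "gam X : Hom R (Tot X) (Tot X)" unfolding Tot_def Let_def gam_def by (rule tmap_hom[OF M M ksign_graded[OF M]])

lemma gam_EL: "a : els X ==> gam X (EL X a) = ksign (Tot X) (fst a) (EL X a)"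
proof (cases a)
 case (Pair n x)
 assume "a : els X"
 then have "EL X (n, ksign (obj X n) n x) = ksign (Tot X) n (EL X (n, x))" using Pair by (intro lin_ksign[OF EL_lin gmodD[OF M] Tot_module]) simp
 then show ?thesis using tmap_el[OF M M ksign_graded[OF M], of n x] Pair by (simp add: gam_def)
qed

lemma gam_gam:
 assumes x: "x : car (Tot X)"
 shows "gam X (gam X x) = x"
proof -
 interpret T: module R "Tot X" by (rule Tot_module)
 show ?thesis by (rule Tot_ext[OF mh_comp[OF gam_hom gam_hom] mh_id Tot_module _ x])
   (simp add: gam_EL mh_ksign[OF gam_hom Tot_module Tot_module] EL_closed ksign_ksign T.abelian_group_axioms ksign_even)
qed

lemma gam_one: "gam X \<one>[Tot X] = \<one>[Tot X]" unfolding one_eq using gam_EL[OF one_homs] by simp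

end

text \<open>
  A linear map of total degree \<open>k\<close> on the direct sums comes from a graded map: this is how the maps
  constructed below are turned into the families that the definition of a retract speaks of.
\<close>

lemma graded_of_tot:
 assumes X: "galg R X" and Y: "galg R Y"
  and G: "G : Hom R (Tot X) (Tot Y)"
  and deg: "!!n x. x : car (obj X n) ==> \<exists>y. y : car (obj Y (n + k)) & G (EL X (n, x)) = EL Y (n + k, y)"
 obtains g where "graded_map R (obj X) (obj Y) k g"
  and "!!n x. x : car (obj X n) ==> G (EL X (n, x)) = EL Y (n + k, g n x)"
proof -
 let ?g = "%n x. G (EL X (n, x)) (n + k)"
 have val: "G (EL X (n, x)) = EL Y (n + k, ?g n x) & ?g n x : car (obj Y (n + k))" if "x : car (obj X n)" for n x using deg[OF that] by auto
 have "graded_map R (obj X) (obj Y) k ?g" unfolding graded_map_def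
 proof
  fix n
  note h = mh_comp[OF lin_hom[OF EL_lin[OF X]] G, of n]
  show "?g n : Hom R (obj X n) (obj Y (n + k))"
  proof (rule mhI)
   fix x assume "x : car (obj X n)" then show "?g n x : car (obj Y (n + k))" using val by blast
  qed (simp_all add: mh_add[OF h] mh_smult[OF h] Tot_def Let_def tot_simps)
 qed
 then show ?thesis using val that by blast
qed

section \<open>Tensor products of chain complexes\<close>

lemma mh_cong:
 assumes M: "module R M" and eq: "!!x. x : car M ==> f x = g x" and g: "g : Hom R M N"
 shows "f : Hom R M N"
proof -
 interpret M: module R M by (rule M)
 show ?thesis by (rule mhI) (simp_all add: eq mh_closed[OF g] mh_add[OF g] mh_smult[OF g])
qed

lemma lin_cong:
 assumes "gmod R M" "!!a. a : homs M ==> F a = G a" "lin R M P G"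
 shows "lin R M P F" unfolding lin_def
proof
 fix n show "(%x. F (n, x)) : Hom R (M n) P" by (rule mh_cong[OF gmodD[OF assms(1)] _ lin_hom[OF assms(3)]]) (simp add: assms(2))
qed

lemma graded_map_hom: "graded_map R M N k f ==> n + k = m ==> f n : Hom R (M n) (N m)" unfolding graded_map_def by blast

lemma graded_id: "graded_map R M M 0 (%_ x. x)" by (simp add: graded_map_def mh_id)

lemma gmod_ag: "gmod R M ==> abelian_group (M n)" by (simp add: gmod_def module_def)

text \<open>The linear extension of a function on generators depends linearly on that function.\<close>

lemma lift_param:
 assumes R: "cring R" "gmod R M" "gmod R N" and P: "module R P"
  and b: "!!z. z : car Z ==> biln R M N P n (\<phi> z)"
  and h: "!!a b. [|a : homs M; b : homs N; fst a + fst b = n|] ==> (%z. \<phi> z (a, b)) : Hom R Z P"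
  and Z: "module R Z"
  and t: "t : car (tensor_module R M N n)"
 shows "(%z. lift R P (\<phi> z) t) : Hom R Z P"
proof -
 interpret P: module R P by (rule P)
 interpret Z: module R Z by (rule Z)
 note T = tensor_module_module[OF R]
 obtain L where L: "!!p. p : set L ==> fst p : homs M & snd p : homs N & fst (fst p) + fst (snd p) = n"
  and t': "t = lsum (tensor_module R M N n) (%p. tens R M N (fst p) (snd p)) L" using tensor_rep[OF R t] by blast
 have eq: "lift R P (\<phi> z) t = lsum P (%p. \<phi> z p) L" if z: "z : car Z" for z
 proof -
  have "lift R P (\<phi> z) t = lsum P (%p. lift R P (\<phi> z) (tens R M N (fst p) (snd p))) L"
   unfolding t' using L by (intro lsum_hom[OF liftn_hom[OF R P b[OF z]] T P] tens_closed[OF R]) auto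
  also have "... = lsum P (%p. \<phi> z p) L" using L by (intro lsum_cong) (simp add: liftn_tens[OF R P b[OF z]])
  finally show ?thesis .
 qed
 have h': "(%z. \<phi> z p) : Hom R Z P" if "p : set L" for p using h[of "fst p" "snd p"] L[OF that] by simp
 have "(%z. lsum P (%p. \<phi> z p) L') : Hom R Z P" if "set L' <= set L" for L' using that
 proof (induction L')
  case Nil show ?case by (simp add: mh_const_zero[OF P])
 next
  case (Cons p L') then show ?case by (auto intro!: mh_plus P h')
 qed
 from this[of L] show ?thesis by (intro mh_cong[OF Z eq]) auto
qed

context
 fixes R :: "('r, 'm) ring_scheme" and M :: "('r, 'a) gmodule" and N :: "('r, 'b) gmodule"
  and M' :: "('r, 'c) gmodule" and N' :: "('r, 'd) gmodule" and p q f g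
 assumes R: "cring R" and M: "gmod R M" and N: "gmod R N" and M': "gmod R M'" and N': "gmod R N'"
  and f: "graded_map R M M' p f" and g: "graded_map R N N' q g"
begin

private lemma tm_biln: "biln R M N (tensor_module R M' N' (n + p + q)) n
  (%((i, x), (j, y)). ksign (tensor_module R M' N' (n + p + q)) (q * i) (tens R M' N' (i + p, f i x) (j + q, g j y)))"
proof -
 have "(%x. ksign (tensor_module R M' N' (n + p + q)) (q * i) (tens R M' N' (i + p, f i x) (j + q, g j y)))
   : Hom R (M i) (tensor_module R M' N' (n + p + q))" if "i + j = n" "y : car (N j)" for i j y using that mh_closed[OF graded_map_hom[OF g refl]]
  by (intro mh_ksignI mh_comp[OF graded_map_hom[OF f refl] tens_left[OF R M' N']] tensor_module_module[OF R M' N']) auto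
 moreover have "(%y. ksign (tensor_module R M' N' (n + p + q)) (q * i) (tens R M' N' (i + p, f i x) (j + q, g j y)))
   : Hom R (N j) (tensor_module R M' N' (n + p + q))" if "i + j = n" "x : car (M i)" for i j x using that mh_closed[OF graded_map_hom[OF f refl]]
  by (intro mh_ksignI mh_comp[OF graded_map_hom[OF g refl] tens_right[OF R M' N']] tensor_module_module[OF R M' N']) auto
 ultimately show ?thesis by (simp add: biln_def)
qed

lemma tensor_map_hom: "n + p + q = m ==>
  tensor_map R M' N' p q f g n : Hom R (tensor_module R M N n) (tensor_module R M' N' m)" unfolding tensor_map_def Let_def
 using liftn_hom[OF R M N tensor_module_module[OF R M' N'] tm_biln] by blast

lemma tensor_map_tens:
 assumes "a : homs M" "b : homs N" "fst a + fst b = n" "n + p + q = m"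
 shows "tensor_map R M' N' p q f g n (tens R M N a b) =
  ksign (tensor_module R M' N' m) (q * fst a) (tens R M' N' (fst a + p, f (fst a) (snd a)) (fst b + q, g (fst b) (snd b)))"
 unfolding tensor_map_def Let_def using liftn_tens[OF R M N tensor_module_module[OF R M' N'] tm_biln assms(1-3)] assms(4)
 by (simp add: case_prod_beta)

end

lemma chain_complex_gmod: "chain_complex R X ==> gmod R (obj X)" by (simp add: chain_complex_def gmod_def)

definition dh :: "('r, 'a, 'z) chain_cx_scheme => 'a homog => 'a homog" where
 "dh X a = (fst a - 1, bd X (fst a) (snd a))"

lemma fst_dh [simp]: "fst (dh X a) = fst a - 1" by (simp add: dh_def)

lemma bd_hom: "chain_complex R X ==> m = n - 1 ==> bd X n : Hom R (obj X n) (obj X m)" unfolding chain_complex_def graded_map_def by simp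

lemma dh_homs: "chain_complex R X ==> a : els X ==> dh X a : els X" using mh_closed[OF bd_hom[of R X _ "fst a"]] by (cases a) (simp add: dh_def)

lemma lin_dh: "chain_complex R X ==> lin R (obj X) P F ==> lin R (obj X) P (%a. F (dh X a))" unfolding dh_def lin_def fst_conv snd_conv
proof
 fix n assume X: "chain_complex R X" and F: "\<forall>n. (%x. F (n, x)) : Hom R (obj X n) P"
 show "(%x. F (n - 1, bd X n x)) : Hom R (obj X n) P" using mh_comp[OF bd_hom[OF X refl, of n] spec[OF F, of "n - 1"]] .
qed

lemma dh_dh: "chain_complex R X ==> a : els X ==> dh X (dh X a) = (fst a - 2, \<zero>[obj X (fst a - 2)])"
 by (cases a) (simp add: dh_def chain_complex_def)

lemma lin_dh_dh:
 assumes X: "chain_complex R X" and F: "lin R (obj X) P F" and P: "module R P" and a: "a : els X"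
 shows "F (dh X (dh X a)) = \<zero>[P]" unfolding dh_dh[OF X a] by (rule lin_zero[OF F gmodD[OF chain_complex_gmod[OF X]] P])

context
 fixes R :: "('r, 'm) ring_scheme" and X :: "('r, 'a, 'z) chain_cx_scheme" and Y :: "('r, 'b, 'w) chain_cx_scheme"
 assumes R: "cring R" and X: "chain_complex R X" and Y: "chain_complex R Y"
begin

private lemma gX: "gmod R (obj X)" by (rule chain_complex_gmod[OF X])
private lemma gY: "gmod R (obj Y)" by (rule chain_complex_gmod[OF Y])

private lemma bX: "graded_map R (obj X) (obj X) (- 1) (bd X)" using X by (simp add: chain_complex_def)
private lemma bY: "graded_map R (obj Y) (obj Y) (- 1) (bd Y)" using Y by (simp add: chain_complex_def)

private abbreviation "T == tensor_module R (obj X) (obj Y)"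
private abbreviation "te == tens R (obj X) (obj Y)"

lemma tensor_bd_hom: "m = n - 1 ==> tensor_bd R X Y n : Hom R (T n) (T m)" unfolding tensor_bd_def
 by (hypsubst, intro mh_plus tensor_module_module[OF R gX gY]
   tensor_map_hom[OF R gX gY gX gY bX graded_id] tensor_map_hom[OF R gX gY gX gY graded_id bY]) auto

lemma tensor_bd_tens:
 assumes a: "a : els X" and b: "b : els Y" and n: "fst a + fst b = n"
 shows "tensor_bd R X Y n (te a b) = te (dh X a) b \<oplus>[T (n - 1)] ksign (T (n - 1)) (fst a) (te a (dh Y b))"
proof -
 have "ksign (T (n - 1)) (- fst a) t = ksign (T (n - 1)) (fst a) t" for t by (rule ksign_cong) simp
 then show ?thesis unfolding tensor_bd_def using tensor_map_tens[OF R gX gY gX gY bX graded_id a b n, of "n - 1"]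
  tensor_map_tens[OF R gX gY gX gY graded_id bY a b n, of "n - 1"] by (simp add: dh_def)
qed

lemma tensor_bd_tn:
 assumes F: "lin R T P F" and P: "module R P" and a: "a : els X" and b: "b : els Y"
 shows "F (fst a + fst b - 1, tensor_bd R X Y (fst a + fst b) (te a b)) =
  F (tn R (obj X) (obj Y) (dh X a) b) \<oplus>[P] ksign P (fst a) (F (tn R (obj X) (obj Y) a (dh Y b)))"
proof -
 have c1: "te (dh X a) b : car (T (fst a + fst b - 1))" using dh_homs[OF X a] b by (intro tens_closed[OF R gX gY]) auto
 have c2: "te a (dh Y b) : car (T (fst a + fst b - 1))" using dh_homs[OF Y b] a by (intro tens_closed[OF R gX gY]) auto
 note tm = tensor_module_module[OF R gX gY]
 have e: "tn R (obj X) (obj Y) (dh X a) b = (fst a + fst b - 1, te (dh X a) b)"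
  "tn R (obj X) (obj Y) a (dh Y b) = (fst a + fst b - 1, te a (dh Y b))" by (simp_all add: tn_def)
 show ?thesis unfolding tensor_bd_tens[OF a b refl] e
  unfolding lin_add[OF F c1 ksign_closed[OF gmod_ag[OF tensor_gmod[OF R gX gY]] c2]] lin_ksign[OF F tm P c2] by (rule refl)
qed

lemma tensor_cx_chain_complex: "chain_complex R (tensor_cx R X Y)" unfolding chain_complex_def
proof (intro conjI allI ballI)
 note tm = tensor_module_module[OF R gX gY]
 note ag = gmod_ag[OF tensor_gmod[OF R gX gY]]
 show "module R (obj (tensor_cx R X Y) n)" for n by (simp add: tensor_cx_def tm)
 show "graded_map R (obj (tensor_cx R X Y)) (obj (tensor_cx R X Y)) (- 1) (bd (tensor_cx R X Y))"
  by (simp add: tensor_cx_def graded_map_def tensor_bd_hom)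
 fix n x assume x: "x : car (obj (tensor_cx R X Y) n)"
 have "tensor_bd R X Y (n - 1) (tensor_bd R X Y n x) = \<zero>[T (n - 2)]"
 proof (rule tensor_ext[OF R gX gY mh_comp[OF tensor_bd_hom[OF refl] tensor_bd_hom] mh_const_zero tm])
  show "module R (T (n - 2))" by (rule tm)
  show "x : car (T n)" using x by (simp add: tensor_cx_def)
  fix a b assume a: "a : els X" and b: "b : els Y" and n: "fst a + fst b = n"
  have da: "dh X a : els X" and db: "dh Y b : els Y" by (rule dh_homs[OF X a], rule dh_homs[OF Y b])
  have c1: "te (dh X a) b : car (T (n - 1))" using da b n by (intro tens_closed[OF R gX gY]) auto
  have c2: "te a (dh Y b) : car (T (n - 1))" using db a n by (intro tens_closed[OF R gX gY]) auto
  have c3: "te (dh X a) (dh Y b) : car (T (n - 2))" using da db n by (intro tens_closed[OF R gX gY]) auto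
  note h = tensor_bd_hom[OF refl, of "n - 1"]
  have z1: "te (dh X (dh X a)) b = \<zero>[T (n - 2)]"
   using mh_zero[OF tens_left[OF R gX gY homs_snd[OF b], of "fst a - 2" "n - 2"] gmodD[OF gX] tm] n by (simp add: dh_dh[OF X a])
  have z2: "te a (dh Y (dh Y b)) = \<zero>[T (n - 2)]"
   using mh_zero[OF tens_right[OF R gX gY homs_snd[OF a], of "fst b - 2" "n - 2"] gmodD[OF gY] tm] n by (simp add: dh_dh[OF Y b])
  interpret Tn: module R "T (n - 2)" by (rule tm)
  show "tensor_bd R X Y (n - 1) (tensor_bd R X Y n (te a b)) = \<zero>[T (n - 2)]"
   using mh_add[OF h c1 ksign_closed[OF ag c2]] mh_ksign[OF h tm tm c2] n c3
    tensor_bd_tens[OF da b, of "n - 1"] tensor_bd_tens[OF a db, of "n - 1"]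
    ksign_cancel[OF ag c3, of "fst a - 1" "fst a"] by (simp add: tensor_bd_tens[OF a b n] z1 z2 ag)
 qed simp
 then show "bd (tensor_cx R X Y) (n - 1) (bd (tensor_cx R X Y) n x) = \<zero>[obj (tensor_cx R X Y) (n - 2)]" by (simp add: tensor_cx_def)
qed

end

section \<open>Sums over a coproduct\<close>

text \<open>
  A representation of the coproduct of each homogeneous element as a sum of tensors is chosen once
  and for all; \<open>csum R C P c F\<close> is then the sum written \<open>\<Sum> F c' c''\<close> in Sweedler's notation. It
  behaves like a finite sum for every \<open>F\<close>, and does not depend on the choice when \<open>F\<close> is bilinear.
\<close>

definition cm :: "('r, 'a, 'z) chain_coalg_scheme => 'a homog => ('r, 'a, 'a) tensor" where
 "cm C a = comult C (fst a) (snd a)"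

definition sw :: "('r, 'm) ring_scheme => ('r, 'a, 'z) chain_coalg_scheme => 'a homog => ('a homog \<times> 'a homog) list" where
 "sw R C a = (SOME L. (\<forall>p\<in>set L. fst p : els C & snd p : els C & fst (fst p) + fst (snd p) = fst a) &
   cm C a = lsum (tensor_module R (obj C) (obj C) (fst a)) (%p. tens R (obj C) (obj C) (fst p) (snd p)) L)"

definition csum :: "('r, 'm) ring_scheme => ('r, 'a, 'z) chain_coalg_scheme => ('r, 'b, 'n) module_scheme => 'a homog =>
  ('a homog => 'a homog => 'b) => 'b" where
 "csum R C P a F = lsum P (%p. F (fst p) (snd p)) (sw R C a)"

locale comultiplicative = cring R for R :: "('r, 'm) ring_scheme" (structure) +
 fixes C :: "('r, 'a, 'z) chain_coalg_scheme"
 assumes cx: "chain_complex R C"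
  and comult_hom: "comult C n : Hom R (obj C n) (tensor_module R (obj C) (obj C) n)"
begin

lemma gm: "gmod R (obj C)" by (rule chain_complex_gmod[OF cx])

lemma cm_closed: "a : els C ==> cm C a : car (tensor_module R (obj C) (obj C) (fst a))"
 unfolding cm_def using mh_closed[OF comult_hom] homs_snd by blast

lemma sw_spec:
 assumes "a : els C"
 shows "(\<forall>p\<in>set (sw R C a). fst p : els C & snd p : els C & fst (fst p) + fst (snd p) = fst a) &
   cm C a = lsum (tensor_module R (obj C) (obj C) (fst a)) (%p. tens R (obj C) (obj C) (fst p) (snd p)) (sw R C a)" unfolding sw_def
 by (rule someI_ex) (rule tensor_rep[OF cring_axioms gm gm cm_closed[OF assms]])

lemma csum_cong:
 assumes "a : els C"
  and "!!x y. [|x : els C; y : els C; fst x + fst y = fst a|] ==> F x y = G x y"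
 shows "csum R C P a F = csum R C P a G" unfolding csum_def using sw_spec[OF assms(1)] assms(2) by (intro lsum_cong) auto

context
 fixes P :: "('r, 'b, 'n) module_scheme"
 assumes P: "module R P"
begin

private lemma ag: "abelian_group P" using P by (simp add: module_def)

lemma csum_closed:
 assumes "a : els C"
  and "!!x y. [|x : els C; y : els C; fst x + fst y = fst a|] ==> F x y : car P"
 shows "csum R C P a F : car P" unfolding csum_def using sw_spec[OF assms(1)] assms(2) by (intro lsum_closed ag) auto

lemma csum_add:
 assumes "a : els C"
  and "!!x y. [|x : els C; y : els C; fst x + fst y = fst a|] ==> F x y : car P"
  and "!!x y. [|x : els C; y : els C; fst x + fst y = fst a|] ==> G x y : car P"
 shows "csum R C P a (%x y. F x y \<oplus>[P] G x y) = csum R C P a F \<oplus>[P] csum R C P a G"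
 unfolding csum_def using sw_spec[OF assms(1)] assms(2,3) by (intro lsum_add ag) auto

lemma csum_zero: "csum R C P a (%x y. \<zero>[P]) = \<zero>[P]" unfolding csum_def by (rule lsum_zero[OF ag])

lemma csum_hom:
 assumes f: "f : Hom R P Q" and Q: "module R Q" and a: "a : els C"
  and "!!x y. [|x : els C; y : els C; fst x + fst y = fst a|] ==> F x y : car P"
 shows "f (csum R C P a F) = csum R C Q a (%x y. f (F x y))" unfolding csum_def using sw_spec[OF a] assms(4) by (intro lsum_hom[OF f P Q]) auto

lemma csum_ksign:
 assumes a: "a : els C"
  and "!!x y. [|x : els C; y : els C; fst x + fst y = fst a|] ==> F x y : car P"
 shows "ksign P k (csum R C P a F) = csum R C P a (%x y. ksign P k (F x y))" by (rule csum_hom[OF mh_ksignI[OF mh_id P] P a assms(2)])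

lemma csum_of_hom:
 assumes f: "f : Hom R (tensor_module R (obj C) (obj C) (fst a)) P" and a: "a : els C"
 shows "f (cm C a) = csum R C P a (%x y. f (tens R (obj C) (obj C) x y))"
proof -
 let ?T = "tensor_module R (obj C) (obj C) (fst a)"
 have s: "cm C a = lsum ?T (%p. tens R (obj C) (obj C) (fst p) (snd p)) (sw R C a)" using sw_spec[OF a] by blast
 have "f (lsum ?T (%p. tens R (obj C) (obj C) (fst p) (snd p)) (sw R C a)) =
   lsum P (%p. f (tens R (obj C) (obj C) (fst p) (snd p))) (sw R C a)" using sw_spec[OF a]
  by (intro lsum_hom[OF f tensor_module_module[OF cring_axioms gm gm] P] tens_closed[OF cring_axioms gm gm]) auto
 then show ?thesis unfolding csum_def using s by simp
qed

lemma csum_lift: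
 assumes F: "bil R (obj C) (obj C) P F" and a: "a : els C"
 shows "csum R C P a F = lift R P (%(x, y). F x y) (cm C a)" unfolding csum_of_hom[OF lift_bil_hom[OF cring_axioms gm gm P F] a]
 by (rule csum_cong[OF a]) (simp add: lift_bil_tens[OF cring_axioms gm gm P F])

lemma csum_liftn:
 assumes F: "biln R (obj C) (obj C) P (fst a) \<phi>" and a: "a : els C"
 shows "lift R P \<phi> (cm C a) = csum R C P a (%x y. \<phi> (x, y))" unfolding csum_of_hom[OF liftn_hom[OF cring_axioms gm gm P F] a]
 by (rule csum_cong[OF a]) (simp add: liftn_tens[OF cring_axioms gm gm P F])

lemma csum_lin:
 assumes F: "bil R (obj C) (obj C) P F"
 shows "lin R (obj C) P (%a. csum R C P a F)"
proof -
 have "lin R (obj C) P (%a. lift R P (%(x, y). F x y) (cm C a))" unfolding lin_def cm_def fst_conv snd_conv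
  using mh_comp[OF comult_hom lift_bil_hom[OF cring_axioms gm gm P F]] by blast
 from lin_cong[OF gm csum_lift[OF F] this] show ?thesis by simp
qed

lemma csum_param_lin:
 assumes F: "!!x y. [|x : els C; y : els C|] ==> lin R M P (%m. F m x y)"
  and a: "a : els C"
 shows "lin R M P (%m. csum R C P a (F m))" unfolding csum_def using sw_spec[OF a] by (intro lin_lsum P F) auto

end

end

lemma csum_swap:
 assumes "comultiplicative R C" "comultiplicative R D" and P: "module R P"
  and a: "a : els C" and b: "b : els D"
  and F: "!!x y z w. [|x : els C; y : els C; fst x + fst y = fst a; z : els D; w : els D; fst z + fst w = fst b|]
   ==> F x y z w : car P"
 shows "csum R C P a (%x y. csum R D P b (F x y)) = csum R D P b (%z w. csum R C P a (%x y. F x y z w))" unfolding csum_def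
 using comultiplicative.sw_spec[OF assms(1) a] comultiplicative.sw_spec[OF assms(2) b] P F by (intro lsum_swap) (auto simp: module_def)

definition tri :: "('r, 'm) ring_scheme => ('r, 'a) gmodule => ('r, 'b, 'n) module_scheme => ('a homog => 'a homog => 'a homog => 'b) => bool" where
 "tri R M P F \<longleftrightarrow> (\<forall>x\<in>homs M. bil R M M P (F x)) & (\<forall>z\<in>homs M. bil R M M P (%x y. F x y z))"

definition eps :: "('r, 'a, 'z) chain_coalg_scheme => 'a homog => 'r" where
 "eps C a = counit C (fst a) (snd a)"

definition uh :: "('r, 'm) ring_scheme => ('r, 'a, 'z) coaug_chain_coalg_scheme => 'a homog" where
 "uh R C = (0, coaug_one R C)"

lemma fst_uh [simp]: "fst (uh R C) = 0" by (simp add: uh_def)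

locale coaugmented = comultiplicative R C
 for R :: "('r, 'm) ring_scheme" (structure) and C :: "('r, 'a, 'z) coaug_chain_coalg_scheme" +
 assumes counit_hom: "counit C n : Hom R (obj C n) (ground_module R n)"
  and counit_bd: "x : car (obj C n) ==> counit C (n - 1) (bd C n x) = \<zero>"
  and one_closed': "coaug_one R C : car (obj C 0)"
  and counit_one: "counit C 0 (coaug_one R C) = \<one>"
  and bd_one: "bd C 0 (coaug_one R C) = \<zero>[obj C (- 1)]"
  and coaug_eq: "r : car (ground_module R n) ==>
   coaug C n r = (if n = 0 then r \<odot>[obj C 0] coaug_one R C else \<zero>[obj C n])"

text \<open>
  The coalgebra axioms in Sweedler's form, tested on multilinear functions with values in one
  fixed module \<open>P\<close>. In this form they pass to the tensor product of two coalgebras without any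
  computation in iterated tensor products.
\<close>

locale coalgebra_into = coaugmented R C + P: module R P
 for R :: "('r, 'm) ring_scheme" (structure) and C :: "('r, 'a, 'z) coaug_chain_coalg_scheme"
  and P :: "('r, 'p) module" +
 assumes csum_one: "bil R (obj C) (obj C) P F ==> csum R C P (uh R C) F = F (uh R C) (uh R C)"
  and coassoc: "tri R (obj C) P G ==> a : els C ==>
   csum R C P a (%x z. csum R C P x (%x y. G x y z)) = csum R C P a (%x w. csum R C P w (G x))"
  and counit_left: "lin R (obj C) P H ==> a : els C ==> csum R C P a (%x y. eps C x \<odot>[P] H y) = H a"
  and counit_right: "lin R (obj C) P H ==> a : els C ==> csum R C P a (%x y. eps C y \<odot>[P] H x) = H a"
  and csum_bd: "bil R (obj C) (obj C) P F ==> a : els C ==>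
   csum R C P (dh C a) F = csum R C P a (%x y. F (dh C x) y \<oplus>[P] ksign P (fst x) (F x (dh C y)))"

lemma ground_simps: "car (ground_module R n) = (if n = 0 then car R else {\<zero>[R]})"
 "zero (ground_module R n) = \<zero>[R]" "add (ground_module R n) = add R" "smult (ground_module R n) = mult R" by (simp_all add: ground_module_def)

lemma ground_module_module: "cring R ==> module R (ground_module R n)"
proof -
 assume "cring R"
 then interpret cring R .
 show ?thesis
 proof (rule moduleI[OF is_cring abelian_groupI])
  fix x assume "x : car (ground_module R n)"
  then show "\<exists>y\<in>carrier (ground_module R n). y \<oplus>[ground_module R n] x = \<zero>[ground_module R n]"
   by (intro bexI[of _ "\<ominus>[R] x"]) (auto simp: ground_simps l_neg split: if_splits)
 qed (auto simp: ground_simps a_ac l_distr r_distr m_assoc split: if_splits)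
qed

context coaugmented
begin

lemma eps_closed: "a : els C ==> eps C a : car R" using mh_closed[OF counit_hom homs_snd] by (fastforce simp: eps_def ground_simps split: if_splits)

lemma eps_deg: "a : els C ==> fst a ~= 0 ==> eps C a = \<zero>"
 using mh_closed[OF counit_hom homs_snd] by (fastforce simp: eps_def ground_simps split: if_splits)

lemma eps_add: "x : car (obj C n) ==> y : car (obj C n) ==> eps C (n, x \<oplus>[obj C n] y) = eps C (n, x) \<oplus> eps C (n, y)"
 using mh_add[OF counit_hom] by (simp add: eps_def ground_simps)

lemma eps_smult: "r : car R ==> x : car (obj C n) ==> eps C (n, r \<odot>[obj C n] x) = r \<otimes> eps C (n, x)"
 using mh_smult[OF counit_hom] by (simp add: eps_def ground_simps)

lemma eps_dh: "a : els C ==> eps C (dh C a) = \<zero>" by (simp add: eps_def dh_def counit_bd homs_snd)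

lemma uh_homs: "uh R C : els C" by (simp add: uh_def one_closed')

lemma eps_uh: "eps C (uh R C) = \<one>" by (simp add: eps_def uh_def counit_one)

lemma eps_scale_lin:
 assumes P: "module R P" and p: "p : car P" shows "lin R (obj C) P (%a. eps C a \<odot>[P] p)"
proof -
 interpret P: module R P by (rule P)
 show ?thesis by (rule linI) (simp_all add: eps_closed eps_add eps_smult p P.smult_l_distr P.smult_assoc1)
qed

lemma dh_uh: "lin R (obj C) P F ==> module R P ==> F (dh C (uh R C)) = \<zero>[P]"
 using lin_zero[of R "obj C" P F "- 1"] gmodD[OF gm] by (simp add: dh_def uh_def bd_one)

end

lemma chain_mapD: "chain_map R X Y f ==> f n : Hom R (obj X n) (obj Y n)"
 "chain_map R X Y f ==> x : car (obj X n) ==> f (n - 1) (bd X n x) = bd Y n (f n x)" by (auto simp: chain_map_def graded_map_def)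

section \<open>Coassociativity as an identity of triple sums\<close>

context
 fixes R :: "('r, 'm) ring_scheme" and L :: "('r, 'a) gmodule" and M :: "('r, 'b) gmodule" and N :: "('r, 'c) gmodule"
 assumes R: "cring R" and L: "gmod R L" and M: "gmod R M" and N: "gmod R N"
begin

private abbreviation "LM == tensor_module R L M"
private abbreviation "MN == tensor_module R M N"
private lemma LM: "gmod R LM" by (rule tensor_gmod[OF R L M])
private lemma MN: "gmod R MN" by (rule tensor_gmod[OF R M N])
private abbreviation "Q == tensor_module R L MN"
private lemma Q: "module R (Q n)" by (rule tensor_module_module[OF R L MN])

private lemma inner:
 assumes z: "c : homs N" and n: "m + fst c = n"
 shows "biln R L M (Q n) m (%((i, x), (j, y)). tens R L MN (i, x) (j + fst c, tens R M N (j, y) c))"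
proof -
 have "(%x. tens R L MN (i, x) (j + fst c, tens R M N (j, y) c)) : Hom R (L i) (Q n)"
  if "i + j = m" "y : car (M j)" for i j y using that z n tens_closed[OF R M N, of "(j, y)" c "j + fst c"] by (intro tens_left[OF R L MN]) auto
 moreover have "(%y. tens R L MN (i, x) (j + fst c, tens R M N (j, y) c)) : Hom R (M j) (Q n)"
  if "i + j = m" "x : car (L i)" for i j x
 proof -
  have "(%y. tens R M N (j, y) c) : Hom R (M j) (MN (j + fst c))" using tens_left[OF R M N homs_snd[OF z], of j "j + fst c"] by simp
  from mh_comp[OF this tens_right[OF R L MN that(2)]] that(1) n show ?thesis by (auto simp: add.assoc)
 qed
 ultimately show ?thesis by (simp add: biln_def)
qed

private lemma outer:
 "biln R LM N (Q n) n (%((m, t), (k, z)). lift R (Q n)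
   (%((i, x), (j, y)). tens R L MN (i, x) (j + k, tens R M N (j, y) (k, z))) t)"
proof -
 have "(%t. lift R (Q n) (%((i, x), (j, y)). tens R L MN (i, x) (j + k, tens R M N (j, y) (k, z))) t)
   : Hom R (LM m) (Q n)" if "m + k = n" "z : car (N k)" for m k z using liftn_hom[OF R L M Q inner[of "(k, z)" m n]] that by simp
 moreover have "(%z. lift R (Q n) (%((i, x), (j, y)). tens R L MN (i, x) (j + k, tens R M N (j, y) (k, z))) t)
   : Hom R (N k) (Q n)" if "m + k = n" "t : car (LM m)" for m k t
 proof (rule lift_param[OF R L M Q _ _ gmodD[OF N] that(2)])
  fix z assume "z : car (N k)"
  then show "biln R L M (Q n) m (%((i, x), (j, y)). tens R L MN (i, x) (j + k, tens R M N (j, y) (k, z)))"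
   using inner[of "(k, z)" m n] that(1) by simp
 next
  fix a b assume a: "a : homs L" and b: "b : homs M" and m: "fst a + fst b = m"
  have "(%z. tens R M N b (k, z)) : Hom R (N k) (MN (fst b + k))" using tens_right[OF R M N homs_snd[OF b], of k "fst b + k"] by simp
  from mh_comp[OF this tens_right[OF R L MN homs_snd[OF a]]] m that(1)
  show "(%z. (%((i, x), (j, y)). tens R L MN (i, x) (j + k, tens R M N (j, y) (k, z))) (a, b))
    : Hom R (N k) (Q n)" by (auto simp: case_prod_beta add.assoc)
 qed
 ultimately show ?thesis by (simp add: biln_def)
qed

lemma tensor_assoc_hom: "tensor_assoc R L M N n : Hom R (tensor_module R LM N n) (Q n)"
 unfolding tensor_assoc_def Let_def by (rule liftn_hom[OF R LM N Q outer])

lemma tensor_assoc_tens: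
 assumes t: "t : car (LM m)" and c: "c : homs N" and n: "m + fst c = n"
 shows "tensor_assoc R L M N n (tens R LM N (m, t) c) =
  lift R (Q n) (%(a, b). tens R L MN a (tn R M N b c)) t"
proof -
 have e: "(%((i, x), (j, y)). tens R L MN (i, x) (j + fst c, tens R M N (j, y) c)) = (%(a, b). tens R L MN a (tn R M N b c))" by (auto simp: tn_def)
 show ?thesis unfolding tensor_assoc_def Let_def using liftn_tens[OF R LM N Q outer, of "(m, t)" c n] t c n e by (simp add: case_prod_beta)
qed

lemma tensor_assoc_inner:
 assumes c: "c : homs N" and n: "m + fst c = n"
 shows "biln R L M (Q n) m (%(a, b). tens R L MN a (tn R M N b c))"
proof -
 have e: "(%((i, x), (j, y)). tens R L MN (i, x) (j + fst c, tens R M N (j, y) c)) = (%(a, b). tens R L MN a (tn R M N b c))" by (auto simp: tn_def)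
 show ?thesis using inner[OF assms] e by simp
qed

end

lemma coalgebra_intoI:
 assumes R: "cring R" and P: "module R P" and C: "coaugmented_chain_coalgebra R C"
 shows "coalgebra_into R C P"
proof -
 interpret cring R by (rule R)
 interpret P: module R P by (rule P)
 have coalg: "chain_coalgebra R C" and co: "chain_coalg_hom R (ground_coalg R) C (coaug C)" using C by (simp_all add: coaugmented_chain_coalgebra_def)
 have cx: "chain_complex R C" and cmap: "chain_map R C (tensor_cx R C C) (comult C)"
  and emap: "chain_map R C (ground_coalg R) (counit C)" using coalg by (simp_all add: chain_coalgebra_def)
 let ?M = "obj C" let ?T = "tensor_module R ?M ?M"
 have gm: "gmod R ?M" by (rule chain_complex_gmod[OF cx])
 interpret Mn: module R "obj C n" for n by (rule gmodD[OF gm])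
 have umap: "coaug C n : Hom R (ground_module R n) (obj C n)" for n
  using chain_mapD(1)[of R "ground_coalg R" C "coaug C" n] co by (simp add: chain_coalg_hom_def ground_coalg_def)
 have G0: "\<one>[R] : car (ground_module R 0)" by (simp add: ground_simps)
 have GZ: "\<zero>[R] : car (ground_module R n)" for n by (simp add: ground_simps)
 have u: "coaug_one R C : car (obj C 0)" unfolding coaug_one_def by (rule mh_closed[OF umap G0])
 have z: "coaug C n \<zero>[R] = \<zero>[obj C n]" for n using mh_zero[OF umap ground_module_module[OF R] gmodD[OF gm]] by (simp add: ground_simps)
 interpret comultiplicative R C using cx chain_mapD(1)[OF cmap] by unfold_locales (simp_all add: tensor_cx_def)
 interpret coaugmented R C
 proof unfold_locales
  show "counit C n : Hom R (obj C n) (ground_module R n)" for n using chain_mapD(1)[OF emap] by (simp add: ground_coalg_def)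
  show "counit C (n - 1) (bd C n x) = \<zero>[R]" if "x : car (obj C n)" for n x using chain_mapD(2)[OF emap that] by (simp add: ground_coalg_def)
  show "coaug_one R C : car (obj C 0)" by (rule u)
  show "counit C 0 (coaug_one R C) = \<one>[R]" using co G0 unfolding chain_coalg_hom_def coaug_one_def by (auto simp: ground_coalg_def)
  have "coaug C (0 - 1) (bd (ground_coalg R) 0 \<one>[R]) = bd C 0 (coaug C 0 \<one>[R])"
   by (rule chain_mapD(2)[of R "ground_coalg R"]) (use co G0 in \<open>simp_all add: chain_coalg_hom_def ground_coalg_def\<close>)
  then show "bd C 0 (coaug_one R C) = \<zero>[obj C (- 1)]" by (simp add: coaug_one_def ground_coalg_def z)
  show "coaug C n r = (if n = 0 then r \<odot>[obj C 0] coaug_one R C else \<zero>[obj C n])"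
   if "r : car (ground_module R n)" for r n
   using that mh_smult[OF umap[of 0] _ G0, of r] z by (auto simp: ground_simps coaug_one_def split: if_splits)
 qed
 note ccs = R gm gm
 have T: "gmod R ?T" by (rule tensor_gmod[OF ccs])
 have Tm: "module R (?T n)" for n by (rule tensor_module_module[OF ccs])
 have Sw: "graded_map R ?M ?T 0 (comult C)" using comult_hom by (simp add: graded_map_def)
 show ?thesis
 proof unfold_locales
  fix F assume F: "bil R ?M ?M P F"
  have c: "comult C 0 (coaug_one R C) = tensor_map R ?M ?M 0 0 (coaug C) (coaug C) 0 (comult (ground_coalg R) 0 \<one>[R])"
   using co G0 unfolding chain_coalg_hom_def coaug_one_def by (auto simp: ground_coalg_def)
  let ?K = "tensor_module R (ground_module R) (ground_module R)"
  have gg: "gmod R (ground_module R)" by (simp add: gmod_def ground_module_module[OF R])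
  have 1: "tens R (ground_module R) (ground_module R) (0, \<one>[R]) (0, \<one>[R]) : car (?K 0)" by (rule tens_closed[OF R gg gg]) (simp_all add: G0)
  have gu: "graded_map R (ground_module R) ?M 0 (coaug C)" using umap by (simp add: graded_map_def)
  have "comult C 0 (coaug_one R C) = tens R ?M ?M (uh R C) (uh R C)"
   using tensor_map_tens[OF R gg gg gm gm gu gu, of "(0, \<one>[R])" "(0, \<one>[R])" 0 0] G0 c
    module.smult_one[OF tensor_module_module[OF R gg gg] 1] by (simp add: ground_coalg_def uh_def coaug_one_def Let_def)
  then have "cm C (uh R C) = tens R ?M ?M (uh R C) (uh R C)" by (simp add: cm_def uh_def)
  then show "csum R C P (uh R C) F = F (uh R C) (uh R C)" by (simp add: csum_lift[OF P F] uh_homs lift_bil_tens[OF ccs P F])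
 next
  fix H a assume H: "lin R ?M P H" and a: "a : homs ?M"
  let ?n = "fst a"
  let ?B = "%x y. if fst x = (0 :: int) then counit C (fst x) (snd x) \<odot>[obj C ?n] snd y else \<zero>[obj C ?n]"
  let ?l = "%((i, x), (j, y)). if i = 0 then counit C i x \<odot>[obj C ?n] y else \<zero>[obj C ?n]"
  let ?r = "%((i, x), (j, y)). if j = 0 then counit C j y \<odot>[obj C ?n] x else \<zero>[obj C ?n]"
  have l: "biln R ?M ?M (obj C ?n) ?n ?l" and r: "biln R ?M ?M (obj C ?n) ?n ?r"
   using Mn.smult_l_distr Mn.smult_assoc1 Mn.smult_r_distr Mn.smult_closed eps_closed eps_add eps_smult m_comm
   by (auto simp: biln_def eps_def intro!: mhI simp flip: Mn.smult_assoc1)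
  have cu: "lift R (obj C ?n) ?l (cm C a) = snd a"
   "lift R (obj C ?n) ?r (cm C a) = snd a" using coalg homs_snd[OF a] unfolding chain_coalgebra_def cm_def by blast+
  have Hn: "(%x. H (?n, x)) : Hom R (obj C ?n) P" by (rule lin_hom[OF H])
  have HB: "H (?n, ?B x y) = eps C x \<odot>[P] H y" if x: "x : homs ?M" and y: "y : homs ?M" and d: "fst x + fst y = fst a" for x y
    using lin_smult[OF H eps_closed[OF x], of "snd y" ?n] homs_snd[OF y] d eps_deg[OF x] lin_closed[OF H y]
     mh_zero[OF Hn Mn.module_axioms P] prod.collapse[of y] by (cases y) (auto simp: eps_def)
  have "H a = (%x. H (?n, x)) (lift R (obj C ?n) ?l (cm C a))" using cu(1) by simp
  also have "... = csum R C P a (%x y. H (?n, ?B x y))" unfolding csum_liftn[OF Mn.module_axioms l a] by (subst csum_hom[OF Mn.module_axioms Hn P a])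
    (use eps_closed homs_snd in \<open>auto simp: case_prod_beta eps_def intro!: Mn.smult_closed\<close>)
  also have "... = csum R C P a (%x y. eps C x \<odot>[P] H y)" by (rule csum_cong[OF a]) (rule HB)
  finally show "csum R C P a (%x y. eps C x \<odot>[P] H y) = H a" by simp
  have "H a = (%x. H (?n, x)) (lift R (obj C ?n) ?r (cm C a))" using cu(2) by simp
  also have "... = csum R C P a (%x y. H (?n, ?B y x))" unfolding csum_liftn[OF Mn.module_axioms r a] by (subst csum_hom[OF Mn.module_axioms Hn P a])
    (use eps_closed homs_snd in \<open>auto simp: case_prod_beta eps_def intro!: Mn.smult_closed\<close>)
  also have "... = csum R C P a (%x y. eps C y \<odot>[P] H x)" by (rule csum_cong[OF a], rule HB) simp_all
  finally show "csum R C P a (%x y. eps C y \<odot>[P] H x) = H a" by simp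
 next
  fix F a assume F: "bil R ?M ?M P F" and a: "a : homs ?M"
  note h = lift_bil_hom[OF ccs P F]
  have c: "cm C (dh C a) = tensor_bd R C C (fst a) (cm C a)" using chain_mapD(2)[OF cmap homs_snd[OF a]] by (simp add: cm_def dh_def tensor_cx_def)
  have "csum R C P (dh C a) F = lift R P (%(x, y). F x y) (tensor_bd R C C (fst a) (cm C a))" unfolding csum_lift[OF P F dh_homs[OF cx a]] c ..
  also have "... = csum R C P a (%x y. lift R P (%(x, y). F x y) (tensor_bd R C C (fst a) (tens R ?M ?M x y)))"
   by (rule csum_of_hom[OF P mh_comp[OF tensor_bd_hom[OF R cx cx refl] h] a])
  also have "... = csum R C P a (%x y. F (dh C x) y \<oplus>[P] ksign P (fst x) (F x (dh C y)))"
  proof (rule csum_cong[OF a])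
   fix x y assume x: "x : homs ?M" and y: "y : homs ?M" and d: "fst x + fst y = fst a"
   have c1: "tens R ?M ?M (dh C x) y : car (?T (fst a - 1))" using dh_homs[OF cx x] y d by (intro tens_closed[OF ccs]) auto
   have c2: "tens R ?M ?M x (dh C y) : car (?T (fst a - 1))" using dh_homs[OF cx y] x d by (intro tens_closed[OF ccs]) auto
   show "lift R P (%(x, y). F x y) (tensor_bd R C C (fst a) (tens R ?M ?M x y)) = F (dh C x) y \<oplus>[P] ksign P (fst x) (F x (dh C y))"
    using dh_homs[OF cx x] dh_homs[OF cx y] x y by (simp add: tensor_bd_tens[OF R cx cx x y d] mh_add[OF h c1 ksign_closed[OF gmod_ag[OF T] c2]]
      mh_ksign[OF h Tm P c2] lift_bil_tens[OF ccs P F])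
  qed
  finally show "csum R C P (dh C a) F = csum R C P a (%x y. F (dh C x) y \<oplus>[P] ksign P (fst x) (F x (dh C y)))" .
 next
  fix G a assume G: "tri R ?M P G" and a: "a : homs ?M"
  let ?n = "fst a" let ?Q = "tensor_module R ?M ?T"
  have Qm: "module R (?Q n)" for n by (rule tensor_module_module[OF R gm T])
  have G1: "bil R ?M ?M P (G x)" if "x : homs ?M" for x using G that by (simp add: tri_def)
  have G3: "bil R ?M ?M P (%x y. G x y z)" if "z : homs ?M" for z using G that by (simp add: tri_def)
  let ?S = "tensor_map R ?T ?M 0 0 (comult C) (%_ x. x) ?n" let ?S2 = "tensor_map R ?M ?T 0 0 (%_ x. x) (comult C) ?n" let ?A = "tensor_assoc R ?M ?M ?M ?n"
  have co: "?A (?S (cm C a))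
    = ?S2 (cm C a)" using coalg homs_snd[OF a] unfolding chain_coalgebra_def cm_def by blast
  let ?\<phi> = "%x w. lift R P (%(y, z). G x y z) (snd w)"
  have bil: "bil R ?M ?T P ?\<phi>"
  proof (rule bilI)
   fix x assume x: "x : homs ?M"
   show "lin R ?T P (%w. lift R P (%(y, z). G x y z) (snd w))" unfolding lin_def using lift_bil_hom[OF ccs P G1[OF x]] by simp
  next
   fix w assume w: "w : homs ?T"
   show "lin R ?M P (%x. lift R P (%(y, z). G x y z) (snd w))" unfolding lin_def
   proof
    fix n
    show "(%x. lift R P (%(y, z). G (n, x) y z) (snd w)) : Hom R (obj C n) P"
    proof (rule lift_param[OF ccs P _ _ gmodD[OF gm] homs_snd[OF w]])
     fix x assume "x : car (obj C n)"
     then show "biln R ?M ?M P (fst w) (%(y, z). G (n, x) y z)" by (intro biln_bil G1) simp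
    next
     fix y z assume yz: "y : homs ?M" "z : homs ?M"
     show "(%x. case (y, z) of (y, z) => G (n, x) y z) : Hom R (obj C n) P" using lin_hom[OF bil_left[OF G3[OF yz(2)] yz(1)]] by simp
    qed
   qed
  qed
  let ?\<Phi> = "lift R P (%(x, w). ?\<phi> x w)"
  have \<Phi>: "?\<Phi> : Hom R (?Q n) P" for n by (rule lift_bil_hom[OF R gm T P bil])
  have \<Phi>t: "?\<Phi> (tens R ?M ?T x w) = ?\<phi> x w" if "x : homs ?M" "w : homs ?T" for x w by (rule lift_bil_tens[OF R gm T P bil that])
  have cmT: "(fst x, cm C x) : homs ?T" if "x : homs ?M" for x using cm_closed[OF that] by simp
  have "?\<Phi> (?S2 (cm C a)) =
    csum R C P a (%x w. ?\<Phi> (?S2 (tens R ?M ?M x w)))"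
   by (rule csum_of_hom[OF P mh_comp[OF tensor_map_hom[OF R gm gm gm T graded_id Sw] \<Phi>] a]) simp
  also have "... = csum R C P a (%x w. csum R C P w (G x))" by (rule csum_cong[OF a])
    (simp add: tensor_map_tens[OF R gm gm gm T graded_id Sw _ _ _ refl] \<Phi>t cm_closed[unfolded cm_def] csum_lift[OF P G1] cm_def)
  finally have rhs: "?\<Phi> (?S2 (cm C a)) = csum R C P a (%x w. csum R C P w (G x))" .
  have as: "?A : Hom R (tensor_module R ?T ?M ?n) (?Q ?n)" by (rule tensor_assoc_hom[OF R gm gm gm])
  have "?\<Phi> (?A (?S (cm C a))) =
    csum R C P a (%x z. ?\<Phi> (?A (?S (tens R ?M ?M x z))))"
   by (rule csum_of_hom[OF P mh_comp[OF tensor_map_hom[OF R gm gm T gm Sw graded_id] mh_comp[OF as \<Phi>]] a]) simp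
  also have "... = csum R C P a (%x z. csum R C P x (%x y. G x y z))"
  proof (rule csum_cong[OF a])
   fix x z assume x: "x : homs ?M" and z: "z : homs ?M" and d: "fst x + fst z = fst a"
   have "?\<Phi> (?A (?S (tens R ?M ?M x z)))
    = ?\<Phi> (?A (tens R ?T ?M (fst x, cm C x) z))" using tensor_map_tens[OF R gm gm T gm Sw graded_id x z d refl] by (simp add: cm_def)
   also have "... = ?\<Phi> (lift R (?Q ?n) (%(x, y). tens R ?M ?T x (tn R ?M ?M y z)) (cm C x))"
    by (simp add: tensor_assoc_tens[OF R gm gm gm cm_closed[OF x] z d])
   also have "... = ?\<Phi> (csum R C (?Q ?n) x (%x y. tens R ?M ?T x (tn R ?M ?M y z)))"
    by (simp add: csum_liftn[OF Qm tensor_assoc_inner[OF R gm gm gm z d] x])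
   also have "... = csum R C P x (%x y. ?\<Phi> (tens R ?M ?T x (tn R ?M ?M y z)))"
    using d z by (intro csum_hom[OF Qm \<Phi> P x] tens_closed[OF R gm T] tn_homs[OF ccs]) auto
   also have "... = csum R C P x (%x y. G x y z)"
    by (rule csum_cong[OF x]) (simp add: \<Phi>t z tn_homs[OF ccs], simp add: tn_def lift_bil_tens[OF ccs P G1] z)
   finally show "?\<Phi> (?A (?S (tens R ?M ?M x z)))
    = csum R C P x (%x y. G x y z)" .
  qed
  finally show "csum R C P a (%x z. csum R C P x (%x y. G x y z)) = csum R C P a (%x w. csum R C P w (G x))" using rhs co by simp
 qed
qed

section \<open>The tensor product of two coalgebras\<close>

lemma tri_right: "tri R M P G ==> x : homs M ==> bil R M M P (G x)" by (simp add: tri_def)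

lemma tri_left: "tri R M P G ==> z : homs M ==> bil R M M P (%x y. G x y z)" by (simp add: tri_def)

lemma tri_closed: "tri R M P G ==> x : homs M ==> y : homs M ==> z : homs M ==> G x y z : car P" by (rule bil_closed[OF tri_right])

context comultiplicative
begin

context
 fixes P :: "('r, 'b, 'n) module_scheme"
 assumes P: "module R P"
begin

lemma tri_bil_left:
 assumes G: "tri R (obj C) P G"
 shows "bil R (obj C) (obj C) P (%x z. csum R C P x (%x y. G x y z))"
proof (rule bilI)
 fix x assume x: "x : els C"
 show "lin R (obj C) P (%z. csum R C P x (%x y. G x y z))" by (rule csum_param_lin[OF P _ x]) (rule bil_right[OF tri_right[OF G]])
next
 fix z assume "z : els C"
 then show "lin R (obj C) P (%x. csum R C P x (%x y. G x y z))" using G by (intro csum_lin[OF P]) (simp add: tri_def)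
qed

lemma tri_bil_right:
 assumes G: "tri R (obj C) P G"
 shows "bil R (obj C) (obj C) P (%x w. csum R C P w (G x))"
proof (rule bilI)
 fix x assume "x : els C"
 then show "lin R (obj C) P (%w. csum R C P w (G x))" using G by (intro csum_lin[OF P]) (simp add: tri_def)
next
 fix w assume w: "w : els C"
 show "lin R (obj C) P (%x. csum R C P w (G x))" by (rule csum_param_lin[OF P _ w]) (rule bil_left[OF tri_left[OF G]])
qed

lemma bil_bd:
 assumes F: "bil R (obj C) (obj C) P F"
 shows "bil R (obj C) (obj C) P (%x y. F (dh C x) y \<oplus>[P] ksign P (fst x) (F x (dh C y)))"
proof (rule bilI)
 fix x assume x: "x : els C"
 show "lin R (obj C) P (%y. F (dh C x) y \<oplus>[P] ksign P (fst x) (F x (dh C y)))"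
  using lin_comp[OF lin_dh[OF cx bil_right[OF F x]] mh_ksignI[OF mh_id P]] by (intro lin_plus P bil_right[OF F dh_homs[OF cx x]])
next
 fix y assume y: "y : els C"
 show "lin R (obj C) P (%x. F (dh C x) y \<oplus>[P] ksign P (fst x) (F x (dh C y)))"
  by (intro lin_plus lin_ksignI P lin_dh[OF cx bil_left[OF F y]] bil_left[OF F dh_homs[OF cx y]])
qed

end

end

locale coaugmented_pair = A: coaugmented R A + B: coaugmented R B
 for R :: "('r, 'm) ring_scheme" (structure) and A :: "('r, 'a, 'z) coaug_chain_coalg_scheme"
  and B :: "('r, 'b, 'w) coaug_chain_coalg_scheme"
begin

abbreviation "M == obj A"
abbreviation "N == obj B"
abbreviation "T == tensor_module R M N"
abbreviation "AB == tensor_coalg R A B"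
abbreviation "t2 == tn R M N"
abbreviation (input) "csA == csum R A"
abbreviation (input) "csB == csum R B"
abbreviation (input) "csAB == csum R AB"

lemma R: "cring R" by (rule A.cring_axioms)

lemma AB_simps [simp]: "obj AB = T" "bd AB = tensor_bd R A B" by (simp_all add: tensor_coalg_def Let_def)

lemma gT: "gmod R T" by (rule tensor_gmod[OF R A.gm B.gm])

lemma t2_homs [simp]: "a : homs M ==> b : homs N ==> t2 a b : homs T" by (rule tn_homs[OF R A.gm B.gm])

lemma AB_cx: "chain_complex R AB" using tensor_cx_chain_complex[OF R A.cx B.cx] by (simp add: chain_complex_def tensor_cx_def)

lemma dh_t2:
 assumes "lin R T P F" "module R P" "a : homs M" "b : homs N"
 shows "F (dh AB (t2 a b)) = F (t2 (dh A a) b) \<oplus>[P] ksign P (fst a) (F (t2 a (dh B b)))"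
 using tensor_bd_tn[OF R A.cx B.cx assms] by (simp add: dh_def[of AB] tn_def[of R M N a b])

lemma t2_lin_left: "lin R T P F ==> b : homs N ==> lin R M P (%a. F (t2 a b))" by (rule bil_left[OF lin_tn[OF R A.gm B.gm]])

lemma t2_lin_right: "lin R T P F ==> a : homs M ==> lin R N P (%b. F (t2 a b))" by (rule bil_right[OF lin_tn[OF R A.gm B.gm]])

subsection \<open>The coproduct\<close>

definition "TT = tensor_module R T T"

lemma TT: "module R (TT n)" unfolding TT_def by (rule tensor_module_module[OF R gT gT])

definition "\<Psi> n x x' y y' = ksign (TT n) (fst x' * fst y) (tens R T T (t2 x y) (t2 x' y'))"

lemma \<Psi>_closed:
 assumes "x : homs M" "x' : homs M" "y : homs N" "y' : homs N" "fst x + fst x' + fst y + fst y' = n"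
 shows "\<Psi> n x x' y y' : car (TT n)"
proof -
 have "tens R T T (t2 x y) (t2 x' y') : car (TT n)" using assms unfolding TT_def by (intro tens_closed[OF R gT gT]) auto
 then show ?thesis unfolding \<Psi>_def using TT by (simp add: module_def)
qed

lemma t2_hom:
 "y : homs N ==> (%z. tens R M N (i, z) y) : Hom R (M i) (T (i + fst y))"
 "x : homs M ==> (%z. tens R M N x (j, z)) : Hom R (N j) (T (fst x + j))"
proof -
 assume "y : homs N"
 from tens_left[OF R A.gm B.gm homs_snd[OF this] refl]
 show "(%z. tens R M N (i, z) y) : Hom R (M i) (T (i + fst y))" by simp
next
 assume "x : homs M"
 from tens_right[OF R A.gm B.gm homs_snd[OF this] refl]
 show "(%z. tens R M N x (j, z)) : Hom R (N j) (T (fst x + j))" by simp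
qed

lemma \<Psi>_hom:
 assumes n: "fst x + fst x' + fst y + fst y' = n"
 shows "[|x' : homs M; y : homs N; y' : homs N|] ==> (%z. \<Psi> n (fst x, z) x' y y') : Hom R (M (fst x)) (TT n)"
  and "[|x : homs M; y : homs N; y' : homs N|] ==> (%z. \<Psi> n x (fst x', z) y y') : Hom R (M (fst x')) (TT n)"
  and "[|x : homs M; x' : homs M; y' : homs N|] ==> (%z. \<Psi> n x x' (fst y, z) y') : Hom R (N (fst y)) (TT n)"
  and "[|x : homs M; x' : homs M; y : homs N|] ==> (%z. \<Psi> n x x' y (fst y', z)) : Hom R (N (fst y')) (TT n)"
proof -
 have c: "tens R M N a b : car (T (fst a + fst b))" if "a : homs M" "b : homs N" for a b by (rule tens_closed[OF R A.gm B.gm that refl])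
 have m: "fst x + fst y + (fst x' + fst y') = n" using n by simp
 note L = mh_ksignI[OF mh_comp[OF _ tens_left[OF R gT gT c m, folded TT_def]] TT]
 note Q = mh_ksignI[OF mh_comp[OF _ tens_right[OF R gT gT c m, folded TT_def]] TT]
 show "[|x' : homs M; y : homs N; y' : homs N|] ==> (%z. \<Psi> n (fst x, z) x' y y') : Hom R (M (fst x)) (TT n)"
  unfolding \<Psi>_def tn_def fst_conv by (rule L[OF t2_hom(1)])
 show "[|x : homs M; y : homs N; y' : homs N|] ==> (%z. \<Psi> n x (fst x', z) y y') : Hom R (M (fst x')) (TT n)"
  unfolding \<Psi>_def tn_def fst_conv by (rule Q[OF t2_hom(1)])
 show "[|x : homs M; x' : homs M; y' : homs N|] ==> (%z. \<Psi> n x x' (fst y, z) y') : Hom R (N (fst y)) (TT n)"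
  unfolding \<Psi>_def tn_def fst_conv by (rule L[OF t2_hom(2)])
 show "[|x : homs M; x' : homs M; y : homs N|] ==> (%z. \<Psi> n x x' y (fst y', z)) : Hom R (N (fst y')) (TT n)"
  unfolding \<Psi>_def tn_def fst_conv by (rule Q[OF t2_hom(2)])
qed

lemma swap_inner:
 assumes x: "x : homs M" and x': "x' : homs M" and n: "fst x + fst x' + m = n"
 shows "biln R N N (TT n) m (%(y, y'). \<Psi> n x x' y y')" unfolding biln_def
proof (intro allI impI conjI ballI)
 fix i j assume ij: "i + j = m"
 show "(%z. (%(y, y'). \<Psi> n x x' y y') ((i, z), j, y)) : Hom R (N i) (TT n)" if "y : car (N j)" for y
  using \<Psi>_hom(3)[of x x' "(i, undefined)" "(j, y)" n] ij x x' n that by simp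
 show "(%z. (%(y, y'). \<Psi> n x x' y y') ((i, y), j, z)) : Hom R (N j) (TT n)" if "y : car (N i)" for y
  using \<Psi>_hom(4)[of x x' "(i, y)" "(j, undefined)" n] ij x x' n that by simp
qed

lemma swap_mid:
 assumes t: "t : car (tensor_module R N N k)" and n: "m + k = n"
 shows "biln R M M (TT n) m (%(x, x'). lift R (TT n) (%(y, y'). \<Psi> n x x' y y') t)" unfolding biln_def
proof (intro allI impI conjI ballI)
 fix i j assume ij: "i + j = m"
 show "(%z. (%(x, x'). lift R (TT n) (%(y, y'). \<Psi> n x x' y y') t) ((i, z), j, x')) : Hom R (M i) (TT n)"
  if x': "x' : car (M j)" for x' unfolding prod.case
 proof (rule lift_param[OF R B.gm B.gm TT _ _ gmodD[OF A.gm] t])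
  show "biln R N N (TT n) k (%(y, y'). \<Psi> n (i, z) (j, x') y y')" if "z : car (M i)" for z using that x' ij n by (intro swap_inner) auto
  show "(%z. (%(y, y'). \<Psi> n (i, z) (j, x') y y') (y, y')) : Hom R (M i) (TT n)"
   if "y : homs N" "y' : homs N" "fst y + fst y' = k" for y y' using \<Psi>_hom(1)[of "(i, undefined)" "(j, x')" y y' n] that x' ij n by simp
 qed
 show "(%z. (%(x, x'). lift R (TT n) (%(y, y'). \<Psi> n x x' y y') t) ((i, x), j, z)) : Hom R (M j) (TT n)"
  if x: "x : car (M i)" for x unfolding prod.case
 proof (rule lift_param[OF R B.gm B.gm TT _ _ gmodD[OF A.gm] t])
  show "biln R N N (TT n) k (%(y, y'). \<Psi> n (i, x) (j, z) y y')" if "z : car (M j)" for z using that x ij n by (intro swap_inner) auto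
  show "(%z. (%(y, y'). \<Psi> n (i, x) (j, z) y y') (y, y')) : Hom R (M j) (TT n)"
   if "y : homs N" "y' : homs N" "fst y + fst y' = k" for y y' using \<Psi>_hom(2)[of "(i, x)" "(j, undefined)" y y' n] that x ij n by simp
 qed
qed

abbreviation "MM == tensor_module R M M"
abbreviation "NN == tensor_module R N N"

lemma gMM: "gmod R MM" by (rule tensor_gmod[OF R A.gm A.gm])
lemma gNN: "gmod R NN" by (rule tensor_gmod[OF R B.gm B.gm])

lemma swap_outer:
 "biln R MM NN (TT n) n (%((_, s), (_, t)). lift R (TT n) (%(x, x'). lift R (TT n) (%(y, y'). \<Psi> n x x' y y') t) s)" unfolding biln_def
proof (intro allI impI conjI ballI)
 fix i j assume ij: "i + j = n"
 show "(%s. (%((_, s), (_, t)). lift R (TT n) (%(x, x'). lift R (TT n) (%(y, y'). \<Psi> n x x' y y') t) s) ((i, s), j, t))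
   : Hom R (MM i) (TT n)" if "t : car (NN j)" for t unfolding prod.case by (rule liftn_hom[OF R A.gm A.gm TT swap_mid[OF that ij]])
 show "(%t. (%((_, s), (_, t)). lift R (TT n) (%(x, x'). lift R (TT n) (%(y, y'). \<Psi> n x x' y y') t) s) ((i, s), j, t))
   : Hom R (NN j) (TT n)" if s: "s : car (MM i)" for s unfolding prod.case
 proof (rule lift_param[OF R A.gm A.gm TT _ _ gmodD[OF gNN] s])
  show "biln R M M (TT n) i (%(x, x'). lift R (TT n) (%(y, y'). \<Psi> n x x' y y') t)" if "t : car (NN j)" for t by (rule swap_mid[OF that ij])
  show "(%t. (%(x, x'). lift R (TT n) (%(y, y'). \<Psi> n x x' y y') t) (x, x')) : Hom R (NN j) (TT n)"
   if "x : homs M" "x' : homs M" "fst x + fst x' = i" for x x'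
   unfolding prod.case using that ij by (intro liftn_hom[OF R B.gm B.gm TT swap_inner]) auto
 qed
qed

lemma middle_swap_eq: "middle_swap R M N n =
  lift R (TT n) (%((_, s), (_, t)). lift R (TT n) (%(x, x'). lift R (TT n) (%(y, y'). \<Psi> n x x' y y') t) s)"
proof -
 have 1: "(%((k, y), (l, y')). ksign (TT n) (j * k) (tens R T T (i + k, tens R M N (i, x) (k, y)) (j + l, tens R M N (j, x') (l, y'))))
   = (%(y, y'). \<Psi> n (i, x) (j, x') y y')" for i x j x' by (auto simp: \<Psi>_def tn_def)
 have 2: "(%((i, x), (j, x')). lift R (TT n) (%(y, y'). \<Psi> n (i, x) (j, x') y y') t) =
   (%(x, x'). lift R (TT n) (%(y, y'). \<Psi> n x x' y y') t)" for t by auto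
 show ?thesis unfolding middle_swap_def Let_def TT_def[symmetric] 1 2 ..
qed

lemma comult_AB: "comult AB n t = middle_swap R M N n (tensor_map R MM NN 0 0 (comult A) (comult B) n t)" by (simp add: tensor_coalg_def Let_def)

lemma grA: "graded_map R M MM 0 (comult A)" using A.comult_hom by (simp add: graded_map_def)
lemma grB: "graded_map R N NN 0 (comult B)" using B.comult_hom by (simp add: graded_map_def)

lemma comult_AB_hom: "comult AB n : Hom R (T n) (TT n)" unfolding comult_AB middle_swap_eq
 by (rule mh_comp[OF tensor_map_hom[OF R A.gm B.gm gMM gNN grA grB] liftn_hom[OF R gMM gNN TT swap_outer]]) simp

lemma comult_AB_tens:
 assumes a: "a : homs M" and b: "b : homs N" and n: "fst a + fst b = n"
 shows "comult AB n (tens R M N a b) = csA (TT n) a (%a1 a2. csB (TT n) b (%b1 b2. \<Psi> n a1 a2 b1 b2))"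
proof -
 have "comult AB n (tens R M N a b) = middle_swap R M N n (tens R MM NN (fst a, cm A a) (fst b, cm B b))"
  unfolding comult_AB using tensor_map_tens[OF R A.gm B.gm gMM gNN grA grB a b n refl] by (simp add: cm_def)
 also have "... = lift R (TT n) (%(x, x'). lift R (TT n) (%(y, y'). \<Psi> n x x' y y') (cm B b)) (cm A a)" unfolding middle_swap_eq
  using liftn_tens[OF R gMM gNN TT swap_outer, of "(fst a, cm A a)" "(fst b, cm B b)" n] n
   A.cm_closed[OF a] B.cm_closed[OF b] by simp
 also have "... = csA (TT n) a (%a1 a2. lift R (TT n) (%(y, y'). \<Psi> n a1 a2 y y') (cm B b))"
  using A.csum_liftn[OF TT swap_mid[OF B.cm_closed[OF b] n] a] by simp
 also have "... = csA (TT n) a (%a1 a2. csB (TT n) b (%b1 b2. \<Psi> n a1 a2 b1 b2))"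
 proof (rule A.csum_cong[OF a])
  fix a1 a2 assume h: "a1 : homs M" "a2 : homs M" "fst a1 + fst a2 = fst a"
  show "lift R (TT n) (%(y, y'). \<Psi> n a1 a2 y y') (cm B b) = csB (TT n) b (%b1 b2. \<Psi> n a1 a2 b1 b2)"
  proof -
   have "biln R N N (TT n) (fst b) (%(y, y'). \<Psi> n a1 a2 y y')" using h n by (intro swap_inner) auto
   from B.csum_liftn[OF TT this b] show ?thesis by simp
  qed
 qed
 finally show ?thesis .
qed

sublocale AB: comultiplicative R "tensor_coalg R A B"
proof unfold_locales
 show "chain_complex R AB" by (rule AB_cx)
 show "comult AB n : Hom R (obj AB n) (tensor_module R (obj AB) (obj AB) n)" for n using comult_AB_hom by (simp add: TT_def)
qed

text \<open>
  Through this formula every sum over the coproduct of \<open>A \<otimes> B\<close> becomes an iterated sum over the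
  coproducts of \<open>A\<close> and \<open>B\<close>; the sign comes from \<open>a''\<close> passing \<open>b'\<close>.
\<close>

lemma csum_AB:
 fixes P :: "('r, 'c, 'n) module_scheme"
 assumes P: "module R P" and F: "bil R T T P F" and a: "a : homs M" and b: "b : homs N"
 shows "csAB P (t2 a b) F =
  csA P a (%a1 a2. csB P b (%b1 b2. ksign P (fst a2 * fst b1) (F (t2 a1 b1) (t2 a2 b2))))"
proof -
 let ?n = "fst a + fst b"
 let ?L = "lift R P (%(x, y). F x y)"
 have L: "?L : Hom R (TT ?n) P" unfolding TT_def by (rule lift_bil_hom[OF R gT gT P F])
 have "csAB P (t2 a b) F = ?L (comult AB ?n (tens R M N a b))"
  using AB.csum_lift[OF P, of F "t2 a b"] F a b t2_homs[OF a b] by (simp add: cm_def, simp add: tn_def)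
 also have "... = csA P a (%a1 a2. ?L (csB (TT ?n) b (%b1 b2. \<Psi> ?n a1 a2 b1 b2)))" unfolding comult_AB_tens[OF a b refl]
  by (intro A.csum_hom[OF TT L P a] B.csum_closed[OF TT b] \<Psi>_closed) auto
 also have "... = csA P a (%a1 a2. csB P b (%b1 b2. ?L (\<Psi> ?n a1 a2 b1 b2)))"
  by (intro A.csum_cong[OF a] B.csum_hom[OF TT L P b] \<Psi>_closed) auto
 also have "... = csA P a (%a1 a2. csB P b (%b1 b2. ksign P (fst a2 * fst b1) (F (t2 a1 b1) (t2 a2 b2))))"
 proof (intro A.csum_cong[OF a] B.csum_cong[OF b])
  fix a1 a2 b1 b2
  assume h: "a1 : homs M" "a2 : homs M" "fst a1 + fst a2 = fst a" "b1 : homs N" "b2 : homs N" "fst b1 + fst b2 = fst b"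
  then have c: "tens R T T (t2 a1 b1) (t2 a2 b2) : car (TT ?n)" unfolding TT_def by (intro tens_closed[OF R gT gT]) auto
  show "?L (\<Psi> ?n a1 a2 b1 b2) = ksign P (fst a2 * fst b1) (F (t2 a1 b1) (t2 a2 b2))"
   unfolding \<Psi>_def mh_ksign[OF L TT P c] using h by (simp add: lift_bil_tens[OF R gT gT P F])
 qed
 finally show ?thesis .
qed

end

context coaugmented_pair
begin

lemma counit_AB: "counit AB n = lift R (ground_module R n) (%((i, x), (j, y)). counit A i x \<otimes> counit B j y)"
 by (simp add: tensor_coalg_def Let_def)

lemma counit_biln: "biln R M N (ground_module R n) n (%((i, x), (j, y)). counit A i x \<otimes> counit B j y)"
proof -
 have e: "eps A a \<otimes> eps B b : car (ground_module R n)"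
  if "a : homs M" "b : homs N" "fst a + fst b = n" for a b
  using that A.eps_closed[OF that(1)] B.eps_closed[OF that(2)] A.eps_deg[OF that(1)] B.eps_deg[OF that(2)]
  by (cases "fst a = 0") (auto simp: ground_simps)
 have "(%x. counit A i x \<otimes> counit B j y) : Hom R (M i) (ground_module R n)" if "i + j = n" "y : car (N j)" for i j y
  using e[of "(i, _)" "(j, y)"] that A.eps_closed[of "(i, _)"] B.eps_closed[of "(j, y)"]
  by (intro mhI) (simp_all add: eps_def ground_simps A.l_distr A.m_assoc A.eps_add[unfolded eps_def, simplified] A.eps_smult[unfolded eps_def, simplified])
 moreover have "(%y. counit A i x \<otimes> counit B j y) : Hom R (N j) (ground_module R n)" if "i + j = n" "x : car (M i)" for i j x
  using e[of "(i, x)" "(j, _)"] that A.eps_closed[of "(i, x)"] B.eps_closed[of "(j, _)"]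
  by (intro mhI) (simp_all add: eps_def ground_simps A.r_distr A.m_lcomm B.eps_add[unfolded eps_def, simplified] B.eps_smult[unfolded eps_def, simplified])
 ultimately show ?thesis by (simp add: biln_def)
qed

lemma gr: "module R (ground_module R n)" by (rule ground_module_module[OF R])

lemma counit_AB_hom: "counit AB n : Hom R (T n) (ground_module R n)" unfolding counit_AB by (rule liftn_hom[OF R A.gm B.gm gr counit_biln])

lemma counit_AB_tens:
 "a : homs M ==> b : homs N ==> fst a + fst b = n ==> counit AB n (tens R M N a b) = eps A a \<otimes> eps B b"
 unfolding counit_AB by (subst liftn_tens[OF R A.gm B.gm gr counit_biln]) (simp_all add: eps_def case_prod_beta)

lemma eps_AB: "a : homs M ==> b : homs N ==> eps AB (t2 a b) = eps A a \<otimes> eps B b" by (simp add: eps_def[of AB] tn_def counit_AB_tens)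

lemma coaug_AB: "coaug AB n r = (if n = 0 then r \<odot>[T 0] tens R M N (uh R A) (uh R B) else \<zero>[T n])"
 by (simp add: tensor_coalg_def Let_def uh_def)

lemma coaug_one_AB: "coaug_one R AB = tens R M N (uh R A) (uh R B)"
proof -
 have "tens R M N (uh R A) (uh R B) : car (T 0)" by (rule tens_closed[OF R A.gm B.gm A.uh_homs B.uh_homs]) simp
 then show ?thesis using module.smult_one[OF tensor_module_module[OF R A.gm B.gm]] by (simp add: coaug_one_def[of R AB] coaug_AB)
qed

lemma uh_AB: "uh R AB = t2 (uh R A) (uh R B)" by (simp add: uh_def[of R AB] coaug_one_AB tn_def)

sublocale AB: coaugmented R "tensor_coalg R A B"
proof unfold_locales
 show "counit AB n : Hom R (obj AB n) (ground_module R n)" for n using counit_AB_hom by simp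
 show "counit AB (n - 1) (bd AB n x) = \<zero>" if "x : car (obj AB n)" for n x
 proof -
  have "counit AB (n - 1) (tensor_bd R A B n x) = \<zero>[ground_module R (n - 1)]"
  proof (rule tensor_ext[OF R A.gm B.gm mh_comp[OF tensor_bd_hom[OF R A.cx B.cx refl] counit_AB_hom] mh_const_zero[OF gr] gr])
   show "x : car (T n)" using that by simp
   fix a b assume a: "a : homs M" and b: "b : homs N" and n: "fst a + fst b = n"
   note da = dh_homs[OF A.cx a] and db = dh_homs[OF B.cx b]
   have c1: "tens R M N (dh A a) b : car (T (n - 1))" and c2: "tens R M N a (dh B b) : car (T (n - 1))"
    using a b n da db by (auto intro!: tens_closed[OF R A.gm B.gm])
   show "counit AB (n - 1) (tensor_bd R A B n (tens R M N a b)) = \<zero>[ground_module R (n - 1)]" unfolding tensor_bd_tens[OF R A.cx B.cx a b n]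
     mh_add[OF counit_AB_hom c1 ksign_closed[OF gmod_ag[OF gT] c2]]
     mh_ksign[OF counit_AB_hom tensor_module_module[OF R A.gm B.gm] gr c2] using a b n da db A.eps_closed[OF a] B.eps_closed[OF b] gr[of "n - 1"]
    by (simp add: counit_AB_tens A.eps_dh B.eps_dh ground_simps module_def ksign_zero[of "ground_module R (n-1)", simplified ground_simps])
  qed
  then show ?thesis by (simp add: ground_simps)
 qed
 show "coaug_one R AB : car (obj AB 0)" unfolding coaug_one_AB AB_simps by (rule tens_closed[OF R A.gm B.gm A.uh_homs B.uh_homs]) simp
 show "counit AB 0 (coaug_one R AB) = \<one>" unfolding coaug_one_AB by (simp add: counit_AB_tens A.uh_homs B.uh_homs A.eps_uh B.eps_uh)
 show "bd AB 0 (coaug_one R AB) = \<zero>[obj AB (- 1)]"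
 proof -
  have l: "(%x. tens R M N x (uh R B)) (dh A (uh R A)) = \<zero>[T (- 1)]"
   using mh_zero[OF tens_left[OF R A.gm B.gm homs_snd[OF B.uh_homs], of "-1" "-1"] gmodD[OF A.gm] gmodD[OF gT]]
   by (simp add: dh_def A.bd_one) (simp add: uh_def A.bd_one)
  have r: "(%y. tens R M N (uh R A) y) (dh B (uh R B)) = \<zero>[T (- 1)]"
   using mh_zero[OF tens_right[OF R A.gm B.gm homs_snd[OF A.uh_homs], of "-1" "-1"] gmodD[OF B.gm] gmodD[OF gT]]
   by (simp add: dh_def B.bd_one) (simp add: uh_def B.bd_one)
  interpret Tm: module R "T (- 1)" by (rule gmodD[OF gT])
  show ?thesis unfolding coaug_one_AB AB_simps using tensor_bd_tens[OF R A.cx B.cx A.uh_homs B.uh_homs, of 0] l r by simp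
 qed
 show "coaug AB n r = (if n = 0 then r \<odot>[obj AB 0] coaug_one R AB else \<zero>[obj AB n])"
  if "r : car (ground_module R n)" for r n by (simp add: coaug_one_AB coaug_AB)
qed

end

locale coalgebra_pair = coaugmented_pair R A B + A: coalgebra_into R A P + B: coalgebra_into R B P
 for R :: "('r, 'm) ring_scheme" (structure) and A :: "('r, 'a, 'z) coaug_chain_coalg_scheme"
  and B :: "('r, 'b, 'w) coaug_chain_coalg_scheme" and P :: "('r, 'p) module"
begin

lemma Pm: "module R P" by (rule A.P.module_axioms)

lemma Pag: "abelian_group P" by (rule A.P.abelian_group_axioms)

lemma bil_t2:
 assumes F: "bil R T T P F"
 shows "a1 : homs M ==> a2 : homs M ==>
   bil R N N P (%b1 b2. ksign P (k (fst b1) (fst b2)) (F (t2 a1 b1) (t2 a2 b2)))" (is "_ ==> _ ==> ?B")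
  and "b1 : homs N ==> b2 : homs N ==>
   bil R M M P (%a1 a2. ksign P (l (fst a1) (fst a2)) (F (t2 a1 b1) (t2 a2 b2)))" (is "_ ==> _ ==> ?A")
proof -
 { assume a: "a1 : homs M" "a2 : homs M"
  show ?B
  proof (rule bilI)
   fix b assume b: "b : homs N"
   show "lin R N P (%b2. ksign P (k (fst b) (fst b2)) (F (t2 a1 b) (t2 a2 b2)))"
    by (rule lin_ksignI[OF t2_lin_right[OF bil_right[OF F t2_homs[OF a(1) b]] a(2)] Pm])
   show "lin R N P (%b1. ksign P (k (fst b1) (fst b)) (F (t2 a1 b1) (t2 a2 b)))"
    by (rule lin_ksignI[OF t2_lin_right[OF bil_left[OF F t2_homs[OF a(2) b]] a(1)] Pm, of "%n. k n (fst b)"])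
  qed }
 { assume b: "b1 : homs N" "b2 : homs N"
  show ?A
  proof (rule bilI)
   fix a assume a: "a : homs M"
   show "lin R M P (%a2. ksign P (l (fst a) (fst a2)) (F (t2 a b1) (t2 a2 b2)))"
    by (rule lin_ksignI[OF t2_lin_left[OF bil_right[OF F t2_homs[OF a b(1)]] b(2)] Pm])
   show "lin R M P (%a1. ksign P (l (fst a1) (fst a)) (F (t2 a1 b1) (t2 a b2)))"
    by (rule lin_ksignI[OF t2_lin_left[OF bil_left[OF F t2_homs[OF a b(2)]] b(1)] Pm, of "%n. l n (fst a)"])
  qed }
qed

lemma bil_csum:
 assumes b: "b : homs N"
  and F: "!!b1 b2. b1 : homs N ==> b2 : homs N ==> bil R M M P (%a1 a2. F a1 a2 b1 b2)"
 shows "bil R M M P (%a1 a2. csB P b (F a1 a2))"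
proof (rule bilI)
 fix a assume a: "a : homs M"
 show "lin R M P (%a2. csB P b (F a a2))" by (rule B.csum_param_lin[OF Pm _ b]) (rule bil_right[OF F a])
 show "lin R M P (%a1. csB P b (F a1 a))" by (rule B.csum_param_lin[OF Pm _ b]) (rule bil_left[OF F a])
qed

lemma AB_csum_one:
 assumes F: "bil R T T P F"
 shows "csAB P (uh R AB) F = F (uh R AB) (uh R AB)"
proof -
 let ?u = "uh R A" and ?v = "uh R B"
 have "csAB P (t2 ?u ?v) F = csA P ?u (%a1 a2. csB P ?v (%b1 b2. ksign P (fst a2 * fst b1) (F (t2 a1 b1) (t2 a2 b2))))"
  by (rule csum_AB[OF Pm F A.uh_homs B.uh_homs])
 also have "... = csB P ?v (%b1 b2. ksign P (fst ?u * fst b1) (F (t2 ?u b1) (t2 ?u b2)))"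
  by (rule A.csum_one[OF bil_csum[OF B.uh_homs bil_t2(2)[OF F]]])
 also have "... = F (t2 ?u ?v) (t2 ?u ?v)" using B.csum_one[OF bil_t2(1)[OF F A.uh_homs A.uh_homs, of "%i j. 0"]] by simp
 finally show ?thesis by (simp add: uh_AB)
qed

lemma AB_counit_left:
 assumes H: "lin R T P H" and t: "t : homs T"
 shows "csAB P t (%x y. eps AB x \<odot>[P] H y) = H t"
proof -
 have bil: "bil R T T P (%x y. eps AB x \<odot>[P] H y)" using AB.eps_closed AB.eps_scale_lin[OF Pm lin_closed[OF H]]
  by (intro bilI lin_scale[OF H Pm]) auto
 show ?thesis
 proof (rule tn_ext[OF R A.gm B.gm Pm AB.csum_lin[OF Pm bil[folded AB_simps], unfolded AB_simps] H _ t])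
  fix a b assume a: "a : homs M" and b: "b : homs N"
  have "csAB P (t2 a b) (%x y. eps AB x \<odot>[P] H y) =
   csA P a (%a1 a2. csB P b (%b1 b2. eps B b1 \<odot>[P] (eps A a1 \<odot>[P] H (t2 a2 b2))))" unfolding csum_AB[OF Pm bil a b]
  proof (intro A.csum_cong[OF a] B.csum_cong[OF b])
   fix a1 a2 b1 b2 assume h: "a1 : homs M" "a2 : homs M" "b1 : homs N" "b2 : homs N"
   have c: "H (t2 a2 b2) : car P" using lin_closed[OF H] h by simp
   show "ksign P (fst a2 * fst b1) (eps AB (t2 a1 b1) \<odot>[P] H (t2 a2 b2)) = eps B b1 \<odot>[P] (eps A a1 \<odot>[P] H (t2 a2 b2))"
    using h c A.eps_closed[OF h(1)] B.eps_closed[OF h(3)] B.eps_deg[OF h(3)] Pag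
    by (cases "fst b1 = 0") (simp_all add: eps_AB A.m_comm flip: A.P.smult_assoc1)
  qed
  also have "... = csA P a (%a1 a2. eps A a1 \<odot>[P] H (t2 a2 b))"
   by (intro A.csum_cong[OF a] B.counit_left[OF lin_scale[OF t2_lin_right[OF H] Pm A.eps_closed] b]) auto
  also have "... = H (t2 a b)" by (rule A.counit_left[OF t2_lin_left[OF H b] a])
  finally show "csAB P (t2 a b) (%x y. eps AB x \<odot>[P] H y) = H (t2 a b)" .
 qed
qed

lemma AB_counit_right:
 assumes H: "lin R T P H" and t: "t : homs T"
 shows "csAB P t (%x y. eps AB y \<odot>[P] H x) = H t"
proof -
 have bil: "bil R T T P (%x y. eps AB y \<odot>[P] H x)" using AB.eps_closed AB.eps_scale_lin[OF Pm lin_closed[OF H]]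
  by (intro bilI lin_scale[OF H Pm]) auto
 show ?thesis
 proof (rule tn_ext[OF R A.gm B.gm Pm AB.csum_lin[OF Pm bil[folded AB_simps], unfolded AB_simps] H _ t])
  fix a b assume a: "a : homs M" and b: "b : homs N"
  have "csAB P (t2 a b) (%x y. eps AB y \<odot>[P] H x) =
   csA P a (%a1 a2. csB P b (%b1 b2. eps B b2 \<odot>[P] (eps A a2 \<odot>[P] H (t2 a1 b1))))" unfolding csum_AB[OF Pm bil a b]
  proof (intro A.csum_cong[OF a] B.csum_cong[OF b])
   fix a1 a2 b1 b2 assume h: "a1 : homs M" "a2 : homs M" "b1 : homs N" "b2 : homs N"
   have c: "H (t2 a1 b1) : car P" using lin_closed[OF H] h by simp
   show "ksign P (fst a2 * fst b1) (eps AB (t2 a2 b2) \<odot>[P] H (t2 a1 b1)) = eps B b2 \<odot>[P] (eps A a2 \<odot>[P] H (t2 a1 b1))"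
    using h c A.eps_closed[OF h(2)] B.eps_closed[OF h(4)] A.eps_deg[OF h(2)] Pag
    by (cases "fst a2 = 0") (simp_all add: eps_AB A.m_comm flip: A.P.smult_assoc1)
  qed
  also have "... = csA P a (%a1 a2. eps A a2 \<odot>[P] H (t2 a1 b))"
   by (intro A.csum_cong[OF a] B.counit_right[OF lin_scale[OF t2_lin_right[OF H] Pm A.eps_closed] b]) auto
  also have "... = H (t2 a b)" by (rule A.counit_right[OF t2_lin_left[OF H b] a])
  finally show "csAB P (t2 a b) (%x y. eps AB y \<odot>[P] H x) = H (t2 a b)" .
 qed
qed

lemma AB_coassoc:
 assumes G: "tri R T P G" and t: "t : homs T"
 shows "csAB P t (%x z. csAB P x (%x y. G x y z)) = csAB P t (%x w. csAB P w (G x))"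
proof -
 let ?g = "%a1 a2 a3 b1 b2 b3. G (t2 a1 b1) (t2 a2 b2) (t2 a3 b3)"
 have G': "tri R (obj AB) P G" using G by simp
 note bl = AB.tri_bil_left[OF Pm G', unfolded AB_simps] and br = AB.tri_bil_right[OF Pm G', unfolded AB_simps]
 note ll = AB.csum_lin[OF Pm bl[folded AB_simps], unfolded AB_simps]
  and lr = AB.csum_lin[OF Pm br[folded AB_simps], unfolded AB_simps]
 show ?thesis
 proof (rule tn_ext[OF R A.gm B.gm Pm ll lr _ t])
  fix a b assume a: "a : homs M" and b: "b : homs N"
  define H where "H = (%a1 a2 a3 b1 b2 b3. ksign P (fst a3 * (fst b1 + fst b2) + fst a2 * fst b1) (?g a1 a2 a3 b1 b2 b3))"
  have Gc: "?g a1 a2 a3 b1 b2 b3 : car P"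
   if "a1 : homs M" "a2 : homs M" "a3 : homs M" "b1 : homs N" "b2 : homs N" "b3 : homs N" for a1 a2 a3 b1 b2 b3
   by (rule tri_closed[OF G]) (use that in auto)
  have Hc: "H a1 a2 a3 b1 b2 b3 : car P"
   if "a1 : homs M" "a2 : homs M" "a3 : homs M" "b1 : homs N" "b2 : homs N" "b3 : homs N" for a1 a2 a3 b1 b2 b3
   unfolding H_def by (rule ksign_closed[OF Pag Gc[OF that]])
  have HB: "tri R N P (H a1 a2 a3)" if h: "a1 : homs M" "a2 : homs M" "a3 : homs M" for a1 a2 a3 unfolding tri_def H_def
  proof (intro conjI ballI)
   fix b assume b: "b : homs N"
   show "bil R N N P (%b2 b3. ksign P (fst a3 * (fst b + fst b2) + fst a2 * fst b) (G (t2 a1 b) (t2 a2 b2) (t2 a3 b3)))"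
    by (rule bil_t2(1)[OF tri_right[OF G t2_homs[OF h(1) b]] h(2,3), of "%i j. fst a3 * (fst b + i) + fst a2 * fst b"])
   show "bil R N N P (%b1 b2. ksign P (fst a3 * (fst b1 + fst b2) + fst a2 * fst b1) (G (t2 a1 b1) (t2 a2 b2) (t2 a3 b)))"
    by (rule bil_t2(1)[OF tri_left[OF G t2_homs[OF h(3) b]] h(1,2), of "%i j. fst a3 * (i + j) + fst a2 * i"])
  qed
  have HA: "tri R M P (%a1 a2 a3. H a1 a2 a3 b1 b2 b3)" if h: "b1 : homs N" "b2 : homs N" "b3 : homs N" for b1 b2 b3 unfolding tri_def H_def
  proof (intro conjI ballI)
   fix a assume a: "a : homs M"
   show "bil R M M P (%a2 a3. ksign P (fst a3 * (fst b1 + fst b2) + fst a2 * fst b1) (G (t2 a b1) (t2 a2 b2) (t2 a3 b3)))"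
    by (rule bil_t2(2)[OF tri_right[OF G t2_homs[OF a h(1)]] h(2,3), of "%i j. j * (fst b1 + fst b2) + i * fst b1"])
   show "bil R M M P (%a1 a2. ksign P (fst a * (fst b1 + fst b2) + fst a2 * fst b1) (G (t2 a1 b1) (t2 a2 b2) (t2 a b3)))"
    by (rule bil_t2(2)[OF tri_left[OF G t2_homs[OF a h(3)]] h(1,2), of "%i j. fst a * (fst b1 + fst b2) + j * fst b1"])
  qed
  have HBs: "tri R M P (%a1 a2 a3. csB P b (%b1 w. csB P w (H a1 a2 a3 b1)))" unfolding tri_def
  proof (intro conjI ballI)
   fix a assume a: "a : homs M"
   show "bil R M M P (%a2 a3. csB P b (%b1 w. csB P w (%b2 b3. H a a2 a3 b1 b2 b3)))" by (intro bil_csum b tri_right[OF HA a])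
   show "bil R M M P (%a1 a2. csB P b (%b1 w. csB P w (%b2 b3. H a1 a2 a b1 b2 b3)))" by (intro bil_csum b tri_left[OF HA a])
  qed
  have "csAB P (t2 a b) (%x z. csAB P x (%x y. G x y z)) =
   csA P a (%a' a3. csB P b (%b' b3. csA P a' (%a1 a2. csB P b' (%b1 b2. H a1 a2 a3 b1 b2 b3))))" unfolding csum_AB[OF Pm bl a b]
  proof (intro A.csum_cong[OF a] B.csum_cong[OF b])
   fix a' a3 b' b3 assume h: "a' : homs M" "a3 : homs M" "b' : homs N" "b3 : homs N"
   have s: "ksign P (fst a3 * fst b') (csAB P (t2 a' b') (%x y. G x y (t2 a3 b3))) =
     csA P a' (%a1 a2. ksign P (fst a3 * fst b') (csB P b' (%b1 b2. ksign P (fst a2 * fst b1) (?g a1 a2 a3 b1 b2 b3))))"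
    unfolding csum_AB[OF Pm tri_left[OF G t2_homs[OF h(2,4)]] h(1,3)]
    using h by (intro A.csum_ksign[OF Pm] B.csum_closed[OF Pm] ksign_closed[OF Pag] Gc) auto
   also have "... = csA P a' (%a1 a2. csB P b' (%b1 b2. H a1 a2 a3 b1 b2 b3))"
   proof (rule A.csum_cong[OF h(1)])
    fix a1 a2 assume h': "a1 : homs M" "a2 : homs M"
    have "ksign P (fst a3 * fst b') (csB P b' (%b1 b2. ksign P (fst a2 * fst b1) (?g a1 a2 a3 b1 b2 b3))) =
     csB P b' (%b1 b2. ksign P (fst a3 * fst b') (ksign P (fst a2 * fst b1) (?g a1 a2 a3 b1 b2 b3)))"
     using h h' by (intro B.csum_ksign[OF Pm] ksign_closed[OF Pag] Gc) auto
    also have "... = csB P b' (%b1 b2. H a1 a2 a3 b1 b2 b3)" using h h' by (intro B.csum_cong) (auto simp: H_def ksign_ksign[OF Pag] Gc)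
    finally show "ksign P (fst a3 * fst b') (csB P b' (%b1 b2. ksign P (fst a2 * fst b1) (?g a1 a2 a3 b1 b2 b3))) = csB P b' (%b1 b2. H a1 a2 a3 b1 b2 b3)" .
   qed
   finally show "ksign P (fst a3 * fst b') (csAB P (t2 a' b') (%x y. G x y (t2 a3 b3))) =
     csA P a' (%a1 a2. csB P b' (%b1 b2. H a1 a2 a3 b1 b2 b3))" .
  qed
  also have "... = csA P a (%a' a3. csA P a' (%a1 a2. csB P b (%b' b3. csB P b' (%b1 b2. H a1 a2 a3 b1 b2 b3))))"
   by (intro A.csum_cong[OF a] csum_swap[OF B.comultiplicative_axioms A.comultiplicative_axioms Pm b] B.csum_closed[OF Pm] Hc)
  also have "... = csA P a (%a' a3. csA P a' (%a1 a2. csB P b (%b1 w. csB P w (H a1 a2 a3 b1))))"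
   by (intro A.csum_cong[OF a] A.csum_cong B.coassoc[OF HB b])
  also have "... = csA P a (%a1 v. csA P v (%a2 a3. csB P b (%b1 w. csB P w (H a1 a2 a3 b1))))"
   by (rule A.coassoc[OF HBs a])
  also have "... = csA P a (%a1 v. csB P b (%b1 w. csA P v (%a2 a3. csB P w (H a1 a2 a3 b1))))"
   by (intro A.csum_cong[OF a] csum_swap[OF A.comultiplicative_axioms B.comultiplicative_axioms Pm _ b] B.csum_closed[OF Pm] Hc)
  also have "... = csAB P (t2 a b) (%x w. csAB P w (G x))" unfolding csum_AB[OF Pm br a b]
  proof (intro A.csum_cong[OF a] B.csum_cong[OF b])
   fix a1 v b1 w assume h: "a1 : homs M" "v : homs M" "b1 : homs N" "w : homs N"
   have s: "ksign P (fst v * fst b1) (csAB P (t2 v w) (G (t2 a1 b1))) =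
     csA P v (%a2 a3. ksign P (fst v * fst b1) (csB P w (%b2 b3. ksign P (fst a3 * fst b2) (?g a1 a2 a3 b1 b2 b3))))"
    unfolding csum_AB[OF Pm tri_right[OF G t2_homs[OF h(1,3)]] h(2,4)]
    using h by (intro A.csum_ksign[OF Pm] B.csum_closed[OF Pm] ksign_closed[OF Pag] Gc) auto
   also have "... = csA P v (%a2 a3. csB P w (H a1 a2 a3 b1))"
   proof (rule A.csum_cong[OF h(2)])
    fix a2 a3 assume h': "a2 : homs M" "a3 : homs M" "fst a2 + fst a3 = fst v"
    have "ksign P (fst v * fst b1) (csB P w (%b2 b3. ksign P (fst a3 * fst b2) (?g a1 a2 a3 b1 b2 b3))) =
     csB P w (%b2 b3. ksign P (fst v * fst b1) (ksign P (fst a3 * fst b2) (?g a1 a2 a3 b1 b2 b3)))"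
     using h h' by (intro B.csum_ksign[OF Pm] ksign_closed[OF Pag] Gc) auto
    also have "... = csB P w (H a1 a2 a3 b1)"
     using h h' by (intro B.csum_cong) (auto simp: H_def ksign_ksign[OF Pag] Gc algebra_simps simp flip: h'(3))
    finally show "ksign P (fst v * fst b1) (csB P w (%b2 b3. ksign P (fst a3 * fst b2) (?g a1 a2 a3 b1 b2 b3))) = csB P w (H a1 a2 a3 b1)" .
   qed
   finally show "csA P v (%a2 a3. csB P w (H a1 a2 a3 b1)) =
    ksign P (fst v * fst b1) (csAB P (t2 v w) (G (t2 a1 b1)))" by simp
  qed
  finally show "csAB P (t2 a b) (%x z. csAB P x (%x y. G x y z)) = csAB P (t2 a b) (%x w. csAB P w (G x))" .
 qed
qed

lemma AB_csum_bd:
 assumes F: "bil R T T P F" and t: "t : homs T"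
 shows "csAB P (dh AB t) F = csAB P t (%x y. F (dh AB x) y \<oplus>[P] ksign P (fst x) (F x (dh AB y)))"
proof -
 have F': "bil R (obj AB) (obj AB) P F" using F by simp
 note lF = AB.csum_lin[OF Pm F', unfolded AB_simps]
 note ll = lin_dh[OF AB.cx AB.csum_lin[OF Pm F'], unfolded AB_simps]
 note bd = AB.bil_bd[OF Pm F', unfolded AB_simps]
 note lr = AB.csum_lin[OF Pm bd[folded AB_simps], unfolded AB_simps]
 show ?thesis
 proof (rule tn_ext[OF R A.gm B.gm Pm ll lr _ t])
  fix a b assume a: "a : homs M" and b: "b : homs N"
  note da = dh_homs[OF A.cx a] and db = dh_homs[OF B.cx b]
  have Fc: "F (t2 a1 b1) (t2 a2 b2) : car P" if "a1 : homs M" "a2 : homs M" "b1 : homs N" "b2 : homs N" for a1 a2 b1 b2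
   by (rule bil_closed[OF F]) (use that in auto)
  note dA = dh_homs[OF A.cx] and dB = dh_homs[OF B.cx]
  define s where "s = (%a1 a2 b1 b2. ksign P (fst a2 * fst b1) (F (t2 a1 b1) (t2 a2 b2)))"
  have sc: "s a1 a2 b1 b2 : car P" if "a1 : homs M" "a2 : homs M" "b1 : homs N" "b2 : homs N" for a1 a2 b1 b2
   unfolding s_def by (rule ksign_closed[OF Pag Fc[OF that]])
  have sB: "bil R N N P (s a1 a2)" if "a1 : homs M" "a2 : homs M" for a1 a2 unfolding s_def by (rule bil_t2(1)[OF F that])
  have sA: "bil R M M P (%a1 a2. csB P b (s a1 a2))" if "b : homs N" for b unfolding s_def by (rule bil_csum[OF that bil_t2(2)[OF F]])
  have sAB: "csAB P (t2 a b) F = csA P a (%a1 a2. csB P b (s a1 a2))" if "a : homs M" "b : homs N" for a b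
   unfolding s_def by (rule csum_AB[OF Pm F that])
  have 1: "csAB P (t2 (dh A a) b) F = csA P a (%a1 a2. csB P b (%b1 b2. s (dh A a1) a2 b1 b2 \<oplus>[P] ksign P (fst a1) (s a1 (dh A a2) b1 b2)))"
   unfolding sAB[OF da b] A.csum_bd[OF sA[OF b] a] using dA by (intro A.csum_cong[OF a]) (simp add: B.csum_add[OF Pm b] sc B.csum_ksign[OF Pm b] Pag)
  have 2: "ksign P (fst a) (csAB P (t2 a (dh B b)) F) =
   csA P a (%a1 a2. csB P b (%b1 b2. ksign P (fst a) (s a1 a2 (dh B b1) b2 \<oplus>[P] ksign P (fst b1) (s a1 a2 b1 (dh B b2)))))"
  proof -
   have "csAB P (t2 a (dh B b)) F = csA P a (%a1 a2. csB P b (%b1 b2. s a1 a2 (dh B b1) b2 \<oplus>[P] ksign P (fst b1) (s a1 a2 b1 (dh B b2))))"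
    unfolding sAB[OF a db] by (rule A.csum_cong[OF a]) (simp add: B.csum_bd[OF sB b])
   then show ?thesis using dB by (simp add: A.csum_ksign[OF Pm a] B.csum_closed[OF Pm b] sc Pag A.P.a_closed)
     (intro A.csum_cong[OF a], simp add: B.csum_ksign[OF Pm b] sc Pag A.P.a_closed)
  qed
  have "csAB P (dh AB (t2 a b)) F = csA P a (%a1 a2. csB P b (%b1 b2.
    (s (dh A a1) a2 b1 b2 \<oplus>[P] ksign P (fst a1) (s a1 (dh A a2) b1 b2)) \<oplus>[P]
    ksign P (fst a) (s a1 a2 (dh B b1) b2 \<oplus>[P] ksign P (fst b1) (s a1 a2 b1 (dh B b2)))))" unfolding dh_t2[OF lF Pm a b] 1 2
   using dA dB by (subst A.csum_add[OF Pm a, symmetric]; (intro B.csum_closed[OF Pm b] A.P.a_closed ksign_closed[OF Pag] sc)?;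
    (simp; fail)?) (intro A.csum_cong[OF a], subst B.csum_add[OF Pm b]; simp add: sc Pag)
  also have "... = csAB P (t2 a b) (%x y. F (dh AB x) y \<oplus>[P] ksign P (fst x) (F x (dh AB y)))" unfolding csum_AB[OF Pm bd a b]
  proof (intro A.csum_cong[OF a] B.csum_cong[OF b])
   fix a1 a2 b1 b2
   assume h: "a1 : homs M" "a2 : homs M" "fst a1 + fst a2 = fst a" "b1 : homs N" "b2 : homs N" "fst b1 + fst b2 = fst b"
   have e1: "F (dh AB (t2 a1 b1)) (t2 a2 b2) = F (t2 (dh A a1) b1) (t2 a2 b2) \<oplus>[P] ksign P (fst a1) (F (t2 a1 (dh B b1)) (t2 a2 b2))"
    by (rule dh_t2[OF bil_left[OF F] Pm]) (use h in auto)
   have e2: "F (t2 a1 b1) (dh AB (t2 a2 b2)) = F (t2 a1 b1) (t2 (dh A a2) b2) \<oplus>[P] ksign P (fst a2) (F (t2 a1 b1) (t2 a2 (dh B b2)))"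
    by (rule dh_t2[OF bil_right[OF F] Pm]) (use h in auto)
   have c: "F (t2 (dh A a1) b1) (t2 a2 b2) : car P" "F (t2 a1 (dh B b1)) (t2 a2 b2) : car P"
    "F (t2 a1 b1) (t2 (dh A a2) b2) : car P" "F (t2 a1 b1) (t2 a2 (dh B b2)) : car P" by (intro Fc dA dB h)+
   have k: "ksign P (fst a1 + (fst a2 - 1) * fst b1) x = ksign P (fst a2 * fst b1 + (fst a1 + fst b1)) x"
    "ksign P (fst a + fst a2 * (fst b1 - 1)) x = ksign P (fst a2 * fst b1 + fst a1) x"
    "ksign P (fst a + (fst b1 + fst a2 * fst b1)) x = ksign P (fst a2 * fst b1 + (fst a1 + fst b1 + fst a2)) x" for x
    using h(3) by (auto intro!: ksign_cong simp: algebra_simps simp flip: h(3))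
   show "(s (dh A a1) a2 b1 b2 \<oplus>[P] ksign P (fst a1) (s a1 (dh A a2) b1 b2)) \<oplus>[P]
     ksign P (fst a) (s a1 a2 (dh B b1) b2 \<oplus>[P] ksign P (fst b1) (s a1 a2 b1 (dh B b2))) =
    ksign P (fst a2 * fst b1) (F (dh AB (t2 a1 b1)) (t2 a2 b2) \<oplus>[P] ksign P (fst (t2 a1 b1)) (F (t2 a1 b1) (dh AB (t2 a2 b2))))"
    unfolding e1 e2 s_def using c by (simp add: ksign_add[OF Pag] ksign_ksign[OF Pag] Pag k A.P.a_ac del: k) (simp add: k A.P.a_ac Pag add.assoc)
  qed
  finally show "csAB P (dh AB (t2 a b)) F = csAB P (t2 a b) (%x y. F (dh AB x) y \<oplus>[P] ksign P (fst x) (F x (dh AB y)))" .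
 qed
qed

lemma AB_coalgebra: "coalgebra_into R AB P" by unfold_locales
  (simp_all add: AB_csum_one AB_coassoc AB_counit_left AB_counit_right AB_csum_bd)

end

section \<open>The ring of words\<close>

lemma EL_reflect:
 assumes X: "galg R X" and f: "!!z. z : car Z ==> f z : car (obj X m)"
  and h: "(%z. EL X (m, f z)) : Hom R Z (Tot X)" and Z: "module R Z"
 shows "f : Hom R Z (obj X m)"
proof (rule mhI)
 interpret Z: module R Z by (rule Z)
 have M: "gmod R (obj X)" using X by (simp add: galg_def)
 interpret Xm: module R "obj X m" by (rule gmodD[OF M])
 note e = EL_lin[OF X]
 show "f z : car (obj X m)" if "z : car Z" for z using f[OF that] .
 show "f (x \<oplus>[Z] y) = f x \<oplus>[obj X m] f y" if "x : car Z" "y : car Z" for x y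
  using that by (intro el_inj[of "obj X" m]) (simp add: mh_add[OF h] lin_add[OF e] f)
 show "f (r \<odot>[Z] x) = r \<odot>[obj X m] f x" if "r : car R" "x : car Z" for r x
  using that by (intro el_inj[of "obj X" m]) (simp add: mh_smult[OF h] lin_smult[OF e] f)
qed

lemma lift_paramw:
 assumes R: "cring R" "gmod R V" and P: "module R P"
  and b: "!!z. z : car Z ==> muln R V P n (\<phi> z)"
  and h: "!!w. [|set w <= homs V; word_deg w = n|] ==> (%z. \<phi> z w) : Hom R Z P"
  and Z: "module R Z" and t: "t : car (tensor_alg R V n)"
 shows "(%z. lift R P (\<phi> z) t) : Hom R Z P" using t
proof (induction rule: word_induct[OF R, consumes 1, case_names zero add])
 case zero
 show ?case by (rule mh_cong[OF Z _ mh_const_zero[OF P]])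
   (simp add: mh_zero[OF liftw_hom[OF R P b] tensor_alg_module[OF R] P])
next
 case (add t r w)
 have wc: "word R V w : car (tensor_alg R V n)" by (rule word_closed[OF R add(3,4)])
 show ?case
 proof (rule mh_cong[OF Z _ mh_plus[OF add(5) mh_scale[OF h[OF add(3,4)] P add(2)] P]])
  fix z assume z: "z : car Z"
  show "lift R P (\<phi> z) (t \<oplus>[tensor_alg R V n] r \<odot>[tensor_alg R V n] word R V w) = lift R P (\<phi> z) t \<oplus>[P] r \<odot>[P] \<phi> z w"
   using mh_add[OF liftw_hom[OF R P b[OF z]] add(1) module.smult_closed[OF tensor_alg_module[OF R] add(2) wc]]
    mh_smult[OF liftw_hom[OF R P b[OF z]] add(2) wc] liftw_word[OF R P b[OF z] add(3,4)] by simp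
 qed
qed

locale word_alg = cring R for R :: "('r, 'm) ring_scheme" (structure) +
 fixes V :: "('r, 'v) gmodule" and X :: "('r, ('r, 'v) tensor_word, 'z) chain_alg_scheme"
 assumes V: "gmod R V" and obj_X: "obj X = tensor_alg R V" and amult_X: "amult X = word_mult R V"
  and aunit_X: "aunit X = word R V []"
begin

lemma R: "cring R" by (rule is_cring)

abbreviation "TA == tensor_alg R V"

lemma TAm: "module R (TA n)" by (rule tensor_alg_module[OF R V])

lemma conc_muln: "set u <= homs V ==> word_deg u = m ==> m + n = k ==> muln R V (TA k) n (%v. word R V (u @ v))" unfolding muln_def
proof (intro conjI allI impI)
 assume u: "set u <= homs V" "word_deg u = m" "m + n = k"
 show "word R V (u @ []) : car (TA k)" if "n = 0" using u that by (intro word_closed[OF R V]) auto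
 fix v w i assume "set v <= homs V" "set w <= homs V" "word_deg v + i + word_deg w = n"
 then show "(%x. word R V (u @ v @ (i, x) # w)) : Hom R (V i) (TA k)" using word_letter[OF R V, of "u @ v" w i k] u by auto
qed

lemma conc_lift_muln:
 assumes t: "t : car (TA n)" and k: "m + n = k"
 shows "muln R V (TA k) m (%u. lift R (TA k) (%v. word R V (u @ v)) t)" unfolding muln_def
proof (intro conjI allI impI)
 show "lift R (TA k) (%v. word R V ([] @ v)) t : car (TA k)" if "m = 0"
  using mh_closed[OF liftw_hom[OF R V TAm conc_muln[of "[]" 0 n k]] t] that k by simp
 fix u w i assume uw: "set u <= homs V" "set w <= homs V" "word_deg u + i + word_deg w = m"
 show "(%x. lift R (TA k) (%v. word R V ((u @ (i, x) # w) @ v)) t) : Hom R (V i) (TA k)"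
 proof (rule lift_paramw[OF R V TAm _ _ gmodD[OF V] t])
  fix x assume "x : car (V i)"
  then show "muln R V (TA k) n (%v. word R V ((u @ (i, x) # w) @ v))" using uw k by (intro conc_muln) auto
 next
  fix v assume "set v <= homs V" "word_deg v = n"
  then show "(%x. word R V ((u @ (i, x) # w) @ v)) : Hom R (V i) (TA k)" using word_letter[OF R V, of u "w @ v" i k] uw k by auto
 qed
qed

lemma word_mult_left: "t : car (TA n) ==> (%s. word_mult R V m n s t) : Hom R (TA m) (TA (m + n))"
 unfolding word_mult_def Let_def by (rule liftw_hom[OF R V TAm conc_lift_muln]) auto

lemma word_mult_word_left:
 "set u <= homs V ==> word_deg u = m ==> t : car (TA n) ==>
  word_mult R V m n (word R V u) t = lift R (TA (m + n)) (%v. word R V (u @ v)) t"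
 unfolding word_mult_def Let_def by (rule liftw_word[OF R V TAm conc_lift_muln]) auto

lemma word_mult_right:
 assumes s: "s : car (TA m)"
 shows "(%t. word_mult R V m n s t) : Hom R (TA n) (TA (m + n))" unfolding word_mult_def Let_def
proof (rule lift_paramw[OF R V TAm _ _ TAm s])
 fix t assume "t : car (TA n)"
 then show "muln R V (TA (m + n)) m (%u. lift R (TA (m + n)) (%v. word R V (u @ v)) t)" by (rule conc_lift_muln) simp
next
 fix u assume "set u <= homs V" "word_deg u = m"
 then show "(%t. lift R (TA (m + n)) (%v. word R V (u @ v)) t) : Hom R (TA n) (TA (m + n))" by (intro liftw_hom[OF R V TAm conc_muln]) auto
qed

lemma word_mult_word:
 "set u <= homs V ==> word_deg u = m ==> set v <= homs V ==> word_deg v = n ==>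
  word_mult R V m n (word R V u) (word R V v) = word R V (u @ v)"
 by (simp add: word_mult_word_left word_closed[OF R V] liftw_word[OF R V TAm conc_muln])

lemma word_mult_assoc:
 assumes x: "x : car (TA l)" and y: "y : car (TA m)" and z: "z : car (TA n)"
 shows "word_mult R V (l + m) n (word_mult R V l m x y) z = word_mult R V l (m + n) x (word_mult R V m n y z)"
proof -
 note L = word_mult_left and Q = word_mult_right
 have l3: "TA (l + m + n) = TA (l + (m + n))" by (simp add: add.assoc)
 have 1: "word_mult R V (l + m) n (word_mult R V l m (word R V u) (word R V v)) z = word_mult R V l (m + n) (word R V u) (word_mult R V m n (word R V v) z)"
  if u: "set u <= homs V" "word_deg u = l" and v: "set v <= homs V" "word_deg v = m" for u v
 proof (rule word_ext[OF R V Q[of _ "l + m" n, unfolded l3] mh_comp[OF Q[of _ m n] Q] TAm _ z])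
  show "word_mult R V l m (word R V u) (word R V v) : car (TA (l + m))"
   unfolding word_mult_word[OF u v] by (rule word_closed[OF R V]) (use u v in simp_all)
  show "word R V v : car (TA m)" "word R V u : car (TA l)" using u v by (auto intro!: word_closed[OF R V])
  fix w assume "set w <= homs V" "word_deg w = n"
  then show "word_mult R V (l + m) n (word_mult R V l m (word R V u) (word R V v)) (word R V w) = word_mult R V l (m + n) (word R V u) (word_mult R V m n (word R V v) (word R V w))"
   using u v by (simp add: word_mult_word)
 qed
 have 2: "word_mult R V (l + m) n (word_mult R V l m (word R V u) y) z = word_mult R V l (m + n) (word R V u) (word_mult R V m n y z)"
  if u: "set u <= homs V" "word_deg u = l" for u
 proof (rule word_ext[OF R V mh_comp[OF Q[of _ l m] L[OF z, of "l + m", unfolded l3]] mh_comp[OF L[OF z] Q] TAm _ y])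
  show "word R V u : car (TA l)" "word R V u : car (TA l)" using u by (auto intro!: word_closed[OF R V])
 qed (rule 1[OF u])
 show ?thesis by (rule word_ext[OF R V mh_comp[OF L[OF y] L[OF z, of "l + m", unfolded l3]] L[OF mh_closed[OF L[OF z] y]] TAm _ x]) (rule 2)
qed

lemma word_unit:
 assumes x: "x : car (TA n)"
 shows "word_mult R V 0 n (word R V []) x = x" "word_mult R V n 0 x (word R V []) = x"
proof -
 have e: "word R V [] : car (TA 0)" by (rule word_closed[OF R V]) auto
 show "word_mult R V 0 n (word R V []) x = x"
  by (rule word_ext[OF R V word_mult_right[OF e, of n, unfolded add_0_left] mh_id TAm _ x]) (simp add: word_mult_word)
 show "word_mult R V n 0 x (word R V []) = x"
  by (rule word_ext[OF R V word_mult_left[OF e, of n, unfolded add_0_right] mh_id TAm _ x]) (simp add: word_mult_word)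
qed

lemma galg: "galg R X" unfolding galg_def obj_X amult_X aunit_X
 using R tensor_alg_gmod[OF R V] word_mult_left word_mult_right word_mult_assoc word_unit word_closed[OF R V, of "[]" 0] by simp

abbreviation "TX == Tot X"

lemma TXm: "module R TX" by (rule Tot_module[OF galg])

definition "W w = EL X (word_deg w, word R V w)"

lemma W_mul: "mul R V TX W"
proof (rule mulI)
 note e = EL_lin[OF galg, unfolded obj_X]
 show "W [] : car TX" unfolding W_def obj_X by (rule lin_closed[OF e]) (simp add: word_closed[OF R V])
 fix u w assume u: "set u <= homs V" and w: "set w <= homs V"
 show "lin R V TX (%l. W (u @ l # w))" unfolding lin_def W_def obj_X
 proof
  fix i
  show "(%x. el TA (word_deg (u @ (i, x) # w), word R V (u @ (i, x) # w))) : Hom R (V i) TX"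
   using mh_comp[OF word_letter[OF R V u w refl] lin_hom[OF e], of i] by (simp add: add.assoc)
 qed
qed

lemma W_closed: "set w <= homs V ==> W w : car TX" by (rule mul_closed[OF W_mul])

lemma W_append: "set u <= homs V ==> set v <= homs V ==> W u \<otimes>[TX] W v = W (u @ v)" unfolding W_def
 by (subst EL_mult[OF galg]) (auto simp: obj_X hmult_def amult_X word_mult_word word_closed[OF R V])

lemma W_Nil: "W [] = \<one>[TX]" by (simp add: W_def Tot_def Let_def tot_simps aunit_X)

lemma gam_W: "set w <= homs V ==> gam X (W w) = ksign TX (word_deg w) (W w)"
 unfolding W_def by (subst gam_EL[OF galg]) (simp_all add: obj_X word_closed[OF R V])

lemma W_ext:
 assumes f: "f : Hom R TX P" and g: "g : Hom R TX P" and P: "module R P"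
  and eq: "!!w. set w <= homs V ==> f (W w) = g (W w)" and t: "t : car TX"
 shows "f t = g t"
proof (rule Tot_ext[OF galg f g P _ t])
 fix a assume "a : els X"
 then obtain n x where a: "a = (n, x)" "x : car (TA n)" by (cases a) (auto simp: obj_X)
 note e = lin_hom[OF EL_lin[OF galg, unfolded obj_X], of n]
 show "f (EL X a) = g (EL X a)" unfolding a(1) obj_X
  by (rule word_ext[OF R V mh_comp[OF e f] mh_comp[OF e g] P _ a(2)]) (use eq in \<open>auto simp: W_def obj_X\<close>)
qed

definition "wext P \<phi> = direct TA P (%a. lift R P \<phi> (snd a))"

lemma wext_lin: "module R P ==> mul R V P \<phi> ==> lin R TA P (%a. lift R P \<phi> (snd a))"
 unfolding lin_def snd_conv by (intro allI liftw_hom[OF R V _ muln_mul])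

lemma wext_hom: "module R P ==> mul R V P \<phi> ==> wext P \<phi> : Hom R TX P"
 unfolding wext_def by (rule Direct_hom[OF galg, unfolded obj_X]) (auto intro: wext_lin)

lemma wext_W:
 assumes P: "module R P" and \<phi>: "mul R V P \<phi>" and w: "set w <= homs V"
 shows "wext P \<phi> (W w) = \<phi> w" using Direct_el[OF galg P, unfolded obj_X, OF wext_lin[OF P \<phi>], of "(word_deg w, word R V w)"]
  liftw_word[OF R V P muln_mul[OF \<phi>] w refl] w by (simp add: wext_def W_def obj_X word_closed[OF R V])

end

section \<open>Differential graded algebras\<close>

definition "Dt X = tmap (- 1) (bd X)"

definition "dga R X \<longleftrightarrow> galg R X & graded_map R (obj X) (obj X) (- 1) (bd X) &
   (\<forall>x\<in>carrier (Tot X). \<forall>y\<in>carrier (Tot X).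
    Dt X (x \<otimes>[Tot X] y) = Dt X x \<otimes>[Tot X] y \<oplus>[Tot X] gam X x \<otimes>[Tot X] Dt X y) &
   (\<forall>x\<in>carrier (Tot X). Dt X (Dt X x) = \<zero>[Tot X])"

lemma Dt_hom': "galg R X ==> graded_map R (obj X) (obj X) (- 1) (bd X) ==> Dt X : Hom R (Tot X) (Tot X)"
 unfolding Dt_def Tot_def Let_def galg_def by (intro tmap_hom) auto

lemma Dt_EL': "galg R X ==> graded_map R (obj X) (obj X) (- 1) (bd X) ==> Dt X (EL X (n, x)) = EL X (n - 1, bd X n x)"
 unfolding Dt_def using tmap_el[of R "obj X" "obj X" "- 1" "bd X" n x] by (simp add: galg_def)

lemma EL_zero: "galg R X ==> EL X (n, \<zero>[obj X n]) = \<zero>[Tot X]" by (rule lin_zero[OF EL_lin _ Tot_module]) (auto simp: galg_def gmod_def)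

lemma dgaD: "dga R X ==> galg R X" "dga R X ==> graded_map R (obj X) (obj X) (- 1) (bd X)" by (simp_all add: dga_def)

lemma Dt_hom: "dga R X ==> Dt X : Hom R (Tot X) (Tot X)" by (rule Dt_hom'[OF dgaD])

lemma Dt_EL: "dga R X ==> Dt X (EL X (n, x)) = EL X (n - 1, bd X n x)" by (rule Dt_EL'[OF dgaD])

lemma Dt_mult: "dga R X ==> x : car (Tot X) ==> y : car (Tot X) ==>
  Dt X (x \<otimes>[Tot X] y) = Dt X x \<otimes>[Tot X] y \<oplus>[Tot X] gam X x \<otimes>[Tot X] Dt X y" by (simp add: dga_def)

lemma dga_chain_complex:
 assumes X: "dga R X" shows "chain_complex R X" unfolding chain_complex_def
proof (intro conjI allI ballI)
 have M: "gmod R (obj X)" using X by (simp add: dga_def galg_def)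
 show "module R (obj X n)" for n by (rule gmodD[OF M])
 show "graded_map R (obj X) (obj X) (- 1) (bd X)" using X by (simp add: dga_def)
 fix n x assume x: "x : car (obj X n)"
 have "EL X (n, x) : car (Tot X)" using x by (intro EL_closed[OF dgaD(1)[OF X]]) simp
 then have "Dt X (Dt X (EL X (n, x))) = \<zero>[Tot X]" using X unfolding dga_def by blast
 then have "EL X (n - 2, bd X (n - 1) (bd X n x)) = EL X (n - 2, \<zero>[obj X (n - 2)])"
  using Dt_EL[OF X, of n x] Dt_EL[OF X, of "n - 1" "bd X n x"] EL_zero[OF dgaD(1)[OF X], of "n - 2"] by simp
 then show "bd X (n - 1) (bd X n x) = \<zero>[obj X (n - 2)]" by (rule el_inj)
qed

lemma ralgD:
 assumes "ralg R P"
 shows "module R P" "ring P" "abelian_group P"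
  "r : car R ==> x : car P ==> y : car P ==> (r \<odot>[P] x) \<otimes>[P] y = r \<odot>[P] (x \<otimes>[P] y)"
  "r : car R ==> x : car P ==> y : car P ==> x \<otimes>[P] (r \<odot>[P] y) = r \<odot>[P] (x \<otimes>[P] y)"
 using assms by (auto simp: ralg_def module_def)

lemma ralg_left: "ralg R P ==> y : car P ==> (%x. x \<otimes>[P] y) : Hom R P P"
 by (rule mhI) (auto simp: ralg_def ring.ring_simprules(13) ring.ring_simprules(5))

lemma ralg_right: "ralg R P ==> x : car P ==> (%y. x \<otimes>[P] y) : Hom R P P"
 by (rule mhI) (auto simp: ralg_def ring.ring_simprules(23) ring.ring_simprules(5))

lemma ralg_ksign:
 assumes P: "ralg R P" and x: "x : car P" and y: "y : car P"
 shows "ksign P k x \<otimes>[P] y = ksign P k (x \<otimes>[P] y)" "x \<otimes>[P] ksign P k y = ksign P k (x \<otimes>[P] y)"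
 using mh_ksign[OF ralg_left[OF P y] ralgD(1)[OF P] ralgD(1)[OF P] x]
  mh_ksign[OF ralg_right[OF P x] ralgD(1)[OF P] ralgD(1)[OF P] y] by auto

lemma bil_mult:
 assumes P: "ralg R P" and F: "lin R M P F" and G: "lin R N P G"
 shows "bil R M N P (%a b. F a \<otimes>[P] G b)"
 by (intro bilI lin_comp[OF G ralg_right[OF P]] lin_comp[OF F ralg_left[OF P]] lin_closed[OF F] lin_closed[OF G])

lemma bil_ksign: "bil R M N P F ==> module R P ==> bil R M N P (%a b. ksign P (k (fst a) (fst b)) (F a b))"
proof (rule bilI)
 assume F: "bil R M N P F" and P: "module R P"
 show "lin R N P (%b. ksign P (k (fst a) (fst b)) (F a b))" if "a : homs M" for a by (rule lin_ksignI[OF bil_right[OF F that] P])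
 show "lin R M P (%a. ksign P (k (fst a) (fst b)) (F a b))" if "b : homs N" for b by (rule lin_ksignI[OF bil_left[OF F that] P, of "%n. k n (fst b)"])
qed

section \<open>The cobar construction is a differential graded algebra\<close>

context coaugmented
begin

definition "bar c = (fst c - 1, ker_proj C (fst c) (snd c))"

definition "hat c = (fst c, ker_proj C (fst c) (snd c))"

abbreviation "Vk == desusp_ker R C"
abbreviation "kC == ker_counit R C"

lemma Cn: "module R (obj C n)" by (rule gmodD[OF gm])

lemma kC_simps: "car (kC n) = {x : car (obj C n). counit C n x = \<zero>}"
 "add (kC n) = add (obj C n)" "zero (kC n) = zero (obj C n)" "smult (kC n) = smult (obj C n)" by (simp_all add: ker_counit_def)

lemma kC: "gmod R kC" unfolding gmod_def
proof
 fix n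
 have "submodule {x : car (obj C n). counit C n x = \<zero>[ground_module R n]} R (obj C n)"
  by (rule kernel_submodule[OF counit_hom Cn ground_module_module[OF cring_axioms]])
 then have "module R ((obj C n)\<lparr>carrier := {x : car (obj C n). counit C n x = \<zero>}\<rparr>)"
  using submodule.submodule_is_module[OF _ Cn] by (simp add: ground_simps)
 then show "module R (kC n)" by (simp add: ker_counit_def)
qed

lemma Vk: "gmod R Vk" using kC by (simp add: gmod_def desusp_ker_def)

lemma counit_ground: "x : car (obj C n) ==> counit C n x : car (ground_module R n)" by (rule mh_closed[OF counit_hom])

lemma coaug_hom: "coaug C n : Hom R (ground_module R n) (obj C n)"
proof (rule mhI)
 interpret Cn: module R "obj C k" for k by (rule Cn)
 interpret G: module R "ground_module R n" by (rule ground_module_module[OF cring_axioms])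
 show "coaug C n x : car (obj C n)" if "x : car (ground_module R n)" for x
  using that one_closed' module.smult_closed[OF Cn, of x "coaug_one R C" 0] by (auto simp: coaug_eq ground_simps)
 show "coaug C n (x \<oplus>[ground_module R n] y) = coaug C n x \<oplus>[obj C n] coaug C n y"
  if "x : car (ground_module R n)" "y : car (ground_module R n)" for x y
  using coaug_eq[OF G.a_closed[OF that]] coaug_eq[OF that(1)] coaug_eq[OF that(2)] that one_closed'
  by (auto simp: ground_simps Cn.smult_l_distr split: if_splits)
 show "coaug C n (r \<odot>[ground_module R n] x) = r \<odot>[obj C n] coaug C n x"
  if "r : car R" "x : car (ground_module R n)" for r x using coaug_eq[OF G.smult_closed[OF that]] coaug_eq[OF that(2)] that one_closed'
  by (auto simp: ground_simps Cn.smult_assoc1 split: if_splits)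
qed

lemma counit_coaug: "r : car (ground_module R n) ==> counit C n (coaug C n r) = r"
 using mh_smult[OF counit_hom _ one_closed', of r] mh_zero[OF counit_hom Cn ground_module_module[OF cring_axioms], of n]
 by (auto simp: coaug_eq ground_simps counit_one split: if_splits)

lemma ker_proj_hom: "ker_proj C n : Hom R (obj C n) (kC n)"
proof -
 interpret Cn: module R "obj C n" by (rule Cn)
 interpret G: module R "ground_module R n" by (rule ground_module_module[OF cring_axioms])
 have ec: "(%x. ksign (obj C n) 1 (coaug C n (counit C n x))) : Hom R (obj C n) (obj C n)" by (rule mh_ksignI[OF mh_comp[OF counit_hom coaug_hom] Cn])
 have p: "ker_proj C n : Hom R (obj C n) (obj C n)" using mh_plus[OF mh_id ec Cn] by (simp add: ker_proj_def[abs_def] a_minus_def neg_ksign)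
 have "counit C n (ker_proj C n x) = \<zero>" if x: "x : car (obj C n)" for x
 proof -
  have cx: "coaug C n (counit C n x) : car (obj C n)" by (rule mh_closed[OF coaug_hom counit_ground[OF x]])
  have "counit C n (ker_proj C n x) = counit C n x \<ominus>[ground_module R n] counit C n x"
   unfolding ker_proj_def mh_minus[OF counit_hom Cn G.module_axioms x cx] counit_coaug[OF counit_ground[OF x]] ..
  also have "... = \<zero>[ground_module R n]" using counit_ground[OF x] by (simp add: minus_eq_zero_iff[OF G.abelian_group_axioms])
  finally show ?thesis by (simp add: ground_simps)
 qed
 then show ?thesis using p by (auto simp: module_hom_def hom_def kC_simps)
qed

lemma ker_proj_ker: "x : car (kC n) ==> ker_proj C n x = x"
proof -
 assume x: "x : car (kC n)"
 interpret Cn: module R "obj C n" by (rule Cn)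
 have "coaug C n \<zero> = \<zero>[obj C n]" using mh_zero[OF coaug_hom ground_module_module[OF cring_axioms] Cn] by (simp add: ground_simps)
 with x show ?thesis by (simp add: ker_proj_def kC_simps a_minus_def)
qed

lemma homs_kC: "a : homs kC \<longleftrightarrow> a : els C & eps C a = \<zero>" by (cases a) (simp add: kC_simps eps_def)

lemma homs_Vk: "l : homs Vk \<longleftrightarrow> (fst l + 1, snd l) : homs kC" by (cases l) (simp add: desusp_ker_def)

lemma bar_homs: "c : els C ==> bar c : homs Vk" using mh_closed[OF ker_proj_hom homs_snd] by (simp add: bar_def desusp_ker_def)

lemma hat_homs: "c : els C ==> hat c : els C & eps C (hat c) = \<zero>"
 using mh_closed[OF ker_proj_hom homs_snd, of c] by (simp add: hat_def kC_simps eps_def)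

lemma fst_bar [simp]: "fst (bar c) = fst c - 1" by (simp add: bar_def)
lemma fst_hat [simp]: "fst (hat c) = fst c" by (simp add: hat_def)

lemma hat_ker: "c : els C ==> eps C c = \<zero> ==> hat c = c"
 using ker_proj_ker[of "snd c" "fst c"] homs_snd by (cases c) (simp add: hat_def kC_simps eps_def)

lemma bar_letter: "l : homs Vk ==> bar (fst l + 1, snd l) = l" using ker_proj_ker by (cases l) (simp add: bar_def desusp_ker_def)

lemma lin_bar:
 assumes F: "lin R Vk P F" shows "lin R (obj C) P (%c. F (bar c))" unfolding lin_def bar_def fst_conv snd_conv
proof
 fix n
 have "(%x. F (n - 1, x)) : Hom R (kC n) P" using lin_hom[OF F, of "n - 1"] by (simp add: desusp_ker_def)
 from mh_comp[OF ker_proj_hom this]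
 show "(%x. F (n - 1, ker_proj C n x)) : Hom R (obj C n) P" .
qed

lemma lin_hat:
 assumes F: "lin R (obj C) P F" shows "lin R (obj C) P (%c. F (hat c))" unfolding lin_def hat_def fst_conv snd_conv
proof
 fix n
 have "(%x. F (n, x)) : Hom R (kC n) P" using lin_hom[OF F, of n] by (auto simp: module_hom_def hom_def kC_simps)
 from mh_comp[OF ker_proj_hom this]
 show "(%x. F (n, ker_proj C n x)) : Hom R (obj C n) P" .
qed

text \<open>\<open>C\<close> is the direct sum of the line through the unit and the kernel of the counit.\<close>

lemma hat_split:
 assumes F: "lin R (obj C) P F" and P: "module R P" and c: "c : els C"
 shows "F c = F (hat c) \<oplus>[P] eps C c \<odot>[P] F (uh R C)"
proof -
 interpret P: module R P by (rule P)
 interpret Cn: module R "obj C n" for n by (rule Cn)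
 obtain n x where c': "c = (n, x)" "x : car (obj C n)" using c by (cases c) auto
 have g: "counit C n x : car (ground_module R n)" by (rule counit_ground[OF c'(2)])
 have cc: "coaug C n (counit C n x) : car (obj C n)" by (rule mh_closed[OF coaug_hom g])
 have Fx: "F (n, x) : car P" using lin_closed[OF F] c' by simp
 have Fu: "F (uh R C) : car P" by (rule lin_closed[OF F uh_homs])
 have e: "eps C (n, x) : car R" by (rule eps_closed) (simp add: c')
 have "F (n, coaug C n (counit C n x)) = eps C (n, x) \<odot>[P] F (uh R C)"
 proof (cases "n = 0")
  case True
  then show ?thesis using g lin_smult[OF F _ one_closed', of "counit C 0 x"] by (simp add: coaug_eq eps_def uh_def ground_simps)
 next
  case False
  then have "counit C n x = \<zero>" using g by (simp add: ground_simps)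
  with False show ?thesis using g Fu lin_zero[OF F Cn.module_axioms P] by (simp add: coaug_eq eps_def)
 qed
 then have "F (hat c) = F c \<ominus>[P] eps C c \<odot>[P] F (uh R C)" unfolding hat_def c' fst_conv snd_conv ker_proj_def
  using lin_minus[OF F Cn.module_axioms P c'(2) cc] by simp
 then show ?thesis using Fx Fu e c' by (simp add: a_minus_def P.a_ac P.r_neg P.smult_closed)
qed

lemma bar_uh: "lin R Vk P F ==> module R P ==> F (bar (uh R C)) = \<zero>[P]"
proof -
 assume F: "lin R Vk P F" and P: "module R P"
 interpret C0: module R "obj C 0" by (rule Cn)
 have "coaug C 0 \<one> = coaug_one R C" by (simp add: coaug_one_def)
 then have "ker_proj C 0 (coaug_one R C) = \<zero>[obj C 0]" using one_closed' by (simp add: ker_proj_def counit_one a_minus_def C0.r_neg)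
 then have "bar (uh R C) = (- 1, \<zero>[Vk (- 1)])" by (simp add: bar_def uh_def desusp_ker_def kC_simps)
 then show ?thesis using lin_zero[OF F gmodD[OF Vk] P] by simp
qed

sublocale word_alg R "desusp_ker R C" "cobar R C" by unfold_locales (simp_all add: Vk cobar_def Let_def)

text \<open>The class \<open>[c - \<epsilon>(c) 1]\<close>, defined for all elements of \<open>C\<close>.\<close>

definition "L c = W [bar c]"

lemma letter_lin: "lin R Vk TX (%l. W [l])" using mul_lin[OF W_mul, of "[]" "[]"] by simp

lemma L_lin: "lin R (obj C) TX L" unfolding L_def by (rule lin_bar[OF letter_lin])

lemma L_closed: "c : els C ==> L c : car TX" by (rule lin_closed[OF L_lin])

lemma L_uh: "L (uh R C) = \<zero>[TX]" unfolding L_def by (rule bar_uh[OF letter_lin TXm])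

lemma gam_L: "c : els C ==> gam (cobar R C) (L c) = ksign TX (fst c - 1) (L c)" unfolding L_def using gam_W[of "[bar c]"] bar_homs by simp

lemma TX_ralg: "ralg R TX" by (rule Tot_ralg[OF galg])

lemma LL_bil: "bil R (obj C) (obj C) TX (%x y. ksign TX (fst x) (L x \<otimes>[TX] L y))" by (rule bil_ksign[OF bil_mult[OF TX_ralg L_lin L_lin] TXm])

end

locale cobar_coalgebra = coalgebra_into R C "Tot (cobar R C)"
 for R :: "('r, 'm) ring_scheme" (structure) and C :: "('r, 'a, 'z) coaug_chain_coalg_scheme"
begin

text \<open>The differential of the letter \<open>[c]\<close>; the signs are those of \<open>-s\<^sup>-\<^sup>1ds\<close> and of \<open>s\<^sup>-\<^sup>1 \<otimes> s\<^sup>-\<^sup>1\<close>.\<close>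

definition "DL c = ksign TX 1 (L (dh C c)) \<oplus>[TX] csum R C TX c (%x y. ksign TX (fst x) (L x \<otimes>[TX] L y))"

lemma DL_lin: "lin R (obj C) TX DL" unfolding DL_def
 by (intro lin_plus[OF lin_comp[OF lin_dh[OF cx L_lin] mh_ksignI[OF mh_id TXm]] csum_lin[OF TXm LL_bil] TXm])

lemma DL_closed: "c : els C ==> DL c : car TX" by (rule lin_closed[OF DL_lin])

lemma DL_uh: "DL (uh R C) = \<zero>[TX]"
proof -
 interpret Tr: ring TX by (rule ralgD(2)[OF TX_ralg])
 have "csum R C TX (uh R C) (%x y. ksign TX (fst x) (L x \<otimes>[TX] L y)) = \<zero>[TX]" using csum_one[OF LL_bil] by (simp add: L_uh)
 moreover have "L (dh C (uh R C)) = \<zero>[TX]" by (rule dh_uh[OF L_lin TXm])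
 ultimately show ?thesis by (simp add: DL_def P.abelian_group_axioms)
qed

lemma cobar_gen_bd:
 assumes l: "l : homs Vk"
 shows "cobar_gen_bd R C l : car (TA (fst l - 1))"
  and "EL (cobar R C) (fst l - 1, cobar_gen_bd R C l) = DL (fst l + 1, snd l)"
proof -
 let ?k = "fst l" let ?x = "snd l" let ?c = "(fst l + 1, snd l)"
 let ?CC = "tensor_module R (obj C) (obj C)" and ?KK = "tensor_module R kC kC" and ?VV = "tensor_module R Vk Vk"
 note R = cring_axioms
 interpret Tr: ring TX by (rule ralgD(2)[OF TX_ralg])
 interpret Q: module R "TA (?k - 1)" by (rule TAm)
 note e = EL_lin[OF galg, unfolded obj_X]
 have ck: "?c : homs kC" using l homs_Vk by simp
 then have c: "?c : els C" by (simp add: homs_kC)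
 have dl: "(?k - 1, bd C (?k + 1) ?x) : homs Vk" using dh_homs[OF cx c] eps_dh[OF c] by (simp add: homs_Vk homs_kC dh_def)
 have w1: "word R Vk [(?k - 1, bd C (?k + 1) ?x)] : car (TA (?k - 1))" using dl by (intro word_closed[OF R Vk]) auto
 have "bar (dh C ?c) = (?k - 1, bd C (?k + 1) ?x)" using bar_letter[OF dl] by (simp add: dh_def)
 then have E1: "EL (cobar R C) (?k - 1, word R Vk [(?k - 1, bd C (?k + 1) ?x)]) = L (dh C ?c)" by (simp add: L_def W_def)
 have pg: "graded_map R (obj C) kC 0 (ker_proj C)" using ker_proj_hom by (simp add: graded_map_def)
 have vg: "graded_map R kC Vk (- 1) (%_ x. x)" by (simp add: graded_map_def desusp_ker_def mh_id)
 have b: "biln R Vk Vk (TA (?k - 1)) (?k - 1) (%(a, b). word R Vk [a, b])"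
 proof -
  have "(%x. word R Vk [(i, x), (j, y)]) : Hom R (Vk i) (TA (?k - 1))" if "i + j = ?k - 1" "y : car (Vk j)" for i j y
   using word_letter[OF R Vk, of "[]" "[(j, y)]" i "?k - 1"] that by simp
  moreover have "(%y. word R Vk [(i, x), (j, y)]) : Hom R (Vk j) (TA (?k - 1))" if "i + j = ?k - 1" "x : car (Vk i)" for i j x
   using word_letter[OF R Vk, of "[(i, x)]" "[]" j "?k - 1"] that by simp
  ultimately show ?thesis by (simp add: biln_def)
 qed
 let ?t1 = "tensor_map R kC kC 0 0 (ker_proj C) (ker_proj C) (?k + 1)"
 let ?t2 = "tensor_map R Vk Vk (- 1) (- 1) (%_ x. x) (%_ x. x) (?k + 1)"
 let ?t3 = "lift R (TA (?k - 1)) (%(a, b). word R Vk [a, b])"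
 have h1: "?t1 : Hom R (?CC (?k + 1)) (?KK (?k + 1))" by (rule tensor_map_hom[OF R gm gm kC kC pg pg]) simp
 have h2: "?t2 : Hom R (?KK (?k + 1)) (?VV (?k - 1))" by (rule tensor_map_hom[OF R kC kC Vk Vk vg vg]) simp
 have h3: "?t3 : Hom R (?VV (?k - 1)) (TA (?k - 1))" by (rule liftn_hom[OF R Vk Vk TAm b])
 let ?\<Theta> = "%t. ?t3 (?t2 (?t1 t))"
 have h\<Theta>: "?\<Theta> : Hom R (?CC (?k + 1)) (TA (?k - 1))" by (rule mh_comp[OF h1 mh_comp[OF h2 h3]])
 let ?E = "%t. EL (cobar R C) (?k - 1, ?\<Theta> t)"
 have hE: "?E : Hom R (?CC (?k + 1)) TX" using mh_comp[OF h\<Theta> lin_hom[OF e]] by (simp add: obj_X)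
 have Et: "?E (tens R (obj C) (obj C) x y) = ksign TX (fst x) (L x \<otimes>[TX] L y)"
  if x: "x : els C" and y: "y : els C" and d: "fst x + fst y = ?k + 1" for x y
 proof -
  have hx: "(fst x, ker_proj C (fst x) (snd x)) : homs kC" "(fst y, ker_proj C (fst y) (snd y)) : homs kC"
   using mh_closed[OF ker_proj_hom homs_snd[OF x]] mh_closed[OF ker_proj_hom homs_snd[OF y]] by auto
  have 1: "?t1 (tens R (obj C) (obj C) x y) = tens R kC kC (fst x, ker_proj C (fst x) (snd x)) (fst y, ker_proj C (fst y) (snd y))"
   using tensor_map_tens[OF R gm gm kC kC pg pg x y d refl] by simp
  have "?t2 (tens R kC kC (fst x, ker_proj C (fst x) (snd x)) (fst y, ker_proj C (fst y) (snd y))) =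
    ksign (?VV (?k - 1)) (- fst x) (tens R Vk Vk (bar x) (bar y))"
   using tensor_map_tens[OF R kC kC Vk Vk vg vg hx, of "?k + 1" "?k - 1"] d by (simp add: bar_def)
  also have "... = ksign (?VV (?k - 1)) (fst x) (tens R Vk Vk (bar x) (bar y))" by (rule ksign_cong) simp
  finally have 2: "?t2 (?t1 (tens R (obj C) (obj C) x y)) = ksign (?VV (?k - 1)) (fst x) (tens R Vk Vk (bar x) (bar y))" using 1 by simp
  have tc: "tens R Vk Vk (bar x) (bar y) : car (?VV (?k - 1))" using bar_homs[OF x] bar_homs[OF y] d by (intro tens_closed[OF R Vk Vk]) auto
  have wc: "word R Vk [bar x, bar y] : car (TA (?k - 1))" using bar_homs[OF x] bar_homs[OF y] d by (intro word_closed[OF R Vk]) auto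
  have "?\<Theta> (tens R (obj C) (obj C) x y) = ksign (TA (?k - 1)) (fst x) (word R Vk [bar x, bar y])"
   using mh_ksign[OF h3 tensor_module_module[OF R Vk Vk] TAm tc] bar_homs[OF x] bar_homs[OF y] d by (simp add: 2 liftn_tens[OF R Vk Vk TAm b])
  moreover have "EL (cobar R C) (?k - 1, word R Vk [bar x, bar y]) = W [bar x, bar y]" using d by (simp add: W_def)
  moreover have "W [bar x, bar y] = L x \<otimes>[TX] L y" using W_append[of "[bar x]" "[bar y]"] bar_homs[OF x] bar_homs[OF y] by (simp add: L_def)
  ultimately show ?thesis using lin_ksign[OF e TAm TXm wc] by (simp add: obj_X)
 qed
 let ?s = "cm C ?c \<ominus>[?CC (?k + 1)] (tens R (obj C) (obj C) ?c (uh R C) \<oplus>[?CC (?k + 1)] tens R (obj C) (obj C) (uh R C) ?c)"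
 have CCm: "module R (?CC n)" for n by (rule tensor_module_module[OF R gm gm])
 interpret CC: module R "?CC (?k + 1)" by (rule CCm)
 have s1: "tens R (obj C) (obj C) ?c (uh R C) : car (?CC (?k + 1))" "tens R (obj C) (obj C) (uh R C) ?c : car (?CC (?k + 1))"
  using c uh_homs by (auto intro!: tens_closed[OF R gm gm])
 have s2: "cm C ?c : car (?CC (?k + 1))" using cm_closed[OF c] by simp
 have sc: "?s : car (?CC (?k + 1))" using s1 s2 by (intro CC.minus_closed CC.a_closed)
 have gen: "cobar_gen_bd R C l = (\<ominus>[TA (?k - 1)] word R Vk [(?k - 1, bd C (?k + 1) ?x)]) \<oplus>[TA (?k - 1)] ?\<Theta> ?s"
  by (simp add: cobar_gen_bd_def Let_def reduced_comult_def cm_def uh_def)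
 have \<Theta>c: "?\<Theta> ?s : car (TA (?k - 1))" by (rule mh_closed[OF h\<Theta> sc])
 show "cobar_gen_bd R C l : car (TA (?k - 1))" unfolding gen using w1 \<Theta>c by (intro Q.a_closed Q.a_inv_closed)
 have Lc: "L ?c : car TX" by (rule L_closed[OF c])
 have z: "?E (tens R (obj C) (obj C) ?c (uh R C)) = \<zero>[TX]" "?E (tens R (obj C) (obj C) (uh R C) ?c) = \<zero>[TX]"
  using Et[OF c uh_homs] Et[OF uh_homs c] Lc by (simp_all add: L_uh P.abelian_group_axioms)
 have Ecm: "?E (cm C ?c) = csum R C TX ?c (%x y. ksign TX (fst x) (L x \<otimes>[TX] L y))"
  using csum_of_hom[OF TXm, of ?E ?c] hE c csum_cong[OF c Et] by simp
 have LLc: "csum R C TX ?c (%x y. ksign TX (fst x) (L x \<otimes>[TX] L y)) : car TX" by (rule lin_closed[OF csum_lin[OF TXm LL_bil] c])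
 have "?E ?s = csum R C TX ?c (%x y. ksign TX (fst x) (L x \<otimes>[TX] L y))"
  using mh_minus[OF hE CCm TXm s2 CC.a_closed[OF s1]] mh_add[OF hE s1] LLc z by (simp add: Ecm a_minus_def)
 moreover have "EL (cobar R C) (?k - 1, \<ominus>[TA (?k - 1)] word R Vk [(?k - 1, bd C (?k + 1) ?x)]) = ksign TX 1 (L (dh C ?c))"
  unfolding neg_ksign E1[symmetric] using lin_ksign[OF e TAm TXm w1] by (simp add: obj_X)
 ultimately show "EL (cobar R C) (?k - 1, cobar_gen_bd R C l) = DL ?c"
  unfolding gen DL_def using lin_add[OF e Q.a_inv_closed[OF w1] \<Theta>c] by (simp add: obj_X)
qed

primrec DW :: "'a homog list => int => ('r, 'a) tensor_word" where
 "DW [] = \<zero>[TX]"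
| "DW (l # w) = DL (fst l + 1, snd l) \<otimes>[TX] W w \<oplus>[TX] ksign TX (fst l) (W [l] \<otimes>[TX] DW w)"

lemma letter_DL_lin: "lin R Vk TX (%l. DL (fst l + 1, snd l))" unfolding lin_def fst_conv snd_conv
proof
 fix n show "(%x. DL (n + 1, x)) : Hom R (Vk n) TX"
  using lin_hom[OF DL_lin, of "n + 1"] by (auto simp: desusp_ker_def module_hom_def hom_def kC_simps)
qed

lemma DW_mul: "mul R Vk TX DW"
proof (rule mulI)
 interpret Tr: ring TX by (rule ralgD(2)[OF TX_ralg])
 show "DW [] : car TX" by simp
 have DWc: "DW w : car TX" if "set w <= homs Vk" for w using that
  by (induction w) (auto intro!: P.a_closed Tr.m_closed ksign_closed[OF P.abelian_group_axioms]
    lin_closed[OF letter_DL_lin] W_closed)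
 fix u w assume u: "set u <= homs Vk" and w: "set w <= homs Vk"
 show "lin R Vk TX (%l. DW (u @ l # w))" using u
 proof (induction u)
  case Nil
  show ?case using lin_comp[OF letter_DL_lin ralg_left[OF TX_ralg W_closed[OF w]]]
    lin_ksignI[OF lin_comp[OF letter_lin ralg_left[OF TX_ralg DWc[OF w]]] TXm, of "%n. n"] by (auto intro: lin_plus TXm)
 next
  case (Cons x u)
  have x: "x : homs Vk" and u: "set u <= homs Vk" using Cons.prems by auto
  have W1: "W [x] : car TX" using x by (intro W_closed) auto
  show ?case using lin_comp[OF mul_lin[OF W_mul u w] ralg_right[OF TX_ralg lin_closed[OF letter_DL_lin x]]]
    lin_comp[OF lin_comp[OF Cons.IH[OF u] ralg_right[OF TX_ralg W1]] mh_ksignI[OF mh_id TXm, of "fst x"]] by (auto intro: lin_plus TXm)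
 qed
qed

lemma cobar_word_bd:
 "set w <= homs Vk ==> cobar_word_bd R C w : car (TA (word_deg w - 1)) &
  EL (cobar R C) (word_deg w - 1, cobar_word_bd R C w) = DW w"
proof (induction w)
 case Nil
 show ?case using EL_zero[OF galg, of "- 1"] tensor_alg_gmod[OF cring_axioms Vk] abelian_monoid.zero_closed[OF abelian_group.axioms(1)[OF gmod_ag]]
  by (fastforce simp: obj_X)
next
 case (Cons l w)
 let ?k = "fst l" and ?n = "word_deg w"
 interpret Q: module R "TA (?k + ?n - 1)" by (rule TAm)
 note R = cring_axioms
 have l: "l : homs Vk" and w: "set w <= homs Vk" using Cons.prems by auto
 note g = cobar_gen_bd[OF l]
 have IH: "cobar_word_bd R C w : car (TA (?n - 1))" "EL (cobar R C) (?n - 1, cobar_word_bd R C w) = DW w" using Cons.IH[OF w] by auto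
 have wc: "word R Vk w : car (TA ?n)" by (rule word_closed[OF R Vk w refl])
 have lc: "word R Vk [l] : car (TA ?k)" using l by (intro word_closed[OF R Vk]) auto
 have i: "TA (?k - 1 + ?n) = TA (?k + ?n - 1)" "TA (?k + (?n - 1)) = TA (?k + ?n - 1)"
  "?k - 1 + ?n = ?k + ?n - 1" "?k + (?n - 1) = ?k + ?n - 1" by (simp_all add: algebra_simps)
 have c1: "word_mult R Vk (?k - 1) ?n (cobar_gen_bd R C l) (word R Vk w) : car (TA (?k + ?n - 1))"
  using mh_closed[OF word_mult_left[OF wc] g(1)] unfolding i .
 have c2: "word_mult R Vk ?k (?n - 1) (word R Vk [l]) (cobar_word_bd R C w) : car (TA (?k + ?n - 1))"
  using mh_closed[OF word_mult_left[OF IH(1)] lc] unfolding i .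
 note e = EL_lin[OF galg, unfolded obj_X]
 have E1: "el TA (?k + ?n - 1, word_mult R Vk (?k - 1) ?n (cobar_gen_bd R C l) (word R Vk w)) = DL (?k + 1, snd l) \<otimes>[TX] W w"
  using EL_mult[OF galg, of "(?k - 1, cobar_gen_bd R C l)" "(?n, word R Vk w)"] g wc i by (simp add: obj_X hmult_def amult_X W_def)
 have E2: "el TA (?k + ?n - 1, word_mult R Vk ?k (?n - 1) (word R Vk [l]) (cobar_word_bd R C w)) = W [l] \<otimes>[TX] DW w"
  using EL_mult[OF galg, of "(?k, word R Vk [l])" "(?n - 1, cobar_word_bd R C w)"] lc IH i by (simp add: obj_X hmult_def amult_X W_def)
 have k2: "ksign (TA (?k + ?n - 1)) ?k (word_mult R Vk ?k (?n - 1) (word R Vk [l]) (cobar_word_bd R C w)) : car (TA (?k + ?n - 1))"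
  by (rule ksign_closed[OF Q.abelian_group_axioms c2])
 show ?case using Q.a_closed[OF c1 k2] lin_add[OF e c1 k2] lin_ksign[OF e TAm TXm c2] by (simp add: Let_def obj_X E1 E2)
qed

lemma cobar_bd_graded: "graded_map R (obj (cobar R C)) (obj (cobar R C)) (- 1) (bd (cobar R C))"
 and Dt_W: "set w <= homs Vk ==> Dt (cobar R C) (W w) = DW w"
proof -
 note R = cring_axioms
 have m: "muln R Vk (TA (n - 1)) n (cobar_word_bd R C)" for n unfolding muln_def
 proof (intro conjI allI impI)
  show "cobar_word_bd R C [] : car (TA (n - 1))" if "n = 0" using cobar_word_bd[of "[]"] that by simp
  fix u w i assume u: "set u <= homs Vk" and w: "set w <= homs Vk" and d: "word_deg u + i + word_deg w = n"
  have s: "set (u @ (i, x) # w) <= homs Vk" "word_deg (u @ (i, x) # w) = n" if "x : car (Vk i)" for x using u w that d by auto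
  have "(%x. cobar_word_bd R C (u @ (i, x) # w)) : Hom R (Vk i) (obj (cobar R C) (n - 1))"
  proof (rule EL_reflect[OF galg _ _ gmodD[OF Vk]])
   show "cobar_word_bd R C (u @ (i, x) # w) : car (obj (cobar R C) (n - 1))" if "x : car (Vk i)" for x
    using cobar_word_bd[OF s(1)[OF that]] s(2)[OF that] by (simp add: obj_X)
   show "(%x. EL (cobar R C) (n - 1, cobar_word_bd R C (u @ (i, x) # w))) : Hom R (Vk i) TX"
   proof (rule mh_cong[OF gmodD[OF Vk] _ lin_hom[OF mul_lin[OF DW_mul u w]]])
    fix x assume "x : car (Vk i)"
    from cobar_word_bd[OF s(1)[OF this]] s(2)[OF this]
    show "EL (cobar R C) (n - 1, cobar_word_bd R C (u @ (i, x) # w)) = DW (u @ (i, x) # w)" by simp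
   qed
  qed
  then show "(%x. cobar_word_bd R C (u @ (i, x) # w)) : Hom R (Vk i) (TA (n - 1))" by (simp add: obj_X)
 qed
 have bd: "bd (cobar R C) n = lift R (TA (n - 1)) (cobar_word_bd R C)" for n by (simp add: cobar_def Let_def)
 show gr: "graded_map R (obj (cobar R C)) (obj (cobar R C)) (- 1) (bd (cobar R C))"
  unfolding graded_map_def bd obj_X using liftw_hom[OF R Vk TAm m] by simp
 assume w: "set w <= homs Vk"
 show "Dt (cobar R C) (W w) = DW w" unfolding W_def Dt_EL'[OF galg gr] bd liftw_word[OF R Vk TAm m w refl] using cobar_word_bd[OF w] by simp
qed

abbreviation "D == Dt (cobar R C)"

lemma D_hom: "D : Hom R TX TX" by (rule Dt_hom'[OF galg cobar_bd_graded])

lemma D_closed: "x : car TX ==> D x : car TX" by (rule mh_closed[OF D_hom])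

lemma D_mult:
 assumes x: "x : car TX" and y: "y : car TX"
 shows "D (x \<otimes>[TX] y) = D x \<otimes>[TX] y \<oplus>[TX] gam (cobar R C) x \<otimes>[TX] D y"
proof -
 interpret Tr: ring TX by (rule ralgD(2)[OF TX_ralg])
 note ag = P.abelian_group_axioms and l = ralg_left[OF TX_ralg] and r = ralg_right[OF TX_ralg]
 note gc = mh_closed[OF gam_hom[OF galg]]
 have 1: "D (W u \<otimes>[TX] W v) = D (W u) \<otimes>[TX] W v \<oplus>[TX] gam (cobar R C) (W u) \<otimes>[TX] D (W v)"
  if u: "set u <= homs Vk" and v: "set v <= homs Vk" for u v using u
 proof (induction u)
  case Nil
  show ?case using v D_closed[OF W_closed[OF v]] W_closed[OF v] Dt_W[of "[]"] by (simp add: W_Nil gam_one[OF galg])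
 next
  case (Cons x u)
  have x: "x : homs Vk" and u: "set u <= homs Vk" using Cons.prems by auto
  have sx: "set [x] <= homs Vk" using x by simp
  have cl: "W [x] : car TX" "W u : car TX" "W v : car TX" "D (W u) : car TX" "D (W v) : car TX"
   "DL (fst x + 1, snd x) : car TX" "DW u : car TX" "DW v : car TX" "DW (u @ v) : car TX"
   using W_closed[OF sx] W_closed[OF u] W_closed[OF v] lin_closed[OF letter_DL_lin x]
    mul_closed[OF DW_mul u] mul_closed[OF DW_mul v] D_closed mul_closed[OF DW_mul, of "u @ v"] u v by auto
  have IH: "DW (u @ v) = DW u \<otimes>[TX] W v \<oplus>[TX] ksign TX (word_deg u) (W u \<otimes>[TX] DW v)"
   using Cons.IH[OF u] u v cl by (simp add: Dt_W W_append gam_W ralg_ksign[OF TX_ralg])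
  have xu: "W (x # u) = W [x] \<otimes>[TX] W u" "W (u @ v) = W u \<otimes>[TX] W v" using W_append[OF sx u] W_append[OF u v] by auto
  have "D (W (x # u) \<otimes>[TX] W v) = DW (x # u @ v)" using x u v by (simp add: W_append Dt_W)
  also have "... = DW (x # u) \<otimes>[TX] W v \<oplus>[TX] ksign TX (fst x + word_deg u) (W (x # u) \<otimes>[TX] DW v)"
   using cl by (simp add: IH xu ksign_add[OF ag] ksign_ksign[OF ag] ralg_ksign[OF TX_ralg] ag Tr.l_distr Tr.r_distr Tr.m_assoc P.a_ac)
  also have "... = D (W (x # u)) \<otimes>[TX] W v \<oplus>[TX] gam (cobar R C) (W (x # u)) \<otimes>[TX] D (W v)"
   using x u v cl W_closed[of "x # u"] by (simp add: Dt_W gam_W ralg_ksign[OF TX_ralg] del: DW.simps)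
  finally show ?case .
 qed
 have 2: "D (W u \<otimes>[TX] y) = D (W u) \<otimes>[TX] y \<oplus>[TX] gam (cobar R C) (W u) \<otimes>[TX] D y" if u: "set u <= homs Vk" for u
  by (rule W_ext[OF mh_comp[OF r[OF W_closed[OF u]] D_hom] mh_plus[OF r[OF D_closed[OF W_closed[OF u]]] mh_comp[OF D_hom r[OF gc[OF W_closed[OF u]]]] TXm] TXm 1[OF u] y])
 show ?thesis
  by (rule W_ext[OF mh_comp[OF l[OF y] D_hom] mh_plus[OF mh_comp[OF D_hom l[OF y]] mh_comp[OF gam_hom[OF galg] l[OF D_closed[OF y]]] TXm] TXm 2 x])
qed

lemma D_L:
 assumes c: "c : els C"
 shows "D (L c) = DL c"
proof -
 interpret Tr: ring TX by (rule ralgD(2)[OF TX_ralg])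
 have b: "bar c : homs Vk" by (rule bar_homs[OF c])
 have z: "W [bar c] \<otimes>[TX] \<zero>[TX] = \<zero>[TX]" using W_closed[of "[bar c]"] b by simp
 have "(fst (bar c) + 1, snd (bar c)) = hat c" by (simp add: bar_def hat_def)
 then have "D (L c) = DL (hat c)" unfolding L_def using Dt_W[of "[bar c]"] b DL_closed[of "hat c"] hat_homs[OF c] z
  by (simp add: W_Nil P.abelian_group_axioms)
 then show ?thesis using hat_split[OF DL_lin TXm c] DL_closed[of "hat c"] hat_homs[OF c] eps_closed[OF c] by (simp add: DL_uh)
qed

end

lemma gam_Dt:
 assumes X: "galg R X" and g: "graded_map R (obj X) (obj X) (- 1) (bd X)" and x: "x : car (Tot X)"
 shows "gam X (Dt X x) = ksign (Tot X) 1 (Dt X (gam X x))"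
proof -
 note D = Dt_hom'[OF X g] and T = Tot_module[OF X]
 have ag: "abelian_group (Tot X)" using T by (simp add: module_def)
 show ?thesis
 proof (rule Tot_ext[OF X mh_comp[OF D gam_hom[OF X]] mh_ksignI[OF mh_comp[OF gam_hom[OF X] D] T] T _ x])
  fix a assume a: "a : els X"
  have da: "(fst a - 1, bd X (fst a) (snd a)) : els X" using mh_closed[OF graded_map_hom[OF g, of "fst a" "fst a - 1"] homs_snd[OF a]] by simp
  have "Dt X (EL X a) = EL X (fst a - 1, bd X (fst a) (snd a))" using Dt_EL'[OF X g, of "fst a" "snd a"] by simp
  then show "gam X (Dt X (EL X a)) = ksign (Tot X) 1 (Dt X (gam X (EL X a)))"
   using gam_EL[OF X a] gam_EL[OF X da] mh_ksign[OF D T T EL_closed[OF X a]] EL_closed[OF X da]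
   by (simp add: ksign_ksign[OF ag]) (rule ksign_cong, simp)
 qed
qed

context cobar_coalgebra
begin

lemma DD_L:
 assumes c: "c : els C"
 shows "D (D (L c)) = \<zero>[TX]"
proof -
 interpret Tr: ring TX by (rule ralgD(2)[OF TX_ralg])
 note ag = P.abelian_group_axioms
 note sg = ksign_add[OF ag] ksign_ksign[OF ag] ralg_ksign[OF TX_ralg]
 let ?s = "ksign TX"
 define E where "E = (%x y. ?s (fst x) (L (dh C x) \<otimes>[TX] L y) \<oplus>[TX] ?s 1 (L x \<otimes>[TX] L (dh C y)))"
 define G where "G = (%x y z. ?s (fst y) (L x \<otimes>[TX] L y \<otimes>[TX] L z))"
 have Lc: "L x : car TX" "L (dh C x) : car TX" if "x : els C" for x using L_closed that dh_homs[OF cx] by auto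
 have Gc: "G x y z : car TX" if "x : els C" "y : els C" "z : els C" for x y z unfolding G_def using Lc that ag by simp
 have Ec: "E x y : car TX" if "x : els C" "y : els C" for x y unfolding E_def using Lc that ag by simp
 have Gtri: "tri R (obj C) TX G" unfolding tri_def
 proof (intro conjI ballI)
  fix x assume x: "x : els C"
  show "bil R (obj C) (obj C) TX (G x)" unfolding G_def
   by (rule bil_ksign[OF bil_mult[OF TX_ralg lin_comp[OF L_lin ralg_right[OF TX_ralg Lc(1)[OF x]]] L_lin] TXm, of "%i j. i"])
  show "bil R (obj C) (obj C) TX (%y z. G y z x)" unfolding G_def
   by (rule bil_ksign[OF bil_comp[OF bil_mult[OF TX_ralg L_lin L_lin] ralg_left[OF TX_ralg Lc(1)[OF x]]] TXm, of "%i j. j"])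
 qed
 have dd: "L (dh C (dh C c)) = \<zero>[TX]" by (rule lin_dh_dh[OF cx L_lin TXm c])
 have cc: "csum R C TX x (%x y. ?s (fst x) (L x \<otimes>[TX] L y)) : car TX" if "x : els C" for x
  by (rule lin_closed[OF csum_lin[OF TXm LL_bil] that])
 have 1: "D (L (dh C c)) = csum R C TX c (%x y. ?s 1 (E x y))" unfolding D_L[OF dh_homs[OF cx c]] DL_def dd csum_bd[OF LL_bil c]
  using Lc ag by (simp add: E_def sg csum_closed[OF TXm c]) (intro csum_cong[OF c], simp add: sg ag, rule arg_cong2[where f="(\<oplus>\<^bsub>TX\<^esub>)"], (rule ksign_cong, simp)+)
 have 2: "?s (fst x) (D (L x \<otimes>[TX] L y)) = E' \<oplus>[TX] (csum R C TX x (%p q. G p q y) \<oplus>[TX] ?s 1 (csum R C TX y (G x)))"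
  if x: "x : els C" and y: "y : els C" and E': "E' = ?s 1 (E x y)" for x y E'
 proof -
  have a: "?s (fst x) (csum R C TX x (%p q. ?s (fst p) (L p \<otimes>[TX] L q)) \<otimes>[TX] L y) = csum R C TX x (%p q. G p q y)"
  proof -
   have h: "(%t. ?s (fst x) (t \<otimes>[TX] L y)) : Hom R TX TX" by (rule mh_ksignI[OF ralg_left[OF TX_ralg Lc(1)[OF y]] TXm])
   have "?s (fst x) (csum R C TX x (%p q. ?s (fst p) (L p \<otimes>[TX] L q)) \<otimes>[TX] L y) =
     csum R C TX x (%p q. ?s (fst x) (?s (fst p) (L p \<otimes>[TX] L q) \<otimes>[TX] L y))" using Lc ag by (intro csum_hom[OF TXm h TXm x]) simp
   also have "... = csum R C TX x (%p q. G p q y)"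
   proof (rule csum_cong[OF x])
    fix p q assume p: "p : els C" and q: "q : els C" and d: "fst p + fst q = fst x"
    have "?s (fst x + fst p) (L p \<otimes>[TX] L q \<otimes>[TX] L y) = ?s (fst q) (L p \<otimes>[TX] L q \<otimes>[TX] L y)"
     by (rule ksign_cong) (simp flip: d)
    then show "?s (fst x) (?s (fst p) (L p \<otimes>[TX] L q) \<otimes>[TX] L y) = G p q y" using Lc p q y by (simp add: sg G_def ag)
   qed
   finally show ?thesis .
  qed
  have b: "?s (fst x + (fst x - 1)) (L x \<otimes>[TX] csum R C TX y (%p q. ?s (fst p) (L p \<otimes>[TX] L q))) = ?s 1 (csum R C TX y (G x))"
  proof -
   have h: "(%t. ?s (fst x + (fst x - 1)) (L x \<otimes>[TX] t)) : Hom R TX TX" by (rule mh_ksignI[OF ralg_right[OF TX_ralg Lc(1)[OF x]] TXm])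
   have "?s (fst x + (fst x - 1)) (L x \<otimes>[TX] csum R C TX y (%p q. ?s (fst p) (L p \<otimes>[TX] L q))) =
     csum R C TX y (%p q. ?s (fst x + (fst x - 1)) (L x \<otimes>[TX] ?s (fst p) (L p \<otimes>[TX] L q)))"
    using Lc ag by (intro csum_hom[OF TXm h TXm y]) simp
   also have "... = csum R C TX y (%p q. ?s 1 (G x p q))"
    using Lc x by (intro csum_cong[OF y]) (simp add: sg G_def ag Tr.m_assoc, rule ksign_cong, simp)
   also have "... = ?s 1 (csum R C TX y (G x))" using x by (intro csum_ksign[OF TXm y, symmetric] Gc)
   finally show ?thesis .
  qed
  have k: "?s (fst x + 1) t = ?s (1 + fst x) t" "?s (fst x + (fst x - 1 + 1)) t = ?s (1 + 1) t" for t by (rule ksign_cong; simp)+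
  have p: "csum R C TX x (%p q. G p q y) : car TX" "csum R C TX y (G x) : car TX" using x y by (auto intro!: csum_closed[OF TXm] Gc)
  show ?thesis unfolding E' E_def D_mult[OF Lc(1)[OF x] Lc(1)[OF y]] gam_L[OF x] D_L[OF x] D_L[OF y] DL_def using Lc x y cc ag p a b
   by (simp add: sg Tr.l_distr Tr.r_distr k ksign_even P.a_ac)
 qed
 have "D (D (L c)) = ?s 1 (D (L (dh C c))) \<oplus>[TX] csum R C TX c (%x y. ?s (fst x) (D (L x \<otimes>[TX] L y)))"
 proof -
  have "D (csum R C TX c (%x y. ?s (fst x) (L x \<otimes>[TX] L y))) = csum R C TX c (%x y. ?s (fst x) (D (L x \<otimes>[TX] L y)))"
   using Lc ag by (subst csum_hom[OF TXm D_hom TXm c]) (auto intro!: csum_cong[OF c] simp: mh_ksign[OF D_hom TXm TXm])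
  then show ?thesis unfolding D_L[OF c] DL_def using Lc[OF c] cc[OF c] ag by (simp add: mh_add[OF D_hom] mh_ksign[OF D_hom TXm TXm])
 qed
 also have "csum R C TX c (%x y. ?s (fst x) (D (L x \<otimes>[TX] L y))) =
   csum R C TX c (%x y. ?s 1 (E x y) \<oplus>[TX] (csum R C TX x (%p q. G p q y) \<oplus>[TX] ?s 1 (csum R C TX y (G x))))"
  by (rule csum_cong[OF c]) (simp add: 2)
 also have "... = csum R C TX c (%x y. ?s 1 (E x y)) \<oplus>[TX] (csum R C TX c (%x y. csum R C TX x (%p q. G p q y)) \<oplus>[TX] csum R C TX c (%x y. ?s 1 (csum R C TX y (G x))))"
  using ag by (simp add: csum_add[OF TXm c] csum_closed[OF TXm] Ec Gc)
 also have "csum R C TX c (%x y. ?s 1 (csum R C TX y (G x))) = ?s 1 (csum R C TX c (%x y. csum R C TX x (%p q. G p q y)))"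
  using csum_ksign[OF TXm c, of "%x y. csum R C TX y (G x)" 1] by (simp add: csum_closed[OF TXm] Gc coassoc[OF Gtri c])
 finally show ?thesis using ag csum_closed[OF TXm c, of "%x y. ?s 1 (E x y)"] csum_closed[OF TXm c, of "%x y. csum R C TX x (%p q. G p q y)"]
   ksign_cancel[OF ag, of _ 0 1] ksign_cancel[OF ag, of _ 1 0] by (simp add: 1 csum_closed[OF TXm] Ec Gc P.a_assoc)
qed

lemma cobar_dga: "dga R (cobar R C)" unfolding dga_def
proof (intro conjI ballI)
 show "galg R (cobar R C)" by (rule galg)
 show "graded_map R (obj (cobar R C)) (obj (cobar R C)) (- 1) (bd (cobar R C))" by (rule cobar_bd_graded)
 show "D (x \<otimes>[TX] y) = D x \<otimes>[TX] y \<oplus>[TX] gam (cobar R C) x \<otimes>[TX] D y" if "x : car TX" "y : car TX" for x y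
  by (rule D_mult[OF that])
 interpret Tr: ring TX by (rule ralgD(2)[OF TX_ralg])
 note ag = P.abelian_group_axioms
 note gc = mh_closed[OF gam_hom[OF galg]]
 show "D (D x) = \<zero>[TX]" if x: "x : car TX" for x
 proof (rule W_ext[OF mh_comp[OF D_hom D_hom] mh_const_zero[OF TXm] TXm _ x])
  fix w assume "set w <= homs Vk"
  then show "D (D (W w)) = \<zero>[TX]"
  proof (induction w)
   case Nil
   show ?case by (simp add: Dt_W mh_zero[OF D_hom TXm TXm])
  next
   case (Cons l w)
   let ?c = "(fst l + 1, snd l)"
   have l: "l : homs Vk" and w: "set w <= homs Vk" using Cons.prems by auto
   have c: "?c : els C" using l by (simp add: homs_Vk homs_kC)
   have Wl: "W (l # w) = L ?c \<otimes>[TX] W w" using W_append[of "[l]" w] l w by (simp add: L_def bar_letter)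
   note x = L_closed[OF c] and y = W_closed[OF w]
   note cl = x y D_closed[OF x] D_closed[OF y] gc[OF x] D_closed[OF gc[OF x]] gc[OF D_closed[OF x]]
   have "D (D (W (l # w))) = gam (cobar R C) (D (L ?c)) \<otimes>[TX] D (W w) \<oplus>[TX] D (gam (cobar R C) (L ?c)) \<otimes>[TX] D (W w)"
    unfolding Wl D_mult[OF x y] using cl Cons.IH[OF w] by (simp add: mh_add[OF D_hom] D_mult DD_L[OF c] gam_gam[OF galg] D_closed)
   also have "... = \<zero>[TX]" using cl ksign_cancel[OF ag Tr.m_closed[OF cl(6) cl(4)], of 1 0]
    by (simp add: gam_Dt[OF galg cobar_bd_graded x] ralg_ksign[OF TX_ralg])
   finally show ?case .
  qed
 qed
qed

end

section \<open>The tensor product of two differential graded algebras\<close>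

lemma galg_left: "galg R X ==> b : els X ==> (%x. amult X i (fst b) x (snd b)) : Hom R (obj X i) (obj X (i + fst b))"
 unfolding galg_def using homs_snd by blast

lemma galg_right: "galg R X ==> a : els X ==> (%y. amult X (fst a) j (snd a) y) : Hom R (obj X j) (obj X (fst a + j))"
 unfolding galg_def using homs_snd by blast

lemma fst_hmult: "fst (hmult X a b) = fst a + fst b" by (simp add: hmult_def)

locale alg_pair = cring R for R :: "('r, 'm) ring_scheme" (structure) +
 fixes X :: "('r, 'a, 'z) chain_alg_scheme" and Y :: "('r, 'b, 'w) chain_alg_scheme"
 assumes X: "dga R X" and Y: "dga R Y"
begin

lemma R: "cring R" by (rule is_cring)
lemma gX: "galg R X" by (rule dgaD(1)[OF X])
lemma gY: "galg R Y" by (rule dgaD(1)[OF Y])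
lemma M: "gmod R (obj X)" using gX by (simp add: galg_def)
lemma N: "gmod R (obj Y)" using gY by (simp add: galg_def)

abbreviation "U == tensor_chain_alg R X Y"
abbreviation "TU == tensor_module R (obj X) (obj Y)"
abbreviation "ten == tens R (obj X) (obj Y)"

lemma U_simps [simp]: "obj U = TU" "bd U = tensor_bd R X Y"
 "aunit U = ten (0, aunit X) (0, aunit Y)" by (simp_all add: tensor_chain_alg_def)

lemma TUm: "module R (TU n)" by (rule tensor_module_module[OF R M N])

definition "\<Psi> n a b a' b' = ksign (TU n) (fst b * fst a') (ten (hmult X a a') (hmult Y b b'))"

lemma \<Psi>_hom:
 assumes n: "fst a + fst b + fst a' + fst b' = n"
 shows "[|a' : els X; b : els Y; b' : els Y|] ==> (%z. \<Psi> n (fst a, z) b a' b') : Hom R (obj X (fst a)) (TU n)"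
  and "[|a : els X; b : els Y; b' : els Y|] ==> (%z. \<Psi> n a b (fst a', z) b') : Hom R (obj X (fst a')) (TU n)"
  and "[|a : els X; a' : els X; b' : els Y|] ==> (%z. \<Psi> n a (fst b, z) a' b') : Hom R (obj Y (fst b)) (TU n)"
  and "[|a : els X; a' : els X; b : els Y|] ==> (%z. \<Psi> n a b a' (fst b', z)) : Hom R (obj Y (fst b')) (TU n)"
proof -
 have m: "fst a + fst a' + (fst b + fst b') = n" using n by simp
 have cX: "amult X (fst a) (fst a') (snd a) (snd a') : car (obj X (fst a + fst a'))" if "a : els X" "a' : els X" for a a'
  by (rule mh_closed[OF galg_left[OF gX that(2)] homs_snd[OF that(1)]])
 have cY: "amult Y (fst a) (fst a') (snd a) (snd a') : car (obj Y (fst a + fst a'))" if "a : els Y" "a' : els Y" for a a'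
  by (rule mh_closed[OF galg_left[OF gY that(2)] homs_snd[OF that(1)]])
 note L = mh_ksignI[OF mh_comp[OF _ tens_left[OF R M N cY m]] TUm]
 note Q = mh_ksignI[OF mh_comp[OF _ tens_right[OF R M N cX m]] TUm]
 show "[|a' : els X; b : els Y; b' : els Y|] ==> (%z. \<Psi> n (fst a, z) b a' b') : Hom R (obj X (fst a)) (TU n)"
  unfolding \<Psi>_def hmult_def fst_conv snd_conv by (rule L[OF galg_left[OF gX]])
 show "[|a : els X; b : els Y; b' : els Y|] ==> (%z. \<Psi> n a b (fst a', z) b') : Hom R (obj X (fst a')) (TU n)"
  unfolding \<Psi>_def hmult_def fst_conv snd_conv by (rule L[OF galg_right[OF gX]])
 show "[|a : els X; a' : els X; b' : els Y|] ==> (%z. \<Psi> n a (fst b, z) a' b') : Hom R (obj Y (fst b)) (TU n)"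
  unfolding \<Psi>_def hmult_def fst_conv snd_conv by (rule Q[OF galg_left[OF gY]])
 show "[|a : els X; a' : els X; b : els Y|] ==> (%z. \<Psi> n a b a' (fst b', z)) : Hom R (obj Y (fst b')) (TU n)"
  unfolding \<Psi>_def hmult_def fst_conv snd_conv by (rule Q[OF galg_right[OF gY]])
qed

lemma inner_biln:
 assumes a: "a : els X" and b: "b : els Y" and n: "fst a + fst b + m = n"
 shows "biln R (obj X) (obj Y) (TU n) m (%(a', b'). \<Psi> n a b a' b')" unfolding biln_def
proof (intro allI impI conjI ballI)
 fix i j assume ij: "i + j = m"
 show "(%z. (%(a', b'). \<Psi> n a b a' b') ((i, z), j, y)) : Hom R (obj X i) (TU n)" if "y : car (obj Y j)" for y
  using \<Psi>_hom(2)[of a b "(i, undefined)" "(j, y)" n] ij a b n that by simp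
 show "(%z. (%(a', b'). \<Psi> n a b a' b') ((i, y), j, z)) : Hom R (obj Y j) (TU n)" if "y : car (obj X i)" for y
  using \<Psi>_hom(4)[of a b "(i, y)" "(j, undefined)" n] ij a b n that by simp
qed

lemma outer_biln:
 assumes t: "t : car (TU k)" and n: "m + k = n"
 shows "biln R (obj X) (obj Y) (TU n) m (%(a, b). lift R (TU n) (%(a', b'). \<Psi> n a b a' b') t)" unfolding biln_def
proof (intro allI impI conjI ballI)
 fix i j assume ij: "i + j = m"
 show "(%z. (%(a, b). lift R (TU n) (%(a', b'). \<Psi> n a b a' b') t) ((i, z), j, y)) : Hom R (obj X i) (TU n)"
  if y: "y : car (obj Y j)" for y unfolding prod.case
 proof (rule lift_param[OF R M N TUm _ _ gmodD[OF M] t])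
  show "biln R (obj X) (obj Y) (TU n) k (%(a', b'). \<Psi> n (i, z) (j, y) a' b')" if "z : car (obj X i)" for z
   using that y ij n by (intro inner_biln) auto
  show "(%z. (%(a', b'). \<Psi> n (i, z) (j, y) a' b') (a', b')) : Hom R (obj X i) (TU n)"
   if "a' : els X" "b' : els Y" "fst a' + fst b' = k" for a' b' using \<Psi>_hom(1)[of "(i, undefined)" "(j, y)" a' b' n] that y ij n by simp
 qed
 show "(%z. (%(a, b). lift R (TU n) (%(a', b'). \<Psi> n a b a' b') t) ((i, x), j, z)) : Hom R (obj Y j) (TU n)"
  if x: "x : car (obj X i)" for x unfolding prod.case
 proof (rule lift_param[OF R M N TUm _ _ gmodD[OF N] t])
  show "biln R (obj X) (obj Y) (TU n) k (%(a', b'). \<Psi> n (i, x) (j, z) a' b')" if "z : car (obj Y j)" for z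
   using that x ij n by (intro inner_biln) auto
  show "(%z. (%(a', b'). \<Psi> n (i, x) (j, z) a' b') (a', b')) : Hom R (obj Y j) (TU n)"
   if "a' : els X" "b' : els Y" "fst a' + fst b' = k" for a' b' using \<Psi>_hom(3)[of "(i, x)" "(j, undefined)" a' b' n] that x ij n by simp
 qed
qed

lemma amult_U: "amult U m n s t = lift R (TU (m + n)) (%(a, b). lift R (TU (m + n)) (%(a', b'). \<Psi> (m + n) a b a' b') t) s"
proof -
 have 1: "(%((k, x'), (l, y')). ksign (TU N) (j * k) (ten (i + k, amult X i k x x') (j + l, amult Y j l y y'))) = (%(a', b'). \<Psi> N (i, x) (j, y) a' b')" for i x j y N
  by (auto simp: \<Psi>_def hmult_def)
 have 2: "(%((i, x), (j, y)). lift R (TU N) (%(a', b'). \<Psi> N (i, x) (j, y) a' b') t) = (%(a, b). lift R (TU N) (%(a', b'). \<Psi> N a b a' b') t)" for N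
  by auto
 show ?thesis by (simp add: tensor_chain_alg_def Let_def 1 2)
qed

lemma amult_left: "t : car (TU n) ==> (%s. amult U m n s t) : Hom R (TU m) (TU (m + n))"
 unfolding amult_U by (rule liftn_hom[OF R M N TUm outer_biln]) auto

lemma amult_right:
 assumes s: "s : car (TU m)" shows "(%t. amult U m n s t) : Hom R (TU n) (TU (m + n))" unfolding amult_U
proof (rule lift_param[OF R M N TUm _ _ TUm s])
 show "biln R (obj X) (obj Y) (TU (m + n)) m (%(a, b). lift R (TU (m + n)) (%(a', b'). \<Psi> (m + n) a b a' b') t)" if "t : car (TU n)" for t
  by (rule outer_biln[OF that refl])
 show "(%t. (%(a, b). lift R (TU (m + n)) (%(a', b'). \<Psi> (m + n) a b a' b') t) (a, b)) : Hom R (TU n) (TU (m + n))"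
  if "a : els X" "b : els Y" "fst a + fst b = m" for a b unfolding prod.case using that by (intro liftn_hom[OF R M N TUm inner_biln]) auto
qed

lemma amult_tens:
 assumes "a : els X" "b : els Y" "a' : els X" "b' : els Y" "fst a + fst b = m" "fst a' + fst b' = n"
 shows "amult U m n (ten a b) (ten a' b') = \<Psi> (m + n) a b a' b'"
 using liftn_tens[OF R M N TUm outer_biln[OF tens_closed[OF R M N assms(3,4,6)] refl] assms(1,2,5)]
  liftn_tens[OF R M N TUm inner_biln assms(3,4,6), of a b "m + n"] assms by (simp add: amult_U)

lemma amult_assoc:
 assumes x: "x : car (TU l)" and y: "y : car (TU m)" and z: "z : car (TU n)"
 shows "amult U (l + m) n (amult U l m x y) z = amult U l (m + n) x (amult U m n y z)"
proof -
 note L = amult_left and Q = amult_right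
 have l3: "TU (l + m + n) = TU (l + (m + n))" by (simp add: add.assoc)
 have 1: "amult U (l + m) n (amult U l m (ten a b) (ten a' b')) z = amult U l (m + n) (ten a b) (amult U m n (ten a' b') z)"
  if a: "a : els X" "b : els Y" "fst a + fst b = l" and a': "a' : els X" "b' : els Y" "fst a' + fst b' = m" for a b a' b'
 proof (rule tensor_ext[OF R M N Q[of _ "l + m" n, unfolded l3] mh_comp[OF Q[of _ m n] Q] TUm _ z])
  show c: "ten a b : car (TU l)" "ten a' b' : car (TU m)" using a a' by (auto intro!: tens_closed[OF R M N])
  show "amult U l m (ten a b) (ten a' b') : car (TU (l + m))" by (rule mh_closed[OF L[OF c(2)] c(1)])
  fix p q assume p: "p : els X" "q : els Y" "fst p + fst q = n"
  have h: "hmult X a a' : els X" "hmult Y b b' : els Y" "hmult X a' p : els X" "hmult Y b' q : els Y"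
   using a a' p hmult_homs[OF gX] hmult_homs[OF gY] by auto

  have tc: "ten (hmult X a a') (hmult Y b b') : car (TU (l + m))" "ten (hmult X a' p) (hmult Y b' q) : car (TU (m + n))" "ten p q : car (TU n)"
   using a a' p h by (auto intro!: tens_closed[OF R M N] simp: hmult_def)
  have as: "hmult X (hmult X a a') p = hmult X a (hmult X a' p)" "hmult Y (hmult Y b b') q = hmult Y b (hmult Y b' q)"
   using gX gY a a' p unfolding galg_def hmult_def homs_def by (auto simp: add.assoc)
  have tc3: "ten (hmult X a (hmult X a' p)) (hmult Y b (hmult Y b' q)) : car (TU (l + (m + n)))"
   using a a' p h hmult_homs[OF gX a(1) h(3)] hmult_homs[OF gY a(2) h(4)] by (auto intro!: tens_closed[OF R M N] simp: hmult_def)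
  have ag: "abelian_group (TU n)" for n using TUm by (simp add: module_def)
  have "amult U (l + m) n (amult U l m (ten a b) (ten a' b')) (ten p q) =
    ksign (TU (l + m + n)) (fst b * fst a') (amult U (l + m) n (ten (hmult X a a') (hmult Y b b')) (ten p q))"
   using mh_ksign[OF L[OF tc(3), of "l + m"] TUm TUm tc(1)] a a' by (simp add: amult_tens \<Psi>_def)
  also have "... = ksign (TU (l + (m + n))) (fst b * fst a' + (fst b + fst b') * fst p) (ten (hmult X a (hmult X a' p)) (hmult Y b (hmult Y b' q)))"
   using a a' p h tc3 by (simp add: amult_tens \<Psi>_def hmult_def[of Y b b'] hmult_def[of X a a'] as[unfolded hmult_def[of Y b b'] hmult_def[of X a a']] l3 ksign_ksign[OF ag])
  also have "... = ksign (TU (l + (m + n))) (fst b' * fst p + fst b * (fst a' + fst p)) (ten (hmult X a (hmult X a' p)) (hmult Y b (hmult Y b' q)))"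
   by (rule ksign_cong) (simp add: algebra_simps)
  also have "... = ksign (TU (l + (m + n))) (fst b' * fst p) (amult U l (m + n) (ten a b) (ten (hmult X a' p) (hmult Y b' q)))"
   using a a' p h tc3 by (subst amult_tens) (simp_all add: \<Psi>_def ksign_ksign[OF ag] fst_hmult)
  also have "... = amult U l (m + n) (ten a b) (amult U m n (ten a' b') (ten p q))"
   using mh_ksign[OF Q[OF c(1), of "m + n"] TUm TUm tc(2)] a' p by (simp add: amult_tens \<Psi>_def)
  finally show "amult U (l + m) n (amult U l m (ten a b) (ten a' b')) (ten p q) = amult U l (m + n) (ten a b) (amult U m n (ten a' b') (ten p q))" .
 qed
 have 2: "amult U (l + m) n (amult U l m (ten a b) y) z = amult U l (m + n) (ten a b) (amult U m n y z)"
  if a: "a : els X" "b : els Y" "fst a + fst b = l" for a b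
 proof (rule tensor_ext[OF R M N mh_comp[OF Q[of _ l m] L[OF z, of "l + m", unfolded l3]] mh_comp[OF L[OF z] Q] TUm _ y])
  show "ten a b : car (TU l)" "ten a b : car (TU l)" using a by (auto intro!: tens_closed[OF R M N])
 qed (rule 1[OF a])
 show ?thesis by (rule tensor_ext[OF R M N mh_comp[OF L[OF y] L[OF z, of "l + m", unfolded l3]] L[OF mh_closed[OF L[OF z] y]] TUm _ x]) (rule 2)
qed

lemma unit_homs: "(0, aunit X) : els X" "(0, aunit Y) : els Y" using gX gY by (simp_all add: galg_def)

lemma hmult_unit: "a : els X ==> hmult X (0, aunit X) a = a" "a : els X ==> hmult X a (0, aunit X) = a"
 "b : els Y ==> hmult Y (0, aunit Y) b = b" "b : els Y ==> hmult Y b (0, aunit Y) = b" using gX gY by (auto simp: galg_def hmult_def homs_def)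

lemma U_galg: "galg R U"
proof -
 have uc: "ten (0, aunit X) (0, aunit Y) : car (TU 0)" by (rule tens_closed[OF R M N unit_homs]) simp
 have u1: "amult U 0 n (ten (0, aunit X) (0, aunit Y)) x = x" if "x : car (TU n)" for n x
  by (rule tensor_ext[OF R M N amult_right[OF uc, of n, unfolded add_0_left] mh_id TUm _ that])
   (simp add: amult_tens[of "(0, aunit X)" "(0, aunit Y)", simplified] unit_homs[simplified] \<Psi>_def hmult_unit)
 have u2: "amult U n 0 x (ten (0, aunit X) (0, aunit Y)) = x" if "x : car (TU n)" for n x
  by (rule tensor_ext[OF R M N amult_left[OF uc, of n, unfolded add_0_right] mh_id TUm _ that])
   (simp add: amult_tens[of _ _ "(0, aunit X)" "(0, aunit Y)", simplified] unit_homs[simplified] \<Psi>_def hmult_unit)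
 show ?thesis unfolding galg_def U_simps using R tensor_gmod[OF R M N] amult_left amult_right amult_assoc u1 u2 uc by blast
qed

end

definition "hdeg Z n = {EL Z (n, z) | z. z : car (obj Z n)}"

lemma hdeg_EL: "a : els Z ==> fst a = n ==> EL Z a : hdeg Z n" by (cases a) (auto simp: hdeg_def)

lemma hdegE: "y : hdeg Z n ==> (!!z. z : car (obj Z n) ==> y = EL Z (n, z) ==> thesis) ==> thesis" by (auto simp: hdeg_def)

context
 fixes R :: "('r, 'm) ring_scheme" and Z :: "('r, 'a, 'z) chain_alg_scheme"
 assumes Z: "galg R Z"
begin

private lemma Zn: "module R (obj Z n)" using Z by (simp add: galg_def gmod_def)

lemma hdeg_closed: "y : hdeg Z n ==> y : car (Tot Z)" using EL_closed[OF Z] by (auto simp: hdeg_def)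

lemma hdeg_zero: "\<zero>[Tot Z] : hdeg Z n"
 using EL_zero[OF Z, of n, symmetric] abelian_monoid.zero_closed[OF abelian_group.axioms(1)[OF module.axioms(2)[OF Zn]]] by (auto simp: hdeg_def)

lemma hdeg_add: "x : hdeg Z n ==> y : hdeg Z n ==> x \<oplus>[Tot Z] y : hdeg Z n"
proof -
 assume "x : hdeg Z n" "y : hdeg Z n"
 then obtain a b where "a : car (obj Z n)" "x = EL Z (n, a)" "b : car (obj Z n)" "y = EL Z (n, b)" by (auto simp: hdeg_def)
 then show ?thesis using lin_add[OF EL_lin[OF Z], of a n b, symmetric] abelian_monoid.a_closed[OF abelian_group.axioms(1)[OF module.axioms(2)[OF Zn]]]
  by (auto simp: hdeg_def)
qed

lemma hdeg_smult: "r : car R ==> x : hdeg Z n ==> r \<odot>[Tot Z] x : hdeg Z n"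
proof -
 assume r: "r : car R" and "x : hdeg Z n"
 then obtain a where "a : car (obj Z n)" "x = EL Z (n, a)" by (auto simp: hdeg_def)
 then show ?thesis using lin_smult[OF EL_lin[OF Z] r, of a n, symmetric] module.smult_closed[OF Zn r] by (auto simp: hdeg_def)
qed

lemma hdeg_ksign: "x : hdeg Z n ==> ksign (Tot Z) k x : hdeg Z n"
proof -
 assume "x : hdeg Z n"
 then obtain a where a: "a : car (obj Z n)" "x = EL Z (n, a)" by (auto simp: hdeg_def)
 then show ?thesis using lin_ksign[OF EL_lin[OF Z] Zn Tot_module[OF Z] a(1), of k, symmetric] ksign_closed[OF module.axioms(2)[OF Zn] a(1)]
  by (auto simp: hdeg_def)
qed

lemma hdeg_mult: "x : hdeg Z m ==> y : hdeg Z n ==> m + n = k ==> x \<otimes>[Tot Z] y : hdeg Z k"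
proof -
 assume k: "m + n = k" and "x : hdeg Z m" "y : hdeg Z n"
 then obtain a b where a: "a : car (obj Z m)" "x = EL Z (m, a)" and b: "b : car (obj Z n)" "y = EL Z (n, b)" by (auto simp: hdeg_def)
 show ?thesis using EL_mult[OF Z, of "(m, a)" "(n, b)"] hmult_homs[OF Z, of "(m, a)" "(n, b)"] a b k by (auto simp: hdeg_def hmult_def)
qed

lemma hdeg_one: "\<one>[Tot Z] : hdeg Z 0" using Z by (auto simp: hdeg_def galg_def Tot_def Let_def tot_simps)

lemma hdeg_gam: "x : hdeg Z n ==> gam Z x = ksign (Tot Z) n x" using gam_EL[OF Z] by (auto simp: hdeg_def)

lemma hdeg_csum:
 assumes C: "comultiplicative R C" and a: "a : els C"
  and F: "!!x y. [|x : els C; y : els C; fst x + fst y = fst a|] ==> F x y : hdeg Z n"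
 shows "csum R C (Tot Z) a F : hdeg Z n"
proof -
 have "F (fst p) (snd p) : hdeg Z n" if "p : set (sw R C a)" for p using comultiplicative.sw_spec[OF C a] F that by blast
 then have "lsum (Tot Z) (%p. F (fst p) (snd p)) xs : hdeg Z n" if "set xs <= set (sw R C a)" for xs
  using that by (induction xs) (simp_all add: hdeg_zero hdeg_add)
 then show ?thesis by (simp add: csum_def)
qed

lemma hdeg_tn:
 assumes R: "cring R" "gmod R M" "gmod R N" and F: "lin R (tensor_module R M N) (Tot Z) F"
  and d: "!!a b. [|a : homs M; b : homs N|] ==> F (tn R M N a b) : hdeg Z (fst a + fst b + k)"
  and t: "t : homs (tensor_module R M N)"
 shows "F t : hdeg Z (fst t + k)"
proof -
 obtain n x where nx: "t = (n, x)" "x : car (tensor_module R M N n)" using t by (cases t) auto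
 have "F (n, x) : hdeg Z (n + k)" using nx(2)
 proof (induction rule: tensor_induct[OF R, consumes 1, case_names zero add])
  case zero
  show ?case using lin_zero[OF F tensor_module_module[OF R] Tot_module[OF Z]] hdeg_zero by simp
 next
  case (add x a b)
  have "tens R M N a b : car (tensor_module R M N n)" using add by (intro tens_closed[OF R]) auto
  then show ?case using lin_add[OF F _ add(1)] d[OF add(2,3)] add by (auto simp: tn_def intro: hdeg_add)
 qed
 then show ?thesis by (simp add: nx)
qed

end

section \<open>Maps out of the ring of words\<close>

context word_alg
begin

lemma hdeg_W: "set w <= homs V ==> W w : hdeg X (word_deg w)" unfolding W_def by (rule hdeg_EL) (auto simp: obj_X intro!: word_closed[OF R V])

lemma hdeg_hom:
 assumes Z: "galg R Z" and G: "G : Hom R TX (Tot Z)"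
  and d: "!!w. set w <= homs V ==> G (W w) : hdeg Z (word_deg w + k)"
  and x: "x : car (TA n)"
 shows "G (EL X (n, x)) : hdeg Z (n + k)" using x
proof (induction rule: word_induct[OF R V, consumes 1, case_names zero add])
 case zero
 have "G (EL X (n, \<zero>[TA n])) = \<zero>[Tot Z]" using EL_zero[OF galg, of n] mh_zero[OF G TXm Tot_module[OF Z]] by (simp add: obj_X)
 then show ?case using hdeg_zero[OF Z] by simp
next
 case (add t r w)
 note e = mh_comp[OF lin_hom[OF EL_lin[OF galg, unfolded obj_X], of n] G]
 have wc: "word R V w : car (TA n)" by (rule word_closed[OF R V add(3,4)])
 have "G (EL X (n, word R V w)) : hdeg Z (n + k)" using d[OF add(3)] add(4) by (simp add: W_def)
 then show ?case using mh_add[OF e add(1) module.smult_closed[OF TAm add(2) wc]] mh_smult[OF e add(2) wc] add(5) add(2)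
  by (auto simp: obj_X intro!: hdeg_add[OF Z] hdeg_smult[OF Z])
qed

context
 fixes P :: "('r, 'b) module" and \<phi>
 assumes P: "ralg R P" and \<phi>: "lin R V P \<phi>"
begin

interpretation PR: ring P by (rule ralgD(2)[OF P])
interpretation PM: module R P by (rule ralgD(1)[OF P])

primrec aw :: "'v homog list => 'b" where
 "aw [] = \<one>[P]"
| "aw (l # w) = \<phi> l \<otimes>[P] aw w"

lemma aw_closed: "set w <= homs V ==> aw w : car P" by (induction w) (auto intro: lin_closed[OF \<phi>])

lemma aw_mul: "mul R V P aw"
proof (rule mulI)
 show "aw [] : car P" by simp
 fix u w assume u: "set u <= homs V" and w: "set w <= homs V"
 show "lin R V P (%l. aw (u @ l # w))" using u
 proof (induction u)
  case Nil
  show ?case using lin_comp[OF \<phi> ralg_left[OF P aw_closed[OF w]]] by simp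
 next
  case (Cons x u)
  then show ?case using lin_comp[OF _ ralg_right[OF P lin_closed[OF \<phi>, of x]]] by simp
 qed
qed

definition "ahom = wext P aw"

lemma ahom_hom: "ahom : Hom R TX P" unfolding ahom_def by (rule wext_hom[OF PM.module_axioms aw_mul])

lemma ahom_W: "set w <= homs V ==> ahom (W w) = aw w" unfolding ahom_def by (rule wext_W[OF PM.module_axioms aw_mul])

lemma ahom_letter: "l : homs V ==> ahom (W [l]) = \<phi> l" using lin_closed[OF \<phi>] by (simp add: ahom_W)

lemma ahom_one: "ahom \<one>[TX] = \<one>[P]" using ahom_W[of "[]"] by (simp add: W_Nil)

lemma ahom_mult:
 assumes x: "x : car TX" and y: "y : car TX"
 shows "ahom (x \<otimes>[TX] y) = ahom x \<otimes>[P] ahom y"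
proof -
 have T: "ralg R TX" by (rule Tot_ralg[OF galg])
 note l = ralg_left and r = ralg_right and h = ahom_hom
 have 1: "ahom (W u \<otimes>[TX] W v) = ahom (W u) \<otimes>[P] ahom (W v)" if "set u <= homs V" "set v <= homs V" for u v
 proof -
  have "aw (u @ v) = aw u \<otimes>[P] aw v" using that by (induction u) (auto simp: PR.m_assoc aw_closed lin_closed[OF \<phi>])
  then show ?thesis using that by (simp add: W_append ahom_W)
 qed
 have 2: "ahom (W u \<otimes>[TX] y) = ahom (W u) \<otimes>[P] ahom y" if u: "set u <= homs V" for u
  by (rule W_ext[OF mh_comp[OF r[OF T W_closed[OF u]] h] mh_comp[OF h r[OF P mh_closed[OF h W_closed[OF u]]]] PM.module_axioms 1[OF u] y])
 show ?thesis by (rule W_ext[OF mh_comp[OF l[OF T y] h] mh_comp[OF h l[OF P mh_closed[OF h y]]] PM.module_axioms 2 x])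
qed

end

lemma ahom_unique:
 assumes P: "ralg R P" and f: "f : Hom R TX P" and g: "g : Hom R TX P"
  and f1: "f \<one>[TX] = \<one>[P]" and g1: "g \<one>[TX] = \<one>[P]"
  and fm: "!!x y. [|x : car TX; y : car TX|] ==> f (x \<otimes>[TX] y) = f x \<otimes>[P] f y"
  and gm: "!!x y. [|x : car TX; y : car TX|] ==> g (x \<otimes>[TX] y) = g x \<otimes>[P] g y"
  and eq: "!!l. l : homs V ==> f (W [l]) = g (W [l])" and x: "x : car TX"
 shows "f x = g x"
proof (rule W_ext[OF f g ralgD(1)[OF P] _ x])
 fix w assume "set w <= homs V"
 then show "f (W w) = g (W w)"
 proof (induction w)
  case Nil show ?case using f1 g1 by (simp add: W_Nil)
 next
  case (Cons l w)
  then have "W (l # w) = W [l] \<otimes>[TX] W w" using W_append[of "[l]" w] by simp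
  moreover have "W [l] : car TX" "W w : car TX" using Cons.prems by (auto intro: W_closed)
  ultimately show ?case using Cons eq fm gm by simp
 qed
qed

lemma ahom_chain:
 assumes X: "dga R X" and Z: "dga R Z" and f: "f : Hom R TX (Tot Z)"
  and f1: "f \<one>[TX] = \<one>[Tot Z]"
  and fm: "!!x y. [|x : car TX; y : car TX|] ==> f (x \<otimes>[TX] y) = f x \<otimes>[Tot Z] f y"
  and deg: "!!l. l : homs V ==> f (W [l]) : hdeg Z (fst l)"
  and eq: "!!l. l : homs V ==> f (Dt X (W [l])) = Dt Z (f (W [l]))" and x: "x : car TX"
 shows "f (Dt X x) = Dt Z (f x)"
proof (rule W_ext[OF mh_comp[OF Dt_hom[OF X] f] mh_comp[OF f Dt_hom[OF Z]] Tot_module[OF dgaD(1)[OF Z]] _ x])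
 have one: "Dt Y \<one>[Tot Y] = \<zero>[Tot Y]" if Y: "dga R Y" for Y :: "('r, 'x, 'y) chain_alg_scheme"
 proof -
  have gY: "galg R Y" by (rule dgaD[OF Y])
  interpret YR: ring "Tot Y" by (rule ralgD(2)[OF Tot_ralg[OF gY]])
  have c: "Dt Y \<one>[Tot Y] : car (Tot Y)" by (rule mh_closed[OF Dt_hom[OF Y]]) simp
  have "Dt Y \<one>[Tot Y] = Dt Y \<one>[Tot Y] \<oplus>[Tot Y] Dt Y \<one>[Tot Y]"
   using Dt_mult[OF Y YR.one_closed YR.one_closed] c by (simp add: gam_one[OF gY])
  then show ?thesis using c YR.add.r_cancel_one' by metis
 qed
 have ZR: "ralg R (Tot Z)" by (rule Tot_ralg[OF dgaD(1)[OF Z]])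
 fix w assume "set w <= homs V"
 then show "f (Dt X (W w)) = Dt Z (f (W w))"
 proof (induction w)
  case Nil show ?case using one[OF X] one[OF Z] f1 mh_zero[OF f TXm Tot_module[OF dgaD(1)[OF Z]]] by (simp add: W_Nil)
 next
  case (Cons l w)
  have l: "l : homs V" and w: "set w <= homs V" using Cons.prems by auto
  have Wl: "W (l # w) = W [l] \<otimes>[TX] W w" using W_append[of "[l]" w] l w by simp
  have c: "W [l] : car TX" "W w : car TX" using l w by (auto intro: W_closed)
  note D = mh_closed[OF Dt_hom[OF X]] and g = mh_closed[OF gam_hom[OF galg]]
  interpret TXR: ring TX by (rule ralgD(2)[OF Tot_ralg[OF galg]])
  have "f (gam X (W [l])) = gam Z (f (W [l]))"
   using gam_W[of "[l]"] l c mh_ksign[OF f TXm Tot_module[OF dgaD(1)[OF Z]] c(1)] hdeg_gam[OF dgaD(1)[OF Z] deg[OF l]] by simp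
  then show ?case unfolding Wl Dt_mult[OF X c] fm[OF c] Dt_mult[OF Z mh_closed[OF f c(1)] mh_closed[OF f c(2)]]
   using c D g eq[OF l] Cons.IH[OF w] by (simp add: mh_add[OF f] fm)
 qed
qed

end

section \<open>Differential of the tensor product algebra\<close>

lemma hmult_dh:
 assumes X: "dga R X" and P: "module R P" and F: "lin R (obj X) P F" and a: "a : els X" and b: "b : els X"
 shows "F (dh X (hmult X a b)) = F (hmult X (dh X a) b) \<oplus>[P] ksign P (fst a) (F (hmult X a (dh X b)))"
proof -
 have g: "galg R X" by (rule dgaD[OF X])
 have M: "gmod R (obj X)" using g by (simp add: galg_def)
 have cx: "chain_complex R X" by (rule dga_chain_complex[OF X])
 let ?n = "fst a + fst b - 1"
 note da = dh_homs[OF cx a] and db = dh_homs[OF cx b]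
 have T: "ralg R (Tot X)" by (rule Tot_ralg[OF g])
 have D: "Dt X (EL X c) = EL X (dh X c)" for c using Dt_EL[OF X, of "fst c" "snd c"] by (simp add: dh_def)
 have c1: "snd (hmult X (dh X a) b) : car (obj X ?n)" "snd (hmult X a (dh X b)) : car (obj X ?n)"
  using hmult_homs[OF g da b] hmult_homs[OF g a db] by (simp_all add: hmult_def algebra_simps)
 have h: "hmult X (dh X a) b = (?n, snd (hmult X (dh X a) b))" "hmult X a (dh X b) = (?n, snd (hmult X a (dh X b)))"
  by (simp_all add: hmult_def algebra_simps)
 have "EL X (dh X (hmult X a b)) = Dt X (EL X a \<otimes>[Tot X] EL X b)" using EL_mult[OF g a b] D by simp
 also have "... = EL X (hmult X (dh X a) b) \<oplus>[Tot X] ksign (Tot X) (fst a) (EL X (hmult X a (dh X b)))"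
  using Dt_mult[OF X EL_closed[OF g a] EL_closed[OF g b]] EL_mult[OF g da b] EL_mult[OF g a db] EL_closed[OF g a] EL_closed[OF g db]
  by (simp add: D gam_EL[OF g a] ralg_ksign[OF T])
 also have "... = EL X (?n, snd (hmult X (dh X a) b) \<oplus>[obj X ?n] ksign (obj X ?n) (fst a) (snd (hmult X a (dh X b))))"
  unfolding lin_add[OF EL_lin[OF g] c1(1) ksign_closed[OF gmod_ag[OF M] c1(2)]]
   lin_ksign[OF EL_lin[OF g] gmodD[OF M] Tot_module[OF g] c1(2)] h[symmetric] ..
 finally have "dh X (hmult X a b) = (?n, snd (hmult X (dh X a) b) \<oplus>[obj X ?n] ksign (obj X ?n) (fst a) (snd (hmult X a (dh X b))))"
  by (intro prod_eqI) (simp_all add: fst_hmult dh_def el_inj)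
 then show ?thesis using lin_add[OF F c1(1) ksign_closed[OF gmod_ag[OF M] c1(2)]] lin_ksign[OF F gmodD[OF M] P c1(2)] h by simp
qed

context alg_pair
begin

abbreviation "TT == Tot U"

lemma TTm: "module R TT" by (rule Tot_module[OF U_galg])
lemma TTr: "ralg R TT" by (rule Tot_ralg[OF U_galg])
lemma TTag: "abelian_group TT" by (rule ralgD(3)[OF TTr])

definition "tt a b = EL U (tn R (obj X) (obj Y) a b)"

lemma EL_U_lin: "lin R TU TT (EL U)" using EL_lin[OF U_galg] by simp

lemma tt_bil: "bil R (obj X) (obj Y) TT tt" using lin_tn[OF R M N EL_U_lin] unfolding tt_def .

lemma tt_closed: "a : els X ==> b : els Y ==> tt a b : car TT" by (rule bil_closed[OF tt_bil])

lemma tt_hdeg: "a : els X ==> b : els Y ==> fst a + fst b = n ==> tt a b : hdeg U n"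
 unfolding tt_def by (rule hdeg_EL) (simp_all add: tn_homs[OF R M N])

lemma tt_mult:
 assumes a: "a : els X" and b: "b : els Y" and a': "a' : els X" and b': "b' : els Y"
 shows "tt a b \<otimes>[TT] tt a' b' = ksign TT (fst b * fst a') (tt (hmult X a a') (hmult Y b b'))"
proof -
 let ?n = "fst a + fst b + (fst a' + fst b')"
 have c: "ten (hmult X a a') (hmult Y b b') : car (TU ?n)"
  using hmult_homs[OF gX a a'] hmult_homs[OF gY b b'] by (intro tens_closed[OF R M N]) (auto simp: fst_hmult)
 have "tt a b \<otimes>[TT] tt a' b' = EL U (?n, \<Psi> ?n a b a' b')"
  using EL_mult[OF U_galg, of "tn R (obj X) (obj Y) a b" "tn R (obj X) (obj Y) a' b'"] tn_homs[OF R M N a b] tn_homs[OF R M N a' b']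
  by (simp add: tt_def hmult_def[of U]) (simp add: tn_def amult_tens a b a' b')
 also have "... = ksign TT (fst b * fst a') (EL U (?n, ten (hmult X a a') (hmult Y b b')))"
  unfolding \<Psi>_def using lin_ksign[OF EL_U_lin TUm TTm c] by simp
 finally show ?thesis by (simp add: tt_def tn_def fst_hmult algebra_simps)
qed

lemma U_bd_graded: "graded_map R (obj U) (obj U) (- 1) (bd U)"
 using tensor_bd_hom[OF R dga_chain_complex[OF X] dga_chain_complex[OF Y]] by (simp add: graded_map_def)

lemma D_tt:
 assumes a: "a : els X" and b: "b : els Y"
 shows "Dt U (tt a b) = tt (dh X a) b \<oplus>[TT] ksign TT (fst a) (tt a (dh Y b))"
 using tensor_bd_tn[OF R dga_chain_complex[OF X] dga_chain_complex[OF Y] EL_U_lin TTm a b]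
  Dt_EL'[OF U_galg U_bd_graded, of "fst a + fst b" "ten a b"] by (simp add: tt_def tn_def[of _ _ _ a b])

lemma U_ext:
 assumes f: "f : Hom R TT P" and g: "g : Hom R TT P" and P: "module R P"
  and eq: "!!a b. [|a : els X; b : els Y|] ==> f (tt a b) = g (tt a b)" and t: "t : car TT"
 shows "f t = g t"
proof (rule Tot_ext[OF U_galg f g P _ t])
 fix a assume "a : els U"
 then show "f (EL U a) = g (EL U a)" using tn_ext[OF R M N P lin_comp[OF EL_U_lin f] lin_comp[OF EL_U_lin g]] eq by (simp add: tt_def)
qed

lemma gam_tt: "a : els X ==> b : els Y ==> gam U (tt a b) = ksign TT (fst a + fst b) (tt a b)" by (rule hdeg_gam[OF U_galg tt_hdeg]) auto

lemma U_dga: "dga R U" unfolding dga_def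
proof (intro conjI ballI)
 show "galg R U" by (rule U_galg)
 show "graded_map R (obj U) (obj U) (- 1) (bd U)" by (rule U_bd_graded)
 note cX = dga_chain_complex[OF X] and cY = dga_chain_complex[OF Y]
 note dX = dh_homs[OF cX] and dY = dh_homs[OF cY]
 note D = Dt_hom'[OF U_galg U_bd_graded] and l = ralg_left[OF TTr] and r = ralg_right[OF TTr] and gh = gam_hom[OF U_galg]
 note sg = ksign_add[OF TTag] ksign_ksign[OF TTag] ralg_ksign[OF TTr] TTag
 interpret TR: ring TT by (rule ralgD(2)[OF TTr])
 have 1: "Dt U (tt a b \<otimes>[TT] tt a' b') = Dt U (tt a b) \<otimes>[TT] tt a' b' \<oplus>[TT] gam U (tt a b) \<otimes>[TT] Dt U (tt a' b')"
  if a: "a : els X" and b: "b : els Y" and a': "a' : els X" and b': "b' : els Y" for a b a' b'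
 proof -
  note h = hmult_homs[OF gX a a'] hmult_homs[OF gY b b'] hmult_homs[OF gX dX[OF a] a'] hmult_homs[OF gX a dX[OF a']]
   hmult_homs[OF gY dY[OF b] b'] hmult_homs[OF gY b dY[OF b']]
  have cl: "tt (hmult X (dh X a) a') (hmult Y b b') : car TT" "tt (hmult X a (dh X a')) (hmult Y b b') : car TT"
   "tt (hmult X a a') (hmult Y (dh Y b) b') : car TT" "tt (hmult X a a') (hmult Y b (dh Y b')) : car TT"
   "tt (hmult X a a') (hmult Y b b') : car TT"
   "tt a b : car TT" "tt a' b' : car TT" "tt (dh X a) b : car TT" "tt a (dh Y b) : car TT"
   "tt (dh X a') b' : car TT" "tt a' (dh Y b') : car TT" by (intro tt_closed h a b a' b' dX dY)+
  have k: "ksign TT (fst b * fst a' + (fst a + fst a')) t = ksign TT (fst a + (fst b - 1) * fst a') t"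
   "ksign TT (fst b * fst a' + fst a) t = ksign TT (fst a + fst b + fst b * (fst a' - 1)) t"
   "ksign TT (fst b * fst a' + (fst a + fst a' + fst b)) t = ksign TT (fst a' + (fst a + fst b + fst b * fst a')) t"
   "ksign TT (fst a + fst b + (fst a' + fst b * fst a')) t = ksign TT (fst a' + (fst a + fst b + fst b * fst a')) t" for t
   by (auto intro!: ksign_cong simp: algebra_simps)
  have "Dt U (tt a b \<otimes>[TT] tt a' b') = ksign TT (fst b * fst a')
    ((tt (hmult X (dh X a) a') (hmult Y b b') \<oplus>[TT] ksign TT (fst a) (tt (hmult X a (dh X a')) (hmult Y b b'))) \<oplus>[TT]
     ksign TT (fst a + fst a') (tt (hmult X a a') (hmult Y (dh Y b) b') \<oplus>[TT] ksign TT (fst b) (tt (hmult X a a') (hmult Y b (dh Y b')))))"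
   unfolding tt_mult[OF a b a' b'] mh_ksign[OF D TTm TTm cl(5)] D_tt[OF h(1,2)]
    hmult_dh[OF X TTm bil_left[OF tt_bil h(2)] a a'] hmult_dh[OF Y TTm bil_right[OF tt_bil h(1)] b b'] fst_hmult ..
  also have "... = (tt (dh X a) b \<oplus>[TT] ksign TT (fst a) (tt a (dh Y b))) \<otimes>[TT] tt a' b' \<oplus>[TT]
    ksign TT (fst a + fst b) (tt a b) \<otimes>[TT] (tt (dh X a') b' \<oplus>[TT] ksign TT (fst a') (tt a' (dh Y b')))"
   using cl by (simp add: sg TR.l_distr TR.r_distr tt_mult a b a' b' dX dY k TR.a_ac)
  finally show ?thesis unfolding D_tt[OF a b] D_tt[OF a' b'] gam_tt[OF a b] .
 qed
 have Dc: "Dt U x : car TT" if "x : car TT" for x by (rule mh_closed[OF D that])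
 have gc: "gam U x : car TT" if "x : car TT" for x by (rule mh_closed[OF gh that])
 fix x y assume x: "x : car TT" and y: "y : car TT"
 have 2: "Dt U (tt a b \<otimes>[TT] y) = Dt U (tt a b) \<otimes>[TT] y \<oplus>[TT] gam U (tt a b) \<otimes>[TT] Dt U y"
  if a: "a : els X" and b: "b : els Y" for a b
  by (rule U_ext[OF mh_comp[OF r[OF tt_closed[OF a b]] D] mh_plus[OF r[OF Dc[OF tt_closed[OF a b]]] mh_comp[OF D r[OF gc[OF tt_closed[OF a b]]]] TTm] TTm 1[OF a b] y])
 show "Dt U (x \<otimes>[TT] y) = Dt U x \<otimes>[TT] y \<oplus>[TT] gam U x \<otimes>[TT] Dt U y"
  by (rule U_ext[OF mh_comp[OF l[OF y] D] mh_plus[OF mh_comp[OF D l[OF y]] mh_comp[OF gh l[OF Dc[OF y]]] TTm] TTm 2 x])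
next
 note cX = dga_chain_complex[OF X] and cY = dga_chain_complex[OF Y]
 note D = Dt_hom'[OF U_galg U_bd_graded]
 have cc: "chain_complex R (tensor_cx R X Y)" by (rule tensor_cx_chain_complex[OF R cX cY])
 fix x assume x: "x : car TT"
 show "Dt U (Dt U x) = \<zero>[TT]"
 proof (rule Tot_ext[OF U_galg mh_comp[OF D D] mh_const_zero[OF TTm] TTm _ x])
  fix a assume a: "a : els U"
  obtain n y where ny: "a = (n, y)" "y : car (TU n)" using a by (cases a) auto
  have "tensor_bd R X Y (n - 1) (tensor_bd R X Y n y) = \<zero>[TU (n - 2)]" using cc ny unfolding chain_complex_def tensor_cx_def by simp
  then show "Dt U (Dt U (EL U a)) = \<zero>[TT]"
   using EL_zero[OF U_galg, of "n - 2"] Dt_EL'[OF U_galg U_bd_graded, of n y] Dt_EL'[OF U_galg U_bd_graded, of "n - 1" "tensor_bd R X Y n y"]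
   by (simp add: ny)
 qed
qed

end

lemma dga_one:
 assumes Y: "dga R Y" shows "Dt Y \<one>[Tot Y] = \<zero>[Tot Y]"
proof -
 have gY: "galg R Y" by (rule dgaD[OF Y])
 interpret YR: ring "Tot Y" by (rule ralgD(2)[OF Tot_ralg[OF gY]])
 have c: "Dt Y \<one>[Tot Y] : car (Tot Y)" by (rule mh_closed[OF Dt_hom[OF Y]]) simp
 have "Dt Y \<one>[Tot Y] = Dt Y \<one>[Tot Y] \<oplus>[Tot Y] Dt Y \<one>[Tot Y]"
  using Dt_mult[OF Y YR.one_closed YR.one_closed] c by (simp add: gam_one[OF gY])
 then show ?thesis using c YR.add.r_cancel_one' by metis
qed

lemma Tot_one: "\<one>[Tot X] = EL X (0, aunit X)" by (simp add: Tot_def Let_def tot_simps)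

lemma dga_unit_bd:
 assumes Y: "dga R Y" and F: "lin R (obj Y) P F" and P: "module R P"
 shows "F (dh Y (0, aunit Y)) = \<zero>[P]"
proof -
 have gY: "galg R Y" by (rule dgaD[OF Y])
 have "EL Y (- 1, bd Y 0 (aunit Y)) = EL Y (- 1, \<zero>[obj Y (- 1)])"
  using dga_one[OF Y] Dt_EL[OF Y, of 0 "aunit Y"] EL_zero[OF gY, of "- 1"] by (simp add: Tot_one)
 then have "bd Y 0 (aunit Y) = \<zero>[obj Y (- 1)]" by (rule el_inj)
 then show ?thesis using lin_zero[OF F _ P, of "- 1"] gY by (simp add: dh_def galg_def gmod_def)
qed

context alg_pair
begin

definition "inX = direct (obj X) TT (%a. tt a (0, aunit Y))"

definition "inY = direct (obj Y) TT (tt (0, aunit X))"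

lemma inX_hom: "inX : Hom R (Tot X) TT" unfolding inX_def by (rule Direct_hom[OF gX TTm bil_left[OF tt_bil unit_homs(2)]])

lemma inY_hom: "inY : Hom R (Tot Y) TT" unfolding inY_def by (rule Direct_hom[OF gY TTm bil_right[OF tt_bil unit_homs(1)]])

lemma inX_EL: "a : els X ==> inX (EL X a) = tt a (0, aunit Y)" unfolding inX_def by (rule Direct_el[OF gX TTm bil_left[OF tt_bil unit_homs(2)]])

lemma inY_EL: "b : els Y ==> inY (EL Y b) = tt (0, aunit X) b" unfolding inY_def by (rule Direct_el[OF gY TTm bil_right[OF tt_bil unit_homs(1)]])

lemma inX_one: "inX \<one>[Tot X] = \<one>[TT]" unfolding Tot_one inX_EL[OF unit_homs(1)] by (simp add: tt_def tn_def)

lemma inY_one: "inY \<one>[Tot Y] = \<one>[TT]" unfolding Tot_one inY_EL[OF unit_homs(2)] by (simp add: tt_def tn_def)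

lemma inX_mult:
 assumes x: "x : car (Tot X)" and y: "y : car (Tot X)"
 shows "inX (x \<otimes>[Tot X] y) = inX x \<otimes>[TT] inX y"
proof -
 note r = ralg_right and l = ralg_left and Tr = Tot_ralg[OF gX] and c = mh_closed[OF inX_hom]
 have 1: "inX (EL X a \<otimes>[Tot X] EL X b) = inX (EL X a) \<otimes>[TT] inX (EL X b)" if a: "a : els X" and b: "b : els X" for a b
  using hmult_homs[OF gX a b] by (simp add: EL_mult[OF gX a b] inX_EL a b tt_mult unit_homs[simplified] hmult_unit)
 have 2: "inX (EL X a \<otimes>[Tot X] y) = inX (EL X a) \<otimes>[TT] inX y" if a: "a : els X" for a
  by (rule Tot_ext[OF gX mh_comp[OF r[OF Tr EL_closed[OF gX a]] inX_hom] mh_comp[OF inX_hom r[OF TTr c[OF EL_closed[OF gX a]]]] TTm 1[OF a] y])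
 show ?thesis by (rule Tot_ext[OF gX mh_comp[OF l[OF Tr y] inX_hom] mh_comp[OF inX_hom l[OF TTr c[OF y]]] TTm 2 x])
qed

lemma inY_mult:
 assumes x: "x : car (Tot Y)" and y: "y : car (Tot Y)"
 shows "inY (x \<otimes>[Tot Y] y) = inY x \<otimes>[TT] inY y"
proof -
 note r = ralg_right and l = ralg_left and Tr = Tot_ralg[OF gY] and c = mh_closed[OF inY_hom]
 have 1: "inY (EL Y a \<otimes>[Tot Y] EL Y b) = inY (EL Y a) \<otimes>[TT] inY (EL Y b)" if a: "a : els Y" and b: "b : els Y" for a b
  using hmult_homs[OF gY a b] by (simp add: EL_mult[OF gY a b] inY_EL a b tt_mult unit_homs[simplified] hmult_unit)
 have 2: "inY (EL Y a \<otimes>[Tot Y] y) = inY (EL Y a) \<otimes>[TT] inY y" if a: "a : els Y" for a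
  by (rule Tot_ext[OF gY mh_comp[OF r[OF Tr EL_closed[OF gY a]] inY_hom] mh_comp[OF inY_hom r[OF TTr c[OF EL_closed[OF gY a]]]] TTm 1[OF a] y])
 show ?thesis by (rule Tot_ext[OF gY mh_comp[OF l[OF Tr y] inY_hom] mh_comp[OF inY_hom l[OF TTr c[OF y]]] TTm 2 x])
qed

lemma tt_inX_inY: "a : els X ==> b : els Y ==> tt a b = inX (EL X a) \<otimes>[TT] inY (EL Y b)"
 by (simp add: inX_EL inY_EL tt_mult unit_homs[simplified] hmult_unit)

lemma inY_inX: "a : els X ==> b : els Y ==>
  inY (EL Y b) \<otimes>[TT] inX (EL X a) = ksign TT (fst b * fst a) (inX (EL X a) \<otimes>[TT] inY (EL Y b))"
 by (simp add: inX_EL inY_EL tt_mult unit_homs[simplified] hmult_unit)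

lemma inX_hdeg: "x : hdeg X n ==> inX x : hdeg U n" by (auto simp: hdeg_def[of X] inX_EL intro!: tt_hdeg unit_homs)

lemma inY_hdeg: "y : hdeg Y n ==> inY y : hdeg U n" by (auto simp: hdeg_def[of Y] inY_EL intro!: tt_hdeg unit_homs)

lemma inY_inX_hdeg: "x : hdeg X m ==> y : hdeg Y n ==>
  inY y \<otimes>[TT] inX x = ksign TT (n * m) (inX x \<otimes>[TT] inY y)" using inY_inX by (fastforce simp: hdeg_def)

lemma D_inX:
 assumes x: "x : car (Tot X)"
 shows "Dt U (inX x) = inX (Dt X x)"
proof (rule Tot_ext[OF gX mh_comp[OF inX_hom Dt_hom[OF U_dga]] mh_comp[OF Dt_hom[OF X] inX_hom] TTm _ x])
 fix a assume a: "a : els X"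
 have D: "Dt X (EL X a) = EL X (dh X a)" using Dt_EL[OF X, of "fst a" "snd a"] by (simp add: dh_def)
 note da = dh_homs[OF dga_chain_complex[OF X] a]
 interpret TR: ring TT by (rule ralgD(2)[OF TTr])
 show "Dt U (inX (EL X a)) = inX (Dt X (EL X a))" using tt_closed[OF da unit_homs(2)] dga_unit_bd[OF Y bil_right[OF tt_bil a] TTm]
  by (simp add: D inX_EL a da D_tt unit_homs[simplified] TTag)
qed

lemma D_inY:
 assumes y: "y : car (Tot Y)"
 shows "Dt U (inY y) = inY (Dt Y y)"
proof (rule Tot_ext[OF gY mh_comp[OF inY_hom Dt_hom[OF U_dga]] mh_comp[OF Dt_hom[OF Y] inY_hom] TTm _ y])
 fix b assume b: "b : els Y"
 have D: "Dt Y (EL Y b) = EL Y (dh Y b)" using Dt_EL[OF Y, of "fst b" "snd b"] by (simp add: dh_def)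
 note db = dh_homs[OF dga_chain_complex[OF Y] b]
 interpret TR: ring TT by (rule ralgD(2)[OF TTr])
 show "Dt U (inY (EL Y b)) = inY (Dt Y (EL Y b))" using tt_closed[OF unit_homs(1) db] dga_unit_bd[OF X bil_left[OF tt_bil b] TTm]
  by (simp add: D inY_EL b db D_tt unit_homs[simplified])
qed

end

section \<open>The Milgram map\<close>

locale milgram = cring R for R :: "('r, 'm) ring_scheme" (structure) +
 fixes A :: "('r, 'a) coaug_chain_coalg" and B :: "('r, 'b) coaug_chain_coalg"
 assumes A_coalg: "coaugmented_chain_coalgebra R A" and B_coalg: "coaugmented_chain_coalgebra R B"
begin

lemma A_into: "module R P ==> coalgebra_into R A P" by (rule coalgebra_intoI[OF is_cring _ A_coalg])

lemma B_into: "module R P ==> coalgebra_into R B P" by (rule coalgebra_intoI[OF is_cring _ B_coalg])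

end

sublocale milgram \<subseteq> coaugmented_pair R A B
proof -
 have P: "module R (ground_module R 0)" by (rule ground_module_module[OF is_cring])
 show "coaugmented_pair R A B" using A_into[OF P] B_into[OF P] by (simp add: coaugmented_pair_def coalgebra_into_def)
qed

context milgram begin

abbreviation "\<Omega>A == cobar R A"
abbreviation "\<Omega>B == cobar R B"
abbreviation "\<Omega>AB == cobar R (tensor_coalg R A B)"
abbreviation "TAB == Tot (cobar R (tensor_coalg R A B))"
abbreviation "UAB == Tot (tensor_chain_alg R (cobar R A) (cobar R B))"

abbreviation umul (infixl "\<star>" 70) where "x \<star> y == x \<otimes>[UAB] y"
abbreviation uadd (infixl "\<squnion>" 65) where "x \<squnion> y == x \<oplus>[UAB] y"
abbreviation usmult (infixl "\<bullet>" 70) where "r \<bullet> x == r \<odot>[UAB] x"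
abbreviation tmul (infixl "*." 70) where "x *. y == x \<otimes>[TAB] y"
abbreviation tadd (infixl "+." 65) where "x +. y == x \<oplus>[TAB] y"

lemma pair: "module R P ==> coalgebra_pair R A B P" unfolding coalgebra_pair_def by (intro conjI coaugmented_pair_axioms A_into B_into)

lemma AB_into: "module R P ==> coalgebra_into R AB P" by (rule coalgebra_pair.AB_coalgebra[OF pair])

sublocale cA: cobar_coalgebra R A unfolding cobar_coalgebra_def by (rule A_into[OF A.TXm])

sublocale cB: cobar_coalgebra R B unfolding cobar_coalgebra_def by (rule B_into[OF B.TXm])

sublocale cAB: cobar_coalgebra R "tensor_coalg R A B" unfolding cobar_coalgebra_def by (rule AB_into[OF AB.TXm])

sublocale U: alg_pair R "cobar R A" "cobar R B" by unfold_locales (rule cA.cobar_dga, rule cB.cobar_dga)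

sublocale AU: coalgebra_into R A "Tot (tensor_chain_alg R (cobar R A) (cobar R B))" by (rule A_into[OF U.TTm])

sublocale BU: coalgebra_into R B "Tot (tensor_chain_alg R (cobar R A) (cobar R B))" by (rule B_into[OF U.TTm])

sublocale AT: coalgebra_into R A "Tot (cobar R (tensor_coalg R A B))" by (rule A_into[OF AB.TXm])

sublocale BT: coalgebra_into R B "Tot (cobar R (tensor_coalg R A B))" by (rule B_into[OF AB.TXm])

definition "La a = U.inX (A.L a)"

definition "Lb b = U.inY (B.L b)"

lemma La_lin: "lin R M UAB La" unfolding La_def by (rule lin_comp[OF A.L_lin U.inX_hom])

lemma Lb_lin: "lin R N UAB Lb" unfolding Lb_def by (rule lin_comp[OF B.L_lin U.inY_hom])

lemma La_closed: "a : homs M ==> La a : car UAB" by (rule lin_closed[OF La_lin])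

lemma Lb_closed: "b : homs N ==> Lb b : car UAB" by (rule lin_closed[OF Lb_lin])

lemma L_hdeg: "a : homs M ==> A.L a : hdeg \<Omega>A (fst a - 1)" "b : homs N ==> B.L b : hdeg \<Omega>B (fst b - 1)"
 "t : homs T ==> AB.L t : hdeg \<Omega>AB (fst t - 1)" using A.hdeg_W[of "[A.bar a]"] A.bar_homs[of a] B.hdeg_W[of "[B.bar b]"] B.bar_homs[of b]
  AB.hdeg_W[of "[AB.bar t]"] AB.bar_homs[of t] by (simp_all add: A.L_def B.L_def AB.L_def)

lemma La_hdeg: "a : homs M ==> La a : hdeg U.U (fst a - 1)" unfolding La_def by (intro U.inX_hdeg L_hdeg)

lemma Lb_hdeg: "b : homs N ==> Lb b : hdeg U.U (fst b - 1)" unfolding Lb_def by (intro U.inY_hdeg L_hdeg)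

lemma Lb_La: "a : homs M ==> b : homs N ==> Lb b \<star> La a = ksign UAB ((fst b - 1) * (fst a - 1)) (La a \<star> Lb b)"
 unfolding La_def Lb_def by (intro U.inY_inX_hdeg L_hdeg)

lemma La_uh: "La (uh R A) = \<zero>[UAB]" unfolding La_def A.L_uh by (rule mh_zero[OF U.inX_hom A.TXm U.TTm])

lemma Lb_uh: "Lb (uh R B) = \<zero>[UAB]" unfolding Lb_def B.L_uh by (rule mh_zero[OF U.inY_hom B.TXm U.TTm])

lemma D_La:
 assumes a: "a : homs M"
 shows "Dt U.U (La a) = ksign UAB 1 (La (dh A a)) \<squnion> csA UAB a (%x y. ksign UAB (fst x) (La x \<star> La y))"
proof -
 interpret TA: ring A.TX by (rule ralgD(2)[OF A.TX_ralg])
 note ag = ralgD(3)[OF A.TX_ralg]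
 have Lc: "A.L x : car A.TX" if "x : homs M" for x by (rule A.L_closed[OF that])
 have "U.inX (csA A.TX a (%x y. ksign A.TX (fst x) (A.L x \<otimes>[A.TX] A.L y))) =
   csA UAB a (%x y. U.inX (ksign A.TX (fst x) (A.L x \<otimes>[A.TX] A.L y)))" by (rule A.csum_hom[OF A.TXm U.inX_hom U.TTm a]) (simp add: Lc ag)
 also have "... = csA UAB a (%x y. ksign UAB (fst x) (La x \<star> La y))"
  by (rule A.csum_cong[OF a]) (simp add: mh_ksign[OF U.inX_hom A.TXm U.TTm] Lc U.inX_mult La_def)
 finally have 1: "U.inX (csA A.TX a (%x y. ksign A.TX (fst x) (A.L x \<otimes>[A.TX] A.L y))) =
   csA UAB a (%x y. ksign UAB (fst x) (La x \<star> La y))" .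
 have c: "csA A.TX a (%x y. ksign A.TX (fst x) (A.L x \<otimes>[A.TX] A.L y)) : car A.TX"
  by (rule lin_closed[OF A.csum_lin[OF A.TXm A.LL_bil] a])
 have d: "A.L (dh A a) : car A.TX" by (rule Lc[OF dh_homs[OF A.cx a]])
 show ?thesis unfolding La_def[of a] U.D_inX[OF Lc[OF a]] cA.D_L[OF a] cA.DL_def
  using 1 c d by (simp add: mh_add[OF U.inX_hom] ag mh_ksign[OF U.inX_hom A.TXm U.TTm]) (simp add: La_def)
qed

lemma D_Lb:
 assumes b: "b : homs N"
 shows "Dt U.U (Lb b) = ksign UAB 1 (Lb (dh B b)) \<squnion> csB UAB b (%x y. ksign UAB (fst x) (Lb x \<star> Lb y))"
proof -
 interpret TB: ring B.TX by (rule ralgD(2)[OF B.TX_ralg])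
 note ag = ralgD(3)[OF B.TX_ralg]
 have Lc: "B.L x : car B.TX" if "x : homs N" for x by (rule B.L_closed[OF that])
 have "U.inY (csB B.TX b (%x y. ksign B.TX (fst x) (B.L x \<otimes>[B.TX] B.L y))) =
   csB UAB b (%x y. U.inY (ksign B.TX (fst x) (B.L x \<otimes>[B.TX] B.L y)))" by (rule B.csum_hom[OF B.TXm U.inY_hom U.TTm b]) (simp add: Lc ag)
 also have "... = csB UAB b (%x y. ksign UAB (fst x) (Lb x \<star> Lb y))"
  by (rule B.csum_cong[OF b]) (simp add: mh_ksign[OF U.inY_hom B.TXm U.TTm] Lc U.inY_mult Lb_def)
 finally have 1: "U.inY (csB B.TX b (%x y. ksign B.TX (fst x) (B.L x \<otimes>[B.TX] B.L y))) =
   csB UAB b (%x y. ksign UAB (fst x) (Lb x \<star> Lb y))" .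
 have c: "csB B.TX b (%x y. ksign B.TX (fst x) (B.L x \<otimes>[B.TX] B.L y)) : car B.TX"
  by (rule lin_closed[OF B.csum_lin[OF B.TXm B.LL_bil] b])
 have d: "B.L (dh B b) : car B.TX" by (rule Lc[OF dh_homs[OF B.cx b]])
 show ?thesis unfolding Lb_def[of b] U.D_inY[OF Lc[OF b]] cB.D_L[OF b] cB.DL_def
  using 1 c d by (simp add: mh_add[OF U.inY_hom] ag mh_ksign[OF U.inY_hom B.TXm U.TTm]) (simp add: Lb_def)
qed

text \<open>
  \<open>q\<close> on the letter of \<open>a \<otimes> b\<close>, written without decomposing \<open>A \<otimes> B\<close>: the value is
  \<open>\<epsilon>(b) [a] \<otimes> 1 + \<epsilon>(a) 1 \<otimes> [b]\<close>.
\<close>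

definition "qb a b = eps B b \<bullet> La a \<squnion> eps A a \<bullet> Lb b"

definition "ql t = lift R UAB (%(a, b). qb a b) (snd t)"

lemma qb_bil: "bil R M N UAB qb" unfolding qb_def
 by (intro bilI lin_plus U.TTm lin_scale La_lin Lb_lin A.eps_scale_lin B.eps_scale_lin La_closed Lb_closed A.eps_closed B.eps_closed)

lemma ql_lin: "lin R T UAB ql" unfolding lin_def ql_def using lift_bil_hom[OF R A.gm B.gm U.TTm qb_bil] by simp

lemma ql_t2: "a : homs M ==> b : homs N ==> ql (t2 a b) = qb a b" by (simp add: ql_def tn_def lift_bil_tens[OF R A.gm B.gm U.TTm qb_bil])

lemma qb_closed: "a : homs M ==> b : homs N ==> qb a b : car UAB" by (rule bil_closed[OF qb_bil])

lemma ql_closed: "t : homs T ==> ql t : car UAB" by (rule lin_closed[OF ql_lin])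

lemma eps_smult_zero: "module R P ==> v : car P ==> a : homs M ==> fst a ~= 0 ==> eps A a \<odot>[P] v = \<zero>[P]"
 "module R P ==> v : car P ==> b : homs N ==> fst b ~= 0 ==> eps B b \<odot>[P] v = \<zero>[P]"
 by (simp_all add: A.eps_deg B.eps_deg module.smult_l_null)

text \<open>
  The counit only sees elements of degree zero, so it absorbs the degree of its argument in a
  sign.
\<close>

lemma eps_ksign:
 assumes P: "module R P" and v: "v : car P"
 shows "a : homs M ==> (fst a = 0 ==> even k = even l) ==> ksign P k (eps A a \<odot>[P] v) = eps A a \<odot>[P] ksign P l v"
  and "b : homs N ==> (fst b = 0 ==> even k = even l) ==> ksign P k (eps B b \<odot>[P] v) = eps B b \<odot>[P] ksign P l v"
proof -
 have ag: "abelian_group P" using P by (simp add: module_def)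
 show "ksign P k (eps A a \<odot>[P] v) = eps A a \<odot>[P] ksign P l v" if "a : homs M" "fst a = 0 ==> even k = even l"
  using that v A.eps_closed[OF that(1)] ag by (cases "fst a = 0") (simp_all add: eps_smult_zero[OF P] ksign_smult[OF P, symmetric] ksign_cong[of k l])
 show "ksign P k (eps B b \<odot>[P] v) = eps B b \<odot>[P] ksign P l v" if "b : homs N" "fst b = 0 ==> even k = even l"
  using that v B.eps_closed[OF that(1)] ag by (cases "fst b = 0") (simp_all add: eps_smult_zero[OF P] ksign_smult[OF P, symmetric] ksign_cong[of k l])
qed

lemma qb_hdeg: "a : homs M ==> b : homs N ==> qb a b : hdeg U.U (fst a + fst b - 1)"
proof -
 assume a: "a : homs M" and b: "b : homs N"
 have "eps B b \<bullet> La a : hdeg U.U (fst a + fst b - 1)"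
  using hdeg_smult[OF U.U_galg B.eps_closed[OF b] La_hdeg[OF a]] eps_smult_zero(2)[OF U.TTm La_closed[OF a] b] hdeg_zero[OF U.U_galg]
  by (cases "fst b = 0") simp_all
 moreover have "eps A a \<bullet> Lb b : hdeg U.U (fst a + fst b - 1)"
  using hdeg_smult[OF U.U_galg A.eps_closed[OF a] Lb_hdeg[OF b]] eps_smult_zero(1)[OF U.TTm Lb_closed[OF b] a] hdeg_zero[OF U.U_galg]
  by (cases "fst a = 0") simp_all
 ultimately show ?thesis unfolding qb_def by (rule hdeg_add[OF U.U_galg])
qed

lemma ql_hdeg: "t : homs T ==> ql t : hdeg U.U (fst t - 1)" using hdeg_tn[OF U.U_galg R A.gm B.gm ql_lin, of "- 1" t] qb_hdeg by (simp add: ql_t2)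

lemma ql_uh: "ql (uh R AB) = \<zero>[UAB]"
proof -
 interpret P: module R UAB by (rule U.TTm)
 show ?thesis by (simp add: uh_AB ql_t2 A.uh_homs B.uh_homs qb_def La_uh Lb_uh A.eps_uh B.eps_uh)
qed

text \<open>Desuspension lowers the stored degree of a letter by one; this is undone here.\<close>

definition "letter l = (fst l + 1, snd l)"

lemma letter_homs: "l : homs AB.Vk ==> letter l : homs T & eps AB (letter l) = \<zero>" using AB.homs_Vk AB.homs_kC by (simp add: letter_def)

lemma W_letter: "l : homs AB.Vk ==> AB.W [l] = AB.L (letter l)" by (simp add: AB.L_def letter_def AB.bar_letter)

lemma letter_lin:
 assumes F: "lin R T P F" shows "lin R AB.Vk P (%l. F (letter l))" unfolding lin_def letter_def fst_conv snd_conv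
proof
 fix n show "(%x. F (n + 1, x)) : Hom R (AB.Vk n) P" using lin_hom[OF F, of "n + 1"] by (auto simp: desusp_ker_def module_hom_def hom_def AB.kC_simps)
qed

lemma q\<phi>: "lin R AB.Vk UAB (%l. ql (letter l))" by (rule letter_lin[OF ql_lin])

definition "Q = AB.ahom UAB (%l. ql (letter l))"

lemma Q_hom: "Q : Hom R TAB UAB" unfolding Q_def by (rule AB.ahom_hom[OF U.TTr q\<phi>])

lemma Q_one: "Q \<one>[TAB] = \<one>[UAB]" unfolding Q_def by (rule AB.ahom_one[OF U.TTr q\<phi>])

lemma Q_mult: "x : car TAB ==> y : car TAB ==> Q (x \<otimes>[TAB] y) = Q x \<star> Q y" unfolding Q_def by (rule AB.ahom_mult[OF U.TTr q\<phi>])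

lemma Q_closed: "x : car TAB ==> Q x : car UAB" by (rule mh_closed[OF Q_hom])

lemma Q_L:
 assumes t: "t : homs T" shows "Q (AB.L t) = ql t"
proof -
 interpret P: module R UAB by (rule U.TTm)
 have b: "AB.bar t : homs AB.Vk" using t AB.bar_homs by simp
 have h: "AB.hat t : homs T" using t AB.hat_homs by simp
 have "Q (AB.L t) = ql (AB.hat t)" unfolding AB.L_def Q_def AB.ahom_letter[OF U.TTr q\<phi> b] by (simp add: letter_def AB.bar_def AB.hat_def)
 also have "... = ql t" using AB.hat_split[OF _ U.TTm, of ql t] ql_lin t ql_closed[OF h] AB.eps_closed[of t] by (simp add: ql_uh)
 finally show ?thesis .
qed

end

context milgram begin

lemma UABag: "abelian_group UAB" by (rule U.TTag)

lemma QQ_bil: "bil R T T UAB (%x y. ksign UAB (fst x) (ql x \<star> ql y))" by (rule bil_ksign[OF bil_mult[OF U.TTr ql_lin ql_lin] U.TTm])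

lemma LaLa_bil: "bil R M M UAB (%x y. ksign UAB (fst x) (La x \<star> La y))" by (rule bil_ksign[OF bil_mult[OF U.TTr La_lin La_lin] U.TTm])

lemma LbLb_bil: "bil R N N UAB (%x y. ksign UAB (fst x) (Lb x \<star> Lb y))" by (rule bil_ksign[OF bil_mult[OF U.TTr Lb_lin Lb_lin] U.TTm])

lemma csum_cross:
 assumes X: "bil R M N UAB X" and a: "a : homs M" and b: "b : homs N"
 shows "csA UAB a (%a1 a2. csB UAB b (%b1 b2. eps B b1 \<bullet> (eps A a2 \<bullet> X a1 b2))) = X a b"
  and "csA UAB a (%a1 a2. csB UAB b (%b1 b2. eps B b2 \<bullet> (eps A a1 \<bullet> X a2 b1))) = X a b"
proof -
 have "csA UAB a (%a1 a2. csB UAB b (%b1 b2. eps B b1 \<bullet> (eps A a2 \<bullet> X a1 b2))) = csA UAB a (%a1 a2. eps A a2 \<bullet> X a1 b)"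
  by (rule A.csum_cong[OF a], rule BU.counit_left[OF lin_scale[OF bil_right[OF X] U.TTm A.eps_closed] b])
 then show "csA UAB a (%a1 a2. csB UAB b (%b1 b2. eps B b1 \<bullet> (eps A a2 \<bullet> X a1 b2))) = X a b"
  using AU.counit_right[OF bil_left[OF X b] a] by simp
 have "csA UAB a (%a1 a2. csB UAB b (%b1 b2. eps B b2 \<bullet> (eps A a1 \<bullet> X a2 b1))) = csA UAB a (%a1 a2. eps A a1 \<bullet> X a2 b)"
  by (rule A.csum_cong[OF a], rule BU.counit_right[OF lin_scale[OF bil_right[OF X] U.TTm A.eps_closed] b])
 then show "csA UAB a (%a1 a2. csB UAB b (%b1 b2. eps B b2 \<bullet> (eps A a1 \<bullet> X a2 b1))) = X a b"
  using AU.counit_left[OF bil_left[OF X b] a] by simp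
qed

text \<open>
  Of the four products in \<open>q(a' \<otimes> b') q(a'' \<otimes> b'')\<close> the two mixed ones cancel each other after
  summation, because \<open>[a] \<otimes> 1\<close> and \<open>1 \<otimes> [b]\<close> commute up to sign.
\<close>

lemma csum_ql:
 assumes a: "a : homs M" and b: "b : homs N"
 shows "csAB UAB (t2 a b) (%x y. ksign UAB (fst x) (ql x \<star> ql y)) =
  eps B b \<bullet> csA UAB a (%x y. ksign UAB (fst x) (La x \<star> La y)) \<squnion>
  eps A a \<bullet> csB UAB b (%x y. ksign UAB (fst x) (Lb x \<star> Lb y))"
proof -
 interpret UR: ring UAB by (rule ralgD(2)[OF U.TTr])
 note ag = UABag and Um = U.TTm and Ur = U.TTr and sm = AU.P.smult_closed
 let ?s = "ksign UAB" and ?AB = "%T. csA UAB a (%a1 a2. csB UAB b (T a1 a2))"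
 let ?FA = "%x y. ?s (fst x) (La x \<star> La y)" and ?FB = "%x y. ?s (fst x) (Lb x \<star> Lb y)"
 let ?X = "%a b. ?s (fst a) (La a \<star> Lb b)" and ?Y = "%a b. ?s (fst a * fst b + fst b) (Lb b \<star> La a)"
 define T1 where "T1 = (%a1 a2 b1 b2. eps B b1 \<bullet> (eps B b2 \<bullet> ?FA a1 a2))"
 define T2 where "T2 = (%a1 a2 b1 b2. eps B b1 \<bullet> (eps A a2 \<bullet> ?X a1 b2))"
 define T3 where "T3 = (%a1 a2 b1 b2. eps B b2 \<bullet> (eps A a1 \<bullet> ?Y a2 b1))"
 define T4 where "T4 = (%a1 a2 b1 b2. eps A a1 \<bullet> (eps A a2 \<bullet> ?FB b1 b2))"
 note ec = A.eps_closed B.eps_closed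
 have cl: "T1 a1 a2 b1 b2 : car UAB" "T2 a1 a2 b1 b2 : car UAB" "T3 a1 a2 b1 b2 : car UAB" "T4 a1 a2 b1 b2 : car UAB"
  if "a1 : homs M" "a2 : homs M" "b1 : homs N" "b2 : homs N" for a1 a2 b1 b2 unfolding T1_def T2_def T3_def T4_def
  by (intro sm ec ksign_closed[OF ag] UR.m_closed La_closed Lb_closed that)+
 have pt: "?s (fst a2 * fst b1) (?s (fst (t2 a1 b1)) (ql (t2 a1 b1) \<star> ql (t2 a2 b2))) =
   (T1 a1 a2 b1 b2 \<squnion> T4 a1 a2 b1 b2) \<squnion> (T2 a1 a2 b1 b2 \<squnion> T3 a1 a2 b1 b2)"
  if h: "a1 : homs M" "a2 : homs M" "b1 : homs N" "b2 : homs N" for a1 a2 b1 b2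
 proof -
  let ?k = "fst a2 * fst b1 + (fst a1 + fst b1)" and ?l = "fst a2 * fst b1 + fst b1"
  note c = La_closed[OF h(1)] La_closed[OF h(2)] Lb_closed[OF h(3)] Lb_closed[OF h(4)] ec(1)[OF h(1)] ec(1)[OF h(2)] ec(2)[OF h(3)] ec(2)[OF h(4)]
  have m: "La a1 \<star> La a2 : car UAB" "La a1 \<star> Lb b2 : car UAB" "Lb b1 \<star> La a2 : car UAB" "Lb b1 \<star> Lb b2 : car UAB"
   using c by auto
  have e: "T1 a1 a2 b1 b2 = ?s ?k (eps B b1 \<bullet> (eps B b2 \<bullet> (La a1 \<star> La a2)))"
   "T2 a1 a2 b1 b2 = ?s ?k (eps B b1 \<bullet> (eps A a2 \<bullet> (La a1 \<star> Lb b2)))"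
   "T3 a1 a2 b1 b2 = ?s ?k (eps B b2 \<bullet> (eps A a1 \<bullet> (Lb b1 \<star> La a2)))"
   "T4 a1 a2 b1 b2 = ?s ?k (eps A a1 \<bullet> (eps A a2 \<bullet> (Lb b1 \<star> Lb b2)))"
   using eps_ksign(2)[OF Um sm[OF c(8) m(1)] h(3), of ?k "fst a1"] eps_ksign(2)[OF Um m(1) h(4), of "fst a1" "fst a1"]
    eps_ksign(2)[OF Um sm[OF c(6) m(2)] h(3), of ?k "fst a1"] eps_ksign(1)[OF Um m(2) h(2), of "fst a1" "fst a1"]
    eps_ksign(2)[OF Um sm[OF c(5) m(3)] h(4), of ?k ?k] eps_ksign(1)[OF Um m(3) h(1), of ?k ?l]
    eps_ksign(1)[OF Um sm[OF c(6) m(4)] h(1), of ?k ?l] eps_ksign(1)[OF Um m(4) h(2), of ?l "fst b1"] by (simp_all add: T1_def T2_def T3_def T4_def)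
  have sc: "r \<bullet> (s \<bullet> v) = s \<bullet> (r \<bullet> v)" if "r : car R" "s : car R" "v : car UAB" for r s v
   using that by (simp add: m_comm flip: AU.P.smult_assoc1)
  have "qb a1 b1 \<star> qb a2 b2 = (eps B b1 \<bullet> (eps B b2 \<bullet> (La a1 \<star> La a2)) \<squnion> eps A a1 \<bullet> (eps A a2 \<bullet> (Lb b1 \<star> Lb b2))) \<squnion>
    (eps B b1 \<bullet> (eps A a2 \<bullet> (La a1 \<star> Lb b2)) \<squnion> eps B b2 \<bullet> (eps A a1 \<bullet> (Lb b1 \<star> La a2)))"
   unfolding qb_def sc[OF c(8,5) m(3)] using c m by (simp add: UR.l_distr UR.r_distr ralgD(4,5)[OF Ur] AU.P.smult_r_distr sc AU.P.a_ac)
  then show ?thesis using c m h sm by (simp add: ql_t2 ag ksign_ksign[OF ag] ksign_add[OF ag] e)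
 qed
 have SB: "csB UAB b ?FB : car UAB" and SA: "csA UAB a ?FA : car UAB"
  by (rule lin_closed[OF B.csum_lin[OF Um LbLb_bil] b], rule lin_closed[OF A.csum_lin[OF Um LaLa_bil] a])
 have "?AB T1 = csA UAB a (%x y. eps B b \<bullet> ?FA x y)"
  unfolding T1_def using La_closed ag by (intro A.csum_cong[OF a] BU.counit_left[OF B.eps_scale_lin[OF Um] b]) simp
 also have "... = eps B b \<bullet> csA UAB a ?FA"
  using La_closed ag by (intro A.csum_hom[OF Um mh_scale[OF mh_id Um ec(2)[OF b]] Um a, symmetric]) simp
 finally have 1: "?AB T1 = eps B b \<bullet> csA UAB a ?FA" .
 have "?AB T4 = csA UAB a (%a1 a2. eps A a1 \<bullet> (eps A a2 \<bullet> csB UAB b ?FB))" unfolding T4_def using Lb_closed ag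
  by (intro A.csum_cong[OF a] B.csum_hom[OF Um mh_scale[OF mh_scale[OF mh_id Um ec(1)] Um ec(1)] Um b, symmetric]) simp_all
 also have "... = eps A a \<bullet> csB UAB b ?FB" by (rule AU.counit_left[OF A.eps_scale_lin[OF Um SB] a])
 finally have 4: "?AB T4 = eps A a \<bullet> csB UAB b ?FB" .
 have 2: "?AB T2 = ?X a b" unfolding T2_def by (rule csum_cross(1)[OF bil_ksign[OF bil_mult[OF Ur La_lin Lb_lin] Um, of "%i j. i"] a b])
 have "bil R M N UAB ?Y" by (rule bil_ksign[OF _ Um, of _ _ _ "%i j. i * j + j"])
   (intro bilI lin_comp[OF Lb_lin ralg_left[OF Ur]] lin_comp[OF La_lin ralg_right[OF Ur]] La_closed Lb_closed)
 then have 3: "?AB T3 = ?Y a b" unfolding T3_def by (rule csum_cross(2)[OF _ a b])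
 have mc: "La a \<star> Lb b : car UAB" using La_closed[OF a] Lb_closed[OF b] by simp
 have Y: "?Y a b = ?s (fst a + 1) (La a \<star> Lb b)" unfolding Lb_La[OF a b] ksign_ksign[OF ag mc] by (rule ksign_cong) (simp add: algebra_simps)
 have "csAB UAB (t2 a b) (%x y. ?s (fst x) (ql x \<star> ql y)) =
   ?AB (%a1 a2 b1 b2. (T1 a1 a2 b1 b2 \<squnion> T4 a1 a2 b1 b2) \<squnion> (T2 a1 a2 b1 b2 \<squnion> T3 a1 a2 b1 b2))"
  unfolding csum_AB[OF Um QQ_bil a b] by (intro A.csum_cong[OF a] B.csum_cong[OF b] pt)
 also have "... = csA UAB a (%a1 a2. (csB UAB b (T1 a1 a2) \<squnion> csB UAB b (T4 a1 a2)) \<squnion> (csB UAB b (T2 a1 a2) \<squnion> csB UAB b (T3 a1 a2)))"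
  by (rule A.csum_cong[OF a]) (simp add: B.csum_add[OF Um b] cl)
 also have "... = (?AB T1 \<squnion> ?AB T4) \<squnion> (?AB T2 \<squnion> ?AB T3)" by (simp add: A.csum_add[OF Um a] B.csum_closed[OF Um b] cl)
 finally show ?thesis unfolding 1 2 3 4 Y using ksign_cancel[OF ag mc, of "fst a" "fst a + 1"] SA SB ec(1)[OF a] ec(2)[OF b] by simp
qed

lemma Q_DL:
 assumes t: "t : homs T"
 shows "Q (cAB.DL t) = Dt U.U (ql t)"
proof (rule tn_ext[OF R A.gm B.gm U.TTm _ lin_comp[OF ql_lin Dt_hom[OF U.U_dga]] _ t])
 note ag = UABag and Um = U.TTm
 have tx: "ring AB.TX" by (rule ralgD(2)[OF AB.TX_ralg])
 show "lin R T UAB (%t. Q (cAB.DL t))" using lin_comp[OF cAB.DL_lin Q_hom] by simp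
 fix a b assume a: "a : homs M" and b: "b : homs N"
 note da = dh_homs[OF A.cx a] and db = dh_homs[OF B.cx b]
 let ?t = "t2 a b"
 have t: "?t : els AB" using a b by simp
 note dt = dh_homs[OF AB.cx t]
 have LLc: "AB.L x \<otimes>[AB.TX] AB.L y : car AB.TX" if "x : els AB" "y : els AB" for x y
  using AB.L_closed that monoid.m_closed[OF ring.is_monoid[OF tx]] by blast
 have "Q (csAB AB.TX ?t (%x y. ksign AB.TX (fst x) (AB.L x \<otimes>[AB.TX] AB.L y))) =
   csAB UAB ?t (%x y. Q (ksign AB.TX (fst x) (AB.L x \<otimes>[AB.TX] AB.L y)))"
  by (rule AB.csum_hom[OF AB.TXm Q_hom Um t]) (simp add: LLc[simplified] ralgD(3)[OF AB.TX_ralg])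
 also have "... = csAB UAB ?t (%x y. ksign UAB (fst x) (ql x \<star> ql y))" by (rule AB.csum_cong[OF t])
   (simp add: mh_ksign[OF Q_hom AB.TXm Um] LLc[simplified] Q_mult AB.L_closed[simplified] Q_L)
 finally have 1: "Q (csAB AB.TX ?t (%x y. ksign AB.TX (fst x) (AB.L x \<otimes>[AB.TX] AB.L y))) =
   csAB UAB ?t (%x y. ksign UAB (fst x) (ql x \<star> ql y))" .
 have cc: "csAB AB.TX ?t (%x y. ksign AB.TX (fst x) (AB.L x \<otimes>[AB.TX] AB.L y)) : car AB.TX"
  by (rule lin_closed[OF AB.csum_lin[OF AB.TXm AB.LL_bil] t])
 have Ld: "AB.L (dh AB ?t) : car AB.TX" by (rule AB.L_closed[OF dt])
 have ec: "eps A a : car R" "eps B b : car R" by (rule A.eps_closed[OF a], rule B.eps_closed[OF b])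
 have lc: "La (dh A a) : car UAB" "Lb (dh B b) : car UAB" "La a : car UAB" "Lb b : car UAB" by (intro La_closed Lb_closed a b da db)+
 have "ql (dh AB ?t) = eps B b \<bullet> La (dh A a) \<squnion> ksign UAB (fst a) (eps A a \<bullet> Lb (dh B b))"
  unfolding dh_t2[OF ql_lin Um a b] ql_t2[OF da b] ql_t2[OF a db] qb_def A.eps_dh[OF a] B.eps_dh[OF b] using ec lc by (simp add: AU.P.smult_l_null)
 also have "ksign UAB (fst a) (eps A a \<bullet> Lb (dh B b)) = eps A a \<bullet> Lb (dh B b)" using eps_ksign(1)[OF Um lc(2) a, of "fst a" 0] by simp
 finally have 2: "ql (dh AB ?t) = eps B b \<bullet> La (dh A a) \<squnion> eps A a \<bullet> Lb (dh B b)" .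
 have S: "csA UAB a (%x y. ksign UAB (fst x) (La x \<star> La y)) : car UAB"
  "csB UAB b (%x y. ksign UAB (fst x) (Lb x \<star> Lb y)) : car UAB"
  by (rule lin_closed[OF A.csum_lin[OF Um LaLa_bil] a], rule lin_closed[OF B.csum_lin[OF Um LbLb_bil] b])
 have "Q (cAB.DL ?t) = ksign UAB 1 (ql (dh AB ?t)) \<squnion> csAB UAB ?t (%x y. ksign UAB (fst x) (ql x \<star> ql y))"
  unfolding cAB.DL_def using cc Ld dt 1 by (simp add: mh_add[OF Q_hom] ralgD(3)[OF AB.TX_ralg] mh_ksign[OF Q_hom AB.TXm Um] Q_L)
 also have "... = Dt U.U (ql ?t)" unfolding csum_ql[OF a b] 2 ql_t2[OF a b] qb_def
  using ec lc S mh_add[OF Dt_hom[OF U.U_dga], of "eps B b \<bullet> La a" "eps A a \<bullet> Lb b"]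
  by (simp add: mh_smult[OF Dt_hom[OF U.U_dga]] D_La[OF a] D_Lb[OF b] ksign_add[OF ag] ag AU.P.smult_r_distr ksign_smult[OF Um] AU.P.a_ac)
 finally show "Q (cAB.DL ?t) = Dt U.U (ql ?t)" .
qed

lemma Q_D: "x : car TAB ==> Q (Dt \<Omega>AB x) = Dt U.U (Q x)"
proof (rule AB.ahom_chain[OF cAB.cobar_dga U.U_dga Q_hom Q_one Q_mult])
 fix l assume l: "l : homs AB.Vk"
 then have t: "letter l : homs T" using letter_homs by blast
 show "Q (AB.W [l]) : hdeg U.U (fst l)" using ql_hdeg[OF t] by (simp add: W_letter[OF l] Q_L[OF t]) (simp add: letter_def)
 show "Q (Dt \<Omega>AB (AB.W [l])) = Dt U.U (Q (AB.W [l]))" using t by (simp add: W_letter[OF l] Q_L cAB.D_L Q_DL)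
qed

lemma Q_hdeg:
 assumes x: "x : car (AB.TA n)" shows "Q (EL \<Omega>AB (n, x)) : hdeg U.U n"
proof -
 have "Q (AB.W w) : hdeg U.U (word_deg w)" if "set w <= homs AB.Vk" for w using that
 proof (induction w)
  case Nil
  show ?case using hdeg_one[OF U.U_galg] by (simp add: AB.W_Nil Q_one)
 next
  case (Cons l w)
  have l: "l : homs AB.Vk" and w: "set w <= homs AB.Vk" using Cons.prems by auto
  have t: "letter l : homs T" using letter_homs[OF l] by blast
  have "Q (AB.W (l # w)) = ql (letter l) \<star> Q (AB.W w)"
   using AB.W_append[of "[l]" w] l w Q_mult[OF AB.W_closed[of "[l]"] AB.W_closed[OF w]] t by (simp add: W_letter Q_L)
  moreover have "ql (letter l) : hdeg U.U (fst l)" using ql_hdeg[OF t] by (simp add: letter_def)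
  ultimately show ?case using hdeg_mult[OF U.U_galg _ Cons.IH[OF w]] by simp
 qed
 then show ?thesis using AB.hdeg_hom[OF U.U_galg Q_hom _ x, of 0] by simp
qed

lemma letter_class: "x : car (ker_counit R AB n) ==> EL \<Omega>AB (n - 1, cobar_letter R AB n x) = AB.L (n, x)"
 "x : car (ker_counit R AB n) ==> cobar_letter R AB n x : car (AB.TA (n - 1))"
 using AB.ker_proj_ker AB.Vk word_closed[OF R AB.Vk, of "[(n - 1, x)]" "n - 1"]
 by (simp_all add: AB.L_def AB.W_def AB.bar_def cobar_letter_def desusp_ker_def AB.obj_X)

lemma letter_class_A: "a : car (ker_counit R A n) ==> EL \<Omega>A (n - 1, cobar_letter R A n a) = A.L (n, a)"
 "a : car (ker_counit R A n) ==> cobar_letter R A n a : car (A.TA (n - 1))" using A.ker_proj_ker word_closed[OF R A.Vk, of "[(n - 1, a)]" "n - 1"]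
 by (simp_all add: A.L_def A.W_def A.bar_def cobar_letter_def desusp_ker_def A.obj_X)

lemma letter_class_B: "a : car (ker_counit R B n) ==> EL \<Omega>B (n - 1, cobar_letter R B n a) = B.L (n, a)"
 "a : car (ker_counit R B n) ==> cobar_letter R B n a : car (B.TA (n - 1))" using B.ker_proj_ker word_closed[OF R B.Vk, of "[(n - 1, a)]" "n - 1"]
 by (simp_all add: B.L_def B.W_def B.bar_def cobar_letter_def desusp_ker_def B.obj_X)

lemma ker_t2: "[|a : car (ker_counit R A m); b : car (N n)|] ==> tens R M N (m, a) (n, b) : car (ker_counit R AB (m + n))"
 "[|a : car (M m); b : car (ker_counit R B n)|] ==> tens R M N (m, a) (n, b) : car (ker_counit R AB (m + n))"
 using tens_closed[OF R A.gm B.gm, of "(m, a)" "(n, b)" "m + n"] A.eps_closed[of "(m, a)"] B.eps_closed[of "(n, b)"]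
 by (auto simp: AB.kC_simps A.kC_simps B.kC_simps counit_AB_tens eps_def)

lemma EL_letter:
 assumes "tens R M N (m, a) (n, b) : car (ker_counit R AB (m + n))"
 shows "EL \<Omega>AB (m + n - 1, cobar_letter R AB (m + n) (tens R M N (m, a) (n, b))) = AB.L (t2 (m, a) (n, b))"
 using letter_class(1)[OF assms] by (simp add: tn_def)

lemma tt_A: "a : car (ker_counit R A n) ==>
  EL U.U (n - 1, tens R (obj \<Omega>A) (obj \<Omega>B) (n - 1, cobar_letter R A n a) (0, aunit \<Omega>B)) = La (n, a)"
 using U.inX_EL[of "(n - 1, cobar_letter R A n a)"] letter_class_A[of a n] by (simp add: La_def U.tt_def tn_def A.obj_X)

lemma tt_B: "b : car (ker_counit R B n) ==>
  EL U.U (n - 1, tens R (obj \<Omega>A) (obj \<Omega>B) (0, aunit \<Omega>A) (n - 1, cobar_letter R B n b)) = Lb (n, b)"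
 using U.inY_EL[of "(n - 1, cobar_letter R B n b)"] letter_class_B[of b n] by (simp add: Lb_def U.tt_def tn_def B.obj_X)

lemma milgram_exists: "\<exists>q. is_milgram_map R A B q"
proof -
 obtain q where g: "graded_map R (obj \<Omega>AB) (obj U.U) 0 q"
  and qe: "!!n x. x : car (obj \<Omega>AB n) ==> Q (EL \<Omega>AB (n, x)) = EL U.U (n + 0, q n x)"
 proof (rule graded_of_tot[OF AB.galg U.U_galg Q_hom, where k = 0])
  show "\<exists>y. y : car (obj U.U (n + 0)) & Q (EL \<Omega>AB (n, x)) = EL U.U (n + 0, y)" if "x : car (obj \<Omega>AB n)" for n x
   using Q_hdeg[of x n] that by (auto simp: hdeg_def AB.obj_X)
 qed auto
 note qe = qe[unfolded add_0_right]
 note cxAB = dga_chain_complex[OF cAB.cobar_dga]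
 have qc: "q n x : car (obj U.U n)" if "x : car (obj \<Omega>AB n)" for n x using mh_closed[OF graded_map_hom[OF g, of n n] that] by simp
 interpret UR: ring UAB by (rule ralgD(2)[OF U.TTr])
 have ELc: "EL \<Omega>AB (n, x) : car TAB" if "x : car (obj \<Omega>AB n)" for n x using that by (intro EL_closed[OF AB.galg]) simp
 have hom: "chain_alg_hom R \<Omega>AB U.U q" unfolding chain_alg_hom_def chain_map_def
 proof (intro conjI allI ballI)
  show "graded_map R (obj \<Omega>AB) (obj U.U) 0 q" by (rule g)
  show "q (n - 1) (bd \<Omega>AB n x) = bd U.U n (q n x)" if x: "x : car (obj \<Omega>AB n)" for n x
  proof (rule el_inj)
   have bx: "bd \<Omega>AB n x : car (obj \<Omega>AB (n - 1))" by (rule mh_closed[OF bd_hom[OF cxAB refl] x])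
   have "EL U.U (n - 1, q (n - 1) (bd \<Omega>AB n x)) = Q (Dt \<Omega>AB (EL \<Omega>AB (n, x)))"
    unfolding qe[OF bx, symmetric] Dt_EL[OF cAB.cobar_dga] ..
   also have "... = EL U.U (n - 1, bd U.U n (q n x))" unfolding Q_D[OF ELc[OF x]] qe[OF x] Dt_EL[OF U.U_dga] ..
   finally show "EL U.U (n - 1, q (n - 1) (bd \<Omega>AB n x)) = EL U.U (n - 1, bd U.U n (q n x))" .
  qed
  have uc: "aunit \<Omega>AB : car (obj \<Omega>AB 0)" using AB.galg by (simp add: galg_def)
  show "q 0 (aunit \<Omega>AB) = aunit U.U" by (rule el_inj[of "obj U.U" 0]) (use qe[OF uc] Q_one in \<open>simp add: Tot_one del: U.U_simps\<close>)
  fix m n x y assume x: "x : car (obj \<Omega>AB m)" and y: "y : car (obj \<Omega>AB n)"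
  have xy: "amult \<Omega>AB m n x y : car (obj \<Omega>AB (m + n))" using hmult_homs[OF AB.galg, of "(m, x)" "(n, y)"] x y by (simp add: hmult_def)
  show "q (m + n) (amult \<Omega>AB m n x y) = amult U.U m n (q m x) (q n y)"
  proof (rule el_inj)
   have "EL U.U (m + n, q (m + n) (amult \<Omega>AB m n x y)) = Q (EL \<Omega>AB (m, x) *. EL \<Omega>AB (n, y))"
    using EL_mult[OF AB.galg, of "(m, x)" "(n, y)"] x y qe[OF xy] by (simp add: hmult_def)
   also have "... = EL U.U (m, q m x) \<star> EL U.U (n, q n y)" unfolding Q_mult[OF ELc[OF x] ELc[OF y]] qe[OF x] qe[OF y] ..
   also have "... = EL U.U (m + n, amult U.U m n (q m x) (q n y))"
    using EL_mult[OF U.U_galg, of "(m, q m x)" "(n, q n y)"] qc[OF x] qc[OF y] by (simp add: hmult_def)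
   finally show "EL U.U (m + n, q (m + n) (amult \<Omega>AB m n x y)) = EL U.U (m + n, amult U.U m n (q m x) (q n y))" .
  qed
 qed
 have ql': "EL U.U (k - 1, q (k - 1) (cobar_letter R AB k x)) = ql (k, x)" if "x : car (ker_counit R AB k)" for k x
  using qe[of "cobar_letter R AB k x" "k - 1"] letter_class[OF that] that by (simp add: AB.obj_X Q_L AB.kC_simps)
 have uA: "uh R A = (0, coaug_one R A)" and uB: "uh R B = (0, coaug_one R B)" by (simp_all add: uh_def)
 have "is_milgram_map R A B q" unfolding is_milgram_map_def Let_def
 proof (intro conjI allI ballI)
  show "chain_alg_hom R \<Omega>AB U.U q" by (rule hom)
  show "q (n - 1) (cobar_letter R AB n (tens R M N (n, a) (0, coaug_one R B))) =
    tens R (obj \<Omega>A) (obj \<Omega>B) (n - 1, cobar_letter R A n a) (0, aunit \<Omega>B)" if a: "a : car (ker_counit R A n)" for n a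
  proof (rule el_inj[of "obj U.U" "n - 1"])
   have a': "(n, a) : homs M" "eps A (n, a) = \<zero>" using a by (simp_all add: A.kC_simps eps_def)
   have k: "tens R M N (n, a) (0, coaug_one R B) : car (ker_counit R AB n)" using ker_t2(1)[OF a B.one_closed'] by simp
   have "ql (n, tens R M N (n, a) (0, coaug_one R B)) = La (n, a)" using ql_t2[OF a'(1) B.uh_homs] La_closed[OF a'(1)] Lb_closed[OF B.uh_homs] a'(2)
    by (simp add: qb_def B.eps_uh Lb_uh AU.P.smult_l_null) (simp add: tn_def uB)
   then show "EL U.U (n - 1, q (n - 1) (cobar_letter R AB n (tens R M N (n, a) (0, coaug_one R B)))) =
    EL U.U (n - 1, tens R (obj \<Omega>A) (obj \<Omega>B) (n - 1, cobar_letter R A n a) (0, aunit \<Omega>B))" unfolding ql'[OF k] tt_A[OF a] .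
  qed
  show "q (n - 1) (cobar_letter R AB n (tens R M N (0, coaug_one R A) (n, b))) =
    tens R (obj \<Omega>A) (obj \<Omega>B) (0, aunit \<Omega>A) (n - 1, cobar_letter R B n b)" if b: "b : car (ker_counit R B n)" for n b
  proof (rule el_inj[of "obj U.U" "n - 1"])
   have b': "(n, b) : homs N" "eps B (n, b) = \<zero>" using b by (simp_all add: B.kC_simps eps_def)
   have k: "tens R M N (0, coaug_one R A) (n, b) : car (ker_counit R AB n)" using ker_t2(2)[OF A.one_closed' b] by simp
   have "ql (n, tens R M N (0, coaug_one R A) (n, b)) = Lb (n, b)" using ql_t2[OF A.uh_homs b'(1)] La_closed[OF A.uh_homs] Lb_closed[OF b'(1)] b'(2)
    by (simp add: qb_def A.eps_uh La_uh AU.P.smult_l_null) (simp add: tn_def uA)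
   then show "EL U.U (n - 1, q (n - 1) (cobar_letter R AB n (tens R M N (0, coaug_one R A) (n, b)))) =
    EL U.U (n - 1, tens R (obj \<Omega>A) (obj \<Omega>B) (0, aunit \<Omega>A) (n - 1, cobar_letter R B n b))" unfolding ql'[OF k] tt_B[OF b] .
  qed
  show "q (m + n - 1) (cobar_letter R AB (m + n) (tens R M N (m, a) (n, b))) = \<zero>[tensor_module R (obj \<Omega>A) (obj \<Omega>B) (m + n - 1)]"
   if a: "a : car (ker_counit R A m)" and b: "b : car (ker_counit R B n)" for m n a b
  proof (rule el_inj[of "obj U.U" "m + n - 1"])
   have a': "(m, a) : homs M" "eps A (m, a) = \<zero>" using a by (simp_all add: A.kC_simps eps_def)
   have b': "(n, b) : homs N" "eps B (n, b) = \<zero>" using b by (simp_all add: B.kC_simps eps_def)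
   have k: "tens R M N (m, a) (n, b) : car (ker_counit R AB (m + n))" using ker_t2(1)[OF a] b'(1) by simp
   have "ql (m + n, tens R M N (m, a) (n, b)) = \<zero>[UAB]" using ql_t2[OF a'(1) b'(1)] La_closed[OF a'(1)] Lb_closed[OF b'(1)] a'(2) b'(2)
    by (simp add: qb_def AU.P.smult_l_null) (simp add: tn_def)
   then show "EL U.U (m + n - 1, q (m + n - 1) (cobar_letter R AB (m + n) (tens R M N (m, a) (n, b)))) =
     EL U.U (m + n - 1, \<zero>[tensor_module R (obj \<Omega>A) (obj \<Omega>B) (m + n - 1)])"
    unfolding ql'[OF k] using EL_zero[OF U.U_galg, of "m + n - 1"] by simp
  qed
 qed
 then show ?thesis by blast
qed

text \<open>
  Every algebra morphism with the prescribed values on letters agrees with \<open>Q\<close>: by linearity, the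
  letters of \<open>a \<otimes> b\<close> with \<open>a\<close> and \<open>b\<close> either the unit or in the kernel of the counit suffice.
\<close>

lemma bil_split_ext:
 assumes P: "module R P" and F: "bil R M N P F" and G: "bil R M N P G"
  and 1: "!!a b. [|a : homs M; eps A a = \<zero>; b : homs N; eps B b = \<zero>|] ==> F a b = G a b"
  and 2: "!!a. [|a : homs M; eps A a = \<zero>|] ==> F a (uh R B) = G a (uh R B)"
  and 3: "!!b. [|b : homs N; eps B b = \<zero>|] ==> F (uh R A) b = G (uh R A) b"
  and 4: "F (uh R A) (uh R B) = G (uh R A) (uh R B)"
  and a: "a : homs M" and b: "b : homs N"
 shows "F a b = G a b"
proof -
 have x: "F a b = G a b" if a: "a : homs M" "eps A a = \<zero>" for a
  using B.hat_split[OF bil_right[OF F a(1)] P b] B.hat_split[OF bil_right[OF G a(1)] P b] 1[OF a] 2[OF a] B.hat_homs[OF b] by simp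
 have u: "F (uh R A) b = G (uh R A) b"
  using B.hat_split[OF bil_right[OF F A.uh_homs] P b] B.hat_split[OF bil_right[OF G A.uh_homs] P b] 3 4 B.hat_homs[OF b] by simp
 show ?thesis using A.hat_split[OF bil_left[OF F b] P a] A.hat_split[OF bil_left[OF G b] P a] x[of "A.hat a"] u A.hat_homs[OF a] by simp
qed

lemma milgram_unique:
 assumes q: "is_milgram_map R A B q" and x: "x : car (obj \<Omega>AB n)"
 shows "EL U.U (n, q n x) = Q (EL \<Omega>AB (n, x))"
proof -
 note q' = q[unfolded is_milgram_map_def Let_def]
 have hom: "chain_alg_hom R \<Omega>AB U.U q" using q' by blast
 have g: "graded_map R (obj \<Omega>AB) (obj U.U) 0 q" using hom by (simp add: chain_alg_hom_def chain_map_def)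
 have gA: "gmod R (obj \<Omega>AB)" and gU: "gmod R (obj U.U)" using AB.galg U.U_galg by (simp_all add: galg_def)
 let ?q = "tmap 0 q"
 have h: "?q : Hom R TAB UAB" unfolding Tot_def Let_def by (rule tmap_hom[OF gA gU g])
 have e: "?q (EL \<Omega>AB (n, x)) = EL U.U (n, q n x)" for n x using tmap_el[OF gA gU g, of n x] by simp
 have qc: "q n x : car (obj U.U n)" if "x : car (obj \<Omega>AB n)" for n x using mh_closed[OF graded_map_hom[OF g, of n n] that] by simp
 have one: "?q \<one>[TAB] = \<one>[UAB]" unfolding Tot_one e using hom by (simp add: chain_alg_hom_def)
 have mult: "?q (x *. y) = ?q x \<star> ?q y" if x: "x : car TAB" and y: "y : car TAB" for x y
 proof -
  note r = ralg_right and l = ralg_left and Tr = AB.TX_ralg and c = mh_closed[OF h]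
  have 1: "?q (EL \<Omega>AB a *. EL \<Omega>AB b) = ?q (EL \<Omega>AB a) \<star> ?q (EL \<Omega>AB b)" if a: "a : els \<Omega>AB" and b: "b : els \<Omega>AB" for a b
  proof -
   obtain m x n y where ab: "a = (m, x)" "b = (n, y)" "x : car (obj \<Omega>AB m)" "y : car (obj \<Omega>AB n)" using a b by (cases a; cases b) auto
   have "q (m + n) (amult \<Omega>AB m n x y) = amult U.U m n (q m x) (q n y)" using hom ab(3,4) unfolding chain_alg_hom_def by blast
   then show ?thesis using EL_mult[OF AB.galg a b] EL_mult[OF U.U_galg, of "(m, q m x)" "(n, q n y)"] qc[OF ab(3)] qc[OF ab(4)]
    by (simp add: ab(1,2) e hmult_def)
  qed
  have 2: "?q (EL \<Omega>AB a *. y) = ?q (EL \<Omega>AB a) \<star> ?q y" if a: "a : els \<Omega>AB" for a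
   by (rule Tot_ext[OF AB.galg mh_comp[OF r[OF Tr EL_closed[OF AB.galg a]] h] mh_comp[OF h r[OF U.TTr c[OF EL_closed[OF AB.galg a]]]] U.TTm 1[OF a] y])
  show ?thesis by (rule Tot_ext[OF AB.galg mh_comp[OF l[OF Tr y] h] mh_comp[OF h l[OF U.TTr c[OF y]]] U.TTm 2 x])
 qed
 have uA: "uh R A = (0, coaug_one R A)" and uB: "uh R B = (0, coaug_one R B)" by (simp_all add: uh_def)
 have L: "?q (AB.L t) = ql t" if t: "t : homs T" for t
 proof (rule tn_ext[OF R A.gm B.gm U.TTm lin_comp[OF AB.L_lin[unfolded AB_simps] h] ql_lin _ t])
  fix a b assume a: "a : homs M" and b: "b : homs N"
  have "?q (AB.L (t2 a b)) = qb a b"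
  proof (rule bil_split_ext[OF U.TTm lin_tn[OF R A.gm B.gm lin_comp[OF AB.L_lin[unfolded AB_simps] h]] qb_bil _ _ _ _ a b])
   fix a assume a: "a : homs M" "eps A a = \<zero>"
   obtain m x where mx: "a = (m, x)" by (cases a)
   have k: "x : car (ker_counit R A m)" using a mx by (simp add: A.kC_simps eps_def)
   have "?q (AB.L (t2 a (uh R B))) = EL U.U (m - 1, q (m - 1) (cobar_letter R AB m (tens R M N (m, x) (0, coaug_one R B))))"
    using EL_letter[of m x 0 "coaug_one R B"] ker_t2(1)[OF k B.one_closed']
     e[of "m - 1" "cobar_letter R AB m (tens R M N (m, x) (0, coaug_one R B))"] by (simp add: mx uB)
   also have "... = La a" using q' k tt_A[OF k] by (simp add: mx)
   finally show "?q (AB.L (t2 a (uh R B))) = qb a (uh R B)"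
    using a La_closed[OF a(1)] Lb_closed[OF B.uh_homs] by (simp add: qb_def B.eps_uh Lb_uh AU.P.smult_l_null)
   fix b assume b: "b : homs N" "eps B b = \<zero>"
   obtain n y where ny: "b = (n, y)" by (cases b)
   have l: "y : car (ker_counit R B n)" "y : car (N n)" using b ny by (simp_all add: B.kC_simps eps_def)
   have "?q (AB.L (t2 a b)) = EL U.U (m + n - 1, q (m + n - 1) (cobar_letter R AB (m + n) (tens R M N (m, x) (n, y))))"
    using EL_letter[of m x n y] ker_t2(1)[OF k l(2)]
     e[of "m + n - 1" "cobar_letter R AB (m + n) (tens R M N (m, x) (n, y))"] by (simp add: mx ny)
   also have "... = \<zero>[UAB]" using q' k l(1) EL_zero[OF U.U_galg, of "m + n - 1"] by simp
   finally show "?q (AB.L (t2 a b)) = qb a b" using a b La_closed[OF a(1)] Lb_closed[OF b(1)] by (simp add: qb_def AU.P.smult_l_null)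
  next
   fix b assume b: "b : homs N" "eps B b = \<zero>"
   obtain n y where ny: "b = (n, y)" by (cases b)
   have l: "y : car (ker_counit R B n)" using b ny by (simp_all add: B.kC_simps eps_def)
   have "?q (AB.L (t2 (uh R A) b)) = EL U.U (n - 1, q (n - 1) (cobar_letter R AB n (tens R M N (0, coaug_one R A) (n, y))))"
    using EL_letter[of 0 "coaug_one R A" n y] ker_t2(2)[OF A.one_closed' l]
     e[of "n - 1" "cobar_letter R AB n (tens R M N (0, coaug_one R A) (n, y))"] by (simp add: ny uA)
   also have "... = Lb b" using q' l tt_B[OF l] by (simp add: ny)
   finally show "?q (AB.L (t2 (uh R A) b)) = qb (uh R A) b"
    using b Lb_closed[OF b(1)] La_closed[OF A.uh_homs] by (simp add: qb_def A.eps_uh La_uh AU.P.smult_l_null)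
  next
   have "?q (AB.L (t2 (uh R A) (uh R B))) = \<zero>[UAB]" using AB.L_uh mh_zero[OF h AB.TXm U.TTm] by (simp add: uh_AB)
   then show "?q (AB.L (t2 (uh R A) (uh R B))) = qb (uh R A) (uh R B)" using ql_uh by (simp add: uh_AB ql_t2 A.uh_homs B.uh_homs)
  qed
  then show "?q (AB.L (t2 a b)) = ql (t2 a b)" by (simp add: ql_t2 a b)
 qed
 have "?q (EL \<Omega>AB (n, x)) = Q (EL \<Omega>AB (n, x))"
 proof (rule AB.ahom_unique[OF U.TTr h Q_hom one Q_one mult Q_mult])
  fix l assume l: "l : homs AB.Vk"
  show "?q (AB.W [l]) = Q (AB.W [l])" using letter_homs[OF l] by (simp add: W_letter[OF l] L Q_L)
 next
  show "EL \<Omega>AB (n, x) : car TAB" using x by (intro EL_closed[OF AB.galg]) simp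
 qed
 then show ?thesis by (simp add: e)
qed

end

context alg_pair
begin

definition "uext P F = direct TU P (%t. lift R P (%(a, b). F a b) (snd t))"

lemma uext_lin: "module R P ==> bil R (obj X) (obj Y) P F ==> lin R TU P (%t. lift R P (%(a, b). F a b) (snd t))"
 unfolding lin_def snd_conv by (intro allI lift_bil_hom[OF R M N])

lemma uext_hom: "module R P ==> bil R (obj X) (obj Y) P F ==> uext P F : Hom R TT P"
 unfolding uext_def by (rule Direct_hom[OF U_galg, unfolded U_simps]) (auto intro: uext_lin)

lemma uext_tt:
 assumes P: "module R P" and F: "bil R (obj X) (obj Y) P F" and a: "a : els X" and b: "b : els Y"
 shows "uext P F (tt a b) = F a b" using Direct_el[OF U_galg P, unfolded U_simps, OF uext_lin[OF P F] tn_homs[OF R M N a b]]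
  lift_bil_tens[OF R M N P F a b] by (simp add: uext_def tt_def tn_def)

lemma inXY_ext:
 assumes f: "f : Hom R TT P" and g: "g : Hom R TT P" and P: "module R P"
  and eq: "!!a y. [|a : els X; y : car (Tot Y)|] ==> f (inX (EL X a) \<otimes>[TT] inY y) = g (inX (EL X a) \<otimes>[TT] inY y)"
  and t: "t : car TT"
 shows "f t = g t" by (rule U_ext[OF f g P _ t]) (simp add: tt_inX_inY eq EL_closed[OF gY])

end

lemma tri_mult:
 assumes P: "ralg R P" and F: "lin R M P F" and E: "bil R M M P E"
 shows "tri R M P (%p q r. ksign P (k (fst p) (fst q) (fst r)) (F p \<otimes>[P] E q r))" unfolding tri_def
proof (intro conjI ballI)
 note Pm = ralgD(1)[OF P]
 fix x assume x: "x : homs M"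
 show "bil R M M P (%q r. ksign P (k (fst x) (fst q) (fst r)) (F x \<otimes>[P] E q r))"
  by (rule bil_ksign[OF bil_comp[OF E ralg_right[OF P lin_closed[OF F x]]] Pm])
 show "bil R M M P (%p q. ksign P (k (fst p) (fst q) (fst x)) (F p \<otimes>[P] E q x))"
  by (rule bil_ksign[OF bil_mult[OF P F bil_left[OF E x]] Pm, of "%i j. k i j (fst x)"])
qed

context coaugmented
begin

lemma lin_Vk: "lin R (obj C) P F ==> lin R Vk P (%l. F (fst l + 1, snd l))" unfolding lin_def fst_conv snd_conv
proof
 fix n assume F: "\<forall>n. (%x. F (n, x)) : Hom R (obj C n) P"
 show "(%x. F (n + 1, x)) : Hom R (Vk n) P" using spec[OF F, of "n + 1"] by (auto simp: desusp_ker_def module_hom_def hom_def kC_simps)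
qed

lemma VkD: "l : homs Vk ==> (fst l + 1, snd l) : els C & eps C (fst l + 1, snd l) = \<zero> & W [l] = L (fst l + 1, snd l)"
 using homs_Vk homs_kC by (simp add: L_def bar_letter)

end

context milgram begin

lemma TABr: "ralg R TAB" by (rule AB.TX_ralg)
lemma TABm: "module R TAB" by (rule AB.TXm)
lemma TABag: "abelian_group TAB" by (rule ralgD(3)[OF TABr])

sublocale TR: ring "Tot (cobar R (tensor_coalg R A B))" by (rule ralgD(2)[OF AB.TX_ralg])

definition "Lt a b = AB.L (t2 a b)"

lemma Lt_bil: "bil R M N TAB Lt" unfolding Lt_def by (rule lin_tn[OF R A.gm B.gm]) (use AB.L_lin in simp)

lemma Lt_closed: "a : homs M ==> b : homs N ==> Lt a b : car TAB" by (rule bil_closed[OF Lt_bil])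

lemma Lt_hdeg: "a : homs M ==> b : homs N ==> fst a + fst b - 1 = n ==> Lt a b : hdeg \<Omega>AB n" using L_hdeg(3)[of "t2 a b"] by (simp add: Lt_def)

lemma Lt_uh: "Lt (uh R A) (uh R B) = \<zero>[TAB]" using AB.L_uh by (simp add: Lt_def uh_AB)

abbreviation "d == Dt \<Omega>AB"

lemma d_hom: "d : Hom R TAB TAB" by (rule cAB.D_hom)
lemma d_closed: "x : car TAB ==> d x : car TAB" by (rule cAB.D_closed)

lemma d_mult_hdeg: "x : hdeg \<Omega>AB k ==> y : car TAB ==> d (x *. y) = d x *. y +. ksign TAB k (x *. d y)"
 using cAB.D_mult[OF hdeg_closed[OF AB.galg]] hdeg_gam[OF AB.galg] hdeg_closed[OF AB.galg] by (simp add: ralg_ksign[OF TABr] d_closed)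

lemma d_Lt:
 assumes a: "a : homs M" and b: "b : homs N"
 shows "d (Lt a b) = (ksign TAB 1 (Lt (dh A a) b) +. ksign TAB (fst a + 1) (Lt a (dh B b))) +.
  csA TAB a (%a1 a2. csB TAB b (%b1 b2. ksign TAB (fst a2 * fst b1 + fst a1 + fst b1) (Lt a1 b1 *. Lt a2 b2)))"
proof -
 have t: "t2 a b : els AB" using a b by simp
 have LL: "bil R T T TAB (%x y. ksign TAB (fst x) (AB.L x *. AB.L y))" using AB.LL_bil by simp
 have Ll: "lin R T TAB AB.L" using AB.L_lin by simp
 have c: "Lt (dh A a) b : car TAB" "Lt a (dh B b) : car TAB" using dh_homs[OF A.cx a] dh_homs[OF B.cx b] a b by (auto intro: Lt_closed)
 have "csAB TAB (t2 a b) (%x y. ksign TAB (fst x) (AB.L x *. AB.L y)) =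
  csA TAB a (%a1 a2. csB TAB b (%b1 b2. ksign TAB (fst a2 * fst b1 + fst a1 + fst b1) (Lt a1 b1 *. Lt a2 b2)))"
  unfolding csum_AB[OF TABm LL a b]
  by (intro A.csum_cong[OF a] B.csum_cong[OF b]) (simp add: ksign_ksign[OF TABag] Lt_closed[unfolded Lt_def] Lt_def add.assoc)
 note s = this
 have D: "d (Lt a b) = cAB.DL (t2 a b)" using cAB.D_L[OF t] by (simp add: Lt_def)
 have e: "ksign TAB 1 (AB.L (dh AB (t2 a b))) = ksign TAB 1 (Lt (dh A a) b) +. ksign TAB (fst a + 1) (Lt a (dh B b))"
  unfolding dh_t2[OF Ll TABm a b] using c by (simp add: ksign_add[OF TABag] TABag ksign_ksign[OF TABag] Lt_def add.commute)
 show ?thesis unfolding D cAB.DL_def e s ..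
qed

section \<open>The section of the Milgram map\<close>

definition "sB = B.ahom TAB (%l. Lt (uh R A) (fst l + 1, snd l))"

lemma LtB_lin: "lin R N TAB (Lt (uh R A))" by (rule bil_right[OF Lt_bil A.uh_homs])

lemma sB_hom: "sB : Hom R B.TX TAB" unfolding sB_def by (rule B.ahom_hom[OF TABr B.lin_Vk[OF LtB_lin]])
lemma sB_one: "sB \<one>[B.TX] = \<one>[TAB]" unfolding sB_def by (rule B.ahom_one[OF TABr B.lin_Vk[OF LtB_lin]])
lemma sB_mult: "x : car B.TX ==> y : car B.TX ==> sB (x \<otimes>[B.TX] y) = sB x *. sB y"
 unfolding sB_def by (rule B.ahom_mult[OF TABr B.lin_Vk[OF LtB_lin]])

lemma sB_closed: "x : car B.TX ==> sB x : car TAB" by (rule mh_closed[OF sB_hom])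

lemma sB_L:
 assumes b: "b : homs N" shows "sB (B.L b) = Lt (uh R A) b"
proof -
 have "sB (B.L b) = Lt (uh R A) (B.hat b)" unfolding B.L_def sB_def B.ahom_letter[OF TABr B.lin_Vk[OF LtB_lin] B.bar_homs[OF b]]
  by (simp add: B.bar_def B.hat_def)
 then show ?thesis using B.hat_split[OF LtB_lin TABm b] B.hat_homs[OF b] B.eps_closed[OF b] Lt_closed[OF A.uh_homs]
  by (simp add: Lt_uh module.smult_r_null[OF TABm])
qed

lemma LtLt_bil_A: "b1 : homs N ==> b2 : homs N ==> bil R M M TAB (%a1 a2. ksign TAB (k (fst a1) (fst a2)) (Lt a1 b1 *. Lt a2 b2))"
 by (rule bil_ksign[OF bil_mult[OF TABr bil_left[OF Lt_bil] bil_left[OF Lt_bil]] TABm])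

lemma d_LtB:
 assumes b: "b : homs N"
 shows "d (Lt (uh R A) b) = sB (cB.DL b)"
proof -
 interpret TB: ring B.TX by (rule ralgD(2)[OF B.TX_ralg])
 note agB = ralgD(3)[OF B.TX_ralg]
 have Lc: "B.L x : car B.TX" if "x : homs N" for x by (rule B.L_closed[OF that])
 note db = dh_homs[OF B.cx b]
 have 1: "sB (csB B.TX b (%x y. ksign B.TX (fst x) (B.L x \<otimes>[B.TX] B.L y))) =
   csB TAB b (%x y. ksign TAB (fst x) (Lt (uh R A) x *. Lt (uh R A) y))"
 proof -
  have "sB (csB B.TX b (%x y. ksign B.TX (fst x) (B.L x \<otimes>[B.TX] B.L y))) =
    csB TAB b (%x y. sB (ksign B.TX (fst x) (B.L x \<otimes>[B.TX] B.L y)))" by (rule B.csum_hom[OF B.TXm sB_hom TABm b]) (simp add: Lc agB)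
  also have "... = csB TAB b (%x y. ksign TAB (fst x) (Lt (uh R A) x *. Lt (uh R A) y))"
   by (rule B.csum_cong[OF b]) (simp add: mh_ksign[OF sB_hom B.TXm TABm] Lc sB_mult sB_L)
  finally show ?thesis .
 qed
 have LL: "bil R M M TAB (%a1 a2. ksign TAB (fst a2 * fst b1 + fst a1 + fst b1) (Lt a1 b1 *. Lt a2 b2))"
  if "b1 : homs N" "b2 : homs N" for b1 b2 using LtLt_bil_A[OF that, of "%i j. j * fst b1 + i + fst b1"] .
 have 2: "csA TAB (uh R A) (%a1 a2. csB TAB b (%b1 b2. ksign TAB (fst a2 * fst b1 + fst a1 + fst b1) (Lt a1 b1 *. Lt a2 b2))) =
   csB TAB b (%x y. ksign TAB (fst x) (Lt (uh R A) x *. Lt (uh R A) y))"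
 proof -
  have "bil R M M TAB (%a1 a2. csB TAB b (%b1 b2. ksign TAB (fst a2 * fst b1 + fst a1 + fst b1) (Lt a1 b1 *. Lt a2 b2)))"
   by (rule coalgebra_pair.bil_csum[OF pair[OF TABm] b]) (rule LL)
  from AT.csum_one[OF this] show ?thesis by simp
 qed
 have c: "csB B.TX b (%x y. ksign B.TX (fst x) (B.L x \<otimes>[B.TX] B.L y)) : car B.TX"
  by (rule lin_closed[OF B.csum_lin[OF B.TXm B.LL_bil] b])
 have 3: "Lt (dh A (uh R A)) b = \<zero>[TAB]" by (rule A.dh_uh[OF bil_left[OF Lt_bil b] TABm])
 show ?thesis unfolding d_Lt[OF A.uh_homs b] 2 3 cB.DL_def using c Lc[OF db] Lt_closed[OF A.uh_homs db]
  by (simp add: mh_add[OF sB_hom] agB TABag mh_ksign[OF sB_hom B.TXm TABm] sB_L[OF db] 1)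
qed

lemma sB_d: "x : car B.TX ==> sB (Dt \<Omega>B x) = d (sB x)"
proof (rule B.ahom_chain[OF cB.cobar_dga cAB.cobar_dga sB_hom sB_one sB_mult])
 fix l assume l: "l : homs B.Vk"
 note v = B.VkD[OF l]
 show "sB (B.W [l]) : hdeg \<Omega>AB (fst l)" using v by (simp add: sB_L Lt_hdeg A.uh_homs)
 show "sB (Dt \<Omega>B (B.W [l])) = d (sB (B.W [l]))" using v by (simp add: sB_L cB.D_L d_LtB)
qed

lemma sB_hdeg: "b : els \<Omega>B ==> sB (EL \<Omega>B b) : hdeg \<Omega>AB (fst b)"
proof -
 assume b: "b : els \<Omega>B"
 have "sB (B.W w) : hdeg \<Omega>AB (word_deg w + 0)" if "set w <= homs B.Vk" for w using that
 proof (induction w)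
  case Nil show ?case using hdeg_one[OF AB.galg] by (simp add: B.W_Nil sB_one)
 next
  case (Cons l w)
  have l: "l : homs B.Vk" and w: "set w <= homs B.Vk" using Cons.prems by auto
  have "B.W (l # w) = B.W [l] \<otimes>[B.TX] B.W w" using B.W_append[of "[l]" w] l w by simp
  moreover have "sB (B.W [l]) : hdeg \<Omega>AB (fst l)" using B.VkD[OF l] by (simp add: sB_L Lt_hdeg A.uh_homs)
  ultimately show ?case using hdeg_mult[OF AB.galg _ Cons.IH[OF w], of _ "fst l"] sB_mult[OF B.W_closed[of "[l]"] B.W_closed[OF w]] l by simp
 qed
 from B.hdeg_hom[OF AB.galg sB_hom this, of "snd b" "fst b"] homs_snd[OF b] show ?thesis by (simp add: B.obj_X)
qed

lemma Q_sB: "x : car B.TX ==> Q (sB x) = U.inY x"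
proof (rule B.ahom_unique[OF U.TTr mh_comp[OF sB_hom Q_hom] U.inY_hom])
 fix l assume l: "l : homs B.Vk"
 note v = B.VkD[OF l]
 have b: "(fst l + 1, snd l) : homs N" "eps B (fst l + 1, snd l) = \<zero>" using v by auto
 show "Q (sB (B.W [l])) = U.inY (B.W [l])" using v La_closed[OF A.uh_homs] Lb_closed[OF b(1)] b
  by (simp add: sB_L) (simp add: Lt_def Q_L A.uh_homs ql_t2 qb_def A.eps_uh La_uh AU.P.smult_l_null Lb_def)
qed (simp_all add: sB_one Q_one U.inY_one sB_mult Q_mult sB_closed U.inY_mult)

end

section \<open>The convolution product\<close>

context milgram begin

abbreviation "sg == ksign TAB"
abbreviation "cs == csB TAB"

lemmas sg_simps = TABag ksign_ksign[OF TABag] ralg_ksign[OF TABr]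
lemmas sg_add = ksign_add[OF TABag]

text \<open>
  The convolution product of maps from \<open>B\<close> to \<open>\<Omega>(A \<otimes> B)\<close>. The integer \<open>m\<close> is the total degree of \<open>g\<close>; the
  sign is that of \<open>g\<close> passing the first factor of the coproduct.
\<close>

definition "conv m f g c = cs c (%x y. sg (m * fst x) (f x *. g y))"

lemma conv_bil: "lin R N TAB f ==> lin R N TAB g ==> bil R N N TAB (%x y. sg (m * fst x) (f x *. g y))"
 using bil_ksign[OF bil_mult[OF TABr] TABm, of N f N g "%i j. m * i"] by simp

lemma conv_lin: "lin R N TAB f ==> lin R N TAB g ==> lin R N TAB (conv m f g)" unfolding conv_def[abs_def] by (rule B.csum_lin[OF TABm conv_bil])

lemma conv_closed: "lin R N TAB f ==> lin R N TAB g ==> c : homs N ==> conv m f g c : car TAB" by (rule lin_closed[OF conv_lin])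

lemma conv_cong: "c : homs N ==> (!!x. x : homs N ==> f x = f' x) ==> (!!x. x : homs N ==> g x = g' x) ==>
  conv m f g c = conv m f' g' c" unfolding conv_def by (rule B.csum_cong) auto

lemma conv_add:
 assumes c: "c : homs N" and f: "!!x. x : homs N ==> f x : car TAB" and f': "!!x. x : homs N ==> f' x : car TAB"
  and g: "!!x. x : homs N ==> g x : car TAB"
 shows "conv m (%x. f x +. f' x) g c = conv m f g c +. conv m f' g c"
  and "conv m g (%x. f x +. f' x) c = conv m g f c +. conv m g f' c"
proof -
 have a: "(f x +. f' x) *. g y = f x *. g y +. f' x *. g y" "g x *. (f y +. f' y) = g x *. f y +. g x *. f' y"
  if "x : homs N" "y : homs N" for x y using that f f' g by (simp_all add: ring.ring_simprules[OF ralgD(2)[OF TABr]])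
 have cl: "f x *. g y : car TAB" "f' x *. g y : car TAB" "g x *. f y : car TAB" "g x *. f' y : car TAB"
  if "x : homs N" "y : homs N" for x y using that f f' g by simp_all
 have "cs c (%x y. sg (m * fst x) ((f x +. f' x) *. g y)) = cs c (%x y. sg (m * fst x) (f x *. g y) +. sg (m * fst x) (f' x *. g y))"
  "cs c (%x y. sg (m * fst x) (g x *. (f y +. f' y))) = cs c (%x y. sg (m * fst x) (g x *. f y) +. sg (m * fst x) (g x *. f' y))"
  by (rule B.csum_cong[OF c], simp add: a cl sg_add)+
 then show "conv m (%x. f x +. f' x) g c = conv m f g c +. conv m f' g c" "conv m g (%x. f x +. f' x) c = conv m g f c +. conv m g f' c"
  by (simp_all add: conv_def B.csum_add[OF TABm c] cl TABag)
qed

lemma conv_sg: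
 assumes c: "c : homs N" and f: "!!x. x : homs N ==> f x : car TAB" and g: "!!x. x : homs N ==> g x : car TAB"
 shows "conv m (%x. sg i (f x)) g c = sg i (conv m f g c)"
  and "conv m g (%x. sg i (f x)) c = sg i (conv m g f c)"
proof -
 have "cs c (%x y. sg (m * fst x) (sg i (f x) *. g y)) = cs c (%x y. sg i (sg (m * fst x) (f x *. g y)))"
  "cs c (%x y. sg (m * fst x) (g x *. sg i (f y))) = cs c (%x y. sg i (sg (m * fst x) (g x *. f y)))"
  by (rule B.csum_cong[OF c], simp add: sg_simps f g add.commute)+
 then show "conv m (%x. sg i (f x)) g c = sg i (conv m f g c)" "conv m g (%x. sg i (f x)) c = sg i (conv m g f c)"
  by (simp_all add: conv_def B.csum_ksign[OF TABm c] f g TABag)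
qed

lemma conv_assoc:
 assumes f: "lin R N TAB f" and g: "lin R N TAB g" and h: "lin R N TAB h" and c: "c : homs N"
 shows "conv n (conv m f g) h c = conv (m + n) f (conv n g h) c"
proof -
 note cl = lin_closed[OF f] lin_closed[OF g] lin_closed[OF h]
 let ?G = "%x y z. sg ((m + n) * fst x + n * fst y) (f x *. (g y *. h z))"
 have "conv n (conv m f g) h c = cs c (%x z. cs x (%x y. ?G x y z))" unfolding conv_def[of n "conv m f g"]
 proof (rule B.csum_cong[OF c])
  fix x z assume x: "x : homs N" and z: "z : homs N"
  have "sg (n * fst x) (conv m f g x *. h z) = cs x (%x' y. sg (n * fst x) (sg (m * fst x') (f x' *. g y) *. h z))" unfolding conv_def
   by (rule B.csum_hom[OF TABm mh_ksignI[OF ralg_left[OF TABr cl(3)[OF z]] TABm] TABm x]) (simp add: cl TABag)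
  also have "... = cs x (%x y. ?G x y z)" by (rule B.csum_cong[OF x], drule sym[of "_ + _"]) (simp add: cl z sg_simps TR.m_assoc algebra_simps)
  finally show "sg (n * fst x) (conv m f g x *. h z) = cs x (%x y. ?G x y z)" .
 qed
 also have "... = cs c (%x w. cs w (?G x))" by (rule BT.coassoc[OF tri_mult[OF TABr f bil_mult[OF TABr g h], of "%i j l. (m + n) * i + n * j"] c])
 also have "... = conv (m + n) f (conv n g h) c" unfolding conv_def[of "m + n"]
 proof (rule B.csum_cong[OF c])
  fix x w assume x: "x : homs N" and w: "w : homs N"
  have "sg ((m + n) * fst x) (f x *. conv n g h w) = cs w (%y z. sg ((m + n) * fst x) (f x *. sg (n * fst y) (g y *. h z)))"
   unfolding conv_def by (rule B.csum_hom[OF TABm mh_ksignI[OF ralg_right[OF TABr cl(1)[OF x]] TABm] TABm w]) (simp add: cl TABag)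
  also have "... = cs w (?G x)" by (rule B.csum_cong[OF w]) (simp add: cl x sg_simps)
  finally show "cs w (?G x) = sg ((m + n) * fst x) (f x *. conv n g h w)" ..
 qed
 finally show ?thesis .
qed

lemma conv_dh:
 assumes f: "lin R N TAB f" and g: "lin R N TAB g" and c: "c : homs N"
 shows "conv m f g (dh B c) = sg m (conv m (%x. f (dh B x)) g c) +. conv (m - 1) f (%x. g (dh B x)) c"
proof -
 note cl = lin_closed[OF f] lin_closed[OF g] and dB = dh_homs[OF B.cx]
 have "conv m f g (dh B c) = cs c (%x y. sg m (sg (m * fst x) (f (dh B x) *. g y)) +. sg ((m - 1) * fst x) (f x *. g (dh B y)))"
  unfolding conv_def BT.csum_bd[OF conv_bil[OF f g] c]
 proof (rule B.csum_cong[OF c])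
  fix x y assume h: "x : homs N" "y : homs N"
  have "sg (m * (fst x - 1)) z = sg (m + m * fst x) z" "sg (fst x + m * fst x) z = sg ((m - 1) * fst x) z" for z by (auto intro!: ksign_cong)
  then show "sg (m * fst (dh B x)) (f (dh B x) *. g y) +. sg (fst x) (sg (m * fst x) (f x *. g (dh B y))) =
    sg m (sg (m * fst x) (f (dh B x) *. g y)) +. sg ((m - 1) * fst x) (f x *. g (dh B y))" using h by (simp add: cl dB sg_simps)
 qed
 also have "... = sg m (conv m (%x. f (dh B x)) g c) +. conv (m - 1) f (%x. g (dh B x)) c"
  unfolding conv_def by (subst B.csum_add[OF TABm c]; simp add: cl dB sg_simps B.csum_ksign[OF TABm c])
 finally show ?thesis .
qed

lemma conv_d:
 assumes f: "lin R N TAB f" and fd: "!!x. x : homs N ==> f x : hdeg \<Omega>AB (k + fst x)" and g: "lin R N TAB g" and c: "c : homs N"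
 shows "d (conv m f g c) = conv m (%x. d (f x)) g c +. sg k (conv (m - 1) f (%x. d (g x)) c)"
proof -
 note cl = lin_closed[OF f] lin_closed[OF g]
 have "d (conv m f g c) = cs c (%x y. d (sg (m * fst x) (f x *. g y)))"
  unfolding conv_def by (rule B.csum_hom[OF TABm d_hom TABm c]) (simp add: cl TABag)
 also have "... = cs c (%x y. sg (m * fst x) (d (f x) *. g y) +. sg k (sg ((m - 1) * fst x) (f x *. d (g y))))"
 proof (rule B.csum_cong[OF c])
  fix x y assume h: "x : homs N" "y : homs N"
  have "sg (m * fst x + (k + fst x)) z = sg (k + (m - 1) * fst x) z" for z by (auto intro!: ksign_cong)
  then show "d (sg (m * fst x) (f x *. g y)) = sg (m * fst x) (d (f x) *. g y) +. sg k (sg ((m - 1) * fst x) (f x *. d (g y)))"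
   using h cl by (simp add: mh_ksign[OF d_hom TABm TABm] d_mult_hdeg[OF fd] d_closed sg_simps sg_add)
 qed
 also have "... = conv m (%x. d (f x)) g c +. sg k (conv (m - 1) f (%x. d (g x)) c)"
  unfolding conv_def by (subst B.csum_add[OF TABm c]; simp add: cl d_closed sg_simps B.csum_ksign[OF TABm c])
 finally show ?thesis .
qed

text \<open>
  The map \<open>c \<mapsto> [1 \<otimes> c]\<close> is a twisting cochain, since the unit of \<open>A\<close> is group-like; its convolution
  commutators correct the differentials below.
\<close>

abbreviation "\<tau> == Lt (uh R A)"

text \<open>The unit of the convolution product.\<close>

abbreviation "e1 == %c. eps B c \<odot>[TAB] \<one>[TAB]"

lemma e1_lin: "lin R N TAB e1"
 by (rule linI) (simp_all add: B.eps_closed B.eps_add B.eps_smult module.smult_closed[OF TABm] module.smult_l_distr[OF TABm] module.smult_assoc1[OF TABm])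

lemma conv_e1:
 assumes f: "lin R N TAB f" and c: "c : homs N"
 shows "conv m e1 f c = f c" "conv 0 f e1 c = f c"
proof -
 note cl = lin_closed[OF f] B.eps_closed
 have "conv m e1 f c = cs c (%x y. eps B x \<odot>[TAB] f y)" unfolding conv_def
 proof (rule B.csum_cong[OF c])
  fix x y assume h: "x : homs N" "y : homs N"
  have "sg (m * fst x) (eps B x \<odot>[TAB] f y) = eps B x \<odot>[TAB] f y"
  proof (cases "fst x = 0")
   case False
   then show ?thesis using h cl B.eps_deg[of x] by (simp add: module.smult_l_null[OF TABm] TABag)
  qed simp
  then show "sg (m * fst x) (e1 x *. f y) = eps B x \<odot>[TAB] f y" using h cl by (simp add: ralgD(4)[OF TABr])
 qed
 then show "conv m e1 f c = f c" by (simp add: BT.counit_left[OF f c])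
 have "conv 0 f e1 c = cs c (%x y. eps B y \<odot>[TAB] f x)" unfolding conv_def by (rule B.csum_cong[OF c]) (simp add: cl ralgD(5)[OF TABr])
 then show "conv 0 f e1 c = f c" by (simp add: BT.counit_right[OF f c])
qed

end

lemma (in comultiplicative) mh_csum:
 assumes P: "module R P" and a: "a : els C"
  and F: "!!x y. [|x : els C; y : els C|] ==> F x y : Hom R Q P"
 shows "(%t. csum R C P a (%x y. F x y t)) : Hom R Q P"
proof -
 have "F (fst p) (snd p) : Hom R Q P" if "p : set (sw R C a)" for p using sw_spec[OF a] F that by blast
 then have "(%t. lsum P (%p. F (fst p) (snd p) t) xs) : Hom R Q P" if "set xs <= set (sw R C a)" for xs
  using that by (induction xs) (auto intro: mh_plus mh_const_zero P)
 then show ?thesis by (simp add: csum_def)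
qed

lemma (in coalgebra_into) csum_reduced:
 assumes F: "bil R (obj C) (obj C) P F" and a: "a : els C" and e: "eps C a = \<zero>"
 shows "csum R C P a F = F a (uh R C) \<oplus>[P] F (uh R C) a \<oplus>[P] csum R C P a (%x y. F (hat x) (hat y))"
proof -
 note r = bil_right[OF F] and l = bil_left[OF F] and u = uh_homs and h = hat_homs
 note cl = bil_closed[OF F]
 have 1: "csum R C P a F = csum R C P a (%x y. F (hat x) (hat y) \<oplus>[P] (eps C y \<odot>[P] F (hat x) (uh R C) \<oplus>[P] eps C x \<odot>[P] F (uh R C) y))"
 proof (rule csum_cong[OF a])
  fix x y assume x: "x : els C" and y: "y : els C"
  show "F x y = F (hat x) (hat y) \<oplus>[P] (eps C y \<odot>[P] F (hat x) (uh R C) \<oplus>[P] eps C x \<odot>[P] F (uh R C) y)"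
   using hat_split[OF l[OF y] P.module_axioms x] hat_split[OF r[OF conjunct1[OF h[OF x]]] P.module_axioms y]
    cl[of "hat x" "hat y"] cl[of "hat x" "uh R C"] cl[of "uh R C" y] h[OF x] h[OF y] u y eps_closed[OF x] eps_closed[OF y] by (simp add: P.a_assoc)
 qed
 have c: "F (hat x) (hat y) : car P" "eps C y \<odot>[P] F (hat x) (uh R C) : car P" "eps C x \<odot>[P] F (uh R C) y : car P"
  if "x : els C" "y : els C" for x y using that h cl u eps_closed by simp_all
 have m: "module R P" by (rule P.module_axioms)
 have "csum R C P a (%x y. eps C y \<odot>[P] F (hat x) (uh R C)) = F a (uh R C)" using counit_right[OF lin_hat[OF l[OF u]] a] hat_ker[OF a e] by simp
 moreover have "csum R C P a (%x y. eps C x \<odot>[P] F (uh R C) y) = F (uh R C) a" by (rule counit_left[OF r[OF u] a])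
 moreover have "csum R C P a (%x y. F (hat x) (hat y)) : car P" by (rule csum_closed[OF m a]) (simp add: c)
 ultimately show ?thesis unfolding 1 using cl[OF a u] cl[OF u a] by (simp add: csum_add[OF m a] c P.a_ac)
qed

section \<open>The twisting cochain\<close>

context milgram begin

text \<open>
  The word \<open>[a\<^sub>1|...|a\<^sub>n]\<close> is sent to the map \<open>c \<mapsto> \<Sum> \<plusminus> [a\<^sub>1 \<otimes> c\<^sub>1] ... [a\<^sub>n \<otimes> c\<^sub>n]\<close>, the sum being
  over the iterated coproduct of \<open>c\<close>. The stored degree of a letter is one less than the degree of
  the element of \<open>A\<close> below it, hence the \<open>+ 1\<close>.
\<close>

primrec phi :: "'a homog list => 'b homog => int => ('r, ('r, 'a, 'b) tensor) tensor_word" where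
 "phi [] = e1"
| "phi (l # w) = conv (word_deg w) (Lt (fst l + 1, snd l)) (phi w)"

lemmas A_letter = A.VkD[THEN conjunct1] A.VkD[THEN conjunct2, THEN conjunct1] A.VkD[THEN conjunct2, THEN conjunct2]

lemma LtB_lin': "a : homs M ==> lin R N TAB (Lt a)" by (rule bil_right[OF Lt_bil])

lemma phi_lin: "set w <= homs A.Vk ==> lin R N TAB (phi w)"
proof (induction w)
 case Nil show ?case using e1_lin by simp
next
 case (Cons l w)
 have l: "l : homs A.Vk" and w: "set w <= homs A.Vk" using Cons.prems by simp_all
 show ?case unfolding phi.simps by (rule conv_lin[OF LtB_lin'[OF A_letter(1)[OF l]] Cons.IH[OF w]])
qed

lemma phi_closed: "set w <= homs A.Vk ==> c : homs N ==> phi w c : car TAB" by (rule lin_closed[OF phi_lin])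

lemma phi_mul:
 assumes c: "c : homs N" shows "mul R A.Vk TAB (%w. phi w c)"
proof (rule mulI)
 show "phi [] c : car TAB" by (rule phi_closed[OF _ c]) simp
 fix u w assume u: "set u <= homs A.Vk" and w: "set w <= homs A.Vk"
 show "lin R A.Vk TAB (%l. phi (u @ l # w) c)" using u c
 proof (induction u arbitrary: c)
  case Nil
  have "lin R A.Vk TAB (%l. sg (word_deg w * fst x) (Lt (fst l + 1, snd l) x *. phi w y))" if "x : homs N" "y : homs N" for x y
   using lin_ksignI[OF lin_comp[OF A.lin_Vk[OF bil_left[OF Lt_bil that(1)]] ralg_left[OF TABr phi_closed[OF w that(2)]]] TABm,
    of "%_. word_deg w * fst x"] .
  then show ?case unfolding append.simps phi.simps conv_def by (rule B.csum_param_lin[OF TABm _ Nil(2)])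
 next
  case (Cons v u)
  have v: "v : homs A.Vk" and u: "set u <= homs A.Vk" using Cons.prems by simp_all
  have "lin R A.Vk TAB (%l. sg (word_deg (u @ l # w) * fst x) (Lt (fst v + 1, snd v) x *. phi (u @ l # w) y))"
   if "x : homs N" "y : homs N" for x y
   using lin_ksignI[OF lin_comp[OF Cons.IH[OF u that(2)] ralg_right[OF TABr Lt_closed[OF A_letter(1)[OF v] that(1)]]] TABm,
    of "%i. (word_deg u + (i + word_deg w)) * fst x"] by simp
  then show ?case unfolding append.simps phi.simps conv_def by (rule B.csum_param_lin[OF TABm _ Cons.prems(2)])
 qed
qed

lemma phi_hdeg: "set w <= homs A.Vk ==> c : homs N ==> phi w c : hdeg \<Omega>AB (word_deg w + fst c)"
proof (induction w arbitrary: c)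
 case Nil
 show ?case
 proof (cases "fst c = 0")
  case True
  then show ?thesis using hdeg_smult[OF AB.galg B.eps_closed[OF Nil(2)] hdeg_one[OF AB.galg]] by simp
 next
  case False
  then show ?thesis using eps_smult_zero(2)[OF TABm TR.one_closed Nil(2)] hdeg_zero[OF AB.galg] by simp
 qed
next
 case (Cons l w)
 have l: "l : homs A.Vk" and w: "set w <= homs A.Vk" using Cons.prems by simp_all
 show ?case unfolding phi.simps conv_def
 proof (rule hdeg_csum[OF AB.galg B.comultiplicative_axioms Cons.prems(2)])
  fix x y assume x: "x : homs N" and y: "y : homs N" and s: "fst x + fst y = fst c"
  show "sg (word_deg w * fst x) (Lt (fst l + 1, snd l) x *. phi w y) : hdeg \<Omega>AB (word_deg (l # w) + fst c)"
   by (rule hdeg_ksign[OF AB.galg hdeg_mult[OF AB.galg Lt_hdeg[OF A_letter(1)[OF l] x refl] Cons.IH[OF w y]]]) (use s in simp)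
 qed
qed

lemma phi_append:
 assumes w: "set w <= homs A.Vk"
 shows "set v <= homs A.Vk ==> c : homs N ==> phi (v @ w) c = conv (word_deg w) (phi v) (phi w) c"
proof (induction v arbitrary: c)
 case Nil
 then show ?case using conv_e1(1)[OF phi_lin[OF w]] by simp
next
 case (Cons l v)
 have l: "l : homs A.Vk" and v: "set v <= homs A.Vk" using Cons.prems by simp_all
 have "phi ((l # v) @ w) c = conv (word_deg v + word_deg w) (Lt (fst l + 1, snd l)) (conv (word_deg w) (phi v) (phi w)) c"
  unfolding append.simps phi.simps word_deg_simps(3) by (rule conv_cong[OF Cons.prems(2) refl Cons.IH[OF v]])
 also have "... = conv (word_deg w) (phi (l # v)) (phi w) c"
  using conv_assoc[OF LtB_lin'[OF A_letter(1)[OF l]] phi_lin[OF v] phi_lin[OF w] Cons.prems(2)] by simp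
 finally show ?case .
qed

text \<open>
  Extended to all of \<open>\<Omega>A\<close>, this is a morphism of algebras to the convolution algebra of maps from \<open>B\<close>
  to \<open>\<Omega>(A \<otimes> B)\<close>.
\<close>

definition "Ph c = A.wext TAB (%w. phi w c)"

lemma Ph_hom: "c : homs N ==> Ph c : Hom R A.TX TAB" unfolding Ph_def by (rule A.wext_hom[OF TABm phi_mul])

lemma Ph_W: "c : homs N ==> set w <= homs A.Vk ==> Ph c (A.W w) = phi w c" unfolding Ph_def by (rule A.wext_W[OF TABm phi_mul])

lemma Ph_closed: "c : homs N ==> x : car A.TX ==> Ph c x : car TAB" by (rule mh_closed[OF Ph_hom])

lemma Ph_L: "c : homs N ==> a : homs M ==> Ph c (A.L a) = Lt (A.hat a) c"
proof -
 assume c: "c : homs N" and a: "a : homs M"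
 have "conv 0 (Lt (A.hat a)) e1 c = Lt (A.hat a) c" using A.hat_homs[OF a] by (intro conv_e1(2)[OF LtB_lin' c]) simp
 then show ?thesis using Ph_W[OF c, of "[A.bar a]"] A.bar_homs[OF a] by (simp add: A.L_def) (simp add: A.bar_def A.hat_def)
qed

lemma Ph_lin:
 assumes x: "x : car A.TX" shows "lin R N TAB (%c. Ph c x)"
proof (rule linI)
 fix n z assume z: "z : car (N n)"
 then show "Ph (n, z) x : car TAB" by (intro Ph_closed x) simp
next
 fix n z z' assume z: "z : car (N n)" "z' : car (N n)"
 then have s: "z \<oplus>[N n] z' : car (N n)" using gmodD[OF B.gm, of n] by (simp add: module_def abelian_group_def abelian_monoid.a_closed)
 show "Ph (n, z \<oplus>[N n] z') x = Ph (n, z) x +. Ph (n, z') x"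
  by (rule A.W_ext[OF Ph_hom mh_plus[OF Ph_hom Ph_hom TABm] TABm _ x]) (use z s in \<open>simp_all add: Ph_W lin_add[OF phi_lin]\<close>)
next
 fix n r z assume z: "r : car R" "z : car (N n)"
 then have s: "r \<odot>[N n] z : car (N n)" using gmodD[OF B.gm, of n] by (simp add: module.smult_closed)
 show "Ph (n, r \<odot>[N n] z) x = r \<odot>[TAB] Ph (n, z) x"
  by (rule A.W_ext[OF Ph_hom mh_scale[OF Ph_hom TABm] TABm _ x]) (use z s in \<open>simp_all add: Ph_W lin_smult[OF phi_lin]\<close>)
qed

lemma Ph_hdeg: "c : homs N ==> x : hdeg \<Omega>A k ==> Ph c x : hdeg \<Omega>AB (k + fst c)"
 by (erule hdegE) (use A.hdeg_hom[OF AB.galg Ph_hom, of c "fst c"] in \<open>simp add: Ph_W phi_hdeg A.obj_X\<close>)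

lemma Ph_mult:
 assumes c: "c : homs N" and x: "x : car A.TX" and y: "y : hdeg \<Omega>A m"
 shows "Ph c (x \<otimes>[A.TX] y) = conv m (%p. Ph p x) (%q. Ph q y) c"
proof -
 interpret TA: ring A.TX by (rule ralgD(2)[OF A.TX_ralg])
 note agA = ralgD(3)[OF A.TX_ralg]
 define gm where "gm i z = (if even i then z else gam \<Omega>A z)" for i :: int and z
 have gh: "gm i : Hom R A.TX A.TX" for i using gam_hom[OF A.galg] mh_id[of R A.TX] by (cases "even i") (simp_all add: gm_def[abs_def])
 have gW: "gm i (A.W w) = ksign A.TX (word_deg w * i) (A.W w)" if "set w <= homs A.Vk" for i w
  using A.gam_W[OF that] by (auto simp: gm_def intro!: ksign_cong[of 0, simplified] ksign_cong)
 have gy: "gm i y = ksign A.TX (m * i) y" for i using hdeg_gam[OF A.galg y] by (auto simp: gm_def intro!: ksign_cong[of 0, simplified] ksign_cong)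
 let ?G = "%x y. cs c (%p q. Ph p x *. Ph q (gm (fst p) y))"
 have Gx: "(%x. ?G x y) : Hom R A.TX TAB" if "y : car A.TX" for y
  by (rule B.mh_csum[OF TABm c]) (intro mh_comp[OF Ph_hom ralg_left[OF TABr]] Ph_closed mh_closed[OF gh] that)
 have Gy: "(%y. ?G x y) : Hom R A.TX TAB" if "x : car A.TX" for x
  by (rule B.mh_csum[OF TABm c]) (intro mh_comp[OF mh_comp[OF gh Ph_hom] ralg_right[OF TABr]] Ph_closed that)
 have 1: "Ph c (A.W v \<otimes>[A.TX] A.W w) = ?G (A.W v) (A.W w)" if v: "set v <= homs A.Vk" and w: "set w <= homs A.Vk" for v w
 proof -
  have "Ph c (A.W v \<otimes>[A.TX] A.W w) = conv (word_deg w) (phi v) (phi w) c" using v w phi_append[OF w v c] by (simp add: A.W_append Ph_W[OF c])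
  also have "... = ?G (A.W v) (A.W w)" unfolding conv_def by (rule B.csum_cong[OF c])
    (simp add: v w gW Ph_W mh_ksign[OF Ph_hom A.TXm TABm] A.W_closed phi_closed sg_simps)
  finally show ?thesis .
 qed
 note l = ralg_left[OF A.TX_ralg] and r = ralg_right[OF A.TX_ralg]
 have 2: "Ph c (A.W v \<otimes>[A.TX] y) = ?G (A.W v) y" if v: "set v <= homs A.Vk" and y: "y : car A.TX" for v y
  by (rule A.W_ext[OF mh_comp[OF r[OF A.W_closed[OF v]] Ph_hom[OF c]] Gy[OF A.W_closed[OF v]] TABm 1[OF v] y])
 note yc = hdeg_closed[OF A.galg y]
 have "Ph c (x \<otimes>[A.TX] y) = ?G x y" by (rule A.W_ext[OF mh_comp[OF l[OF yc] Ph_hom[OF c]] Gx[OF yc] TABm 2[OF _ yc] x])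
 also have "... = conv m (%p. Ph p x) (%q. Ph q y) c"
  unfolding conv_def by (rule B.csum_cong[OF c]) (simp add: gy mh_ksign[OF Ph_hom A.TXm TABm] yc Ph_closed x sg_simps)
 finally show ?thesis .
qed

end

lemma Dt_hdeg: "dga R X ==> x : hdeg X n ==> Dt X x : hdeg X (n - 1)"
 by (erule hdegE) (simp add: Dt_EL, rule hdeg_EL, simp_all add: mh_closed[OF graded_map_hom[OF dgaD(2)]])

lemma (in abelian_group) cancel_middle:
 assumes "p1 : car G" "p2 : car G" "p3 : car G" "p4 : car G"
  "q1 : car G" "q2 : car G" "q3 : car G" "q4 : car G" and 0: "p4 \<oplus> q3 = \<zero>"
 shows "(p1 \<oplus> p2 \<oplus> p3 \<oplus> p4) \<oplus> (q1 \<oplus> q2 \<oplus> q3 \<oplus> q4) = (p1 \<oplus> q1) \<oplus> (p2 \<oplus> q2) \<oplus> p3 \<oplus> q4"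
proof -
 have "(p1 \<oplus> p2 \<oplus> p3 \<oplus> p4) \<oplus> (q1 \<oplus> q2 \<oplus> q3 \<oplus> q4) = ((p1 \<oplus> q1) \<oplus> (p2 \<oplus> q2) \<oplus> p3 \<oplus> q4) \<oplus> (p4 \<oplus> q3)"
  using assms(1-8) by (simp add: a_ac)
 then show ?thesis using assms by simp
qed

context milgram begin

lemma d_Lt_twist:
 assumes a: "a : homs M" and e: "eps A a = \<zero>" and c: "c : homs N"
 shows "d (Lt a c) = sg (fst a - 1) (Lt a (dh B c)) +. Ph c (Dt \<Omega>A (A.L a)) +.
  conv (fst a - 1) \<tau> (Lt a) c +. sg (fst a) (conv (- 1) (Lt a) \<tau> c)"
proof -
 let ?J = "%x y b1 b2. sg (fst y * fst b1 + fst x + fst b1) (Lt x b1 *. Lt y b2)"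
 note da = dh_homs[OF A.cx a] and dc = dh_homs[OF B.cx c]
 define F where "F = (%x y. sg (fst x) (conv (fst y - 1) (Lt x) (Lt y) c))"
 have Fc: "F x y : car TAB" if "x : homs M" "y : homs M" for x y
  unfolding F_def using conv_closed[OF LtB_lin'[OF that(1)] LtB_lin'[OF that(2)] c] TABag by simp
 have FX: "csB TAB c (?J x y) = F x y"
  if h: "x : homs M" "y : homs M" for x y unfolding F_def conv_def
 proof (subst B.csum_ksign[OF TABm c])
  show "cs c (?J x y) =
    cs c (%b1 b2. sg (fst x) (sg ((fst y - 1) * fst b1) (Lt x b1 *. Lt y b2)))"
   by (rule B.csum_cong[OF c]) (simp add: Lt_closed h sg_simps, auto intro!: ksign_cong)
 qed (simp add: Lt_closed h TABag)
 have Fb: "bil R M M TAB F"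
 proof -
  have "bil R M M TAB (%x y. ?J x y b1 b2)" if "b1 : homs N" "b2 : homs N" for b1 b2
   using LtLt_bil_A[OF that, of "%i j. j * fst b1 + i + fst b1"] .
  from coalgebra_pair.bil_csum[OF pair[OF TABm] c, of "?J", OF this]
  have b: "bil R M M TAB (%x y. csB TAB c (?J x y))" .
  show ?thesis
  proof (rule bilI)
   show "lin R M TAB (F x)" if "x : homs M" for x by (rule lin_cong[OF A.gm _ bil_right[OF b that]]) (simp add: FX that)
   show "lin R M TAB (%x. F x y)" if "y : homs M" for y by (rule lin_cong[OF A.gm _ bil_left[OF b that]]) (simp add: FX that)
  qed
 qed
 have ahh: "A.hat x : homs M" if "x : homs M" for x using A.hat_homs[OF that] by simp
 have X: "csA TAB a (%x y. csB TAB c (?J x y)) =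
   sg (fst a) (conv (- 1) (Lt a) \<tau> c) +. conv (fst a - 1) \<tau> (Lt a) c +. csA TAB a (%x y. F (A.hat x) (A.hat y))"
  (is "_ = ?X1 +. ?X2 +. ?X3")
 proof -
  have "csA TAB a (%x y. csB TAB c (?J x y)) = csA TAB a F"
   by (rule A.csum_cong[OF a]) (simp add: FX)
  then show ?thesis unfolding AT.csum_reduced[OF Fb a e] by (simp add: F_def)
 qed
 have Lc: "A.L x : car A.TX" if "x : homs M" for x by (rule A.L_closed[OF that])
 interpret TA: ring A.TX by (rule ralgD(2)[OF A.TX_ralg])
 note agA = ralgD(3)[OF A.TX_ralg]
 have "Ph c (csA A.TX a (%x y. ksign A.TX (fst x) (A.L x \<otimes>[A.TX] A.L y))) =
   csA TAB a (%x y. Ph c (ksign A.TX (fst x) (A.L x \<otimes>[A.TX] A.L y)))"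
  by (rule A.csum_hom[OF A.TXm Ph_hom[OF c] TABm a]) (simp add: Lc agA)
 also have "... = ?X3"
 proof (rule A.csum_cong[OF a])
  fix x y assume h: "x : homs M" "y : homs M"
  have "conv (fst y - 1) (%p. Ph p (A.L x)) (%q. Ph q (A.L y)) c = conv (fst y - 1) (Lt (A.hat x)) (Lt (A.hat y)) c"
   by (rule conv_cong[OF c]) (simp_all add: Ph_L h)
  then show "Ph c (ksign A.TX (fst x) (A.L x \<otimes>[A.TX] A.L y)) = F (A.hat x) (A.hat y)"
   using h by (simp add: mh_ksign[OF Ph_hom[OF c] A.TXm TABm] Lc F_def Ph_mult[OF c Lc L_hdeg(1)])
 qed
 finally have P: "Ph c (Dt \<Omega>A (A.L a)) = sg 1 (Lt (dh A a) c) +. ?X3" using lin_closed[OF A.csum_lin[OF A.TXm A.LL_bil] a] Lc[OF da]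
  by (simp add: cA.D_L[OF a] cA.DL_def mh_add[OF Ph_hom[OF c]] mh_ksign[OF Ph_hom[OF c] A.TXm TABm] agA
    Ph_L[OF c da] A.hat_ker[OF da A.eps_dh[OF a]])
 have 3: "?X3 : car TAB" by (rule A.csum_closed[OF TABm a]) (simp add: Fc ahh)
 have "sg (fst a + 1) t = sg (fst a - 1) t" for t by (rule ksign_cong) simp
 then show ?thesis unfolding d_Lt[OF a c] X P
  using 3 Lt_closed[OF da c] Lt_closed[OF a dc] conv_closed[OF LtB_lin LtB_lin'[OF a] c] conv_closed[OF LtB_lin'[OF a] LtB_lin c]
  by (simp add: TABag cAB.P.a_ac)
qed

text \<open>
  The morphism commutes with the differentials once the one of the convolution algebra is twisted
  by the commutator with \<open>\<tau>\<close>. The twist appears because the coproduct of \<open>a\<close> contains \<open>1 \<otimes> a\<close> and \<open>a \<otimes> 1\<close>,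
  whereas the differential of \<open>[a]\<close> in \<open>\<Omega>A\<close> is built from the reduced coproduct. Since both sides are
  compatible with convolution products, the case of one letter suffices.
\<close>

lemma phi_d:
 assumes "set w <= homs A.Vk" and "c : homs N"
 shows "d (phi w c) = sg (word_deg w) (phi w (dh B c)) +. Ph c (Dt \<Omega>A (A.W w)) +.
  conv (word_deg w) \<tau> (phi w) c +. sg (word_deg w + 1) (conv (- 1) (phi w) \<tau> c)" using assms
proof (induction w arbitrary: c)
 case Nil
 note c = Nil(2)
 have 1: "d (e1 c) = \<zero>[TAB]" "e1 (dh B c) = \<zero>[TAB]" using dga_one[OF cAB.cobar_dga] B.eps_closed[OF c]
  by (simp_all add: mh_smult[OF d_hom] B.eps_dh[OF c] module.smult_r_null[OF TABm] module.smult_l_null[OF TABm])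
 have "conv (- 1) e1 \<tau> c = conv 0 \<tau> e1 c" by (simp add: conv_e1[OF LtB_lin c])
 then show ?case using c dga_one[OF cA.cobar_dga] mh_zero[OF Ph_hom[OF c] A.TXm TABm] Lt_closed[OF A.uh_homs c]
  by (simp add: 1 A.W_Nil conv_e1[OF LtB_lin c] TABag ksign_cancel[OF TABag, of _ 0 1, simplified])
next
 case (Cons l w)
 note c = Cons.prems(2)
 have l: "l : homs A.Vk" and w: "set w <= homs A.Vk" using Cons.prems by simp_all
 let ?k = "fst l" and ?m = "word_deg w" and ?a = "(fst l + 1, snd l)"
 let ?f = "Lt ?a" and ?g = "phi w"
 let ?P = "%x. Ph x (Dt \<Omega>A (A.W [l]))" and ?Q = "%x. Ph x (Dt \<Omega>A (A.W w))"
 have f: "lin R N TAB ?f" by (rule LtB_lin'[OF A_letter(1)[OF l]])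
 have g: "lin R N TAB ?g" by (rule phi_lin[OF w])
 have Wl: "A.W [l] : car A.TX" and Ww: "A.W w : car A.TX" using l w by (simp_all add: A.W_closed)
 have P: "lin R N TAB ?P" and Q: "lin R N TAB ?Q" by (intro Ph_lin cA.D_closed Wl Ww)+
 have fb: "lin R N TAB (%x. ?f (dh B x))" and gb: "lin R N TAB (%x. ?g (dh B x))" by (intro lin_dh[OF B.cx] f g)+
 note t = LtB_lin
 note cl = lin_closed[OF f] lin_closed[OF g] lin_closed[OF P] lin_closed[OF Q] lin_closed[OF fb] lin_closed[OF gb] conv_closed f g P Q fb gb t TABag conv_lin
 let ?X1 = "conv ?m (%x. ?f (dh B x)) ?g c" let ?X2 = "conv ?m ?P ?g c" let ?X3 = "conv (?k + ?m) \<tau> (phi (l # w)) c"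
 let ?X4 = "conv (?m - 1) ?f (conv ?m \<tau> ?g) c" let ?Y1 = "conv (?m - 1) ?f (%x. ?g (dh B x)) c" let ?Y2 = "conv (?m - 1) ?f ?Q c"
 let ?Y4 = "conv (- 1) (phi (l # w)) \<tau> c"
 have 1: "conv ?m (%x. d (?f x)) ?g c = sg ?k ?X1 +. ?X2 +. ?X3 +. sg (?k + 1) ?X4"
 proof -
  have "conv ?m (%x. d (?f x)) ?g c = conv ?m (%x. sg ?k (?f (dh B x)) +. ?P x +. conv ?k \<tau> ?f x +. sg (?k + 1) (conv (- 1) ?f \<tau> x)) ?g c"
   using d_Lt_twist[OF A_letter(1)[OF l] A_letter(2)[OF l]] A_letter(3)[OF l] by (intro conv_cong[OF c]) simp_all
  also have "... = sg ?k ?X1 +. ?X2 +. conv ?m (conv ?k \<tau> ?f) ?g c +. sg (?k + 1) (conv ?m (conv (- 1) ?f \<tau>) ?g c)"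
   by (simp only: conv_add[OF c] conv_sg[OF c] cl ksign_closed cAB.P.a_closed)
  finally show ?thesis using conv_assoc[OF t f g c, of ?m ?k] conv_assoc[OF f t g c, of ?m "- 1"] by simp
 qed
 have 2: "conv (?m - 1) ?f (%x. d (?g x)) c = sg ?m ?Y1 +. ?Y2 +. ?X4 +. sg (?m + 1) ?Y4"
 proof -
  have "conv (?m - 1) ?f (%x. d (?g x)) c = conv (?m - 1) ?f (%x. sg ?m (?g (dh B x)) +. ?Q x +. conv ?m \<tau> ?g x +. sg (?m + 1) (conv (- 1) ?g \<tau> x)) c"
   using Cons.IH[OF w] by (intro conv_cong[OF c]) simp_all
  also have "... = sg ?m ?Y1 +. ?Y2 +. ?X4 +. sg (?m + 1) (conv (?m - 1) ?f (conv (- 1) ?g \<tau>) c)"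
   by (simp only: conv_add[OF c] conv_sg[OF c] cl ksign_closed cAB.P.a_closed)
  finally show ?thesis using conv_assoc[OF f g t c, of "- 1" ?m] by simp
 qed
 have 3: "Ph c (Dt \<Omega>A (A.W (l # w))) = ?X2 +. sg ?k ?Y2"
 proof -
  have Dc: "Dt \<Omega>A (A.W [l]) : car A.TX" "Dt \<Omega>A (A.W w) : car A.TX" by (intro cA.D_closed Wl Ww)+
  interpret TA: ring A.TX by (rule ralgD(2)[OF A.TX_ralg])
  note agA = ralgD(3)[OF A.TX_ralg]
  have D: "Dt \<Omega>A (A.W (l # w)) = Dt \<Omega>A (A.W [l]) \<otimes>[A.TX] A.W w \<oplus>[A.TX] ksign A.TX ?k (A.W [l] \<otimes>[A.TX] Dt \<Omega>A (A.W w))"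
   using cA.D_mult[OF Wl Ww] A.W_append[of "[l]" w] A.gam_W[of "[l]"] l w Wl Dc by (simp add: ralg_ksign[OF A.TX_ralg])
  have X2: "conv ?m ?P (%q. Ph q (A.W w)) c = ?X2" by (rule conv_cong[OF c]) (simp_all add: Ph_W w)
  have Y2: "conv (?m - 1) (%p. Ph p (A.W [l])) ?Q c = ?Y2" by (rule conv_cong[OF c]) (simp_all add: Ph_W l conv_e1[OF f])
  show ?thesis using Wl Ww Dc unfolding D
   by (simp add: mh_add[OF Ph_hom[OF c]] mh_ksign[OF Ph_hom[OF c] A.TXm TABm] agA Ph_mult[OF c _ A.hdeg_W[OF w]]
     Ph_mult[OF c _ Dt_hdeg[OF cA.cobar_dga A.hdeg_W[OF w]]] X2 Y2)
 qed
 have 4: "sg (?k + ?m) (phi (l # w) (dh B c)) = sg ?k ?X1 +. sg (?k + ?m) ?Y1"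
 proof -
  have "sg (?k + ?m + ?m) z = sg ?k z" for z by (rule ksign_cong) simp
  then show ?thesis using c cl by (simp add: conv_dh[OF f g c] sg_add sg_simps)
 qed
 have fd: "?f x : hdeg \<Omega>AB (?k + fst x)" if "x : homs N" for x by (rule Lt_hdeg[OF A_letter(1)[OF l] that]) simp
 have cl': "?X1 : car TAB" "?X2 : car TAB" "?X3 : car TAB" "?X4 : car TAB" "?Y1 : car TAB" "?Y2 : car TAB" "?Y4 : car TAB"
  using c cl phi_lin[of "l # w"] Cons.prems(1) by blast+
 have "d (phi (l # w) c) = conv ?m (%x. d (?f x)) ?g c +. sg ?k (conv (?m - 1) ?f (%x. d (?g x)) c)" using conv_d[OF f fd g c, of ?m] by simp
 also have "... = (sg ?k ?X1 +. ?X2 +. ?X3 +. sg (?k + 1) ?X4) +. (sg (?k + ?m) ?Y1 +. sg ?k ?Y2 +. sg ?k ?X4 +. sg (?k + ?m + 1) ?Y4)"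
  unfolding 1 2 using cl' by (simp add: sg_add sg_simps add.assoc del: phi.simps)
 also have "... = (sg ?k ?X1 +. sg (?k + ?m) ?Y1) +. (?X2 +. sg ?k ?Y2) +. ?X3 +. sg (?k + ?m + 1) ?Y4"
  by (rule abelian_group.cancel_middle[OF TABag]) (simp_all add: cl' TABag ksign_cancel del: phi.simps)
 finally show ?case unfolding 3 using 4 by simp
qed

end

section \<open>The contracting operator\<close>

context milgram begin

abbreviation "wy w y == U.inX (A.W w) \<star> U.inY y"

text \<open>
  On \<open>x \<otimes> y\<close> the element \<open>c\<close> is distributed over the letters of \<open>x\<close>, and the letters \<open>[b]\<close> of \<open>y\<close> become
  \<open>[1 \<otimes> b]\<close>. The sign is that of \<open>c\<close> passing \<open>x\<close>.
\<close>

definition "K c = U.uext TAB (%x y. sg (fst c * fst x) (Ph c (EL \<Omega>A x) *. sB (EL \<Omega>B y)))"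

lemma K_bil: "c : homs N ==> bil R (obj \<Omega>A) (obj \<Omega>B) TAB (%x y. sg (fst c * fst x) (Ph c (EL \<Omega>A x) *. sB (EL \<Omega>B y)))"
 using bil_ksign[OF bil_mult[OF TABr lin_comp[OF EL_lin[OF A.galg] Ph_hom] lin_comp[OF EL_lin[OF B.galg] sB_hom]] TABm,
   of c "%i j. fst c * i"] .

lemma K_hom: "c : homs N ==> K c : Hom R UAB TAB" unfolding K_def by (rule U.uext_hom[OF TABm K_bil])

lemma K_closed: "c : homs N ==> u : car UAB ==> K c u : car TAB" by (rule mh_closed[OF K_hom])

lemma inXY_closed: "x : car A.TX ==> U.inX x : car UAB" "y : car B.TX ==> U.inY y : car UAB"
 by (rule mh_closed[OF U.inX_hom], assumption, rule mh_closed[OF U.inY_hom], assumption)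

lemma K_prod:
 assumes c: "c : homs N" and x: "x : hdeg \<Omega>A k" and y: "y : car B.TX"
 shows "K c (U.inX x \<star> U.inY y) = sg (fst c * k) (Ph c x *. sB y)"
proof -
 obtain z where z: "z : car (obj \<Omega>A k)" "x = EL \<Omega>A (k, z)" using x by (rule hdegE)
 have xc: "x : car A.TX" by (rule hdeg_closed[OF A.galg x])
 show ?thesis
 proof (rule Tot_ext[OF B.galg mh_comp[OF mh_comp[OF U.inY_hom ralg_right[OF U.TTr inXY_closed(1)[OF xc]]] K_hom[OF c]]
    mh_ksignI[OF mh_comp[OF sB_hom ralg_right[OF TABr Ph_closed[OF c xc]]] TABm] TABm _ y])
  fix b assume b: "b : els \<Omega>B"
  have "U.inX x \<star> U.inY (EL \<Omega>B b) = U.tt (k, z) b" using U.tt_inX_inY[of "(k, z)" b] z b by simp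
  then show "K c (U.inX x \<star> U.inY (EL \<Omega>B b)) = sg (fst c * k) (Ph c x *. sB (EL \<Omega>B b))"
   using U.uext_tt[OF TABm K_bil[OF c], of "(k, z)" b] z b by (simp add: K_def)
 qed
qed

lemma K_word: "c : homs N ==> set w <= homs A.Vk ==> y : car B.TX ==> K c (wy w y) = sg (fst c * word_deg w) (phi w c *. sB y)"
 using K_prod[OF _ A.hdeg_W] Ph_W by simp

lemma wy_closed: "set w <= homs A.Vk ==> y : car B.TX ==> wy w y : car UAB"
 using inXY_closed(1)[OF A.W_closed] inXY_closed(2) ring.ring_simprules(5)[OF ralgD(2)[OF U.TTr]] by blast

lemma wy_ext:
 assumes f: "f : Hom R UAB P" and g: "g : Hom R UAB P" and P: "module R P"
  and eq: "!!w y. [|set w <= homs A.Vk; y : car B.TX|] ==> f (wy w y) = g (wy w y)" and u: "u : car UAB"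
 shows "f u = g u"
proof (rule U.inXY_ext[OF f g P _ u])
 fix a y assume a: "a : els \<Omega>A" and y: "y : car B.TX"
 note h = mh_comp[OF U.inX_hom ralg_left[OF U.TTr inXY_closed(2)[OF y]]]
 show "f (U.inX (EL \<Omega>A a) \<star> U.inY y) = g (U.inX (EL \<Omega>A a) \<star> U.inY y)"
  by (rule A.W_ext[OF mh_comp[OF h f] mh_comp[OF h g] P eq[OF _ y] EL_closed[OF A.galg a]])
qed

lemma K_lin:
 assumes u: "u : car UAB" shows "lin R N TAB (%c. K c u)"
proof -
 have w: "lin R N TAB (%c. K c (wy w y))" if "set w <= homs A.Vk" "y : car B.TX" for w y
  by (rule lin_cong[OF B.gm _ lin_ksignI[OF lin_comp[OF phi_lin[OF that(1)] ralg_left[OF TABr sB_closed[OF that(2)]]] TABm, of "%i. i * word_deg w"]])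
   (simp add: K_word that)
 note s = module.smult_closed[OF gmodD[OF B.gm]] and a = module.axioms(2)[OF gmodD[OF B.gm], THEN abelian_group.axioms(1), THEN abelian_monoid.a_closed]
 show ?thesis
 proof (rule linI)
  fix n z assume z: "z : car (N n)"
  then show "K (n, z) u : car TAB" by (intro K_closed u) simp
  { fix z' assume z': "z' : car (N n)"
   show "K (n, z \<oplus>[N n] z') u = K (n, z) u +. K (n, z') u"
    by (rule wy_ext[OF K_hom mh_plus[OF K_hom K_hom TABm] TABm _ u]) (use z z' a in \<open>simp_all add: lin_add[OF w]\<close>) }
  { fix r assume r: "r : car R"
   show "K (n, r \<odot>[N n] z) u = r \<odot>[TAB] K (n, z) u"
    by (rule wy_ext[OF K_hom mh_scale[OF K_hom TABm] TABm _ u]) (use z r s in \<open>simp_all add: lin_smult[OF w]\<close>) }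
 qed
qed

lemma K_inY:
 assumes c: "c : homs N" and y: "y : car B.TX"
 shows "K c (U.inY y) = eps B c \<odot>[TAB] sB y"
proof -
 interpret UR: ring UAB by (rule ralgD(2)[OF U.TTr])
 have "wy [] y = U.inY y" using inXY_closed(2)[OF y] by (simp add: A.W_Nil U.inX_one)
 then show ?thesis using K_word[OF c _ y, of "[]"] B.eps_closed[OF c] sB_closed[OF y] by (simp add: ralgD(4)[OF TABr])
qed

lemma La_wy:
 assumes a: "a : homs M" and w: "set w <= homs A.Vk" and y: "y : car B.TX"
 shows "La a \<star> wy w y = wy (A.bar a # w) y"
proof -
 interpret UR: ring UAB by (rule ralgD(2)[OF U.TTr])
 have "A.L a \<otimes>[A.TX] A.W w = A.W (A.bar a # w)" using A.W_append[of "[A.bar a]" w] A.bar_homs[OF a] w by (simp add: A.L_def)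
 then show ?thesis
  using U.inX_mult[OF A.L_closed[OF a] A.W_closed[OF w]] inXY_closed(1)[OF A.L_closed[OF a]] inXY_closed(1)[OF A.W_closed[OF w]] inXY_closed(2)[OF y]
  by (simp add: La_def UR.m_assoc)
qed

text \<open>
  The operators obey a recursion over the letters of \<open>A\<close>, because \<open>Ph\<close> is multiplicative; this is what
  the inductions below run on.
\<close>

lemma K_La:
 assumes c: "c : homs N" and a: "a : homs M" and u: "u : car UAB"
 shows "K c (La a \<star> u) = sg (fst c * (fst a - 1)) (cs c (%x y. Lt (A.hat a) x *. K y u))"
proof (rule wy_ext[OF mh_comp[OF ralg_right[OF U.TTr La_closed[OF a]] K_hom[OF c]] mh_ksignI[OF B.mh_csum[OF TABm c] TABm] TABm _ u])
 have ah: "A.hat a : homs M" using A.hat_homs[OF a] by simp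
 show "(%t. Lt (A.hat a) x *. K y t) : Hom R UAB TAB" if "x : homs N" "y : homs N" for x y
  by (rule mh_comp[OF K_hom[OF that(2)] ralg_right[OF TABr Lt_closed[OF ah that(1)]]])
 fix w y assume w: "set w <= homs A.Vk" and y: "y : car B.TX"
 let ?m = "word_deg w" and ?k = "fst c * (fst a - 1)"
 have wa: "set (A.bar a # w) <= homs A.Vk" using w A.bar_homs[OF a] by simp
 have "K c (La a \<star> wy w y) = sg (fst c * (fst a - 1 + ?m)) (conv ?m (Lt (A.hat a)) (phi w) c *. sB y)"
  unfolding La_wy[OF a w y] K_word[OF c wa y] by (simp add: A.bar_def A.hat_def)
 also have "conv ?m (Lt (A.hat a)) (phi w) c *. sB y = cs c (%p q. sg (?m * fst p) (Lt (A.hat a) p *. phi w q) *. sB y)"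
  unfolding conv_def by (rule B.csum_hom[OF TABm ralg_left[OF TABr sB_closed[OF y]] TABm c]) (simp add: Lt_closed ah phi_closed w TABag)
 also have "sg (fst c * (fst a - 1 + ?m)) ... = cs c (%p q. sg (fst c * (fst a - 1 + ?m)) (sg (?m * fst p) (Lt (A.hat a) p *. phi w q) *. sB y))"
  by (rule B.csum_ksign[OF TABm c]) (simp add: Lt_closed ah phi_closed w sB_closed y TABag)
 also have "... = cs c (%p q. sg ?k (Lt (A.hat a) p *. K q (wy w y)))"
 proof (rule B.csum_cong[OF c])
  fix p q assume p: "p : homs N" and q: "q : homs N" and s: "fst p + fst q = fst c"
  have "sg (fst c * (fst a - 1 + ?m) + ?m * fst p) z = sg (?k + fst q * ?m) z" for z by (rule ksign_cong) (simp flip: s, blast)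
  then show "sg (fst c * (fst a - 1 + ?m)) (sg (?m * fst p) (Lt (A.hat a) p *. phi w q) *. sB y) = sg ?k (Lt (A.hat a) p *. K q (wy w y))"
   by (simp add: K_word[OF q w y] Lt_closed ah p phi_closed w q sB_closed y sg_simps TR.m_assoc)
 qed
 also have "... = sg ?k (cs c (%p q. Lt (A.hat a) p *. K q (wy w y)))"
  by (rule B.csum_ksign[OF TABm c, symmetric]) (simp add: Lt_closed ah K_closed wy_closed w y)
 finally show "K c (La a \<star> wy w y) = sg ?k (cs c (%p q. Lt (A.hat a) p *. K q (wy w y)))" .
qed

lemma K_hdeg:
 assumes c: "c : homs N" and u: "u : hdeg U.U n"
 shows "K c u : hdeg \<Omega>AB (n + fst c)"
proof -
 obtain z where z: "z : car (obj U.U n)" "u = EL U.U (n, z)" using u by (rule hdegE)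
 have "K c (EL U.U (n, z)) : hdeg \<Omega>AB (fst (n, z) + fst c)"
 proof (rule hdeg_tn[OF AB.galg R U.M U.N lin_comp[OF U.EL_U_lin K_hom[OF c]]])
  fix a b assume a: "a : els \<Omega>A" and b: "b : els \<Omega>B"
  have "K c (U.tt a b) = sg (fst c * fst a) (Ph c (EL \<Omega>A a) *. sB (EL \<Omega>B b))"
   using U.uext_tt[OF TABm K_bil[OF c] a b] by (simp add: K_def)
  then show "K c (EL U.U (tn R (obj \<Omega>A) (obj \<Omega>B) a b)) : hdeg \<Omega>AB (fst a + fst b + fst c)"
   using hdeg_ksign[OF AB.galg hdeg_mult[OF AB.galg Ph_hdeg[OF c hdeg_EL[OF a refl]] sB_hdeg[OF b] refl]] by (simp add: U.tt_def algebra_simps)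
 qed (use z in simp)
 then show ?thesis using z by simp
qed

text \<open>
  The two commutator terms of the twisted differential survive as \<open>[1 \<otimes> c'] K(c'')\<close> on the left and,
  because \<open>K\<close> takes \<open>[b]\<close> to \<open>[1 \<otimes> b]\<close>, as \<open>K(c')([c''] u)\<close> on the right.
\<close>

lemma d_K:
 assumes c: "c : homs N" and u: "u : car UAB"
 shows "d (K c u) = K (dh B c) u +. sg (fst c) (K c (Dt U.U u)) +. cs c (%x y. \<tau> x *. K y u) +. cs c (%x y. sg (1 + fst x) (K x (Lb y \<star> u)))"
proof (rule wy_ext[OF mh_comp[OF K_hom[OF c] d_hom] mh_plus[OF mh_plus[OF mh_plus[OF K_hom[OF dh_homs[OF B.cx c]]
   mh_ksignI[OF mh_comp[OF Dt_hom[OF U.U_dga] K_hom[OF c]] TABm] TABm] B.mh_csum[OF TABm c] TABm] B.mh_csum[OF TABm c] TABm] TABm _ u])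
 show "(%u. \<tau> x *. K y u) : Hom R UAB TAB" if "x : homs N" "y : homs N" for x y
  by (rule mh_comp[OF K_hom[OF that(2)] ralg_right[OF TABr Lt_closed[OF A.uh_homs that(1)]]])
 show "(%u. sg (1 + fst x) (K x (Lb y \<star> u))) : Hom R UAB TAB" if "x : homs N" "y : homs N" for x y
  by (rule mh_ksignI[OF mh_comp[OF ralg_right[OF U.TTr Lb_closed[OF that(2)]] K_hom[OF that(1)]] TABm])
 fix w y assume w: "set w <= homs A.Vk" and y: "y : car B.TX"
 let ?k = "word_deg w" let ?s = "fst c * ?k"
 interpret UR: ring UAB by (rule ralgD(2)[OF U.TTr])
 note Ww = A.W_closed[OF w] and dc = dh_homs[OF B.cx c] and Wh = A.hdeg_W[OF w] and yc = sB_closed[OF y]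
 note DWh = Dt_hdeg[OF cA.cobar_dga Wh] and Dy = cB.D_closed[OF y]
 note pc = phi_closed[OF w] and tc = Lt_closed[OF A.uh_homs]
 have DWc: "Dt \<Omega>A (A.W w) : car A.TX" by (rule cA.D_closed[OF Ww])
 let ?E1 = "phi w (dh B c) *. sB y" let ?E2 = "Ph c (Dt \<Omega>A (A.W w)) *. sB y" let ?E5 = "phi w c *. sB (Dt \<Omega>B y)"
 let ?E3 = "conv ?k \<tau> (phi w) c *. sB y" let ?E4 = "conv (- 1) (phi w) \<tau> c *. sB y"
 note cv = conv_closed[OF LtB_lin phi_lin[OF w] c] conv_closed[OF phi_lin[OF w] LtB_lin c]
 have E: "?E1 : car TAB" "?E2 : car TAB" "?E3 : car TAB" "?E4 : car TAB" "?E5 : car TAB"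
  using pc[OF c] pc[OF dc] Ph_closed[OF c DWc] cv yc sB_closed[OF Dy] by simp_all
 have L: "d (K c (wy w y)) = sg (?s + ?k) ?E1 +. sg ?s ?E2 +. sg ?s ?E3 +. sg (?s + ?k + 1) ?E4 +. sg (?s + ?k + fst c) ?E5"
 proof -
  have "d (phi w c) *. sB y = sg ?k ?E1 +. ?E2 +. ?E3 +. sg (?k + 1) ?E4" unfolding phi_d[OF w c] using pc[OF dc] Ph_closed[OF c DWc] cv yc
   by (simp add: mh_add[OF ralg_left[OF TABr yc]] sg_simps)
  then show ?thesis unfolding K_word[OF c w y] using E pc[OF c] yc d_mult_hdeg[OF phi_hdeg[OF w c] yc] sB_d[OF y]
   by (simp add: mh_ksign[OF d_hom TABm TABm] sg_simps sg_add add.assoc)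
 qed
 have 1: "K (dh B c) (wy w y) = sg (?s + ?k) ?E1" unfolding K_word[OF dc w y] by (rule ksign_cong) auto
 have 2: "sg (fst c) (K c (Dt U.U (wy w y))) = sg ?s ?E2 +. sg (?s + ?k + fst c) ?E5"
 proof -
  have "Dt U.U (wy w y) = U.inX (Dt \<Omega>A (A.W w)) \<star> U.inY y \<squnion> ksign UAB ?k (wy w (Dt \<Omega>B y))"
   using Dt_mult[OF U.U_dga inXY_closed(1)[OF Ww] inXY_closed(2)[OF y]] hdeg_gam[OF U.U_galg U.inX_hdeg[OF Wh]]
    inXY_closed(1)[OF Ww] inXY_closed(2)[OF Dy] by (simp add: U.D_inX[OF Ww] U.D_inY[OF y] ralg_ksign[OF U.TTr])
  moreover have "sg (fst c + fst c * (?k - 1)) t = sg ?s t" "sg (fst c + (?k + ?s)) t = sg (?s + ?k + fst c) t" for t by (auto intro!: ksign_cong)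
  ultimately show ?thesis using wy_closed[OF w Dy] inXY_closed(1)[OF DWc] inXY_closed(2)[OF y] E
   by (simp add: mh_add[OF K_hom[OF c]] UABag mh_ksign[OF K_hom[OF c] U.TTm TABm] K_word[OF c w Dy] K_prod[OF c DWh y] sg_simps sg_add)
 qed
 have 3: "cs c (%p q. \<tau> p *. K q (wy w y)) = sg ?s ?E3"
 proof -
  have "sg ?s ?E3 = cs c (%p q. sg ?s (sg (?k * fst p) (\<tau> p *. phi w q) *. sB y))" unfolding conv_def
   by (rule B.csum_hom[OF TABm mh_ksignI[OF ralg_left[OF TABr yc] TABm] TABm c]) (simp add: tc pc TABag)
  also have "... = cs c (%p q. \<tau> p *. K q (wy w y))"
  proof (rule B.csum_cong[OF c])
   fix p q assume p: "p : homs N" and q: "q : homs N" and s: "fst p + fst q = fst c"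
   have "sg (?s + ?k * fst p) z = sg (fst q * ?k) z" for z by (rule ksign_cong) (simp flip: s, blast)
   then show "sg ?s (sg (?k * fst p) (\<tau> p *. phi w q) *. sB y) = \<tau> p *. K q (wy w y)"
    by (simp add: K_word[OF q w y] tc p pc q yc sg_simps TR.m_assoc)
  qed
  finally show ?thesis ..
 qed
 have 4: "cs c (%p q. sg (1 + fst p) (K p (Lb q \<star> wy w y))) = sg (?s + ?k + 1) ?E4"
 proof -
  have "sg (?s + ?k + 1) ?E4 = cs c (%p q. sg (?s + ?k + 1) (sg (- 1 * fst p) (phi w p *. \<tau> q) *. sB y))" unfolding conv_def
   by (rule B.csum_hom[OF TABm mh_ksignI[OF ralg_left[OF TABr yc] TABm] TABm c]) (simp add: tc pc TABag)
  also have "... = cs c (%p q. sg (1 + fst p) (K p (Lb q \<star> wy w y)))"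
  proof (rule B.csum_cong[OF c])
   fix p q assume p: "p : homs N" and q: "q : homs N" and s: "fst p + fst q = fst c"
   interpret TB: ring B.TX by (rule ralgD(2)[OF B.TX_ralg])
   note Lq = B.L_closed[OF q]
   have Ly: "B.L q \<otimes>[B.TX] y : car B.TX" using Lq y by simp
   have "Lb q \<star> wy w y = ksign UAB ((fst q - 1) * ?k) (wy w (B.L q \<otimes>[B.TX] y))"
   proof -
    have "Lb q \<star> wy w y = (Lb q \<star> U.inX (A.W w)) \<star> U.inY y"
     using Lb_closed[OF q] inXY_closed(1)[OF Ww] inXY_closed(2)[OF y] by (simp add: UR.m_assoc)
    also have "Lb q \<star> U.inX (A.W w) = ksign UAB ((fst q - 1) * ?k) (U.inX (A.W w) \<star> Lb q)"
     unfolding Lb_def by (rule U.inY_inX_hdeg[OF Wh L_hdeg(2)[OF q]])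
    finally show ?thesis using Lb_closed[OF q] inXY_closed(1)[OF Ww] inXY_closed(2)[OF y]
     by (simp add: ralg_ksign[OF U.TTr] UR.m_assoc U.inY_mult[OF Lq y] Lb_def)
   qed
   moreover have "sg (1 + fst p + ((fst q - 1) * ?k + fst p * ?k)) z = sg (?s + ?k + 1 + - 1 * fst p) z" for z
    by (rule ksign_cong) (simp flip: s, blast)
   ultimately show "sg (?s + ?k + 1) (sg (- 1 * fst p) (phi w p *. \<tau> q) *. sB y) = sg (1 + fst p) (K p (Lb q \<star> wy w y))"
    using wy_closed[OF w Ly] sB_closed[OF Lq]
    by (simp add: mh_ksign[OF K_hom[OF p] U.TTm TABm] K_word[OF p w Ly] sB_mult[OF Lq y] sB_L[OF q] tc q pc p yc sg_simps TR.m_assoc)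
  qed
  finally show ?thesis ..
 qed
 show "d (K c (wy w y)) = K (dh B c) (wy w y) +. sg (fst c) (K c (Dt U.U (wy w y))) +. cs c (%p q. \<tau> p *. K q (wy w y)) +.
   cs c (%p q. sg (1 + fst p) (K p (Lb q \<star> wy w y)))" unfolding L 1 2 3 4 using E by (simp add: TABag cAB.P.a_ac)
qed

end

context milgram begin

abbreviation "L == AB.L"
abbreviation "dU == Dt U.U"

lemma L_lin: "lin R T TAB L" using AB.L_lin by simp
lemma L_closed: "t : homs T ==> L t : car TAB" by (rule lin_closed[OF L_lin])
lemma L_t2: "L (t2 a b) = Lt a b" by (simp add: Lt_def)
lemma dU_closed: "u : car UAB ==> dU u : car UAB" by (rule mh_closed[OF Dt_hom[OF U.U_dga]])
lemma umul_closed: "u : car UAB ==> v : car UAB ==> u \<star> v : car UAB" by (rule ring.ring_simprules(5)[OF ralgD(2)[OF U.TTr]])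

text \<open>
  At \<open>c = 1\<close> only one term survives in the formula for \<open>d K\<close>, because \<open>d1 = 0\<close> and the letter \<open>[1]\<close>
  vanishes; so this operator is a chain map. It is the section of \<open>q\<close>.
\<close>

definition "S = K (uh R B)"

lemma S_hom: "S : Hom R UAB TAB" unfolding S_def by (rule K_hom[OF B.uh_homs])
lemma S_closed: "u : car UAB ==> S u : car TAB" by (rule mh_closed[OF S_hom])

lemma \<tau>Lb_bil:
 assumes u: "u : car UAB"
 shows "bil R N N TAB (%x y. \<tau> x *. K y u)" "bil R N N TAB (%x y. sg (k + fst x) (K x (Lb y \<star> u)))"
proof -
 show "bil R N N TAB (%x y. \<tau> x *. K y u)" by (rule bil_mult[OF TABr LtB_lin K_lin[OF u]])
 have "bil R N N TAB (%x y. K x (Lb y \<star> u))"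
  by (intro bilI lin_comp[OF Lb_lin mh_comp[OF ralg_left[OF U.TTr u] K_hom]] K_lin umul_closed Lb_closed u)
 then show "bil R N N TAB (%x y. sg (k + fst x) (K x (Lb y \<star> u)))" using bil_ksign[OF _ TABm, of N N _ "%i j. k + i"] by simp
qed

lemma d_S:
 assumes u: "u : car UAB" shows "d (S u) = S (dU u)"
proof -
 have "cs (uh R B) (%x y. \<tau> x *. K y u) = \<zero>[TAB]" "cs (uh R B) (%x y. sg (1 + fst x) (K x (Lb y \<star> u))) = \<zero>[TAB]"
  using K_closed[OF B.uh_homs u] mh_zero[OF ralg_left[OF U.TTr u] U.TTm U.TTm] mh_zero[OF K_hom[OF B.uh_homs] U.TTm TABm]
  by (simp_all add: BT.csum_one[OF \<tau>Lb_bil(1)[OF u]] BT.csum_one[OF \<tau>Lb_bil(2)[OF u]] Lt_uh Lb_uh TABag)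
 moreover have "K (dh B (uh R B)) u = \<zero>[TAB]" by (rule B.dh_uh[OF K_lin[OF u] TABm])
 ultimately show ?thesis unfolding S_def d_K[OF B.uh_homs u] using K_closed[OF B.uh_homs dU_closed[OF u]] by simp
qed

text \<open>
  The operators \<open>K\<close> along \<open>\<epsilon> \<otimes> 1 : A \<otimes> B \<rightarrow> B\<close>. The recursion for \<open>K\<close> turns the letter \<open>[1 \<otimes> c']\<close> in the
  formula for \<open>d K\<close> into the letter \<open>[t']\<close> of an arbitrary element \<open>t\<close>.
\<close>

definition "Kt t u = lift R TAB (%(a, b). eps A a \<odot>[TAB] K b u) (snd t)"

lemma Kt_bil:
 assumes u: "u : car UAB" shows "bil R M N TAB (%a b. eps A a \<odot>[TAB] K b u)"
 by (intro bilI lin_scale[OF K_lin[OF u] TABm] A.eps_closed A.eps_scale_lin[OF TABm] K_closed u)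

lemma Kt_lin: "u : car UAB ==> lin R T TAB (%t. Kt t u)" unfolding lin_def Kt_def using lift_bil_hom[OF R A.gm B.gm TABm Kt_bil] by simp

lemma Kt_t2: "u : car UAB ==> a : homs M ==> b : homs N ==> Kt (t2 a b) u = eps A a \<odot>[TAB] K b u"
 by (simp add: Kt_def tn_def lift_bil_tens[OF R A.gm B.gm TABm Kt_bil])

lemma Kt_closed: "u : car UAB ==> t : homs T ==> Kt t u : car TAB" by (rule lin_closed[OF Kt_lin])

lemma t_ext:
 assumes "lin R T P F" "lin R T P G" "module R P" "!!a b. [|a : homs M; b : homs N|] ==> F (t2 a b) = G (t2 a b)" "t : homs T"
 shows "F t = G t" by (rule tn_ext[OF R A.gm B.gm assms(3,1,2,4,5)])

lemma Kt_hom: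
 assumes t: "t : homs T" shows "Kt t : Hom R UAB TAB"
proof (rule mhI)
 interpret TM: module R TAB by (rule TABm)
 interpret UM: module R UAB by (rule U.TTm)
 show "Kt t u : car TAB" if "u : car UAB" for u by (rule Kt_closed[OF that t])
 show "Kt t (u \<squnion> v) = Kt t u +. Kt t v" if u: "u : car UAB" and v: "v : car UAB" for u v
  by (rule t_ext[OF Kt_lin lin_plus[OF Kt_lin Kt_lin TABm] TABm _ t])
   (use u v in \<open>simp_all add: Kt_t2 mh_add[OF K_hom] K_closed A.eps_closed module.smult_r_distr[OF TABm]\<close>)
 show "Kt t (r \<bullet> u) = r \<odot>[TAB] Kt t u" if r: "r : car R" and u: "u : car UAB" for r u
  by (rule t_ext[OF Kt_lin lin_scale[OF Kt_lin TABm r] TABm _ t])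
   (use u r in \<open>simp_all add: Kt_t2 mh_smult[OF K_hom] K_closed A.eps_closed m_comm module.smult_closed[OF U.TTm] flip: module.smult_assoc1[OF TABm]\<close>)
qed

lemma d_Kt:
 assumes t: "t : homs T" and u: "u : car UAB"
 shows "d (Kt t u) = Kt (dh AB t) u +. sg (fst t) (Kt t (dU u)) +. csAB TAB t (%x y. L x *. Kt y u) +.
  csAB TAB t (%x y. sg (1 + fst x) (Kt x (ql y \<star> u)))"
proof -
 let ?X = "%x y. L x *. Kt y u" let ?Y = "%x y. sg (1 + fst x) (Kt x (ql y \<star> u))"
 note Du = dU_closed[OF u]
 have F1: "bil R T T TAB ?X" by (rule bil_mult[OF TABr L_lin Kt_lin[OF u]])
 have F2: "bil R T T TAB ?Y"
 proof (rule bilI)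
  fix x assume x: "x : homs T"
  show "lin R T TAB (%y. sg (1 + fst x) (Kt x (ql y \<star> u)))"
   by (rule lin_comp[OF ql_lin mh_ksignI[OF mh_comp[OF ralg_left[OF U.TTr u] Kt_hom[OF x]] TABm]])
  show "lin R T TAB (%y. sg (1 + fst y) (Kt y (ql x \<star> u)))" by (rule lin_ksignI[OF Kt_lin[OF umul_closed[OF ql_closed[OF x] u]] TABm])
 qed
 have F: "bil R (obj AB) (obj AB) TAB ?X" "bil R (obj AB) (obj AB) TAB ?Y"
  using F1 F2 by simp_all
 have dl: "lin R T TAB (%t. Kt (dh AB t) u)" using lin_dh[OF AB.cx, of TAB "%t. Kt t u"] Kt_lin[OF u] by simp
 show ?thesis
 proof (rule t_ext[OF lin_comp[OF Kt_lin[OF u] d_hom] lin_plus[OF lin_plus[OF lin_plus[OF dl lin_ksignI[OF Kt_lin[OF Du] TABm] TABm]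
    AB.csum_lin[OF TABm F(1), simplified] TABm] AB.csum_lin[OF TABm F(2), simplified] TABm] TABm _ t])
  fix a b assume a: "a : homs M" and b: "b : homs N"
  note ea = A.eps_closed[OF a] and da = dh_homs[OF A.cx a] and db = dh_homs[OF B.cx b]
  let ?G = "%a. cs b (%x y. Lt a x *. K y u)"
  let ?z = "%x y. sg (1 + fst x) (K x (Lb y \<star> u))" let ?w = "%x. sg (fst a * fst x + 1 + fst x) (K x (La a \<star> u))"
  let ?Z = "cs b (%x y. ?z x y)"
  have Gl: "lin R M TAB ?G" by (rule B.csum_param_lin[OF TABm _ b]) (rule lin_comp[OF bil_left[OF Lt_bil] ralg_left[OF TABr K_closed[OF _ u]]])
  have Zc: "?Z : car TAB" by (rule lin_closed[OF B.csum_lin[OF TABm \<tau>Lb_bil(2)[OF u]] b])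
  have 1: "Kt (dh AB (t2 a b)) u = eps A a \<odot>[TAB] K (dh B b) u" using dh_t2[OF Kt_lin[OF u] TABm a b] K_closed[OF db u] K_closed[OF b u] ea
   by (simp add: Kt_t2 u da a b db A.eps_dh[OF a] eps_ksign(1)[OF TABm _ a, of _ _ 0] module.smult_l_null[OF TABm] module.smult_closed[OF TABm])
  have 2: "sg (fst a + fst b) (eps A a \<odot>[TAB] K b (dU u)) = eps A a \<odot>[TAB] sg (fst b) (K b (dU u))"
   by (rule eps_ksign(1)[OF TABm K_closed[OF b Du] a]) simp
  have 3: "csAB TAB (t2 a b) ?X = ?G a"
  proof -
   have "csAB TAB (t2 a b) ?X = csA TAB a (%a1 a2. eps A a2 \<odot>[TAB] ?G a1)" unfolding csum_AB[OF TABm F1 a b]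
   proof (rule A.csum_cong[OF a])
    fix a1 a2 assume h: "a1 : homs M" "a2 : homs M"
    have "eps A a2 \<odot>[TAB] ?G a1 = cs b (%x y. eps A a2 \<odot>[TAB] (Lt a1 x *. K y u))"
     by (rule B.csum_hom[OF TABm mh_scale[OF mh_id TABm A.eps_closed[OF h(2)]] TABm b]) (simp add: Lt_closed h K_closed u)
    also have "... = cs b (%b1 b2. sg (fst a2 * fst b1) (L (t2 a1 b1) *. Kt (t2 a2 b2) u))" by (rule B.csum_cong[OF b])
      (simp add: L_t2 Kt_t2 u h Lt_closed K_closed A.eps_closed ralgD(5)[OF TABr] eps_ksign(1)[OF TABm _ h(2), of _ _ 0])
    finally show "cs b (%b1 b2. sg (fst a2 * fst b1) (L (t2 a1 b1) *. Kt (t2 a2 b2) u)) = eps A a2 \<odot>[TAB] ?G a1" ..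
   qed
   then show ?thesis using AT.counit_right[OF Gl a] by simp
  qed
  have 4: "csAB TAB (t2 a b) ?Y = sg 1 (?G (A.hat a)) +. eps A a \<odot>[TAB] ?Z"
  proof -
   let ?H = "%a. cs b (%x y. sg (fst a * fst x + 1 + fst x) (K x (qb a y \<star> u)))"
   have qc: "qb x y \<star> u : car UAB" if "x : homs M" "y : homs N" for x y by (rule umul_closed[OF qb_closed[OF that] u])
   have Hl: "lin R M TAB ?H"
   proof (rule B.csum_param_lin[OF TABm _ b])
    fix x y assume "x : homs N" "y : homs N"
    then show "lin R M TAB (%a. sg (fst a * fst x + 1 + fst x) (K x (qb a y \<star> u)))"
     using lin_ksignI[OF lin_comp[OF bil_left[OF qb_bil] mh_comp[OF ralg_left[OF U.TTr u] K_hom]] TABm, of y x "%i. i * fst x + 1 + fst x"] by simp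
   qed
   have "csAB TAB (t2 a b) ?Y = csA TAB a (%a1 a2. eps A a1 \<odot>[TAB] ?H a2)"
    unfolding csum_AB[OF TABm F2 a b]
   proof (rule A.csum_cong[OF a])
    fix a1 a2 assume h: "a1 : homs M" "a2 : homs M"
    have "eps A a1 \<odot>[TAB] ?H a2 = cs b (%x y. eps A a1 \<odot>[TAB] sg (fst a2 * fst x + 1 + fst x) (K x (qb a2 y \<star> u)))"
     by (rule B.csum_hom[OF TABm mh_scale[OF mh_id TABm A.eps_closed[OF h(1)]] TABm b]) (simp add: qc h K_closed TABag)
    also have "... = cs b (%b1 b2. sg (fst a2 * fst b1) (sg (1 + fst (t2 a1 b1)) (Kt (t2 a1 b1) (ql (t2 a2 b2) \<star> u))))"
    proof (rule B.csum_cong[OF b])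
     fix x y assume k: "x : homs N" "y : homs N"
     have "sg (fst a2 * fst x + (1 + (fst a1 + fst x))) (eps A a1 \<odot>[TAB] K x (qb a2 y \<star> u)) =
       eps A a1 \<odot>[TAB] sg (fst a2 * fst x + 1 + fst x) (K x (qb a2 y \<star> u))"
      by (rule eps_ksign(1)[OF TABm K_closed[OF k(1) qc[OF h(2) k(2)]] h(1)]) auto
     then show "eps A a1 \<odot>[TAB] sg (fst a2 * fst x + 1 + fst x) (K x (qb a2 y \<star> u)) =
       sg (fst a2 * fst x) (sg (1 + fst (t2 a1 x)) (Kt (t2 a1 x) (ql (t2 a2 y) \<star> u)))"
      using h k by (simp add: ql_t2 Kt_t2 qc K_closed A.eps_closed module.smult_closed[OF TABm] sg_simps)
    qed
    finally show "cs b (%b1 b2. sg (fst a2 * fst b1) (sg (1 + fst (t2 a1 b1)) (Kt (t2 a1 b1) (ql (t2 a2 b2) \<star> u)))) = eps A a1 \<odot>[TAB] ?H a2" ..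
   qed
   also have "... = ?H a" by (rule AT.counit_left[OF Hl a])
   also have "... = cs b (%x y. eps B y \<odot>[TAB] ?w x +. eps A a \<odot>[TAB] ?z x y)"
   proof (rule B.csum_cong[OF b])
    fix x y assume k: "x : homs N" "y : homs N"
    note c = umul_closed[OF La_closed[OF a] u] umul_closed[OF Lb_closed[OF k(2)] u]
    have "K x (qb a y \<star> u) = eps B y \<odot>[TAB] K x (La a \<star> u) +. eps A a \<odot>[TAB] K x (Lb y \<star> u)"
     unfolding qb_def using La_closed[OF a] Lb_closed[OF k(2)] ea B.eps_closed[OF k(2)] u c k
     by (simp add: mh_add[OF ralg_left[OF U.TTr u]] mh_smult[OF ralg_left[OF U.TTr u]] module.smult_closed[OF U.TTm]
       mh_add[OF K_hom] mh_smult[OF K_hom])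
    moreover have "sg (fst a * fst x + 1 + fst x) (eps A a \<odot>[TAB] K x (Lb y \<star> u)) = eps A a \<odot>[TAB] ?z x y"
     by (rule eps_ksign(1)[OF TABm K_closed[OF k(1) c(2)] a]) simp
    ultimately show "sg (fst a * fst x + 1 + fst x) (K x (qb a y \<star> u)) =
      eps B y \<odot>[TAB] ?w x +. eps A a \<odot>[TAB] ?z x y"
     using K_closed[OF k(1) c(1)] K_closed[OF k(1) c(2)] ea B.eps_closed[OF k(2)]
     by (simp add: sg_add ksign_smult[OF TABm] module.smult_closed[OF TABm])
   qed
   also have "... = cs b (%x y. eps B y \<odot>[TAB] ?w x) +. cs b (%x y. eps A a \<odot>[TAB] ?z x y)"
    by (rule B.csum_add[OF TABm b])
     (simp_all add: K_closed umul_closed La_closed Lb_closed a u TABag ea B.eps_closed module.smult_closed[OF TABm])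
   also have "cs b (%x y. eps B y \<odot>[TAB] ?w x) = sg (fst a * fst b + 1 + fst b) (K b (La a \<star> u))"
    using BT.counit_right[OF lin_ksignI[OF K_lin[OF umul_closed[OF La_closed[OF a] u]] TABm, of "%i. fst a * i + 1 + i"] b] .
   also have "cs b (%x y. eps A a \<odot>[TAB] ?z x y) = eps A a \<odot>[TAB] ?Z"
    by (rule B.csum_hom[OF TABm mh_scale[OF mh_id TABm ea] TABm b, symmetric])
     (simp add: K_closed umul_closed Lb_closed u TABag)
   also have "sg (fst a * fst b + 1 + fst b) (K b (La a \<star> u)) = sg 1 (?G (A.hat a))" using A.hat_homs[OF a] lin_closed[OF Gl, of "A.hat a"]
    by (simp add: K_La[OF b a u] sg_simps) (auto intro!: ksign_cong)
   finally show ?thesis .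
  qed
  have Ga: "?G a = ?G (A.hat a) +. eps A a \<odot>[TAB] ?G (uh R A)" by (rule A.hat_split[OF Gl TABm a])
  have c: "?G (A.hat a) : car TAB" "?G (uh R A) : car TAB"
   using lin_closed[OF Gl A.uh_homs] lin_closed[OF Gl, of "A.hat a"] A.hat_homs[OF a] by simp_all
  have e: "e +. (g +. y) +. (sg 1 g +. z) = e +. y +. z" if "e : car TAB" "g : car TAB" "y : car TAB" "z : car TAB" for e g y z
  proof -
   have "e +. (g +. y) +. (sg 1 g +. z) = (e +. y +. z) +. (sg 0 g +. sg 1 g)" using that by (simp add: cAB.P.a_ac TABag)
   then show ?thesis using that ksign_cancel[OF TABag that(2), of 0 1] by simp
  qed
  show "d (Kt (t2 a b) u) = Kt (dh AB (t2 a b)) u +. sg (fst (t2 a b)) (Kt (t2 a b) (dU u)) +.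
    csAB TAB (t2 a b) ?X +. csAB TAB (t2 a b) ?Y"
   unfolding 1 3 4 Ga Kt_t2[OF u a b] Kt_t2[OF Du a b] fst_tn 2 using c Zc ea K_closed[OF b u] K_closed[OF db u] K_closed[OF b Du]
   by (simp add: mh_smult[OF d_hom] d_K[OF b u] e module.smult_r_distr[OF TABm] module.smult_closed[OF TABm] TABag)
 qed
qed

end

lemma (in coaugmented) L_ext:
 assumes f: "f : Hom R TX P" and g: "g : Hom R TX P" and P: "module R P"
  and 1: "f \<one>[TX] = g \<one>[TX]"
  and L: "!!c x. [|c : els C; eps C c = \<zero>; x : car TX; f x = g x|] ==> f (L c \<otimes>[TX] x) = g (L c \<otimes>[TX] x)"
  and x: "x : car TX"
 shows "f x = g x"
proof (rule W_ext[OF f g P _ x])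
 fix w assume "set w <= homs Vk"
 then show "f (W w) = g (W w)"
 proof (induction w)
  case Nil show ?case using 1 by (simp add: W_Nil)
 next
  case (Cons l w)
  then have l: "l : homs Vk" and w: "set w <= homs Vk" by simp_all
  have "W (l # w) = L (fst l + 1, snd l) \<otimes>[TX] W w" using W_append[of "[l]" w] VkD[OF l] l w by simp
  then show ?case using L[OF _ _ W_closed[OF w] Cons.IH[OF w]] VkD[OF l] by metis
 qed
qed

context milgram begin

lemma wy_induct:
 assumes f: "!!c. c : homs N ==> f c : Hom R UAB P" and g: "!!c. c : homs N ==> g c : Hom R UAB P" and P: "module R P"
  and Y: "!!c y. c : homs N ==> y : car B.TX ==> f c (U.inY y) = g c (U.inY y)"
  and L: "!!a u c. [|a : homs M; eps A a = \<zero>; u : car UAB; !!c. c : homs N ==> f c u = g c u; c : homs N|] ==> f c (La a \<star> u) = g c (La a \<star> u)"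
  and c: "c : homs N" and u: "u : car UAB"
 shows "f c u = g c u"
proof (rule wy_ext[OF f[OF c] g[OF c] P _ u])
 fix w y assume "set w <= homs A.Vk" and y: "y : car B.TX"
 then show "f c (wy w y) = g c (wy w y)" using c
 proof (induction w arbitrary: c)
  case Nil
  interpret UR: ring UAB by (rule ralgD(2)[OF U.TTr])
  show ?case using Y[OF Nil(3) y] inXY_closed(2)[OF y] by (simp add: A.W_Nil U.inX_one)
 next
  case (Cons l w)
  then have l: "l : homs A.Vk" and w: "set w <= homs A.Vk" by simp_all
  have "La (fst l + 1, snd l) \<star> wy w y = wy (l # w) y" using La_wy[OF A_letter(1)[OF l] w y] by (simp add: A.bar_letter[OF l])
  then show ?case using L[OF A_letter(1,2)[OF l] wy_closed[OF w y] Cons.IH[OF w y] Cons.prems(3)] by simp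
 qed
qed

section \<open>The homotopy\<close>

text \<open>
  The operator \<open>-(Kt t - \<epsilon>(t) S)\<close>: subtracting the value of \<open>Kt\<close> at the unit makes it vanish for
  \<open>t = 1\<close>, so that it depends only on the letter \<open>[t]\<close>.
\<close>

definition "kap t u = sg 1 (Kt t u) +. eps AB t \<odot>[TAB] S u"

lemma eps_AB_closed: "t : homs T ==> eps AB t : car R" using AB.eps_closed by simp

lemma kap_lin: "u : car UAB ==> lin R T TAB (%t. kap t u)" unfolding kap_def using AB.eps_scale_lin[OF TABm S_closed]
 by (intro lin_plus lin_comp[OF Kt_lin mh_ksignI[OF mh_id TABm]] TABm) simp_all

lemma kap_hom: "t : homs T ==> kap t : Hom R UAB TAB"
 using mh_plus[OF mh_ksignI[OF Kt_hom TABm] mh_scale[OF S_hom TABm eps_AB_closed] TABm] by (simp add: kap_def[abs_def])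

lemma kap_closed: "t : homs T ==> u : car UAB ==> kap t u : car TAB" by (rule mh_closed[OF kap_hom])

lemma kap_t2: "a : homs M ==> b : homs N ==> u : car UAB ==>
  kap (t2 a b) u = sg 1 (eps A a \<odot>[TAB] K b u) +. (eps A a \<otimes> eps B b) \<odot>[TAB] S u" by (simp add: kap_def Kt_t2 eps_AB)

lemma kap_ker: "a : homs M ==> eps A a = \<zero> ==> b : homs N ==> u : car UAB ==> kap (t2 a b) u = \<zero>[TAB]"
 by (simp add: kap_t2 K_closed S_closed B.eps_closed module.smult_l_null[OF TABm] TABag)

lemma kap_uh: "u : car UAB ==> kap (uh R AB) u = \<zero>[TAB]" using ksign_cancel[OF TABag S_closed[of u], of 1 0]
 by (simp add: uh_AB kap_t2 A.uh_homs B.uh_homs A.eps_uh B.eps_uh module.smult_one[OF TABm] K_closed S_closed flip: S_def)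

lemma kap_inY: "b : homs N ==> y : car B.TX ==> kap (t2 (uh R A) b) (U.inY y) = \<zero>[TAB]"
 using ksign_cancel[OF TABag module.smult_closed[OF TABm B.eps_closed sB_closed], of b y 1 0]
 by (simp add: kap_t2 A.uh_homs inXY_closed A.eps_uh module.smult_one[OF TABm] S_def K_inY B.uh_homs B.eps_uh sB_closed
   B.eps_closed module.smult_closed[OF TABm])

text \<open>
  Up to coproduct terms, \<open>kap t\<close> is a homotopy between \<open>[t] S\<close> and \<open>S q[t]\<close>: it measures the failure of
  \<open>S\<close> to be linear over \<open>\<Omega>(A \<otimes> B)\<close>, which acts on \<open>\<Omega>A \<otimes> \<Omega>B\<close> through \<open>q\<close>.
\<close>

lemma d_kap:
 assumes t: "t : homs T" and u: "u : car UAB"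
 shows "d (kap t u) +. sg 1 (kap (dh AB t) u) +. sg (fst t - 1) (kap t (dU u)) +.
   csAB TAB t (%x y. sg 1 (L x *. kap y u) +. sg (fst x) (kap x (ql y \<star> u))) =
  S (ql t \<star> u) +. sg 1 (L t *. S u)"
proof -
 have obj: "obj AB = T" by simp
 have t': "t : els AB" using t by simp
 note dt = dh_homs[OF AB_cx t', unfolded obj] and Du = dU_closed[OF u] and e = eps_AB_closed
 note qc = umul_closed[OF ql_closed u] and sm = module.smult_closed[OF TABm]
 let ?A = "Kt (dh AB t) u" let ?B = "sg (fst t) (Kt t (dU u))"
 let ?C = "csAB TAB t (%x y. L x *. Kt y u)" let ?E = "csAB TAB t (%x y. sg (1 + fst x) (Kt x (ql y \<star> u)))"
 have cl: "?A : car TAB" "?B : car TAB" "?C : car TAB" "?E : car TAB"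
  using Kt_closed[OF u dt] Kt_closed[OF Du t] L_closed Kt_closed[OF u] Kt_closed[OF qc]
  by (simp add: TABag, simp add: TABag, intro AB.csum_closed[OF TABm t'], simp, intro AB.csum_closed[OF TABm t'], simp add: TABag)
 have 1: "d (kap t u) = sg 1 ?A +. sg 1 ?B +. sg 1 ?C +. sg 1 ?E +. eps AB t \<odot>[TAB] S (dU u)"
  using cl Kt_closed[OF u t] S_closed[OF u] e[OF t] sm
  by (simp add: kap_def mh_add[OF d_hom] mh_ksign[OF d_hom TABm TABm] mh_smult[OF d_hom] d_S[OF u] d_Kt[OF t u] sg_add TABag)
 have 2: "sg 1 (kap (dh AB t) u) = ?A"
 proof -
  have "sg (1 + 1) ?A = ?A" by (simp add: ksign_def)
  then show ?thesis using cl S_closed[OF u] AB.eps_dh[OF t'] by (simp add: kap_def sg_add sg_simps module.smult_l_null[OF TABm])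
 qed
 have 3: "sg (fst t - 1) (kap t (dU u)) = ?B +. sg 1 (eps AB t \<odot>[TAB] S (dU u))"
 proof -
  have "sg (fst t - 1) (eps AB t \<odot>[TAB] S (dU u)) = sg 1 (eps AB t \<odot>[TAB] S (dU u))"
  proof (cases "fst t = 0")
   case False
   then show ?thesis using AB.eps_deg[OF t'] S_closed[OF Du] by (simp add: module.smult_l_null[OF TABm] TABag)
  qed (auto intro: ksign_cong)
  then show ?thesis using Kt_closed[OF Du t] S_closed[OF Du] e[OF t] sm by (simp add: kap_def sg_add sg_simps)
 qed
 have 4: "csAB TAB t (%x y. sg 1 (L x *. kap y u) +. sg (fst x) (kap x (ql y \<star> u))) =
   ?C +. sg 1 (L t *. S u) +. (?E +. S (ql t \<star> u))"
 proof -
  have s: "L x : car TAB" "Kt y u : car TAB" "Kt x (ql y \<star> u) : car TAB" "S (ql y \<star> u) : car TAB"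
    "L x *. S u : car TAB"
   if "x : homs T" "y : homs T" for x y using that L_closed Kt_closed[OF u] Kt_closed[OF qc] S_closed[OF qc] S_closed[OF u] by simp_all
  have add: "csAB TAB t (%x y. f x y +. g x y) = csAB TAB t f +. csAB TAB t g"
   if "!!x y. [|x : homs T; y : homs T|] ==> f x y : car TAB" "!!x y. [|x : homs T; y : homs T|] ==> g x y : car TAB" for f g
   by (rule AB.csum_add[OF TABm t']) (use that in simp_all)
  have "csAB TAB t (%x y. sg 1 (L x *. kap y u) +. sg (fst x) (kap x (ql y \<star> u))) =
    csAB TAB t (%x y. (L x *. Kt y u +. eps AB y \<odot>[TAB] sg 1 (L x *. S u)) +. (sg (1 + fst x) (Kt x (ql y \<star> u)) +. eps AB x \<odot>[TAB] S (ql y \<star> u)))"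
  proof (rule AB.csum_cong[OF t'])
   fix x y assume h': "x : els AB" "y : els AB"
   then have h: "x : homs T" "y : homs T" by simp_all
   have "sg (fst x) (eps AB x \<odot>[TAB] S (ql y \<star> u)) = eps AB x \<odot>[TAB] S (ql y \<star> u)"
    using AB.eps_deg[OF h'(1)] s(4)[OF h] by (cases "fst x = 0") (simp_all add: module.smult_l_null[OF TABm] TABag)
   moreover have "sg (1 + 1) (L x *. Kt y u) = L x *. Kt y u" by (simp add: ksign_def)
   ultimately show "sg 1 (L x *. kap y u) +. sg (fst x) (kap x (ql y \<star> u)) =
     (L x *. Kt y u +. eps AB y \<odot>[TAB] sg 1 (L x *. S u)) +. (sg (1 + fst x) (Kt x (ql y \<star> u)) +. eps AB x \<odot>[TAB] S (ql y \<star> u))"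
    using s[OF h] e[OF h(1)] e[OF h(2)] S_closed[OF u] sm
    by (simp add: kap_def mh_add[OF ralg_right[OF TABr]] sg_add sg_simps ralgD(5)[OF TABr] ksign_smult[OF TABm] add.commute)
  qed
  also have "... = (?C +. csAB TAB t (%x y. eps AB y \<odot>[TAB] sg 1 (L x *. S u))) +. (?E +. csAB TAB t (%x y. eps AB x \<odot>[TAB] S (ql y \<star> u)))"
   using s e sm by (simp add: add TABag)
  also have "csAB TAB t (%x y. eps AB y \<odot>[TAB] sg 1 (L x *. S u)) = sg 1 (L t *. S u)"
   by (rule cAB.counit_right[OF _ t']) (use lin_comp[OF L_lin mh_ksignI[OF ralg_left[OF TABr S_closed[OF u]] TABm]] in simp)
  also have "csAB TAB t (%x y. eps AB x \<odot>[TAB] S (ql y \<star> u)) = S (ql t \<star> u)"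
   by (rule cAB.counit_left[OF _ t']) (use lin_comp[OF ql_lin mh_comp[OF ralg_left[OF U.TTr u] S_hom]] in simp)
  finally show ?thesis .
 qed
 have Z: "eps AB t \<odot>[TAB] S (dU u) : car TAB" by (intro sm e t S_closed Du)
 have F: "S (ql t \<star> u) : car TAB" "sg 1 (L t *. S u) : car TAB"
  using L_closed[OF t] S_closed[OF u] S_closed[OF qc[OF t]] by (simp_all add: TABag)
 have c: "sg 1 x +. x = \<zero>[TAB]" if "x : car TAB" for x using ksign_cancel[OF TABag that, of 1 0] by simp
 have r: "sg 1 a +. sg 1 b +. sg 1 c' +. sg 1 e +. z +. a +. (b +. sg 1 z) +. (c' +. g +. (e +. f)) = f +. g"
  if "a : car TAB" "b : car TAB" "c' : car TAB" "e : car TAB" "z : car TAB" "f : car TAB" "g : car TAB" for a b c' e z f g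
 proof -
  have "sg 1 a +. sg 1 b +. sg 1 c' +. sg 1 e +. z +. a +. (b +. sg 1 z) +. (c' +. g +. (e +. f)) =
    (sg 1 a +. a) +. ((sg 1 b +. b) +. ((sg 1 c' +. c') +. ((sg 1 e +. e) +. ((sg 1 z +. z) +. (f +. g)))))"
   using that by (simp add: cAB.P.a_ac TABag)
  then show ?thesis using that by (simp add: c)
 qed
 show ?thesis unfolding 1 2 3 4 by (rule r[OF cl Z F])
qed

end

context milgram begin

text \<open>
  The recursion replaces the letters of a word one after the other by their effect on \<open>S q\<close>; \<open>kap\<close>
  interpolates at the letter where the replacement takes place.
\<close>

primrec hw :: "('r, 'a, 'b) tensor homog list => int => ('r, ('r, 'a, 'b) tensor) tensor_word" where
 "hw [] = \<zero>[TAB]"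
| "hw (l # w) = sg (fst l) (AB.W [l] *. hw w) +. kap (fst l + 1, snd l) (Q (AB.W w))"

lemma AB_letter: "l : homs AB.Vk ==> (fst l + 1, snd l) : homs T" using AB.VkD by simp

lemma hw_closed: "set w <= homs AB.Vk ==> hw w : car TAB"
proof (induction w)
 case (Cons l w)
 then have l: "l : homs AB.Vk" and w: "set w <= homs AB.Vk" by simp_all
 have "AB.W [l] : car TAB" using AB.W_closed[of "[l]"] l by simp
 then show ?case using Cons.IH[OF w] kap_closed[OF AB_letter[OF l] Q_closed[OF AB.W_closed[OF w]]] by (simp add: TABag)
qed simp

lemma hw_mul: "mul R AB.Vk TAB hw"
proof (rule mulI)
 show "hw [] : car TAB" by simp
 fix u w assume u: "set u <= homs AB.Vk" and w: "set w <= homs AB.Vk"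
 show "lin R AB.Vk TAB (%l. hw (u @ l # w))" using u
 proof (induction u)
  case Nil
  have "lin R AB.Vk TAB (%l. sg (fst l) (AB.W [l] *. hw w))"
   by (rule lin_ksignI[OF lin_comp[OF AB.letter_lin ralg_left[OF TABr hw_closed[OF w]]] TABm])
  moreover have "lin R AB.Vk TAB (%l. kap (fst l + 1, snd l) (Q (AB.W w)))"
   using AB.lin_Vk[of TAB "%t. kap t (Q (AB.W w))"] kap_lin[OF Q_closed[OF AB.W_closed[OF w]]] by simp
  ultimately show ?case by (simp add: lin_plus TABm)
 next
  case (Cons v u)
  then have v: "v : homs AB.Vk" and u: "set u <= homs AB.Vk" by simp_all
  have "AB.W [v] : car TAB" using AB.W_closed[of "[v]"] v by simp
  then have "lin R AB.Vk TAB (%l. sg (fst v) (AB.W [v] *. hw (u @ l # w)))"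
   by (intro lin_comp[OF Cons.IH[OF u] mh_ksignI[OF ralg_right[OF TABr] TABm]])
  moreover have "lin R AB.Vk TAB (%l. kap (fst v + 1, snd v) (Q (AB.W (u @ l # w))))"
   by (rule lin_comp[OF mul_lin[OF AB.W_mul u w] mh_comp[OF Q_hom kap_hom[OF AB_letter[OF v]]]])
  ultimately show ?case by (simp add: lin_plus TABm)
 qed
qed

definition "H = AB.wext TAB hw"

lemma H_hom: "H : Hom R TAB TAB" unfolding H_def by (rule AB.wext_hom[OF TABm hw_mul])
lemma H_closed: "x : car TAB ==> H x : car TAB" by (rule mh_closed[OF H_hom])
lemma H_W: "set w <= homs AB.Vk ==> H (AB.W w) = hw w" unfolding H_def by (rule AB.wext_W[OF TABm hw_mul])
lemma H_one: "H \<one>[TAB] = \<zero>[TAB]" using H_W[of "[]"] by (simp add: AB.W_Nil)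

lemma H_L:
 assumes t: "t : homs T" and x: "x : car TAB"
 shows "H (L t *. x) = sg (fst t - 1) (L t *. H x) +. kap t (Q x)"
proof (rule AB.W_ext[OF mh_comp[OF ralg_right[OF TABr L_closed[OF t]] H_hom]
   mh_plus[OF mh_ksignI[OF mh_comp[OF H_hom ralg_right[OF TABr L_closed[OF t]]] TABm] mh_comp[OF Q_hom kap_hom[OF t]] TABm] TABm _ x])
 fix w assume w: "set w <= homs AB.Vk"
 have t': "t : els AB" using t by simp
 note b = AB.bar_homs[OF t'] and q = Q_closed[OF AB.W_closed[OF w]]
 have "kap t (Q (AB.W w)) = kap (AB.hat t) (Q (AB.W w))"
  using AB.hat_split[OF _ TABm t', of "%t. kap t (Q (AB.W w))"] kap_lin[OF q] kap_uh[OF q] eps_AB_closed[OF t]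
   kap_closed[OF _ q, of "AB.hat t"] AB.hat_homs[OF t'] by (simp add: module.smult_r_null[OF TABm])
 moreover have "L t *. AB.W w = AB.W (AB.bar t # w)" using AB.W_append[of "[AB.bar t]" w] b w by (simp add: AB.L_def)
 ultimately show "H (L t *. AB.W w) = sg (fst t - 1) (L t *. H (AB.W w)) +. kap t (Q (AB.W w))"
  using b w by (simp add: H_W AB.L_def) (simp add: AB.bar_def AB.hat_def)
qed

lemma kap_ext:
 assumes f: "f : Hom R TAB P" and P: "module R P" and u: "u : car UAB" and t: "t : homs T"
  and eq: "!!a b. [|a : homs M; b : homs N|] ==> f (kap (t2 a b) u) = \<zero>[P]"
 shows "f (kap t u) = \<zero>[P]" by (rule t_ext[OF lin_comp[OF kap_lin[OF u] f] lin_zeroI[OF P] P eq t])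

lemma Q_Lt: "a : homs M ==> b : homs N ==> Q (Lt a b) = qb a b" using Q_L[of "t2 a b"] by (simp add: L_t2 ql_t2)

text \<open>For \<open>a\<close> in the kernel of the counit \<open>q[a \<otimes> c] = \<epsilon>(c) [a]\<close>, so that \<open>q\<close> collapses the coproduct of \<open>c\<close>.\<close>

lemma Q_K:
 assumes "c : homs N" and "u : car UAB"
 shows "Q (K c u) = eps B c \<bullet> u"
proof (rule wy_induct[OF mh_comp[OF K_hom Q_hom] mh_scale[OF mh_id U.TTm B.eps_closed] U.TTm _ _ assms])
 fix c y assume c: "c : homs N" and y: "y : car B.TX"
 show "Q (K c (U.inY y)) = eps B c \<bullet> U.inY y" by (simp add: K_inY[OF c y] mh_smult[OF Q_hom] B.eps_closed c sB_closed y Q_sB)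
next
 fix a u c assume a: "a : homs M" "eps A a = \<zero>" and u: "u : car UAB" and c: "c : homs N"
  and IH: "!!c. c : homs N ==> Q (K c u) = eps B c \<bullet> u"
 note v = umul_closed[OF La_closed[OF a(1)] u]
 have "Q (cs c (%x y. Lt a x *. K y u)) = csB UAB c (%x y. Q (Lt a x *. K y u))"
  by (rule B.csum_hom[OF TABm Q_hom U.TTm c]) (simp add: Lt_closed a K_closed u)
 also have "... = csB UAB c (%x y. eps B x \<bullet> (eps B y \<bullet> (La a \<star> u)))"
 proof (rule B.csum_cong[OF c])
  fix x y assume h: "x : homs N" "y : homs N"
  have "qb a x = eps B x \<bullet> La a" using La_closed[OF a(1)] Lb_closed[OF h(1)] B.eps_closed[OF h(1)] a(2)
   by (simp add: qb_def module.smult_l_null[OF U.TTm] module.smult_closed[OF U.TTm] abelian_monoid.r_zero[OF abelian_group.axioms(1)[OF UABag]])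
  then show "Q (Lt a x *. K y u) = eps B x \<bullet> (eps B y \<bullet> (La a \<star> u))"
   using La_closed[OF a(1)] B.eps_closed[OF h(1)] B.eps_closed[OF h(2)] u v
   by (simp add: Q_mult Lt_closed a h K_closed Q_Lt IH ralgD(4,5)[OF U.TTr] module.smult_closed[OF U.TTm])
    (simp add: m_comm flip: module.smult_assoc1[OF U.TTm])
 qed
 also have "... = eps B c \<bullet> (La a \<star> u)" by (rule BU.counit_left[OF B.eps_scale_lin[OF U.TTm v] c])
 finally have "Q (K c (La a \<star> u)) = ksign UAB (fst c * (fst a - 1)) (eps B c \<bullet> (La a \<star> u))"
  using B.csum_closed[OF TABm c, of "%x y. Lt a x *. K y u"]
  by (simp add: K_La[OF c a(1) u] A.hat_ker[OF a] mh_ksign[OF Q_hom TABm U.TTm] Lt_closed a K_closed u)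
 also have "... = eps B c \<bullet> (La a \<star> u)" using eps_ksign(2)[OF U.TTm v c, of "fst c * (fst a - 1)" 0] by simp
 finally show "Q (K c (La a \<star> u)) = eps B c \<bullet> (La a \<star> u)" .
qed

lemma Q_S: "u : car UAB ==> Q (S u) = u" by (simp add: S_def Q_K B.uh_homs B.eps_uh module.smult_one[OF U.TTm])

lemma H_sB: "y : car B.TX ==> H (sB y) = \<zero>[TAB]"
proof (rule B.L_ext[OF mh_comp[OF sB_hom H_hom] mh_const_zero[OF TABm] TABm])
 show "H (sB \<one>[B.TX]) = \<zero>[TAB]" by (simp add: sB_one H_one)
 fix b y assume b: "b : homs N" and y: "y : car B.TX" and IH: "H (sB y) = \<zero>[TAB]"
 have "sB (B.L b \<otimes>[B.TX] y) = L (t2 (uh R A) b) *. sB y" by (simp add: sB_mult B.L_closed b y sB_L L_t2)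
 then show "H (sB (B.L b \<otimes>[B.TX] y)) = \<zero>[TAB]" using H_L[of "t2 (uh R A) b" "sB y"] L_closed[of "t2 (uh R A) b"] A.uh_homs
  by (simp add: b sB_closed y IH Q_sB kap_inY TABag)
qed

text \<open>
  All side conditions on the homotopy come from this vanishing. By the recursion for \<open>K\<close>, a letter
  of \<open>A\<close> leaves \<open>K c\<close> as \<open>[a \<otimes> c']\<close> with \<open>\<epsilon>(a) = 0\<close>, and there \<open>kap\<close> is zero; for the letters \<open>[1 \<otimes> b]\<close> that
  remain, \<open>Kt\<close> and \<open>\<epsilon> S\<close> agree.
\<close>

lemma H_K:
 assumes "c : homs N" and "u : car UAB"
 shows "H (K c u) = \<zero>[TAB]"
proof (rule wy_induct[OF mh_comp[OF K_hom H_hom] mh_const_zero[OF TABm] TABm _ _ assms])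
 fix c y assume c: "c : homs N" and y: "y : car B.TX"
 show "H (K c (U.inY y)) = \<zero>[TAB]" by (simp add: K_inY[OF c y] mh_smult[OF H_hom] B.eps_closed c sB_closed y H_sB module.smult_r_null[OF TABm])
next
 fix a u c assume a: "a : homs M" "eps A a = \<zero>" and u: "u : car UAB" and c: "c : homs N"
  and IH: "!!c. c : homs N ==> H (K c u) = \<zero>[TAB]"
 have "H (cs c (%x y. Lt a x *. K y u)) = cs c (%x y. H (Lt a x *. K y u))"
  by (rule B.csum_hom[OF TABm H_hom TABm c]) (simp add: Lt_closed a K_closed u)
 also have "... = cs c (%x y. \<zero>[TAB])"
 proof (rule B.csum_cong[OF c])
  fix x y assume h: "x : homs N" "y : homs N"
  show "H (Lt a x *. K y u) = \<zero>[TAB]" using H_L[of "t2 a x" "K y u"] L_closed[of "t2 a x"]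
   by (simp add: a h K_closed u IH Q_closed kap_ker TABag L_t2)
 qed
 also have "... = \<zero>[TAB]" by (rule B.csum_zero[OF TABm])
 finally show "H (K c (La a \<star> u)) = \<zero>[TAB]" using B.csum_closed[OF TABm c, of "%x y. Lt a x *. K y u"]
  by (simp add: K_La[OF c a(1) u] A.hat_ker[OF a] mh_ksign[OF H_hom TABm TABm] Lt_closed a K_closed u TABag)
qed

lemma H_S: "u : car UAB ==> H (S u) = \<zero>[TAB]" by (simp add: S_def H_K B.uh_homs)

lemma Q_kap: "u : car UAB ==> t : homs T ==> Q (kap t u) = \<zero>[UAB]"
proof (rule kap_ext[OF Q_hom U.TTm])
 fix a b assume u: "u : car UAB" and h: "a : homs M" "b : homs N"
 show "Q (kap (t2 a b) u) = \<zero>[UAB]" using ksign_cancel[OF UABag, of "(eps A a \<otimes> eps B b) \<bullet> u" 1 0] u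
  by (simp add: kap_t2 h mh_add[OF Q_hom] mh_ksign[OF Q_hom TABm U.TTm] mh_smult[OF Q_hom] K_closed S_closed A.eps_closed B.eps_closed
    Q_K Q_S TABag module.smult_closed[OF TABm] module.smult_closed[OF U.TTm] module.smult_assoc1[OF U.TTm])
qed

lemma H_kap: "u : car UAB ==> t : homs T ==> H (kap t u) = \<zero>[TAB]"
proof (rule kap_ext[OF H_hom TABm])
 fix a b assume u: "u : car UAB" and h: "a : homs M" "b : homs N"
 show "H (kap (t2 a b) u) = \<zero>[TAB]"
  by (simp add: kap_t2 u h mh_add[OF H_hom] mh_ksign[OF H_hom TABm TABm] mh_smult[OF H_hom] K_closed S_closed A.eps_closed B.eps_closed
    H_K H_S TABag module.smult_closed[OF TABm] module.smult_r_null[OF TABm])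
qed

lemma Q_H: "x : car TAB ==> Q (H x) = \<zero>[UAB]"
proof (rule AB.L_ext[OF mh_comp[OF H_hom Q_hom] mh_const_zero[OF U.TTm] U.TTm])
 interpret UR: ring UAB by (rule ralgD(2)[OF U.TTr])
 show "Q (H \<one>[TAB]) = \<zero>[UAB]" by (simp add: H_one mh_zero[OF Q_hom TABm U.TTm])
 fix t x assume "t : els AB" and x: "x : car TAB" and IH: "Q (H x) = \<zero>[UAB]"
 then have t: "t : homs T" by simp
 show "Q (H (L t *. x)) = \<zero>[UAB]" using L_closed[OF t] H_closed[OF x] Q_closed[OF x] Q_closed[OF L_closed[OF t]]
  by (simp add: H_L[OF t x] mh_add[OF Q_hom] mh_ksign[OF Q_hom TABm U.TTm] Q_mult IH Q_kap t kap_closed TABag UABag)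
qed

lemma H_H: "x : car TAB ==> H (H x) = \<zero>[TAB]"
proof (rule AB.L_ext[OF mh_comp[OF H_hom H_hom] mh_const_zero[OF TABm] TABm])
 show "H (H \<one>[TAB]) = \<zero>[TAB]" by (simp add: H_one mh_zero[OF H_hom TABm TABm])
 fix t x assume "t : els AB" and x: "x : car TAB" and IH: "H (H x) = \<zero>[TAB]"
 then have t: "t : homs T" by simp
 have "kap t \<zero>[UAB] = \<zero>[TAB]" by (rule mh_zero[OF kap_hom[OF t] U.TTm TABm])
 then show "H (H (L t *. x)) = \<zero>[TAB]" using L_closed[OF t] H_closed[OF x] Q_closed[OF x]
  by (simp add: H_L[OF t] x mh_add[OF H_hom] mh_ksign[OF H_hom TABm TABm] IH Q_H H_kap t kap_closed TABag)
qed

text \<open>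
  Both sides are linear and agree on the empty word, so it is enough to pass from \<open>x\<close> to \<open>[t] x\<close>.
  There the coproduct terms of \<open>d[t]\<close> cancel those of \<open>d_kap\<close>, and what remains is
  \<open>S(q[t] q x) - [t] S(q x)\<close> from \<open>d_kap\<close> plus, up to sign, \<open>[t]\<close> times the formula for \<open>x\<close>.
\<close>

lemma d_H:
 assumes "x : car TAB"
 shows "d (H x) +. H (d x) = S (Q x) +. sg 1 x"
proof (rule AB.L_ext[OF mh_plus[OF mh_comp[OF H_hom d_hom] mh_comp[OF d_hom H_hom] TABm]
   mh_plus[OF mh_comp[OF Q_hom S_hom] mh_ksignI[OF mh_id TABm] TABm] TABm _ _ assms])
 interpret UR: ring UAB by (rule ralgD(2)[OF U.TTr])
 have "S \<one>[UAB] = \<one>[TAB]" using K_inY[OF B.uh_homs, of "\<one>[B.TX]"] ring.ring_simprules(6)[OF ralgD(2)[OF B.TX_ralg]]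
  by (simp add: S_def U.inY_one sB_one B.eps_uh module.smult_one[OF TABm])
 then show "d (H \<one>[TAB]) +. H (d \<one>[TAB]) = S (Q \<one>[TAB]) +. sg 1 \<one>[TAB]" using ksign_cancel[OF TABag TR.one_closed, of 0 1]
  by (simp add: H_one dga_one[OF cAB.cobar_dga] mh_zero[OF d_hom TABm TABm] mh_zero[OF H_hom TABm TABm] Q_one)
 fix t x assume t': "t : els AB" and x: "x : car TAB" and IH: "d (H x) +. H (d x) = S (Q x) +. sg 1 x"
 then have t: "t : homs T" by simp
 note dt' = dh_homs[OF AB_cx t'] and z = Q_closed[OF x] and Hx = H_closed[OF x] and Lt = L_closed[OF t]
 have dt: "dh AB t : homs T" using dt' by simp
 note qc = umul_closed[OF ql_closed z]
 let ?P = "csAB TAB t (%x y. sg (fst x) (L x *. L y))"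
 let ?V = "csAB TAB t (%p q. sg 1 (L p *. kap q (Q x)) +. sg (fst p) (kap p (ql q \<star> Q x)))"
 have Pc: "?P : car TAB" by (rule AB.csum_closed[OF TABm t']) (simp add: L_closed TABag)
 have vc: "sg 1 (L p *. kap q (Q x)) +. sg (fst p) (kap p (ql q \<star> Q x)) : car TAB" if "p : homs T" "q : homs T" for p q
  using L_closed[OF that(1)] kap_closed[OF that(2) z] kap_closed[OF that(1) qc[OF that(2)]] by (simp add: TABag)
 have Vc: "?V : car TAB" by (rule AB.csum_closed[OF TABm t']) (use vc in simp)
 have DL: "d (L t) = sg 1 (L (dh AB t)) +. ?P" using cAB.D_L[OF t'] by (simp add: cAB.DL_def)
 have DLc: "d (L t) : car TAB" by (rule d_closed[OF Lt])
 have 1: "H (?P *. x) = sg (fst t) (?P *. H x) +. ?V"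
 proof -
  have "H (?P *. x) = csAB TAB t (%p q. H (sg (fst p) (L p *. L q) *. x))"
   by (rule AB.csum_hom[OF TABm mh_comp[OF ralg_left[OF TABr x] H_hom] TABm t']) (simp add: L_closed TABag)
  also have "... = csAB TAB t (%p q. sg (fst t) (sg (fst p) (L p *. L q) *. H x) +. (sg 1 (L p *. kap q (Q x)) +. sg (fst p) (kap p (ql q \<star> Q x))))"
  proof (rule AB.csum_cong[OF t'])
   fix p q assume "p : els AB" "q : els AB" and s: "fst p + fst q = fst t"
   then have h: "p : homs T" "q : homs T" by simp_all
   note k = L_closed[OF h(1)] L_closed[OF h(2)] kap_closed[OF h(2) z] kap_closed[OF h(1) qc[OF h(2)]]
   have "sg (fst p + (fst p - 1 + (fst q - 1))) v = sg (fst t + fst p) v" "sg (fst p + (fst p - 1)) v = sg 1 v" for v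
    by (rule ksign_cong, simp flip: s, blast?)+
   then show "H (sg (fst p) (L p *. L q) *. x) = sg (fst t) (sg (fst p) (L p *. L q) *. H x) +. (sg 1 (L p *. kap q (Q x)) +. sg (fst p) (kap p (ql q \<star> Q x)))"
    using k x Hx by (simp add: sg_simps mh_ksign[OF H_hom TABm TABm] TR.m_assoc H_L h Q_mult Q_L ralgD(4,5)[OF TABr] mh_add[OF ralg_right[OF TABr]] sg_add cAB.P.a_ac)
  qed
  also have "... = csAB TAB t (%p q. sg (fst t) (sg (fst p) (L p *. L q) *. H x)) +. ?V"
   by (rule AB.csum_add[OF TABm t']) (use L_closed Hx vc in \<open>simp_all add: TABag\<close>)
  also have "csAB TAB t (%p q. sg (fst t) (sg (fst p) (L p *. L q) *. H x)) = sg (fst t) (?P *. H x)"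
   by (rule AB.csum_hom[OF TABm mh_ksignI[OF ralg_left[OF TABr Hx] TABm] TABm t', symmetric]) (simp add: L_closed TABag)
  finally show ?thesis .
 qed
 have 2: "H (d (L t) *. x) = sg (fst t) (d (L t) *. H x) +. sg 1 (kap (dh AB t) (Q x)) +. ?V"
 proof -
  have "sg (1 + (fst t - 1 - 1)) v = sg (fst t + 1) v" for v by (rule ksign_cong) simp
  then have "H (sg 1 (L (dh AB t)) *. x) = sg (fst t) (sg 1 (L (dh AB t)) *. H x) +. sg 1 (kap (dh AB t) (Q x))"
   using L_closed[OF dt] x Hx kap_closed[OF dt z] by (simp add: sg_simps sg_add mh_ksign[OF H_hom TABm TABm] H_L[OF dt x])
  then show ?thesis unfolding DL using L_closed[OF dt] Pc x Hx kap_closed[OF dt z] Vc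
   by (simp add: mh_add[OF ralg_left[OF TABr]] mh_add[OF H_hom] 1 TABag sg_add cAB.P.a_ac)
 qed
 have hL: "L t : hdeg \<Omega>AB (fst t - 1)" by (rule L_hdeg(3)[OF t])
 have 3: "H (d (L t *. x)) = sg (fst t) (d (L t) *. H x) +. sg 1 (kap (dh AB t) (Q x)) +. ?V +. (L t *. H (d x) +. sg (fst t - 1) (kap t (dU (Q x))))"
 proof -
  have "sg (fst t - 1 + (fst t - 1)) v = v" for v by (simp add: ksign_def)
  then have "H (sg (fst t - 1) (L t *. d x)) = L t *. H (d x) +. sg (fst t - 1) (kap t (dU (Q x)))"
   using Lt d_closed[OF x] H_closed[OF d_closed[OF x]] kap_closed[OF t dU_closed[OF z]]
   by (simp add: mh_ksign[OF H_hom TABm TABm] H_L[OF t] Q_D[OF x] sg_simps sg_add)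
  then show ?thesis using DLc x Lt d_closed[OF x] by (simp add: d_mult_hdeg[OF hL x] mh_add[OF H_hom] TABag 2)
 qed
 have 4: "d (H (L t *. x)) = sg (fst t - 1) (d (L t) *. H x) +. L t *. d (H x) +. d (kap t (Q x))"
 proof -
  have "sg (fst t - 1 + (fst t - 1)) v = v" for v by (simp add: ksign_def)
  then show ?thesis using Lt Hx DLc d_closed[OF Hx] kap_closed[OF t z]
   by (simp add: H_L[OF t x] mh_add[OF d_hom] mh_ksign[OF d_hom TABm TABm] TABag d_mult_hdeg[OF hL Hx] sg_simps sg_add)
 qed
 have cl: "d (L t) *. H x : car TAB" "L t *. d (H x) : car TAB" "d (kap t (Q x)) : car TAB" "sg 1 (kap (dh AB t) (Q x)) : car TAB"
  "L t *. H (d x) : car TAB" "sg (fst t - 1) (kap t (dU (Q x))) : car TAB"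
  using DLc Hx Lt d_closed[OF Hx] d_closed[OF kap_closed[OF t z]] kap_closed[OF dt z] H_closed[OF d_closed[OF x]] kap_closed[OF t dU_closed[OF z]]
  by (simp_all add: TABag)
 have r: "(sg (fst t - 1) a +. b +. c) +. (sg (fst t) a +. k +. v +. (e +. g)) = (b +. e) +. (c +. k +. g +. v)"
  if "a : car TAB" "b : car TAB" "c : car TAB" "k : car TAB" "v : car TAB" "e : car TAB" "g : car TAB" for a b c k v e g
 proof -
  have "(sg (fst t - 1) a +. b +. c) +. (sg (fst t) a +. k +. v +. (e +. g)) = (sg (fst t - 1) a +. sg (fst t) a) +. ((b +. e) +. (c +. k +. g +. v))"
   using that by (simp add: cAB.P.a_ac TABag)
  then show ?thesis using that ksign_cancel[OF TABag that(1), of "fst t - 1" "fst t"] by simp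
 qed
 have "d (H (L t *. x)) +. H (d (L t *. x)) = (L t *. d (H x) +. L t *. H (d x)) +.
   (d (kap t (Q x)) +. sg 1 (kap (dh AB t) (Q x)) +. sg (fst t - 1) (kap t (dU (Q x))) +. ?V)" unfolding 3 4 by (rule r[OF cl(1-4) Vc cl(5,6)])
 also have "... = L t *. (S (Q x) +. sg 1 x) +. (S (ql t \<star> Q x) +. sg 1 (L t *. S (Q x)))"
  using mh_add[OF ralg_right[OF TABr Lt] d_closed[OF Hx] H_closed[OF d_closed[OF x]]] d_kap[OF t z] by (simp add: IH)
 also have "... = S (Q (L t *. x)) +. sg 1 (L t *. x)"
 proof -
  have "L t *. (S (Q x) +. sg 1 x) +. (S (ql t \<star> Q x) +. sg 1 (L t *. S (Q x))) = S (ql t \<star> Q x) +. sg 1 (L t *. x) +. (sg 0 (L t *. S (Q x)) +. sg 1 (L t *. S (Q x)))"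
   using Lt x S_closed[OF z] S_closed[OF qc[OF t]] by (simp add: mh_add[OF ralg_right[OF TABr]] sg_simps cAB.P.a_ac)
  then show ?thesis using Lt x S_closed[OF z] S_closed[OF qc[OF t]] ksign_cancel[OF TABag, of "L t *. S (Q x)" 0 1]
   by (simp add: Q_mult Q_L[OF t] TABag)
 qed
 finally show "d (H (L t *. x)) +. H (d (L t *. x)) = S (Q (L t *. x)) +. sg 1 (L t *. x)" .
qed

end

context milgram begin

lemma H_word_hdeg: "set w <= homs AB.Vk ==> hw w : hdeg \<Omega>AB (word_deg w + 1)"
proof (induction w)
 case Nil show ?case using hdeg_zero[OF AB.galg] by simp
next
 case (Cons l w)
 then have l: "l : homs AB.Vk" and w: "set w <= homs AB.Vk" by simp_all
 note t = AB_letter[OF l]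
 obtain z where z: "z : car (obj \<Omega>AB (word_deg w))" "AB.W w = EL \<Omega>AB (word_deg w, z)" using AB.hdeg_W[OF w] by (rule hdegE)
 have u: "Q (AB.W w) : hdeg U.U (word_deg w)" using Q_hdeg[of z] z by (simp add: AB.obj_X)
 note uc = Q_closed[OF AB.W_closed[OF w]]
 have "kap (fst l + 1, snd l) (Q (AB.W w)) : hdeg \<Omega>AB (fst (fst l + 1, snd l) + word_deg w)"
 proof (rule hdeg_tn[OF AB.galg R A.gm B.gm kap_lin[OF uc] _ t])
  fix a b assume a: "a : homs M" and b: "b : homs N"
  show "kap (t2 a b) (Q (AB.W w)) : hdeg \<Omega>AB (fst a + fst b + word_deg w)"
  proof (cases "fst a = 0 & fst b = 0")
   case True
   then show ?thesis unfolding kap_t2[OF a b uc] using K_hdeg[OF b u] K_hdeg[OF B.uh_homs u] A.eps_closed[OF a] B.eps_closed[OF b]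
    by (auto intro!: hdeg_add[OF AB.galg] hdeg_ksign[OF AB.galg] hdeg_smult[OF AB.galg] simp: S_def)
  next
   case False
   then have "(eps A a \<otimes> eps B b) \<odot>[TAB] S (Q (AB.W w)) = \<zero>[TAB]"
    using A.eps_deg[OF a] B.eps_deg[OF b] A.eps_closed[OF a] B.eps_closed[OF b] S_closed[OF uc] by (auto simp: module.smult_l_null[OF TABm])
   moreover have "eps A a \<odot>[TAB] K b (Q (AB.W w)) : hdeg \<Omega>AB (fst a + fst b + word_deg w)"
    using hdeg_smult[OF AB.galg A.eps_closed[OF a] K_hdeg[OF b u]] eps_smult_zero(1)[OF TABm K_closed[OF b uc] a] hdeg_zero[OF AB.galg]
    by (cases "fst a = 0") (simp_all add: add.commute)
   ultimately show ?thesis unfolding kap_t2[OF a b uc] by (intro hdeg_add[OF AB.galg] hdeg_ksign[OF AB.galg]) (simp_all add: hdeg_zero[OF AB.galg])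
  qed
 qed
 moreover have "AB.W [l] *. hw w : hdeg \<Omega>AB (fst l + word_deg w + 1)"
  using hdeg_mult[OF AB.galg AB.hdeg_W[of "[l]"] Cons.IH[OF w], of "fst l + word_deg w + 1"] l by simp
 ultimately show ?case by (simp add: hdeg_add[OF AB.galg] hdeg_ksign[OF AB.galg] add.commute add.left_commute)
qed

theorem milgram_retract:
 "\<exists>\<sigma> h. strong_deformation_retract R (tensor_chain_alg R (cobar R A) (cobar R B)) (cobar R (tensor_coalg R A B)) \<sigma> (milgram_map R A B) h"
proof -
 define q where "q = milgram_map R A B"
 have q: "is_milgram_map R A B q" unfolding q_def milgram_map_def by (rule someI_ex[OF milgram_exists])
 have qm: "chain_map R \<Omega>AB U.U q" using q by (simp add: is_milgram_map_def Let_def chain_alg_hom_def)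
 have Eq: "Q (EL \<Omega>AB (n, x)) = EL U.U (n, q n x)" if "x : car (obj \<Omega>AB n)" for n x using milgram_unique[OF q that] ..
 have "\<exists>y. y : car (obj \<Omega>AB (n + 0)) & S (EL U.U (n, x)) = EL \<Omega>AB (n + 0, y)" if "x : car (obj U.U n)" for n x
  using K_hdeg[OF B.uh_homs hdeg_EL[of "(n, x)" U.U n]] that by (auto simp: S_def hdeg_def)
 then obtain s where sg': "graded_map R (obj U.U) (obj \<Omega>AB) 0 s"
  and Es: "!!n x. x : car (obj U.U n) ==> S (EL U.U (n, x)) = EL \<Omega>AB (n + 0, s n x)" by (rule graded_of_tot[OF U.U_galg AB.galg S_hom]) blast+
 have "\<exists>y. y : car (obj \<Omega>AB (n + 1)) & H (EL \<Omega>AB (n, x)) = EL \<Omega>AB (n + 1, y)" if "x : car (obj \<Omega>AB n)" for n x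
 proof -
  have "H (EL \<Omega>AB (n, x)) : hdeg \<Omega>AB (n + 1)"
   by (rule AB.hdeg_hom[OF AB.galg H_hom]) (use that in \<open>simp_all add: H_W H_word_hdeg AB.obj_X\<close>)
  then show ?thesis by (auto simp: hdeg_def)
 qed
 then obtain h where hg: "graded_map R (obj \<Omega>AB) (obj \<Omega>AB) 1 h"
  and Eh: "!!n x. x : car (obj \<Omega>AB n) ==> H (EL \<Omega>AB (n, x)) = EL \<Omega>AB (n + 1, h n x)"
  by (rule graded_of_tot[OF AB.galg AB.galg H_hom]) blast+
 note cX = dga_chain_complex[OF U.U_dga] and cY = dga_chain_complex[OF cAB.cobar_dga]
 have sc: "s n x : car (obj \<Omega>AB n)" if "x : car (obj U.U n)" for n x using mh_closed[OF graded_map_hom[OF sg'], of n n x] that by simp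
 have hc: "h n x : car (obj \<Omega>AB (n + 1))" if "x : car (obj \<Omega>AB n)" for n x
  using mh_closed[OF graded_map_hom[OF hg], of n "n + 1" x] that by simp
 have qc: "q n x : car (obj U.U n)" if "x : car (obj \<Omega>AB n)" for n x by (rule mh_closed[OF chain_mapD(1)[OF qm] that])
 have bX: "bd U.U n x : car (obj U.U (n - 1))" if "x : car (obj U.U n)" for n x by (rule mh_closed[OF bd_hom[OF cX refl] that])
 have bY: "bd \<Omega>AB n x : car (obj \<Omega>AB (n - 1))" if "x : car (obj \<Omega>AB n)" for n x by (rule mh_closed[OF bd_hom[OF cY refl] that])
 note DX = Dt_EL[OF U.U_dga] and DY = Dt_EL[OF cAB.cobar_dga]
 have eX: "EL U.U (n, x) : car UAB" if "x : car (obj U.U n)" for n x using EL_closed[OF U.U_galg] that by simp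
 have eY: "EL \<Omega>AB (n, x) : car TAB" if "x : car (obj \<Omega>AB n)" for n x using EL_closed[OF AB.galg] that by simp
 have Es': "EL \<Omega>AB (n, s n x) = S (EL U.U (n, x))" if "x : car (obj U.U n)" for n x using Es[OF that] by simp
 have "strong_deformation_retract R U.U \<Omega>AB s q h" unfolding strong_deformation_retract_def chain_map_def[of R U.U]
 proof (intro conjI allI ballI cX cY qm sg' hg)
  fix n x assume x: "x : car (obj U.U n)"
  have "EL \<Omega>AB (n - 1, s (n - 1) (bd U.U n x)) = EL \<Omega>AB (n - 1, bd \<Omega>AB n (s n x))"
   using d_S[OF eX[OF x]] Es'[OF x] Es'[OF bX[OF x]] DX[of n x] DY[of n "s n x"] by simp
  then show "s (n - 1) (bd U.U n x) = bd \<Omega>AB n (s n x)" by (rule el_inj)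
  have "EL U.U (n, q n (s n x)) = EL U.U (n, x)" using Eq[OF sc[OF x]] Q_S[OF eX[OF x]] Es'[OF x] by simp
  then show "q n (s n x) = x" by (rule el_inj)
  have "EL \<Omega>AB (n + 1, h n (s n x)) = EL \<Omega>AB (n + 1, \<zero>[obj \<Omega>AB (n + 1)])"
   using Eh[OF sc[OF x]] Es'[OF x] H_S[OF eX[OF x]] EL_zero[OF AB.galg, of "n + 1"] by simp
  then show "h n (s n x) = \<zero>[obj \<Omega>AB (n + 1)]" by (rule el_inj)
 next
  fix n y assume y: "y : car (obj \<Omega>AB n)"
  interpret Yn: module R "obj \<Omega>AB n" using cY by (simp add: chain_complex_def)
  have c: "bd \<Omega>AB (n + 1) (h n y) : car (obj \<Omega>AB n)" "h (n - 1) (bd \<Omega>AB n y) : car (obj \<Omega>AB n)"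
   using bY[OF hc[OF y]] hc[OF bY[OF y]] by simp_all
  have "EL \<Omega>AB (n, bd \<Omega>AB (n + 1) (h n y) \<oplus>[obj \<Omega>AB n] h (n - 1) (bd \<Omega>AB n y)) = d (H (EL \<Omega>AB (n, y))) +. H (d (EL \<Omega>AB (n, y)))"
   using lin_add[OF EL_lin[OF AB.galg] c] Eh[OF y] Eh[OF bY[OF y]] DY[of n y] DY[of "n + 1" "h n y"] by simp
  also have "... = S (Q (EL \<Omega>AB (n, y))) +. sg 1 (EL \<Omega>AB (n, y))" by (rule d_H[OF eY[OF y]])
  also have "... = EL \<Omega>AB (n, s n (q n y) \<ominus>[obj \<Omega>AB n] y)"
   using lin_minus[OF EL_lin[OF AB.galg] Yn.module_axioms TABm sc[OF qc[OF y]] y] by (simp add: Es'[OF qc[OF y]] Eq[OF y] a_minus_def neg_ksign)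
  finally show "bd \<Omega>AB (n + 1) (h n y) \<oplus>[obj \<Omega>AB n] h (n - 1) (bd \<Omega>AB n y) = s n (q n y) \<ominus>[obj \<Omega>AB n] y" by (rule el_inj)
  have "EL U.U (n + 1, q (n + 1) (h n y)) = EL U.U (n + 1, \<zero>[obj U.U (n + 1)])"
   using Eq[OF hc[OF y]] Eh[OF y] Q_H[OF eY[OF y]] EL_zero[OF U.U_galg, of "n + 1"] by simp
  then show "q (n + 1) (h n y) = \<zero>[obj U.U (n + 1)]" by (rule el_inj)
  have "EL \<Omega>AB (n + 2, h (n + 1) (h n y)) = EL \<Omega>AB (n + 2, \<zero>[obj \<Omega>AB (n + 2)])"
   using Eh[OF hc[OF y]] Eh[OF y] H_H[OF eY[OF y]] EL_zero[OF AB.galg, of "n + 2"] by (simp add: add.assoc)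
  then show "h (n + 1) (h n y) = \<zero>[obj \<Omega>AB (n + 2)]" by (rule el_inj)
 qed
 then show ?thesis unfolding q_def by blast
qed

end

lemma retract_equivalence:
 assumes sdr: "strong_deformation_retract R X Y g f \<phi>"
 shows "chain_homotopy_equivalence R Y X f"
proof -
 note s = sdr[unfolded strong_deformation_retract_def]
 have X: "chain_complex R X" using s by simp
 have Xn: "module R (obj X n)" for n using X by (simp add: chain_complex_def)
 have "chain_homotopic R X X (%n x. f n (g n x)) (%_ x. x)" unfolding chain_homotopic_def
 proof (intro exI[of _ "%n x. \<zero>[obj X (n + 1)]"] conjI allI ballI)
  show "graded_map R (obj X) (obj X) 1 (%n x. \<zero>[obj X (n + 1)])" by (simp add: graded_map_def mh_const_zero[OF Xn])
  fix n x assume x: "x : car (obj X n)"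
  interpret Xn: module R "obj X n" by (rule Xn)
  have "bd X (n + 1) \<zero>[obj X (n + 1)] = \<zero>[obj X n]" using mh_zero[OF bd_hom[OF X] Xn Xn, of n "n + 1"] by simp
  then show "bd X (n + 1) \<zero>[obj X (n + 1)] \<oplus>[obj X n] \<zero>[obj X (n - 1 + 1)] = f n (g n x) \<ominus>[obj X n] x"
   using s x by (simp add: a_minus_def Xn.r_neg)
 qed
 moreover have "chain_homotopic R Y Y (%n y. g n (f n y)) (%_ y. y)" unfolding chain_homotopic_def using s by (intro exI[of _ \<phi>]) simp
 ultimately show ?thesis using s unfolding chain_homotopy_equivalence_def by blast
qed

theorem theoremA1:
  fixes R :: "('r, 'm) ring_scheme"
    and A :: "('r, 'a) coaug_chain_coalg"
    and B :: "('r, 'b) coaug_chain_coalg"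
  assumes "cring R"
    and "coaugmented_chain_coalgebra R A"
    and "coaugmented_chain_coalgebra R B"
  shows "(\<exists>\<sigma> h. strong_deformation_retract R
           (tensor_chain_alg R (cobar R A) (cobar R B)) (cobar R (tensor_coalg R A B))
           \<sigma> (milgram_map R A B) h) \<and>
         chain_homotopy_equivalence R
           (cobar R (tensor_coalg R A B)) (tensor_chain_alg R (cobar R A) (cobar R B))
           (milgram_map R A B)"
proof -
 have "milgram R A B" using assms by (intro milgram.intro milgram_axioms.intro)
 from milgram.milgram_retract[OF this] show ?thesis using retract_equivalence by blast
qed

end
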